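(* Assume $d\ge 3$ and let $\varphi:\mathbb{Z}^d\to(0,\infty)$ satisfy $\sum_{x\in\mathbb{Z}^d}\varphi(x)G(0,x)<\infty$. Then the stationary Markov process $\{\eta_t:t\ge 0\}$ on $\Omega$ with stationary law $\mu$ whose generator is the $L_2(\mu)$-closure of $L_\varphi f=\sum_{x\in\mathbb{Z}^d}\varphi(x)(a_x-I)f$ (defined on local functions, with $(a_xf)(\eta)=f(a_x\eta)$) is mixing.
   Context: Abelian sandpile on $\mathbb{Z}^d$: $\Delta_{xx}=2d$, $\Delta_{xy}=-1$ if $|x-y|=1$, $0$ otherwise; $\Delta_V$ its restriction to $V\times V$. $\Omega=\{1,\dots,2d\}^{\mathbb{Z}^d}$. For finite $V$, toppling $z$ maps $\xi$ to $\xi-(\Delta_V)_{z\cdot}$ and is legal if $\xi(z)>2d$; $a_{x,V}\xi$ is the stable result of legal topplings applied to $\xi+\delta_x$. $\mathcal{R}_V$ is the set of recurrent states of the Markov chain applying $a_{X,V}$ with $X$ i.i.d. from a strictly positive distribution on $V$; $\mu_V$ is uniform on $\mathcal{R}_V$ and $\mu$ is its (known to exist) weak limit as $V\uparrow\mathbb{Z}^d$. $N_V(x,y,\eta)$ is the number of topplings at $y$ when stabilizing $\eta_V+\delta_x$ in $V$, $N(x,y,\eta)=\sup_VN_V(x,y,\eta)$, and for $\mu$-a.e. $\eta$ (when $d\ge3$) $a_x\eta=\eta+\delta_x-\Delta N(x,\cdot,\eta)$; these operators preserve $\mu$, and the closure of $L_\varphi$ generates a stationary Markov process with law $\mu$.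 $G(x,y)=(\Delta^{-1})_{xy}$. Mixing means: for all $f,g\in L_2(\mu)$, $\mathbb{E}[f(\eta_0)g(\eta_t)]\to\int f\,d\mu\int g\,d\mu$ as $t\to\infty$. *)

theory Defs
  imports "HOL-Probability.Probability"
begin

(* Sites of Z^d: functions from a finite index type 'd (d = CARD('d)) to int. *)
type_synonym 'd site = "'d \<Rightarrow> int"
type_synonym 'd config = "'d site \<Rightarrow> int"

definition nbr :: "('d::finite) site \<Rightarrow> 'd site \<Rightarrow> bool" where
  "nbr x y \<longleftrightarrow> (\<Sum>i\<in>UNIV. \<bar>x i - y i\<bar>) = 1"

definition lap :: "('d::finite) site \<Rightarrow> 'd site \<Rightarrow> int" where
  "lap x y = (if x = y then 2 * int CARD('d) else if nbr x y then -1 else 0)"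

definition lapV :: "('d::finite) site set \<Rightarrow> 'd site \<Rightarrow> 'd site \<Rightarrow> int" where
  "lapV V z y = (if z \<in> V \<and> y \<in> V then lap z y else 0)"

definition topple_total :: "('d::finite) site set \<Rightarrow> ('d site \<Rightarrow> nat) \<Rightarrow> 'd site \<Rightarrow> int" where
  "topple_total V n y = (\<Sum>z\<in>V. int (n z) * lapV V z y)"

(* topseq V xi n : there is a sequence of legal topplings in V starting from xi
   in which site z topples exactly n z times *)
inductive topseq :: "('d::finite) site set \<Rightarrow> 'd config \<Rightarrow> ('d site \<Rightarrow> nat) \<Rightarrow> bool"
  for V :: "'d site set" and \<xi> :: "'d config" where
  start: "topseq V \<xi> (\<lambda>_. 0)"
| step: "topseq V \<xi> n \<Longrightarrow> z \<in> V \<Longrightarrow> \<xi> z - topple_total V n z > 2 * int CARD('d)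
          \<Longrightarrow> topseq V \<xi> (n(z := Suc (n z)))"

definition stable_on :: "('d::finite) site set \<Rightarrow> 'd config \<Rightarrow> bool" where
  "stable_on V \<zeta> \<longleftrightarrow> (\<forall>z\<in>V. \<zeta> z \<le> 2 * int CARD('d))"

(* Toppling numbers of the stabilization of xi in V (well defined by the abelian property) *)
definition odometer :: "('d::finite) site set \<Rightarrow> 'd config \<Rightarrow> 'd site \<Rightarrow> nat" where
  "odometer V \<xi> = (THE n. topseq V \<xi> n \<and> stable_on V (\<lambda>y. \<xi> y - topple_total V n y))"

definition stabilize :: "('d::finite) site set \<Rightarrow> 'd config \<Rightarrow> 'd config" where
  "stabilize V \<xi> = (\<lambda>y. \<xi> y - topple_total V (odometer V \<xi>) y)"

definition add_grain :: "('d::finite) site \<Rightarrow> 'd config \<Rightarrow> 'd config" where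
  "add_grain x \<xi> = \<xi>(x := \<xi> x + 1)"

definition aV :: "('d::finite) site set \<Rightarrow> 'd site \<Rightarrow> 'd config \<Rightarrow> 'd config" where
  "aV V x \<xi> = stabilize V (add_grain x \<xi>)"

definition OmegaV :: "('d::finite) site set \<Rightarrow> 'd config set" where
  "OmegaV V = {\<xi>. (\<forall>y\<in>V. 1 \<le> \<xi> y \<and> \<xi> y \<le> 2 * int CARD('d)) \<and> (\<forall>y. y \<notin> V \<longrightarrow> \<xi> y = 0)}"

(* one-step transition relation of the chain applying a_{X,V}, X with full support on V *)
definition chain_step :: "('d::finite) site set \<Rightarrow> 'd config \<Rightarrow> 'd config \<Rightarrow> bool" where
  "chain_step V \<xi> \<zeta> \<longleftrightarrow> (\<exists>x\<in>V. \<zeta> = aV V x \<xi>)"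

definition recurrentV :: "('d::finite) site set \<Rightarrow> 'd config set" where
  "recurrentV V = {\<xi> \<in> OmegaV V. \<forall>\<zeta>. (chain_step V)\<^sup>*\<^sup>* \<xi> \<zeta> \<longrightarrow> (chain_step V)\<^sup>*\<^sup>* \<zeta> \<xi>}"

definition Omega_M :: "('d::finite) config measure" where
  "Omega_M = (\<Pi>\<^sub>M x\<in>(UNIV :: 'd site set). count_space {1 .. 2 * int CARD('d)})"

(* mu is the weak limit of mu_V (uniform on R_V) as V increases to Z^d:
   convergence of all cylinder probabilities *)
definition is_sandpile_limit :: "('d::finite) config measure \<Rightarrow> bool" where
  "is_sandpile_limit \<mu> \<longleftrightarrow> prob_space \<mu> \<and> sets \<mu> = sets (Omega_M :: 'd config measure) \<and>
     (\<forall>W \<xi>. finite W \<longrightarrow>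
        ((\<lambda>V. real (card {\<zeta> \<in> recurrentV V. \<forall>x\<in>W. \<zeta> x = \<xi> x}) / real (card (recurrentV V)))
          \<longlongrightarrow> measure \<mu> {\<eta> \<in> space \<mu>. \<forall>x\<in>W. \<eta> x = \<xi> x}) (finite_subsets_at_top UNIV))"

definition restr :: "('d::finite) site set \<Rightarrow> 'd config \<Rightarrow> 'd config" where
  "restr V \<eta> = (\<lambda>y. if y \<in> V then \<eta> y else 0)"

definition NV :: "('d::finite) site set \<Rightarrow> 'd site \<Rightarrow> 'd site \<Rightarrow> 'd config \<Rightarrow> nat" where
  "NV V x y \<eta> = odometer V (add_grain x (restr V \<eta>)) y"

definition Ntop :: "('d::finite) site \<Rightarrow> 'd site \<Rightarrow> 'd config \<Rightarrow> enat" where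
  "Ntop x y \<eta> = (SUP V\<in>{V. finite V}. enat (NV V x y \<eta>))"

(* infinite-volume addition operator a_x eta = eta + delta_x - Delta N(x,.,eta),
   defined where all N(x,.,eta) are finite (mu-a.e. for d >= 3), identity otherwise *)
definition ainf :: "('d::finite) site \<Rightarrow> 'd config \<Rightarrow> 'd config" where
  "ainf x \<eta> = (if (\<forall>y. Ntop x y \<eta> \<noteq> \<infinity>)
     then (\<lambda>z. \<eta> z + (if z = x then 1 else 0)
               - (\<Sum>y\<in>{y. y = z \<or> nbr z y}. lap z y * int (the_enat (Ntop x y \<eta>))))
     else \<eta>)"

(* Green's function G = Delta^{-1}: G(x,y) = sum_n walks_n(x,y) / (2d)^(n+1),
   walks_n(x,y) = number of nearest-neighbour paths of length n from x to y *)
fun walks :: "nat \<Rightarrow> ('d::finite) site \<Rightarrow> 'd site \<Rightarrow> nat" where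
  "walks 0 x y = (if x = y then 1 else 0)"
| "walks (Suc n) x y = (\<Sum>z\<in>{z. nbr x z}. walks n z y)"

definition green :: "('d::finite) site \<Rightarrow> 'd site \<Rightarrow> real" where
  "green x y = (\<Sum>n. real (walks n x y) / (2 * real CARD('d)) ^ (n + 1))"

definition local_fun :: "(('d::finite) config \<Rightarrow> real) \<Rightarrow> bool" where
  "local_fun f \<longleftrightarrow> (\<exists>W. finite W \<and> (\<forall>\<eta> \<eta>'. (\<forall>x\<in>W. \<eta> x = \<eta>' x) \<longrightarrow> f \<eta> = f \<eta>'))"

definition genL :: "(('d::finite) site \<Rightarrow> real) \<Rightarrow> ('d config \<Rightarrow> real) \<Rightarrow> 'd config \<Rightarrow> real" where
  "genL \<phi> f \<eta> = (\<Sum>\<^sub>\<infinity>x. \<phi> x * (f (ainf x \<eta>) - f \<eta>))"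

definition L2 :: "'a measure \<Rightarrow> ('a \<Rightarrow> real) \<Rightarrow> bool" where
  "L2 M f \<longleftrightarrow> f \<in> borel_measurable M \<and> integrable M (\<lambda>x. (f x)\<^sup>2)"

definition nrm2 :: "'a measure \<Rightarrow> ('a \<Rightarrow> real) \<Rightarrow> real" where
  "nrm2 M f = sqrt (\<integral>x. (f x)\<^sup>2 \<partial>M)"

definition closure_graph :: "('d::finite) config measure \<Rightarrow> ('d site \<Rightarrow> real)
     \<Rightarrow> ('d config \<Rightarrow> real) \<Rightarrow> ('d config \<Rightarrow> real) \<Rightarrow> bool" where
  "closure_graph \<mu> \<phi> f h \<longleftrightarrow> L2 \<mu> f \<and> L2 \<mu> h \<and>
     (\<exists>F :: nat \<Rightarrow> 'd config \<Rightarrow> real.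
        (\<forall>n. local_fun (F n) \<and> L2 \<mu> (F n) \<and> L2 \<mu> (genL \<phi> (F n))) \<and>
        (\<lambda>n. nrm2 \<mu> (\<lambda>\<eta>. F n \<eta> - f \<eta>)) \<longlonglongrightarrow> 0 \<and>
        (\<lambda>n. nrm2 \<mu> (\<lambda>\<eta>. genL \<phi> (F n) \<eta> - h \<eta>)) \<longlonglongrightarrow> 0)"

definition C0_contraction_semigroup :: "'a measure \<Rightarrow> (real \<Rightarrow> ('a \<Rightarrow> real) \<Rightarrow> ('a \<Rightarrow> real)) \<Rightarrow> bool" where
  "C0_contraction_semigroup M P \<longleftrightarrow>
     (\<forall>t f. 0 \<le> t \<longrightarrow> L2 M f \<longrightarrow> L2 M (P t f)) \<and>
     (\<forall>t f g a b. 0 \<le> t \<longrightarrow> L2 M f \<longrightarrow> L2 M g \<longrightarrow>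
        (AE x in M. P t (\<lambda>y. a * f y + b * g y) x = a * P t f x + b * P t g x)) \<and>
     (\<forall>f. L2 M f \<longrightarrow> (AE x in M. P 0 f x = f x)) \<and>
     (\<forall>s t f. 0 \<le> s \<longrightarrow> 0 \<le> t \<longrightarrow> L2 M f \<longrightarrow> (AE x in M. P (s + t) f x = P s (P t f) x)) \<and>
     (\<forall>t f. 0 \<le> t \<longrightarrow> L2 M f \<longrightarrow> nrm2 M (P t f) \<le> nrm2 M f) \<and>
     (\<forall>f. L2 M f \<longrightarrow> ((\<lambda>t. nrm2 M (\<lambda>x. P t f x - f x)) \<longlongrightarrow> 0) (at_right 0))"

definition generator_graph :: "'a measure \<Rightarrow> (real \<Rightarrow> ('a \<Rightarrow> real) \<Rightarrow> ('a \<Rightarrow> real))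
     \<Rightarrow> ('a \<Rightarrow> real) \<Rightarrow> ('a \<Rightarrow> real) \<Rightarrow> bool" where
  "generator_graph M P f h \<longleftrightarrow> L2 M f \<and> L2 M h \<and>
     ((\<lambda>t. nrm2 M (\<lambda>x. (P t f x - f x) / t - h x)) \<longlongrightarrow> 0) (at_right 0)"

end

theory Submission
 imports Defs
begin

text \<open>Let g be in the domain of the generator and h_t = P_t g. Since the a_x preserve \<mu>, dissipation of energy forces
 h_t to become asymptotically invariant under those additions of one grain that cause no toppling.
 Split the space, for a finite set A, into the events EE A \<zeta>: the configuration equals \<zeta> on A, and everything outside A
 burns while A is unburnt. All recurrent patterns \<zeta> on A are joined by single additions, each of which maps EE A \<zeta> onto
 EE A (\<zeta> + \<delta>_z) and preserves \<mu>; hence h_t has asymptotically the same integral over all of them.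
 The share of the patterns on A that lie in a fixed event EE A0 \<zeta>0 is, by inclusion and exclusion, a combination of
 ratios of numbers of recurrent configurations. Each ratio is monotone in A (Rayleigh) and its mean does not exceed its
 supremum, so it concentrates at a constant as A grows. Hence the integral of h_t over EE A0 \<zeta>0 tends to the measure of the event
 times the integral of g, and approximation in L2 finishes the proof.
 That A and the avalanches are finite rests on flows of finite energy in half-spaces of dimension at least 3.\<close>

section \<open>Burning on finite graphs\<close>

text \<open>Dissipation of energy is explicit only for a grain added without toppling. Whether a
  pattern on a finite set may be changed depends in general on the environment, and the events
  \<open>EE A \<zeta>\<close> are shaped to remove this dependence: once exactly A stays unburnt
  while a window W inside A is protected, inside and outside factorise, all admissible patterns on A
  are equally likely, and they can be exchanged with the outside fixed. W is free, and enlarging it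
  is what makes the ratios concentrate. Potential theory is done by counting.
  \<open>trees S k\<close> counts recurrent configurations on S with \<open>k y\<close> edges from y
  to a sink; the share of those in which y burns from one of two sinks is a voltage; the ratio of
  \<open>trees\<close> after and before wiring a vertex to the sink is an effective resistance. Thus
  neither determinants nor a tree bijection appear. Half-spaces enter because burning is explored
  slab by slab: only the region beyond the current slab is known to be untouched, so resistances
  must be bounded there, uniformly in the volume.\<close>

definition cut :: "'a set => ('a => int) => 'a => int" where
 "cut A f = (\<lambda>y. if y \<in> A then f y else 0)"

locale symmetric_graph =
 fixes adj :: "'a => 'a => bool"
 assumes adj_sym: "adj x y ==> adj y x"
  and adj_irrefl: "\<not> adj x x"
begin

definition dg :: "'a set => 'a => nat" where
 "dg S y = card {z \<in> S. adj y z}"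

lemma dg_mono: "finite T ==> S \<subseteq> T ==> dg S y \<le> dg T y" unfolding dg_def by (rule card_mono) auto

lemma dg_Un: "finite S ==> finite T ==> S \<inter> T = {} ==> dg (S \<union> T) y = dg S y + dg T y"
 unfolding dg_def by (subst card_Un_disjoint[symmetric]) (auto intro!: arg_cong[where f=card])

lemma dg_Diff: "finite S ==> A \<subseteq> S ==> dg S y = dg A y + dg (S - A) y"
 using dg_Un[of A "S - A" y] by (metis Diff_disjoint Un_Diff_cancel2 finite_Diff finite_subset sup.absorb1 Un_commute)

lemma dg_empty [simp]: "dg {} y = 0" by (simp add: dg_def)

lemma dg_sum: "finite S ==> dg S y = (\<Sum>z\<in>S. of_bool (adj y z))"
 unfolding dg_def by (simp add: sum.If_cases of_bool_def Int_def conj_commute)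

lemma dg_self: "dg (insert y S) y = dg S y" unfolding dg_def using adj_irrefl by (metis (lifting) insert_iff)

lemma dg_singleton: "dg {x} y = of_bool (adj y x)" unfolding dg_def by (auto simp: of_bool_def card_1_singleton_iff)

text \<open>Burning test with a sink: \<open>k y\<close> edges join y to the sink, heights are at
  most the full degree, and no nonempty F is a forbidden subconfiguration. A singleton F gives
  heights at least 1. The value 0 off S lets configurations be cut and glued as plain
  functions.\<close>

definition rec :: "'a set => ('a => nat) => ('a => int) set" where
 "rec S k = {h. (\<forall>y. y \<notin> S --> h y = 0) \<and> (\<forall>y\<in>S. h y \<le> int (dg S y + k y)) \<and>
   (\<forall>F\<subseteq>S. F \<noteq> {} --> (\<exists>y\<in>F. int (dg F y) < h y))}"

text \<open>Classically the number of spanning trees of S with the sink added; the identities proved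
  below for this count are the corresponding tree identities.\<close>

definition trees :: "'a set => ('a => nat) => nat" where
 "trees S k = card (rec S k)"

lemma rec_cong: "(\<And>y. y \<in> S ==> k y = k' y) ==> rec S k = rec S k'" unfolding rec_def by auto

lemma trees_cong: "(\<And>y. y \<in> S ==> k y = k' y) ==> trees S k = trees S k'" unfolding trees_def using rec_cong[of S k k'] by auto

lemma recD:
 assumes "h \<in> rec S k"
 shows "\<And>y. y \<notin> S ==> h y = 0" and "\<And>y. y \<in> S ==> h y \<le> int (dg S y + k y)"
  and "\<And>F. F \<subseteq> S ==> F \<noteq> {} ==> \<exists>y\<in>F. int (dg F y) < h y" using assms unfolding rec_def by auto

lemma rec_ge_1: "h \<in> rec S k ==> y \<in> S ==> 1 \<le> h y" using recD(3)[of h S k "{y}"] by auto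

lemma finite_rec: assumes "finite S" shows "finite (rec S k)"
proof -
 have "rec S k \<subseteq> {h. \<forall>y. (y \<in> S --> h y \<in> {0..int (Max ((\<lambda>y. dg S y + k y) ` S))}) \<and> (y \<notin> S --> h y = 0)}"
 proof safe
  fix h y assume e: "h \<in> rec S k"
  show "h y = 0" if "y \<notin> S" using recD(1)[OF e that] .
  assume y: "y \<in> S"
  have "h y \<le> int (dg S y + k y)" by (rule recD(2)[OF e y])
  moreover have "dg S y + k y \<le> Max ((\<lambda>y. dg S y + k y) ` S)" using assms y by auto
  ultimately show "h y \<in> {0..int (Max ((\<lambda>y. dg S y + k y) ` S))}" using rec_ge_1[OF e y] by auto
 qed
 moreover have "finite {h. \<forall>y. (y \<in> S --> h y \<in> {0..int (Max ((\<lambda>y. dg S y + k y) ` S))}) \<and> (y \<notin> S --> h y = 0)}"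
  by (rule finite_set_of_finite_funs) (use assms in auto)
 ultimately show ?thesis by (rule finite_subset)
qed

lemma rec_empty [simp]: "rec {} k = {\<lambda>_. 0}" unfolding rec_def by auto

lemma trees_empty [simp]: "trees {} k = 1" by (simp add: trees_def)

text \<open>The sink edges are split: those counted by j are held unburnt, the others are burnt from
  the start. Quantifying over all F, as in \<open>rec\<close>, says that A can burn completely while
  S - A stays unburnt, without naming an order of burning.\<close>

definition ignites :: "'a set => ('a => nat) => ('a => int) => 'a set => bool" where
 "ignites S j h A \<longleftrightarrow> (\<forall>F\<subseteq>A. F \<noteq> {} --> (\<exists>y\<in>F. int (dg (F \<union> (S - A)) y + j y) < h y))"

text \<open>Ignited sets are closed under union (\<open>ignites_burnt\<close>), so this is the final
  burnt set when burning is confined to B.\<close>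

definition burnt :: "'a set => 'a set => ('a => nat) => ('a => int) => 'a set" where
 "burnt S B j h = \<Union>{A. A \<subseteq> B \<and> ignites S j h A}"

lemma burnt_subset: "burnt S B j h \<subseteq> B" unfolding burnt_def by auto

lemma ignites_burnt:
 assumes "finite S" "B \<subseteq> S"
 shows "ignites S j h (burnt S B j h)" unfolding ignites_def
proof (intro allI impI)
 fix F assume F: "F \<subseteq> burnt S B j h" "F \<noteq> {}"
 then obtain A x where A: "x \<in> F" "x \<in> A" "A \<subseteq> B" "ignites S j h A" unfolding burnt_def by blast
 have AX: "A \<subseteq> burnt S B j h" using A unfolding burnt_def by auto
 from A obtain y where y: "y \<in> F \<inter> A" "int (dg ((F \<inter> A) \<union> (S - A)) y + j y) < h y"
  unfolding ignites_def by (metis Int_lower2 disjoint_iff)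
 have "F \<subseteq> S" using F burnt_subset assms by fastforce
 have "dg (F \<union> (S - burnt S B j h)) y \<le> dg ((F \<inter> A) \<union> (S - A)) y"
  by (rule dg_mono) (use assms \<open>F \<subseteq> S\<close> AX in \<open>auto intro: finite_subset\<close>)
 thus "\<exists>y\<in>F. int (dg (F \<union> (S - burnt S B j h)) y + j y) < h y" using y by (intro bexI[of _ y]) auto
qed

lemma burnt_stuck:
 assumes "finite S" "B \<subseteq> S" "y \<in> B - burnt S B j h"
 shows "h y \<le> int (dg (S - burnt S B j h) y + j y)"
proof (rule ccontr)
 assume "\<not> ?thesis"
 hence c: "int (dg (S - burnt S B j h) y + j y) < h y" by simp
 let ?X = "burnt S B j h"
 have "ignites S j h (insert y ?X)" unfolding ignites_def
 proof (intro allI impI)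
  fix F assume F: "F \<subseteq> insert y ?X" "F \<noteq> {}"
  show "\<exists>z\<in>F. int (dg (F \<union> (S - insert y ?X)) z + j z) < h z"
  proof (cases "F \<inter> ?X = {}")
   case True
   hence "F = {y}" using F by auto
   moreover have "{y} \<union> (S - insert y ?X) = S - ?X" using assms by auto
   ultimately show ?thesis using c by auto
  next
   case False
   then obtain z where z: "z \<in> F \<inter> ?X" "int (dg ((F \<inter> ?X) \<union> (S - ?X)) z + j z) < h z"
    using ignites_burnt[OF assms(1,2), of j h] unfolding ignites_def by (metis Int_lower2)
   have "?X \<subseteq> S" using burnt_subset assms by fastforce
   hence "finite (F \<inter> ?X)" using finite_subset[OF _ assms(1), of ?X] by auto
   hence "dg (F \<union> (S - insert y ?X)) z \<le> dg ((F \<inter> ?X) \<union> (S - ?X)) z" by (intro dg_mono) (use assms F in auto)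
   thus ?thesis using z by (intro bexI[of _ z]) auto
  qed
 qed
 moreover have "insert y ?X \<subseteq> B" using assms burnt_subset[of S B j h] by auto
 ultimately have "insert y ?X \<subseteq> burnt S B j h" unfolding burnt_def[of S B j h] by (intro Union_upper) auto
 thus False using assms by auto
qed

lemma burnt_eqI:
 assumes "finite S" "B \<subseteq> S" "A \<subseteq> B" "ignites S j h A"
  and "\<And>y. y \<in> B - A ==> h y \<le> int (dg (S - A) y + j y)"
 shows "burnt S B j h = A"
proof (rule ccontr)
 assume ne: "burnt S B j h \<noteq> A"
 let ?X = "burnt S B j h"
 have AX: "A \<subseteq> ?X" using assms unfolding burnt_def by auto
 hence "?X - A \<noteq> {}" using ne by auto
 then obtain y where y: "y \<in> ?X - A" "int (dg ((?X - A) \<union> (S - ?X)) y + j y) < h y"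
  using ignites_burnt[OF assms(1,2), of j h] unfolding ignites_def by (meson Diff_subset)
 have "(?X - A) \<union> (S - ?X) = S - A" using AX burnt_subset[of S B j h] assms by auto
 thus False using y assms(5)[of y] burnt_subset[of S B j h] by auto
qed

lemma burnt_eq_iff:
 assumes "finite S" "B \<subseteq> S" "A \<subseteq> B"
 shows "burnt S B j h = A \<longleftrightarrow> ignites S j h A \<and> (\<forall>y\<in>B - A. h y \<le> int (dg (S - A) y + j y))"
 using burnt_eqI[OF assms] ignites_burnt[OF assms(1,2)] burnt_stuck[OF assms(1,2)] by (metis)

text \<open>Sink edges of the part that survives a burning inside B. A surviving site of B failed to
  burn, so its height is bounded by the unburnt degree and only j remains; a site outside B was
  never tested, and the burnt set A acts on it as additional sink.\<close>

definition resid :: "'a set => 'a set => ('a => nat) => ('a => nat) => 'a => nat" where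
 "resid B A k j y = (if y \<in> B then j y else k y + dg A y)"

definition split_at :: "'a set => ('a => nat) => 'a set => ('a => int) => ('a => int) \<times> ('a => int)" where
 "split_at S j A h = (cut A (\<lambda>y. h y - int (dg (S - A) y + j y)), cut (S - A) h)"

definition glue_at :: "'a set => ('a => nat) => 'a set => ('a => int) \<times> ('a => int) => 'a => int" where
 "glue_at S j A = (\<lambda>(\<xi>, \<zeta>) y. if y \<in> A then \<xi> y + int (dg (S - A) y + j y) else \<zeta> y)"

lemma split_glue:
 assumes "\<forall>y. y \<notin> A --> \<xi> y = 0" "\<forall>y. y \<notin> S - A --> \<zeta> y = 0"
 shows "split_at S j A (glue_at S j A (\<xi>, \<zeta>)) = (\<xi>, \<zeta>)" using assms unfolding split_at_def glue_at_def cut_def by auto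

lemma glue_split:
 assumes "\<forall>y. y \<notin> S --> h y = 0"
 shows "glue_at S j A (split_at S j A h) = h" using assms unfolding split_at_def glue_at_def cut_def by auto

text \<open>The burning history cuts a recurrent configuration into two independent ones. On A the
  edges that were unburnt all along are subtracted from the heights; on the rest the burning test is
  inherited and the upper bound sharpens exactly at the sites of B, since they did not burn.\<close>

lemma split_rec:
 assumes S: "finite S" "B \<subseteq> S" and jk: "\<forall>y\<in>S. j y \<le> k y"
  and e: "h \<in> rec S k" and A: "burnt S B j h = A"
 shows "split_at S j A h \<in> rec A (\<lambda>y. k y - j y) \<times> rec (S - A) (resid B A k j)"
proof -
 have AB: "A \<subseteq> B" using A burnt_subset by metis
 have ig: "ignites S j h A" using ignites_burnt[OF S, of j h] A by simp
 have st: "\<And>y. y \<in> B - A ==> h y \<le> int (dg (S - A) y + j y)" using burnt_stuck[OF S, of _ j h] A by simp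
 have d: "dg S y = dg A y + dg (S - A) y" for y by (rule dg_Diff) (use S AB in auto)
 have 1: "cut A (\<lambda>y. h y - int (dg (S - A) y + j y)) \<in> rec A (\<lambda>y. k y - j y)" unfolding rec_def
 proof (intro CollectI conjI allI impI ballI)
  show "y \<notin> A ==> cut A (\<lambda>y. h y - int (dg (S - A) y + j y)) y = 0" for y by (simp add: cut_def)
  show "cut A (\<lambda>y. h y - int (dg (S - A) y + j y)) y \<le> int (dg A y + (k y - j y))" if y: "y \<in> A" for y
   using recD(2)[OF e, of y] d[of y] bspec[OF jk, of y] AB S y by (auto simp: cut_def of_nat_diff)
  fix F assume F: "F \<subseteq> A" "F \<noteq> {}"
  then obtain y where y: "y \<in> F" "int (dg (F \<union> (S - A)) y + j y) < h y" using ig unfolding ignites_def by blast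
  have "finite F" by (rule finite_subset[OF _ S(1)]) (use F AB S in auto)
  hence "dg (F \<union> (S - A)) y = dg F y + dg (S - A) y" by (intro dg_Un) (use F S in auto)
  thus "\<exists>y\<in>F. int (dg F y) < cut A (\<lambda>y. h y - int (dg (S - A) y + j y)) y"
   using y F by (intro bexI[of _ y]) (auto simp: cut_def)
 qed
 have 2: "cut (S - A) h \<in> rec (S - A) (resid B A k j)" unfolding rec_def
 proof (intro CollectI conjI allI impI ballI)
  show "y \<notin> S - A ==> cut (S - A) h y = 0" for y by (auto simp: cut_def)
  show "cut (S - A) h y \<le> int (dg (S - A) y + resid B A k j y)" if y: "y \<in> S - A" for y
   using st[of y] recD(2)[OF e, of y] d[of y] y by (auto simp: cut_def resid_def)
  fix F assume F: "F \<subseteq> S - A" "F \<noteq> {}"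
  then obtain y where "y \<in> F" "int (dg F y) < h y" using recD(3)[OF e, of F] by auto
  thus "\<exists>y\<in>F. int (dg F y) < cut (S - A) h y" using F by (intro bexI[of _ y]) (auto simp: cut_def)
 qed
 from 1 2 show ?thesis by (simp add: split_at_def)
qed

lemma glue_rec:
 assumes S: "finite S" "B \<subseteq> S" "A \<subseteq> B" and jk: "\<forall>y\<in>S. j y \<le> k y"
  and x: "\<xi> \<in> rec A (\<lambda>y. k y - j y)" and z: "\<zeta> \<in> rec (S - A) (resid B A k j)"
 shows "glue_at S j A (\<xi>, \<zeta>) \<in> rec S k" and "burnt S B j (glue_at S j A (\<xi>, \<zeta>)) = A"
proof -
 let ?e = "glue_at S j A (\<xi>, \<zeta>)"
 have d: "dg S y = dg A y + dg (S - A) y" for y by (rule dg_Diff) (use S in auto)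
 show "burnt S B j ?e = A"
 proof (rule burnt_eqI[OF S])
  show "ignites S j ?e A" unfolding ignites_def
  proof (intro allI impI)
   fix F assume F: "F \<subseteq> A" "F \<noteq> {}"
   then obtain y where y: "y \<in> F" "int (dg F y) < \<xi> y" using recD(3)[OF x] by blast
   have "finite F" by (rule finite_subset[OF _ S(1)]) (use F S in auto)
   hence "dg (F \<union> (S - A)) y = dg F y + dg (S - A) y" by (intro dg_Un) (use F S in auto)
   thus "\<exists>y\<in>F. int (dg (F \<union> (S - A)) y + j y) < ?e y" using y F by (intro bexI[of _ y]) (auto simp: glue_at_def)
  qed
  show "?e y \<le> int (dg (S - A) y + j y)" if "y \<in> B - A" for y using recD(2)[OF z, of y] that S by (auto simp: glue_at_def resid_def)
 qed
 show "?e \<in> rec S k" unfolding rec_def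
 proof (intro CollectI conjI allI impI ballI)
  show "?e y = 0" if "y \<notin> S" for y using that recD(1)[OF z, of y] S by (auto simp: glue_at_def)
  show "?e y \<le> int (dg S y + k y)" if y: "y \<in> S" for y
  proof (cases "y \<in> A")
   case True
   thus ?thesis using recD(2)[OF x, of y] d[of y] bspec[OF jk y] by (auto simp: glue_at_def of_nat_diff)
  next
   case False
   thus ?thesis using recD(2)[OF z, of y] y d[of y] bspec[OF jk y] by (auto simp: glue_at_def resid_def split: if_splits)
  qed
  fix F assume F: "F \<subseteq> S" "F \<noteq> {}"
  have fF: "finite F" by (rule finite_subset[OF F(1) S(1)])
  show "\<exists>y\<in>F. int (dg F y) < ?e y"
  proof (cases "F \<inter> A = {}")
   case True
   then obtain y where "y \<in> F" "int (dg F y) < \<zeta> y" using recD(3)[OF z, of F] F by auto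
   thus ?thesis using True by (intro bexI[of _ y]) (auto simp: glue_at_def)
  next
   case False
   then obtain y where y: "y \<in> F \<inter> A" "int (dg (F \<inter> A) y) < \<xi> y" using recD(3)[OF x, of "F \<inter> A"] by auto
   have "dg F y \<le> dg ((F \<inter> A) \<union> (S - A)) y" by (rule dg_mono) (use F fF S in auto)
   also have "... = dg (F \<inter> A) y + dg (S - A) y" by (rule dg_Un) (use fF S in auto)
   finally show ?thesis using y by (intro bexI[of _ y]) (auto simp: glue_at_def)
  qed
 qed
qed

lemma bij_betw_split:
 assumes S: "finite S" "B \<subseteq> S" "A \<subseteq> B" and jk: "\<forall>y\<in>S. j y \<le> k y"
 shows "bij_betw (split_at S j A) {h\<in>rec S k. burnt S B j h = A}
      (rec A (\<lambda>y. k y - j y) \<times> rec (S - A) (resid B A k j))"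
proof (rule bij_betw_byWitness[where f' = "glue_at S j A"])
 show "\<forall>h\<in>{h\<in>rec S k. burnt S B j h = A}. glue_at S j A (split_at S j A h) = h" using glue_split recD(1) by blast
 show "\<forall>p\<in>rec A (\<lambda>y. k y - j y) \<times> rec (S - A) (resid B A k j). split_at S j A (glue_at S j A p) = p"
  using split_glue recD(1) by (metis (lifting) mem_Sigma_iff surj_pair)
 show "split_at S j A ` {h\<in>rec S k. burnt S B j h = A} \<subseteq> rec A (\<lambda>y. k y - j y) \<times> rec (S - A) (resid B A k j)"
  using split_rec[OF S(1,2) jk] by blast
 show "glue_at S j A ` (rec A (\<lambda>y. k y - j y) \<times> rec (S - A) (resid B A k j)) \<subseteq> {h\<in>rec S k. burnt S B j h = A}"
  using glue_rec[OF S jk] by auto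
qed

lemma card_burnt:
 assumes S: "finite S" "B \<subseteq> S" "A \<subseteq> B" and jk: "\<forall>y\<in>S. j y \<le> k y"
 shows "card {h\<in>rec S k. burnt S B j h = A} = trees A (\<lambda>y. k y - j y) * trees (S - A) (resid B A k j)"
 using bij_betw_same_card[OF bij_betw_split[of S B A j k]] assms by (simp add: trees_def card_cartesian_product)

lemma sum_burnt:
 fixes f :: "('a => int) => 'b::comm_monoid_add"
 assumes S: "finite S" "B \<subseteq> S"
 shows "(\<Sum>h\<in>rec S k. f h) = (\<Sum>A\<in>Pow B. \<Sum>h\<in>{h\<in>rec S k. burnt S B j h = A}. f h)"
proof -
 have "finite (Pow B)" using S finite_subset by auto
 thus ?thesis
  by (subst sum.group[where g="burnt S B j" and T="Pow B"]) (use finite_rec[OF S(1)] in \<open>auto dest: subsetD[OF burnt_subset]\<close>)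
qed

text \<open>Product formula summed over all outcomes of the burning. The identities for a single
  sink, for a root vertex and for cores are instances, obtained by the choice of B with j =
  0.\<close>

lemma trees_decomp:
 assumes S: "finite S" "B \<subseteq> S" and jk: "\<forall>y\<in>S. j y \<le> k y"
 shows "trees S k = (\<Sum>A\<in>Pow B. trees A (\<lambda>y. k y - j y) * trees (S - A) (resid B A k j))"
proof -
 have "trees S k = (\<Sum>h\<in>rec S k. 1)" by (simp add: trees_def)
 also have "... = (\<Sum>A\<in>Pow B. card {h\<in>rec S k. burnt S B j h = A})" by (subst sum_burnt[OF S, of _ _ j]) simp
 also have "... = (\<Sum>A\<in>Pow B. trees A (\<lambda>y. k y - j y) * trees (S - A) (resid B A k j))"
  by (rule sum.cong) (use card_burnt[OF S _ jk] in auto)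
 finally show ?thesis .
qed

end

section \<open>Potentials and energy\<close>

context symmetric_graph
begin

lemma real_dg_subset:
 assumes "finite S" "A \<subseteq> S"
 shows "real (dg A y) = (\<Sum>z\<in>S. of_bool (adj y z) * of_bool (z \<in> A))"
proof -
 have "real (dg A y) = (\<Sum>z\<in>A. of_bool (adj y z))"
  using dg_sum[of A y] finite_subset[OF assms(2,1)] by (simp only: of_nat_sum of_nat_of_bool)
 also have "... = (\<Sum>z\<in>S. of_bool (adj y z) * of_bool (z \<in> A))" by (rule sum.mono_neutral_cong_left) (use assms in auto)
 finally show ?thesis .
qed

lemma real_dg: "finite S ==> real (dg S y) = (\<Sum>z\<in>S. of_bool (adj y z))"
 using dg_sum[of S y] by (simp only: of_nat_sum of_nat_of_bool)

text \<open>Sink 1 topples together with the set that burns from its edges \<open>k1\<close> while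
  sink 2, with edges \<open>k2\<close>, is held unburnt; each site of that set topples once. Firing
  sink 2 is the reverse move, so this is a permutation.\<close>

definition fire :: "'a set => ('a => nat) => ('a => nat) => ('a => int) => 'a => int" where
 "fire S k1 k2 h y = (let A = burnt S S k2 h in
   if y \<in> A then h y - int (dg (S - A) y + k2 y)
   else if y \<in> S then h y + int (dg A y + k1 y) else 0)"

lemma fire_rec:
 assumes S: "finite S" and e: "h \<in> rec S (\<lambda>y. k1 y + k2 y)"
 shows "fire S k1 k2 h \<in> rec S (\<lambda>y. k1 y + k2 y)"
  and "burnt S S k1 (fire S k1 k2 h) = S - burnt S S k2 h"
  and "fire S k2 k1 (fire S k1 k2 h) = h"
proof -
 define A where "A = burnt S S k2 h"
 have AS: "A \<subseteq> S" unfolding A_def by (rule burnt_subset)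
 have "split_at S k2 A h \<in> rec A (\<lambda>y. k1 y + k2 y - k2 y) \<times> rec (S - A) (resid S A (\<lambda>y. k1 y + k2 y) k2)"
  by (rule split_rec[OF S subset_refl _ e A_def[symmetric]]) auto
 moreover have "rec (S - A) (resid S A (\<lambda>y. k1 y + k2 y) k2) = rec (S - A) k2" by (rule rec_cong) (auto simp: resid_def)
 ultimately have sp: "fst (split_at S k2 A h) \<in> rec A k1" "snd (split_at S k2 A h) \<in> rec (S - A) k2" by (auto simp: mem_Times_iff)
 have SSA: "S - (S - A) = A" using AS by auto
 have T: "fire S k1 k2 h = glue_at S k1 (S - A) (snd (split_at S k2 A h), fst (split_at S k2 A h))"
  using AS by (auto simp: fun_eq_iff fire_def Let_def A_def[symmetric] glue_at_def split_at_def cut_def SSA)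
 have r: "rec A (resid S (S - A) (\<lambda>y. k1 y + k2 y) k1) = rec A k1"
  by (rule rec_cong) (use AS in \<open>auto simp: resid_def\<close>)
 have g: "fire S k1 k2 h \<in> rec S (\<lambda>y. k1 y + k2 y)" "burnt S S k1 (fire S k1 k2 h) = S - A" unfolding T
  using glue_rec[of S S "S - A" k1 "\<lambda>y. k1 y + k2 y" "snd (split_at S k2 A h)" "fst (split_at S k2 A h)"] S sp by (auto simp: SSA r)
 show "fire S k1 k2 h \<in> rec S (\<lambda>y. k1 y + k2 y)" by fact
 show "burnt S S k1 (fire S k1 k2 h) = S - burnt S S k2 h" using g A_def by simp
 show "fire S k2 k1 (fire S k1 k2 h) = h"
 proof
  fix y
  show "fire S k2 k1 (fire S k1 k2 h) y = h y" using AS recD(1)[OF e, of y] unfolding fire_def[of S k2 k1] Let_def g(2) SSA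
   by (auto simp: fire_def Let_def A_def[symmetric])
 qed
qed

lemma bij_betw_fire:
 assumes "finite S"
 shows "bij_betw (fire S k1 k2) (rec S (\<lambda>y. k1 y + k2 y)) (rec S (\<lambda>y. k1 y + k2 y))"
proof -
 have c: "rec S (\<lambda>y. k2 y + k1 y) = rec S (\<lambda>y. k1 y + k2 y)" by (simp add: add.commute)
 show ?thesis by (rule bij_betw_byWitness[where f'="fire S k2 k1"])
   (use fire_rec[OF assms, of _ k1 k2] fire_rec[OF assms, of _ k2 k1] c in auto)
qed

text \<open>Divided by the number of configurations, this is the voltage at y when sink 1 has
  potential 1 and sink 2 potential 0; see \<open>lp_ign\<close> and \<open>ign_swap\<close>.\<close>

definition ign :: "'a set => ('a => nat) => ('a => nat) => 'a => real" where
 "ign S k1 k2 y = (\<Sum>h\<in>rec S (\<lambda>y. k1 y + k2 y). of_bool (y \<in> burnt S S k2 h))"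

definition lp :: "'a set => ('a => nat) => ('a => real) => 'a => real" where
 "lp S k u y = (real (dg S y) + real (k y)) * u y - (\<Sum>z\<in>S. of_bool (adj y z) * u z)"

lemma ign_bounds:
 "finite S ==> 0 \<le> ign S k1 k2 y" "finite S ==> ign S k1 k2 y \<le> real (trees S (\<lambda>y. k1 y + k2 y))"
proof -
 assume "finite S"
 show "0 \<le> ign S k1 k2 y" unfolding ign_def by (rule sum_nonneg) auto
 have "ign S k1 k2 y \<le> (\<Sum>h\<in>rec S (\<lambda>y. k1 y + k2 y). 1)" unfolding ign_def by (rule sum_mono) auto
 thus "ign S k1 k2 y \<le> real (trees S (\<lambda>y. k1 y + k2 y))" by (simp add: trees_def)
qed

text \<open>Firing one of the two sinks permutes the recurrent configurations, hence preserves the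
 mean height at every site.\<close>

lemma lp_ign:
 assumes S: "finite S" and y: "y \<in> S"
 shows "lp S (\<lambda>y. k1 y + k2 y) (ign S k1 k2) y = real (k1 y) * real (trees S (\<lambda>y. k1 y + k2 y))"
proof -
 let ?R = "rec S (\<lambda>y. k1 y + k2 y)"
 let ?A = "burnt S S k2"
 have AS: "?A h \<subseteq> S" for h by (rule burnt_subset)
 have d: "real (dg S y) = real (dg (?A h) y) + real (dg (S - ?A h) y)" for h using dg_Diff[OF S AS[of h], of y] by simp
 have "(\<Sum>h\<in>?R. real_of_int (fire S k1 k2 h y)) = (\<Sum>h\<in>?R. real_of_int (h y))"
  by (rule sum.reindex_bij_betw[OF bij_betw_fire[OF S]])
 moreover have "real_of_int (fire S k1 k2 h y) = real_of_int (h y) + (real (k1 y) + real (dg (?A h) y)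
   - (real (dg S y) + real (k1 y) + real (k2 y)) * of_bool (y \<in> ?A h))" for h using y d[of h] by (auto simp: fire_def Let_def)
 ultimately have "(\<Sum>h\<in>?R. real (k1 y) + real (dg (?A h) y)
   - (real (dg S y) + real (k1 y) + real (k2 y)) * of_bool (y \<in> ?A h)) = 0" by (simp add: sum.distrib)
 hence "real (k1 y) * real (card ?R) + (\<Sum>h\<in>?R. real (dg (?A h) y))
   - (real (dg S y) + real (k1 y) + real (k2 y)) * ign S k1 k2 y = 0"
  by (simp only: sum.distrib sum_subtractf sum_distrib_left[symmetric] ign_def sum_constant) (simp add: mult.commute)
 moreover have "(\<Sum>h\<in>?R. real (dg (?A h) y)) = (\<Sum>z\<in>S. of_bool (adj y z) * ign S k1 k2 z)"
  unfolding real_dg_subset[OF S AS] ign_def sum_distrib_left by (rule sum.swap)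
 ultimately show ?thesis by (simp add: lp_def trees_def algebra_simps)
qed

text \<open>After firing sink 1, the sites that burn from sink 2 are those that did not burn from
  sink 1 before; firing is a bijection, so the two counts are complementary.\<close>

lemma ign_swap:
 assumes S: "finite S" and y: "y \<in> S"
 shows "ign S k1 k2 y + ign S k2 k1 y = real (trees S (\<lambda>y. k1 y + k2 y))"
proof -
 let ?R = "rec S (\<lambda>y. k1 y + k2 y)"
 have "ign S k2 k1 y = (\<Sum>h\<in>?R. of_bool (y \<in> burnt S S k1 h))" unfolding ign_def by (simp add: add.commute)
 also have "... = (\<Sum>h\<in>?R. of_bool (y \<in> burnt S S k1 (fire S k1 k2 h)))"
  by (rule sum.reindex_bij_betw[OF bij_betw_fire[OF S], symmetric])
 also have "... = (\<Sum>h\<in>?R. 1 - of_bool (y \<in> burnt S S k2 h))" by (rule sum.cong) (use fire_rec(2)[OF S] y in auto)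
 finally show ?thesis by (simp add: ign_def sum_subtractf trees_def)
qed

lemma trees_zero: assumes "finite S" "S \<noteq> {}" shows "trees S (\<lambda>_. 0) = 0"
proof -
 have "False" if e: "h \<in> rec S (\<lambda>_. 0)" for h
 proof -
  obtain y where "y \<in> S" "int (dg S y) < h y" using recD(3)[OF e, of S] assms by auto
  thus False using recD(2)[OF e, of y] by auto
 qed
 hence "rec S (\<lambda>_. 0) = {}" by auto
 thus ?thesis by (simp add: trees_def)
qed

lemma trees_singleton: "trees {x} k = k x"
proof -
 have "rec {x} k = (\<lambda>c y. if y = x then c else 0) ` {1..int (k x)}"
 proof (intro equalityI subsetI)
  fix h assume e: "h \<in> rec {x} k"
  have "h = (\<lambda>y. if y = x then h x else 0)" using recD(1)[OF e] by auto
  moreover have "h x \<in> {1..int (k x)}" using recD(2)[OF e, of x] rec_ge_1[OF e, of x] dg_self[of x "{}"] by auto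
  ultimately show "h \<in> (\<lambda>c y. if y = x then c else 0) ` {1..int (k x)}" by (rule image_eqI)
 next
  fix h assume "h \<in> (\<lambda>c y. if y = x then c else 0) ` {1..int (k x)}"
  then obtain c where c: "c \<in> {1..int (k x)}" "h = (\<lambda>y. if y = x then c else 0)" by auto
  have d: "dg {x} x = 0" using dg_self[of x "{}"] by simp
  show "h \<in> rec {x} k" unfolding rec_def
  proof (intro CollectI conjI allI impI ballI)
   fix F assume "F \<subseteq> {x}" "F \<noteq> {}"
   hence "F = {x}" by auto
   thus "\<exists>y\<in>F. int (dg F y) < h y" using c d by simp
  qed (use c d in auto)
 qed
 moreover have "inj_on (\<lambda>c y. if y = x then c else (0::int)) {1..int (k x)}" by (rule inj_onI) (auto dest: fun_cong[where x=x])
 ultimately show ?thesis by (simp add: trees_def card_image)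
qed

definition wire :: "'a set => ('a => nat) => 'a => nat" where
 "wire Q k y = k y + dg Q y"

lemma trees_single_sink:
 assumes D: "finite D" "x \<in> D"
 shows "trees D (\<lambda>y. if y = x then c else 0) = c * trees (D - {x}) (dg {x})"
proof -
 let ?k = "\<lambda>y. if y = x then c else 0"
 have "trees D ?k = (\<Sum>A\<in>Pow {x}. trees A (\<lambda>y. ?k y - 0) * trees (D - A) (resid {x} A ?k (\<lambda>_. 0)))"
  by (rule trees_decomp) (use D in auto)
 also have "... = trees (D - {}) (resid {x} {} ?k (\<lambda>_. 0)) + trees {x} (\<lambda>y. ?k y - 0) * trees (D - {x}) (resid {x} {x} ?k (\<lambda>_. 0))"
  by (simp add: Pow_insert)
 also have "trees (D - {}) (resid {x} {} ?k (\<lambda>_. 0)) = trees D (\<lambda>_. 0)" by (simp, rule trees_cong) (auto simp: resid_def)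
 also have "trees D (\<lambda>_. 0) = 0" using trees_zero D by auto
 also have "trees (D - {x}) (resid {x} {x} ?k (\<lambda>_. 0)) = trees (D - {x}) (dg {x})" by (rule trees_cong) (auto simp: resid_def)
 finally show ?thesis unfolding trees_singleton by simp
qed

text \<open>Burn everything possible except x. If A is burnt, then x has \<open>k x + dg A x\<close>
  burnt edges and as many admissible heights, and summing over A turns \<open>dg A x\<close> into
  the voltages \<open>ign\<close> at the neighbours of x.\<close>

lemma trees_root:
 assumes S: "finite S" "x \<in> S"
 shows "real (trees S k) = real (k x) * real (trees (S - {x}) (wire {x} k)) +
      (\<Sum>z\<in>S - {x}. of_bool (adj x z) * ign (S - {x}) k (dg {x}) z)"
proof -
 let ?S = "S - {x}"
 have fS: "finite ?S" using S by auto
 have w: "wire {x} k = (\<lambda>y. k y + dg {x} y)" by (simp add: wire_def fun_eq_iff)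
 have "trees S k = (\<Sum>A\<in>Pow ?S. trees A (\<lambda>y. k y - 0) * trees (S - A) (resid ?S A k (\<lambda>_. 0)))"
  by (rule trees_decomp) (use S in auto)
 also have "... = (\<Sum>A\<in>Pow ?S. card {h\<in>rec ?S (\<lambda>y. k y + dg {x} y). burnt ?S ?S (dg {x}) h = A} * (k x + dg A x))"
 proof (rule sum.cong[OF refl])
  fix A assume A: "A \<in> Pow ?S"
  have "trees (S - A) (resid ?S A k (\<lambda>_. 0)) = trees (S - A) (\<lambda>y. if y = x then k x + dg A x else 0)"
   by (rule trees_cong) (auto simp: resid_def)
  also have "... = (k x + dg A x) * trees (S - A - {x}) (dg {x})" by (rule trees_single_sink) (use S A in auto)
  also have "S - A - {x} = ?S - A" by auto
  finally have 1: "trees (S - A) (resid ?S A k (\<lambda>_. 0)) = (k x + dg A x) * trees (?S - A) (dg {x})" .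
  have "card {h\<in>rec ?S (\<lambda>y. k y + dg {x} y). burnt ?S ?S (dg {x}) h = A}
    = trees A (\<lambda>y. k y + dg {x} y - dg {x} y) * trees (?S - A) (resid ?S A (\<lambda>y. k y + dg {x} y) (dg {x}))"
   by (rule card_burnt) (use fS A in auto)
  also have "trees (?S - A) (resid ?S A (\<lambda>y. k y + dg {x} y) (dg {x})) = trees (?S - A) (dg {x})"
   by (rule trees_cong) (auto simp: resid_def)
  finally show "trees A (\<lambda>y. k y - 0) * trees (S - A) (resid ?S A k (\<lambda>_. 0)) =
    card {h\<in>rec ?S (\<lambda>y. k y + dg {x} y). burnt ?S ?S (dg {x}) h = A} * (k x + dg A x)" using 1 by simp
 qed
 also have "... = (\<Sum>A\<in>Pow ?S. \<Sum>h\<in>{h\<in>rec ?S (\<lambda>y. k y + dg {x} y). burnt ?S ?S (dg {x}) h = A}. k x + dg (burnt ?S ?S (dg {x}) h) x)"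
  by (rule sum.cong) auto
 also have "... = (\<Sum>h\<in>rec ?S (\<lambda>y. k y + dg {x} y). k x + dg (burnt ?S ?S (dg {x}) h) x)"
  by (rule sum_burnt[symmetric]) (use fS in auto)
 finally have "real (trees S k) = real (k x) * real (trees ?S (wire {x} k))
   + (\<Sum>h\<in>rec ?S (\<lambda>y. k y + dg {x} y). real (dg (burnt ?S ?S (dg {x}) h) x))" by (simp add: sum.distrib trees_def w)
 also have "(\<Sum>h\<in>rec ?S (\<lambda>y. k y + dg {x} y). real (dg (burnt ?S ?S (dg {x}) h) x))
   = (\<Sum>z\<in>?S. of_bool (adj x z) * ign ?S k (dg {x}) z)"
  unfolding real_dg_subset[OF fS burnt_subset] ign_def sum_distrib_left by (rule sum.swap)
 finally show ?thesis .
qed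

text \<open>Deletion-contraction for c parallel sink edges at x: a tree avoids all of them, or uses
  exactly one of them and x merges with the sink.\<close>

lemma trees_add_sink:
 assumes S: "finite S" "x \<in> S"
 shows "trees S (k(x := k x + c)) = trees S k + c * trees (S - {x}) (wire {x} k)"
proof -
 let ?k = "k(x := k x + c)"
 have t: "trees (S - {x}) (wire {x} ?k) = trees (S - {x}) (wire {x} k)" by (rule trees_cong) (auto simp: wire_def)
 have r: "rec (S - {x}) (\<lambda>y. ?k y + dg {x} y) = rec (S - {x}) (\<lambda>y. k y + dg {x} y)" by (rule rec_cong) auto
 have i: "ign (S - {x}) ?k (dg {x}) z = ign (S - {x}) k (dg {x}) z" for z unfolding ign_def r ..
 have "real (trees S ?k) = real (trees S k + c * trees (S - {x}) (wire {x} k))"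
  unfolding trees_root[OF S, of ?k] i t of_nat_add of_nat_mult trees_root[OF S, of k] by (simp add: algebra_simps)
 thus ?thesis by linarith
qed

text \<open>Divided by \<open>trees S k\<close>, u is the Green function of S with pole x. Its value
  at the pole, the ratio of two counts, is the effective resistance between x and the sink; u itself
  is the voltage with x as sink 1.\<close>

lemma potential:
 assumes S: "finite S" "x \<in> S"
 obtains u where "u x = real (trees (S - {x}) (wire {x} k))"
  and "\<And>y. 0 \<le> u y" and "\<And>y. u y \<le> u x"
  and "\<And>y. y \<in> S ==> lp S k u y = (if y = x then real (trees S k) else 0)"
  and "\<And>y. y \<in> S - {x} ==> u y = ign (S - {x}) (dg {x}) k y"
proof -
 let ?S = "S - {x}"
 define w where "w = ign ?S k (dg {x})"
 define t where "t = real (trees ?S (wire {x} k))"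
 define u where "u = (\<lambda>y. if y = x then t else t - w y)"
 have fS: "finite ?S" using S by auto
 have wr: "wire {x} k = (\<lambda>y. k y + dg {x} y)" by (simp add: wire_def fun_eq_iff)
 have wb: "0 \<le> w y" "w y \<le> t" for y using ign_bounds[OF fS, of k "dg {x}" y] by (auto simp: w_def t_def wr)
 have Ssum: "(\<Sum>z\<in>S. of_bool (adj y z) * u z) = of_bool (adj y x) * t + (\<Sum>z\<in>?S. of_bool (adj y z) * (t - w z))" for y
  using S by (subst sum.remove[of S x]) (auto simp: u_def intro!: sum.cong)
 have dS: "real (dg ?S y) = (\<Sum>z\<in>?S. of_bool (adj y z))" for y by (rule real_dg[OF fS])
 have Sd: "real (dg S y) = real (dg ?S y) + of_bool (adj y x)" for y using dg_Diff[of S "{x}" y] S by (simp add: dg_singleton)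
 show thesis
 proof (rule that[of u])
  show "u x = real (trees ?S (wire {x} k))" by (simp add: u_def t_def)
  show "0 \<le> u y" for y using wb[of y] by (auto simp: u_def)
  show "u y \<le> u x" for y using wb[of y] by (auto simp: u_def)
  show "u y = ign ?S (dg {x}) k y" if y: "y \<in> ?S" for y using ign_swap[OF fS y, of k "dg {x}"] y by (simp add: u_def t_def w_def wr)
  fix y assume y: "y \<in> S"
  have s: "(\<Sum>z\<in>?S. of_bool (adj y z) * (t - w z)) = real (dg ?S y) * t - (\<Sum>z\<in>?S. of_bool (adj y z) * w z)"
   by (simp add: dS sum_distrib_right sum_subtractf right_diff_distrib)
  show "lp S k u y = (if y = x then real (trees S k) else 0)"
  proof (cases "y = x")
   case True
   have "lp S k u y = (real (dg ?S x) + real (k x)) * t - (real (dg ?S x) * t - (\<Sum>z\<in>?S. of_bool (adj x z) * w z))"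
    unfolding lp_def Ssum s Sd using True adj_irrefl by (simp add: u_def Sd s)
   also have "... = real (trees S k)" unfolding trees_root[OF S, of k] w_def t_def by (simp add: algebra_simps)
   finally show ?thesis using True by simp
  next
   case False
   hence "y \<in> ?S" using y by auto
   from lp_ign[OF fS this, of k "dg {x}"]
   have "(real (dg ?S y) + (real (k y) + of_bool (adj y x))) * w y - (\<Sum>z\<in>?S. of_bool (adj y z) * w z) = real (k y) * t"
    by (simp add: lp_def w_def t_def wr dg_singleton)
   thus ?thesis using False unfolding lp_def Ssum s Sd by (simp add: u_def algebra_simps)
  qed
 qed
qed

definition enb :: "'a set => ('a => nat) => ('a => real) => ('a => real) => real" where
 "enb S k f g = (\<Sum>y\<in>S. \<Sum>z\<in>S. of_bool (adj y z) * ((f y - f z) * (g y - g z))) / 2 + (\<Sum>y\<in>S. real (k y) * (f y * g y))"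

abbreviation "en S k f \<equiv> enb S k f f"

lemma en_nonneg: "0 \<le> en S k f"
proof -
 have "0 \<le> of_bool b * (c * c)" for b and c :: real by simp
 thus ?thesis unfolding enb_def by (intro add_nonneg_nonneg divide_nonneg_pos sum_nonneg) auto
qed

lemma sum_lp:
 assumes "finite S"
 shows "(\<Sum>y\<in>S. f y * lp S k u y) = enb S k f u"
proof -
 let ?a = "\<lambda>y z. (of_bool (adj y z) :: real)"
 have sy: "?a y z = ?a z y" for y z using adj_sym by (auto simp: of_bool_def)
 have d: "real (dg S y) = (\<Sum>z\<in>S. ?a y z)" for y by (rule real_dg[OF assms])
 have "(\<Sum>y\<in>S. f y * lp S k u y) = (\<Sum>y\<in>S. \<Sum>z\<in>S. ?a y z * (f y * u y - f y * u z)) + (\<Sum>y\<in>S. real (k y) * (f y * u y))"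
  unfolding sum.distrib[symmetric]
  by (rule sum.cong) (simp_all add: lp_def d sum_distrib_left sum_distrib_right sum_subtractf algebra_simps)
 also have "(\<Sum>y\<in>S. \<Sum>z\<in>S. ?a y z * (f y * u y - f y * u z)) = (\<Sum>y\<in>S. \<Sum>z\<in>S. ?a y z * ((f y - f z) * (u y - u z))) / 2"
 proof -
  have "(\<Sum>y\<in>S. \<Sum>z\<in>S. ?a y z * (f y * u y - f y * u z)) = (\<Sum>z\<in>S. \<Sum>y\<in>S. ?a y z * (f y * u y - f y * u z))"
   by (rule sum.swap)
  also have "... = (\<Sum>y\<in>S. \<Sum>z\<in>S. ?a y z * (f z * u z - f z * u y))" by (intro sum.cong refl) (simp add: sy)
  finally have sw: "(\<Sum>y\<in>S. \<Sum>z\<in>S. ?a y z * (f y * u y - f y * u z)) = (\<Sum>y\<in>S. \<Sum>z\<in>S. ?a y z * (f z * u z - f z * u y))" .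
  have "(\<Sum>y\<in>S. \<Sum>z\<in>S. ?a y z * ((f y - f z) * (u y - u z))) =
    (\<Sum>y\<in>S. \<Sum>z\<in>S. ?a y z * (f y * u y - f y * u z)) + (\<Sum>y\<in>S. \<Sum>z\<in>S. ?a y z * (f z * u z - f z * u y))"
   unfolding sum.distrib[symmetric] by (intro sum.cong refl) (simp add: algebra_simps)
  thus ?thesis using sw by simp
 qed
 finally show ?thesis by (simp add: enb_def)
qed

lemma enb_expand: "en S k (\<lambda>y. f y - a * g y) = en S k f - 2 * a * enb S k f g + a\<^sup>2 * en S k g"
proof -
 let ?a = "\<lambda>y z. (of_bool (adj y z) :: real)"
 have 1: "(\<Sum>y\<in>S. \<Sum>z\<in>S. ?a y z * (((f y - a * g y) - (f z - a * g z)) * ((f y - a * g y) - (f z - a * g z))))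
  = (\<Sum>y\<in>S. \<Sum>z\<in>S. ?a y z * ((f y - f z) * (f y - f z))) - 2 * a * (\<Sum>y\<in>S. \<Sum>z\<in>S. ?a y z * ((f y - f z) * (g y - g z)))
   + a\<^sup>2 * (\<Sum>y\<in>S. \<Sum>z\<in>S. ?a y z * ((g y - g z) * (g y - g z)))"
  unfolding sum_distrib_left sum_subtractf[symmetric] sum.distrib[symmetric]
  by (intro sum.cong refl) (simp add: algebra_simps power2_eq_square)
 have 2: "(\<Sum>y\<in>S. real (k y) * ((f y - a * g y) * (f y - a * g y)))
  = (\<Sum>y\<in>S. real (k y) * (f y * f y)) - 2 * a * (\<Sum>y\<in>S. real (k y) * (f y * g y)) + a\<^sup>2 * (\<Sum>y\<in>S. real (k y) * (g y * g y))"
  unfolding sum_distrib_left sum_subtractf[symmetric] sum.distrib[symmetric]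
  by (intro sum.cong refl) (simp add: algebra_simps power2_eq_square)
 show ?thesis unfolding enb_def 1 2 by (simp add: algebra_simps add_divide_distrib diff_divide_distrib)
qed

end

lemma discriminant_le:
 fixes p b q :: real
 assumes "\<And>a. 0 \<le> p - 2 * a * b + a\<^sup>2 * q" and "0 \<le> q"
 shows "b\<^sup>2 \<le> p * q"
proof (cases "q = 0")
 case True
 have "b = 0"
 proof (rule ccontr)
  assume "b \<noteq> 0"
  thus False using assms(1)[of "(p + 1) / (2 * b)"] True by (simp add: field_simps)
 qed
 thus ?thesis using True by simp
next
 case False
 hence "q > 0" using assms by simp
 thus ?thesis using assms(1)[of "b / q"] by (simp add: field_simps power2_eq_square)
qed

context symmetric_graph
begin

lemma enb_Cauchy_Schwarz: "(enb S k f g)\<^sup>2 \<le> en S k f * en S k g"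
 by (rule discriminant_le) (use en_nonneg enb_expand[of S k f _ g] in \<open>auto\<close>, metis en_nonneg enb_expand)

text \<open>Dirichlet principle: pairing f with the potential of pole x reproduces
  \<open>f x\<close>, and Cauchy-Schwarz for the energy form bounds its square by energy times
  resistance.\<close>

lemma trees_energy_le:
 assumes S: "finite S" "x \<in> S"
 shows "(f x)\<^sup>2 * real (trees S k) \<le> en S k f * real (trees (S - {x}) (wire {x} k))"
proof (cases "trees S k = 0")
 case True
 thus ?thesis using en_nonneg by simp
next
 case False
 obtain u where u: "u x = real (trees (S - {x}) (wire {x} k))"
  "\<And>y. y \<in> S ==> lp S k u y = (if y = x then real (trees S k) else 0)" using potential[OF S, of k] by metis
 have *: "enb S k f' u = f' x * real (trees S k)" for f'
  using sum_lp[OF S(1), of f' k u] u(2) S by (simp add: sum.delta if_distrib cong: if_cong)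
 have "(f x * real (trees S k))\<^sup>2 \<le> en S k f * (u x * real (trees S k))" using enb_Cauchy_Schwarz[of S k f u] unfolding * .
 hence "((f x)\<^sup>2 * real (trees S k)) * real (trees S k) \<le> (en S k f * u x) * real (trees S k)"
  by (simp add: power2_eq_square mult_ac)
 thus ?thesis using False u(1) by (simp add: mult_le_cancel_right)
qed

text \<open>Rayleigh monotonicity: turning vertices into sinks lowers effective resistances.\<close>

lemma trees_wire_mono:
 assumes S: "finite S" "S1 \<subseteq> S" "x \<in> S1" and k1: "\<And>y. y \<in> S1 ==> k1 y = k y + dg (S - S1) y"
 shows "trees (S1 - {x}) (wire {x} k1) * trees S k \<le> trees (S - {x}) (wire {x} k) * trees S1 k1"
proof -
 have f1: "finite S1" using S finite_subset by auto
 obtain u where u: "u x = real (trees (S1 - {x}) (wire {x} k1))"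
  "\<And>y. y \<in> S1 ==> lp S1 k1 u y = (if y = x then real (trees S1 k1) else 0)" using potential[OF f1 S(3), of k1] by metis
 \<comment> \<open>Extending the potential of S1 by zero preserves its energy: the edges from S1 to
   S - S1 are exactly the additional sinks in \<open>k1\<close>. The extension is then a trial
   function on S.\<close>
 define f where "f = (\<lambda>y. if y \<in> S1 then u y else 0)"
 have "en S k f = (\<Sum>y\<in>S. f y * lp S k f y)" by (rule sum_lp[OF S(1), symmetric])
 also have "... = (\<Sum>y\<in>S1. f y * lp S k f y)" by (rule sum.mono_neutral_right) (use S in \<open>auto simp: f_def\<close>)
 also have "... = (\<Sum>y\<in>S1. u y * lp S1 k1 u y)"
 proof (rule sum.cong[OF refl])
  fix y assume y: "y \<in> S1"
  have "(\<Sum>z\<in>S. of_bool (adj y z) * f z) = (\<Sum>z\<in>S1. of_bool (adj y z) * f z)"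
   by (rule sum.mono_neutral_right) (use S in \<open>auto simp: f_def\<close>)
  also have "... = (\<Sum>z\<in>S1. of_bool (adj y z) * u z)" by (rule sum.cong) (auto simp: f_def)
  finally show "f y * lp S k f y = u y * lp S1 k1 u y" using y k1[OF y] dg_Diff[OF S(1,2), of y] by (simp add: lp_def f_def)
 qed
 also have "... = (\<Sum>y\<in>S1. if y = x then u x * real (trees S1 k1) else 0)" by (rule sum.cong) (auto simp: u(2))
 also have "... = u x * real (trees S1 k1)" using S f1 by simp
 finally have e: "en S k f = u x * real (trees S1 k1)" .
 have "(u x)\<^sup>2 * real (trees S k) \<le> (u x * real (trees S1 k1)) * real (trees (S - {x}) (wire {x} k))"
  using trees_energy_le[OF S(1), of x f k] S e by (auto simp: f_def)
 hence "u x * (u x * real (trees S k)) \<le> u x * (real (trees S1 k1) * real (trees (S - {x}) (wire {x} k)))"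
  by (simp add: power2_eq_square mult_ac)
 hence "u x = 0 \<or> u x * real (trees S k) \<le> real (trees S1 k1) * real (trees (S - {x}) (wire {x} k))"
  using u(1) by (auto simp: mult_le_cancel_left)
 hence "real (trees (S1 - {x}) (wire {x} k1) * trees S k) \<le> real (trees (S - {x}) (wire {x} k) * trees S1 k1)"
  using u(1) by (auto simp: mult_ac)
 thus ?thesis by linarith
qed

section \<open>Burning in two stages, currents, and wiring of several vertices\<close>

lemma burnt_extend:
 assumes S: "finite S" "B \<subseteq> S" and A: "A = burnt S B j h"
 shows "burnt (S - A) (S - A) j (cut (S - A) h) \<subseteq> burnt S S j h"
proof -
 let ?A' = "burnt (S - A) (S - A) j (cut (S - A) h)"
 have A'S: "?A' \<subseteq> S - A" by (rule burnt_subset)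
 have AS: "A \<subseteq> S" using A burnt_subset S by blast
 have ig: "ignites S j h A" using ignites_burnt[OF S] A by simp
 have ig': "ignites (S - A) j (cut (S - A) h) ?A'" by (rule ignites_burnt) (use S in auto)
 have "ignites S j h (A \<union> ?A')" unfolding ignites_def
 proof (intro allI impI)
  fix F assume F: "F \<subseteq> A \<union> ?A'" "F \<noteq> {}"
  have FS: "F \<subseteq> S" using F AS A'S by blast
  show "\<exists>y\<in>F. int (dg (F \<union> (S - (A \<union> ?A'))) y + j y) < h y"
  proof (cases "F \<inter> A = {}")
   case True
   hence "F \<subseteq> ?A'" using F by auto
   then obtain y where y: "y \<in> F" "int (dg (F \<union> (S - A - ?A')) y + j y) < cut (S - A) h y"
    using ig' F unfolding ignites_def by blast
   have "S - A - ?A' = S - (A \<union> ?A')" by auto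
   moreover have "cut (S - A) h y = h y" using y \<open>F \<subseteq> ?A'\<close> A'S by (auto simp: cut_def)
   ultimately show ?thesis using y by auto
  next
   case False
   then obtain y where y: "y \<in> F \<inter> A" "int (dg ((F \<inter> A) \<union> (S - A)) y + j y) < h y"
    using ig unfolding ignites_def by (metis Int_lower2)
   have "dg (F \<union> (S - (A \<union> ?A'))) y \<le> dg ((F \<inter> A) \<union> (S - A)) y"
    by (rule dg_mono) (use F FS S finite_subset[OF FS] in auto)
   thus ?thesis using y by (intro bexI[of _ y]) auto
  qed
 qed
 moreover have "A \<union> ?A' \<subseteq> S" using AS A'S by auto
 ultimately have "A \<union> ?A' \<subseteq> burnt S S j h" unfolding burnt_def[of S S] by (intro Union_upper) auto
 thus ?thesis by simp
qed

text \<open>The left side is the current into sink 2 of the second stage, started afresh on S - A.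
  Burning may pause at the edge of B and resume, so the unrestricted burning touches at least these
  edges of sink 2.\<close>

lemma sum_ign_le:
 assumes S: "finite S" "B \<subseteq> S" "A \<subseteq> B"
  and r: "\<And>y. y \<in> S - A ==> resid B A (\<lambda>y. k1 y + k2 y) k2 y = k1' y + k2 y"
 shows "real (trees A k1) * (\<Sum>y\<in>S - A. real (k2 y) * ign (S - A) k1' k2 y)
  \<le> (\<Sum>h\<in>{h\<in>rec S (\<lambda>y. k1 y + k2 y). burnt S B k2 h = A}. \<Sum>y\<in>S. real (k2 y) * of_bool (y \<in> burnt S S k2 h))"
proof -
 let ?R = "{h\<in>rec S (\<lambda>y. k1 y + k2 y). burnt S B k2 h = A}"
 let ?f = "\<lambda>\<zeta>. \<Sum>y\<in>S - A. real (k2 y) * of_bool (y \<in> burnt (S - A) (S - A) k2 \<zeta>)"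
 have rr: "rec (S - A) (resid B A (\<lambda>y. k1 y + k2 y) k2) = rec (S - A) (\<lambda>y. k1' y + k2 y)" by (rule rec_cong) (rule r)
 have "bij_betw (split_at S k2 A) ?R (rec A (\<lambda>y. k1 y + k2 y - k2 y) \<times> rec (S - A) (resid B A (\<lambda>y. k1 y + k2 y) k2))"
  by (rule bij_betw_split[OF S]) auto
 hence bij: "bij_betw (split_at S k2 A) ?R (rec A k1 \<times> rec (S - A) (\<lambda>y. k1' y + k2 y))" unfolding rr by simp
 have "real (trees A k1) * (\<Sum>y\<in>S - A. real (k2 y) * ign (S - A) k1' k2 y)
  = real (trees A k1) * (\<Sum>\<zeta>\<in>rec (S - A) (\<lambda>y. k1' y + k2 y). ?f \<zeta>)"
  unfolding ign_def sum_distrib_left[of "real (k2 _)"] by (subst sum.swap) simp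
 also have "... = (\<Sum>p\<in>rec A k1 \<times> rec (S - A) (\<lambda>y. k1' y + k2 y). ?f (snd p))"
  by (simp add: sum.cartesian_product' trees_def flip: sum.cartesian_product)
 also have "... = (\<Sum>h\<in>?R. ?f (snd (split_at S k2 A h)))" by (rule sum.reindex_bij_betw[OF bij, symmetric])
 also have "... \<le> (\<Sum>h\<in>?R. \<Sum>y\<in>S. real (k2 y) * of_bool (y \<in> burnt S S k2 h))"
 proof (rule sum_mono)
  fix h assume e: "h \<in> ?R"
  have sub: "burnt (S - A) (S - A) k2 (cut (S - A) h) \<subseteq> burnt S S k2 h" by (rule burnt_extend[OF S(1,2)]) (use e in auto)
  have "?f (snd (split_at S k2 A h)) \<le> (\<Sum>y\<in>S - A. real (k2 y) * of_bool (y \<in> burnt S S k2 h))"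
   unfolding split_at_def snd_conv by (intro sum_mono mult_left_mono) (use sub in auto)
  also have "... \<le> (\<Sum>y\<in>S. real (k2 y) * of_bool (y \<in> burnt S S k2 h))" by (rule sum_mono2) (use S in auto)
  finally show "?f (snd (split_at S k2 A h)) \<le> (\<Sum>y\<in>S. real (k2 y) * of_bool (y \<in> burnt S S k2 h))" .
 qed
 finally show ?thesis .
qed

text \<open>Conservation of current: testing the voltage equation against the constant 1 shows that
  what leaves through sink 2 entered through sink 1, whose edges carry at most one unit
  each.\<close>

lemma sum_ign_total:
 assumes S: "finite S"
 shows "(\<Sum>y\<in>S. real (k2 y) * ign S k1 k2 y) \<le> real (trees S (\<lambda>y. k1 y + k2 y)) * (\<Sum>y\<in>S. real (k1 y))"
proof -
 let ?k = "\<lambda>y. k1 y + k2 y"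
 have "(\<Sum>y\<in>S. 1 * lp S ?k (ign S k1 k2) y) = enb S ?k (\<lambda>_. 1) (ign S k1 k2)" by (rule sum_lp[OF S])
 hence "real (trees S ?k) * (\<Sum>y\<in>S. real (k1 y)) = (\<Sum>y\<in>S. real (k1 y) * ign S k1 k2 y) + (\<Sum>y\<in>S. real (k2 y) * ign S k1 k2 y)"
  using lp_ign[OF S, of _ k1 k2] by (simp add: enb_def sum.distrib sum_distrib_right algebra_simps)
 moreover have "0 \<le> (\<Sum>y\<in>S. real (k1 y) * ign S k1 k2 y)"
  by (intro sum_nonneg mult_nonneg_nonneg) (use ign_bounds[OF S] in auto)
 ultimately show ?thesis by simp
qed

lemma burnt_eq_larger:
 assumes "finite S" "B \<subseteq> B'" "B' \<subseteq> S" "burnt S B' j h \<subseteq> B"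
 shows "burnt S B j h = burnt S B' j h"
proof -
 have BS: "B \<subseteq> S" using assms by auto
 show ?thesis unfolding burnt_eq_iff[OF assms(1) BS assms(4)] using ignites_burnt[OF assms(1,3)] burnt_stuck[OF assms(1,3)] assms by blast
qed

lemma sum_dg_le:
 assumes "finite S" "finite W" "\<And>w. w \<in> W ==> dg S w \<le> D"
 shows "(\<Sum>y\<in>S. dg W y) \<le> D * card W"
proof -
 have "(\<Sum>y\<in>S. dg W y) = (\<Sum>y\<in>S. \<Sum>w\<in>W. of_bool (adj y w))" using assms by (simp add: dg_sum)
 also have "... = (\<Sum>w\<in>W. \<Sum>y\<in>S. of_bool (adj w y))"
  using adj_sym by (subst sum.swap) (intro sum.cong refl, auto simp: of_bool_def)
 also have "... = (\<Sum>w\<in>W. dg S w)" using assms by (simp add: dg_sum)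
 also have "... \<le> (\<Sum>w\<in>W. D)" by (rule sum_mono) (rule assms)
 finally show ?thesis by (simp add: mult.commute)
qed

lemma wire_wire: "y \<in> S ==> finite Q ==> x \<notin> Q ==> wire {x} (wire Q k) y = wire (insert x Q) k y"
 using dg_Un[of "{x}" Q y] by (simp add: wire_def)

lemma trees_wire_insert:
 "finite Q ==> x \<notin> Q ==> trees (S - Q - {x}) (wire {x} (wire Q k)) = trees (S - insert x Q) (wire (insert x Q) k)"
proof -
 assume a: "finite Q" "x \<notin> Q"
 have "S - insert x Q = S - Q - {x}" by auto
 thus ?thesis using a by (simp, intro trees_cong wire_wire) auto
qed

lemma trees_wire_pos:
 assumes S: "finite S" "Q \<subseteq> S" and t: "0 < trees S k"
 shows "0 < trees (S - Q) (wire Q k)"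
proof -
 have "finite Q" using S finite_subset by blast
 thus ?thesis using S(2)
 proof (induction Q rule: finite_induct)
  case empty
  have "trees S (wire {} k) = trees S k" by (rule trees_cong) (simp add: wire_def)
  thus ?case using t by simp
 next
  case (insert x Q)
  have x: "x \<in> S - Q" using insert by auto
  have "(1::real)\<^sup>2 * real (trees (S - Q) (wire Q k)) \<le> en (S - Q) (wire Q k) (\<lambda>_. 1) * real (trees (S - Q - {x}) (wire {x} (wire Q k)))"
   by (rule trees_energy_le) (use S x in auto)
  moreover have "0 < trees (S - Q) (wire Q k)" using insert by auto
  ultimately have "trees (S - Q - {x}) (wire {x} (wire Q k)) \<noteq> 0" by (intro notI) simp
  thus ?case using trees_wire_insert[of Q x S k] insert by simp
 qed
qed

text \<open>Wire the vertices of Q one at a time: the ratio of counts is a telescoping product of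
  effective resistances, each monotone by Rayleigh. Positivity of the intermediate counts allows
  cancelling.\<close>

lemma trees_wires_mono:
 assumes S: "finite S" "S1 \<subseteq> S" "Q \<subseteq> S1" and k1: "\<And>y. y \<in> S1 ==> k1 y = k y + dg (S - S1) y"
 shows "trees (S1 - Q) (wire Q k1) * trees S k \<le> trees (S - Q) (wire Q k) * trees S1 k1"
proof (cases "trees S k = 0")
 case False
 hence "finite Q" using S finite_subset by blast
 thus ?thesis using S(3)
 proof (induction Q rule: finite_induct)
  case empty
  have "trees S (wire {} k) = trees S k" "trees S1 (wire {} k1) = trees S1 k1" by (auto intro!: trees_cong simp: wire_def)
  thus ?case by simp
 next
  case (insert x Q)
  let ?a1 = "trees (S1 - Q) (wire Q k1)" and ?a = "trees (S - Q) (wire Q k)"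
  let ?b1 = "trees (S1 - insert x Q) (wire (insert x Q) k1)" and ?b = "trees (S - insert x Q) (wire (insert x Q) k)"
  have IH: "?a1 * trees S k \<le> ?a * trees S1 k1" using insert by auto
  have "trees (S1 - Q - {x}) (wire {x} (wire Q k1)) * trees (S - Q) (wire Q k)
   \<le> trees (S - Q - {x}) (wire {x} (wire Q k)) * trees (S1 - Q) (wire Q k1)"
  proof (rule trees_wire_mono)
   fix y assume y: "y \<in> S1 - Q"
   have "S - Q - (S1 - Q) = S - S1" using insert by auto
   thus "wire Q k1 y = wire Q k y + dg (S - Q - (S1 - Q)) y" using k1[of y] y by (simp add: wire_def)
  qed (use S insert in auto)
  hence step: "?b1 * ?a \<le> ?b * ?a1" using insert by (simp add: trees_wire_insert)
  have a0: "0 < ?a" by (rule trees_wire_pos) (use S insert False in auto)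
  have "(?b1 * trees S k) * ?a = (?b1 * ?a) * trees S k" by simp
  also have "... \<le> (?b * ?a1) * trees S k" using step by (rule mult_right_mono) simp
  also have "... = ?b * (?a1 * trees S k)" by simp
  also have "... \<le> ?b * (?a * trees S1 k1)" using IH by (rule mult_left_mono) simp
  finally have "(?b1 * trees S k) * ?a \<le> (?b * trees S1 k1) * ?a" by (simp add: mult_ac)
  thus ?case using a0 by (simp only: mult_le_cancel2)
 qed
qed simp

text \<open>Sinks of strength c are added on Y and removed again by deletion-contraction, one site
  at a time. Rayleigh monotonicity controls wiring a set but not deleting it; with c counting the
  edges to a deleted set, this formula expresses deletion through wirings, at the price of
  signs.\<close>

lemma trees_expand:
 assumes "finite Y" "finite S" "Y \<subseteq> S"
 shows "real (trees S k) = (\<Sum>Q\<in>Pow Y. (\<Prod>y\<in>Q. - real (c y)) *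
   real (trees (S - Q) (\<lambda>z. k z + (if z \<in> Y then c z else 0) + dg Q z)))" using assms
proof (induction Y arbitrary: S k rule: finite_induct)
 case empty
 have "trees S (\<lambda>z. k z + (if z \<in> {} then c z else 0) + dg {} z) = trees S k" by (rule trees_cong) simp
 thus ?case by simp
next
 case (insert y Y)
 define k' where "k' = k(y := k y + c y)"
 let ?T = "\<lambda>Q. real (trees (S - Q) (\<lambda>z. k z + (if z \<in> insert y Y then c z else 0) + dg Q z))"
 have fY: "finite (Pow Y)" using insert by auto
 have "trees S k' = trees S k + c y * trees (S - {y}) (wire {y} k)" unfolding k'_def by (rule trees_add_sink) (use insert in auto)
 hence "real (trees S k) = real (trees S k') + (- real (c y)) * real (trees (S - {y}) (wire {y} k))" by (simp add: algebra_simps)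
 also have "real (trees S k') = (\<Sum>Q\<in>Pow Y. (\<Prod>y\<in>Q. - real (c y)) * ?T Q)"
 proof (subst insert.IH)
  show "(\<Sum>Q\<in>Pow Y. (\<Prod>y\<in>Q. - real (c y)) * real (trees (S - Q) (\<lambda>z. k' z + (if z \<in> Y then c z else 0) + dg Q z)))
   = (\<Sum>Q\<in>Pow Y. (\<Prod>y\<in>Q. - real (c y)) * ?T Q)"
   by (intro sum.cong refl arg_cong2[where f="(*)"] arg_cong[where f=real] trees_cong) (use insert in \<open>auto simp: k'_def\<close>)
 qed (use insert in auto)
 also have "real (trees (S - {y}) (wire {y} k)) = (\<Sum>Q\<in>Pow Y. (\<Prod>y\<in>Q. - real (c y)) * ?T (insert y Q))"
 proof (subst insert.IH)
  show "(\<Sum>Q\<in>Pow Y. (\<Prod>y\<in>Q. - real (c y)) * real (trees (S - {y} - Q) (\<lambda>z. wire {y} k z + (if z \<in> Y then c z else 0) + dg Q z)))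
   = (\<Sum>Q\<in>Pow Y. (\<Prod>y\<in>Q. - real (c y)) * ?T (insert y Q))"
  proof (intro sum.cong refl arg_cong2[where f="(*)"] arg_cong[where f=real])
   fix Q assume "Q \<in> Pow Y"
   hence Q: "finite Q" "y \<notin> Q" using insert finite_subset by auto
   have "S - {y} - Q = S - insert y Q" by auto
   thus "trees (S - {y} - Q) (\<lambda>z. wire {y} k z + (if z \<in> Y then c z else 0) + dg Q z)
    = trees (S - insert y Q) (\<lambda>z. k z + (if z \<in> insert y Y then c z else 0) + dg (insert y Q) z)"
    using dg_Un[of "{y}" Q] Q by (simp, intro trees_cong) (auto simp: wire_def)
  qed
 qed (use insert in auto)
 also have "(- real (c y)) * (\<Sum>Q\<in>Pow Y. (\<Prod>y\<in>Q. - real (c y)) * ?T (insert y Q))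
   = (\<Sum>Q\<in>insert y ` Pow Y. (\<Prod>y\<in>Q. - real (c y)) * ?T Q)"
 proof -
  have "inj_on (insert y) (Pow Y)"
  proof (rule inj_onI)
   fix Q Q' assume "Q \<in> Pow Y" "Q' \<in> Pow Y" "insert y Q = insert y Q'"
   hence "Q - {y} = Q'  - {y}" "y \<notin> Q" "y \<notin> Q'" using insert.hyps by auto
   thus "Q = Q'" by simp
  qed
  hence "(\<Sum>Q\<in>insert y ` Pow Y. (\<Prod>y\<in>Q. - real (c y)) * ?T Q) = (\<Sum>Q\<in>Pow Y. (\<Prod>y\<in>insert y Q. - real (c y)) * ?T (insert y Q))"
   by (subst sum.reindex) (auto simp: o_def)
  also have "... = (\<Sum>Q\<in>Pow Y. (- real (c y)) * ((\<Prod>y\<in>Q. - real (c y)) * ?T (insert y Q)))"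
  proof (rule sum.cong[OF refl])
   fix Q assume "Q \<in> Pow Y"
   hence "finite Q" "y \<notin> Q" using insert finite_subset by auto
   hence "(\<Prod>y\<in>insert y Q. - real (c y)) = (- real (c y)) * (\<Prod>y\<in>Q. - real (c y))" by simp
   thus "(\<Prod>y\<in>insert y Q. - real (c y)) * ?T (insert y Q) = (- real (c y)) * ((\<Prod>y\<in>Q. - real (c y)) * ?T (insert y Q))"
    by (simp only: mult.assoc)
  qed
  finally show ?thesis by (simp add: sum_distrib_left)
 qed
 also have "(\<Sum>Q\<in>Pow Y. (\<Prod>y\<in>Q. - real (c y)) * ?T Q) + (\<Sum>Q\<in>insert y ` Pow Y. (\<Prod>y\<in>Q. - real (c y)) * ?T Q)
  = (\<Sum>Q\<in>Pow (insert y Y). (\<Prod>y\<in>Q. - real (c y)) * ?T Q)"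
  unfolding Pow_insert by (rule sum.union_disjoint[symmetric]) (use insert fY in auto)
 finally show ?case .
qed

section \<open>Cores: what stays unburnt around a protected window W\<close>

definition rim :: "'a set => ('a => nat) => 'a set => 'a set => 'a => nat" where
 "rim S k W A y = (if y \<in> W then k y + dg (S - A) y else 0)"

text \<open>Burn from the sink with W protected and sort by the surviving core A. The hypothesis on
  Q says that wiring Q is invisible outside W, so the burnt part contributes the same factor whether
  or not Q is wired. The core keeps a sink only on W: its other sites were free to burn and did
  not.\<close>

lemma trees_core_sum:
 assumes V: "finite V" "W \<subseteq> V" "Q \<subseteq> W" and Q: "\<And>y. y \<in> V - W ==> dg Q y = 0"
 shows "trees (V - Q) (wire Q k) = (\<Sum>A\<in>{A. W \<subseteq> A \<and> A \<subseteq> V}. trees (V - A) k * trees (A - Q) (wire Q (rim V k W A)))"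
proof -
 have "trees (V - Q) (wire Q k) = (\<Sum>X\<in>Pow (V - W). trees X (\<lambda>y. wire Q k y - 0) * trees (V - Q - X) (resid (V - W) X (wire Q k) (\<lambda>_. 0)))"
  by (rule trees_decomp) (use V in auto)
 also have "... = (\<Sum>A\<in>{A. W \<subseteq> A \<and> A \<subseteq> V}. trees (V - A) k * trees (A - Q) (wire Q (rim V k W A)))"
 proof (rule sum.reindex_bij_witness[of _ "\<lambda>A. V - A" "\<lambda>X. V - X"])
  fix X assume X: "X \<in> Pow (V - W)"
  have "trees X (\<lambda>y. wire Q k y - 0) = trees X k" by (rule trees_cong) (use X Q in \<open>auto simp: wire_def\<close>)
  moreover have "V - X - Q = V - Q - X" by auto
  moreover have VX: "V - (V - X) = X" using X by auto
  moreover have "trees (V - Q - X) (resid (V - W) X (wire Q k) (\<lambda>_. 0)) = trees (V - Q - X) (wire Q (rim V k W (V - X)))"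
   by (rule trees_cong) (use Q in \<open>auto simp: resid_def wire_def rim_def VX\<close>)
  ultimately show "trees (V - (V - X)) k * trees (V - X - Q) (wire Q (rim V k W (V - X))) =
   trees X (\<lambda>y. wire Q k y - 0) * trees (V - Q - X) (resid (V - W) X (wire Q k) (\<lambda>_. 0))" by simp
 qed (use V in auto)
 finally show ?thesis .
qed

text \<open>Only finite F are tested, so that the same definition makes sense for B the whole
  lattice.\<close>

definition clears :: "'a set => 'a set => ('a => int) => bool" where
 "clears A B h \<longleftrightarrow> (\<forall>F. finite F \<and> F \<subseteq> B - A \<and> F \<noteq> {} --> (\<exists>y\<in>F. int (dg (F \<union> A) y) < h y))"

lemma clears_ignites:
 assumes "finite S" "A \<subseteq> S" shows "ignites S (\<lambda>_. 0) h (S - A) \<longleftrightarrow> clears A S h"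
proof -
 have "S - (S - A) = A" using assms by auto
 moreover have "finite F" if "F \<subseteq> S - A" for F using that assms finite_subset by blast
 ultimately show ?thesis unfolding ignites_def clears_def by auto
qed

definition with_core :: "'a set => ('a => nat) => 'a set => ('a => int) => ('a => int) set" where
 "with_core S k A \<zeta> = {h\<in>rec S k. (\<forall>y\<in>A. h y = \<zeta> y) \<and> clears A S h}"

lemma rec_resid_rim: "W \<subseteq> A ==> A \<subseteq> S ==> rec (S - (S - A)) (resid (S - W) (S - A) k (\<lambda>_. 0)) = rec A (rim S k W A)"
proof -
 assume a: "W \<subseteq> A" "A \<subseteq> S"
 have "S - (S - A) = A" using a by auto
 thus ?thesis by (simp, intro rec_cong) (use a in \<open>auto simp: resid_def rim_def\<close>)
qed

lemma with_core_burnt: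
 assumes S: "finite S" "W \<subseteq> A" "A \<subseteq> S" and z: "\<zeta> \<in> rec A (rim S k W A)" and e: "h \<in> with_core S k A \<zeta>"
 shows "burnt S (S - W) (\<lambda>_. 0) h = S - A" "cut A h = \<zeta>"
proof -
 have SA: "S - (S - A) = A" using S by auto
 show "burnt S (S - W) (\<lambda>_. 0) h = S - A"
 proof (rule burnt_eqI)
  show "ignites S (\<lambda>_. 0) h (S - A)" using e clears_ignites[OF S(1,3)] by (simp add: with_core_def)
  show "h y \<le> int (dg (S - (S - A)) y + 0)" if "y \<in> S - W - (S - A)" for y
   using recD(2)[OF z, of y] that e by (auto simp: SA rim_def with_core_def)
 qed (use S in auto)
 show "cut A h = \<zeta>" by (rule ext) (use e recD(1)[OF z] in \<open>auto simp: cut_def with_core_def\<close>)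
qed

lemma with_coreI:
 assumes S: "finite S" "W \<subseteq> A" "A \<subseteq> S" and e: "h \<in> rec S k" and b: "burnt S (S - W) (\<lambda>_. 0) h = S - A"
 shows "cut A h \<in> rec A (rim S k W A)" "h \<in> with_core S k A (cut A h)"
proof -
 have SA: "S - (S - A) = A" using S by auto
 have "split_at S (\<lambda>_. 0) (S - A) h \<in> rec (S - A) (\<lambda>y. k y - 0) \<times> rec (S - (S - A)) (resid (S - W) (S - A) k (\<lambda>_. 0))"
  by (rule split_rec[OF S(1) _ _ e b]) auto
 thus "cut A h \<in> rec A (rim S k W A)" unfolding rec_resid_rim[OF S(2,3)] by (simp add: split_at_def SA)
 have "ignites S (\<lambda>_. 0) h (S - A)" using ignites_burnt[OF S(1), of "S - W" "\<lambda>_. 0" h] b by auto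
 thus "h \<in> with_core S k A (cut A h)" using e clears_ignites[OF S(1,3)] by (simp add: with_core_def cut_def)
qed

text \<open>Whatever the pattern on A, the outside ranges over all recurrent configurations of S -
  A. Hence all patterns are equally frequent, which is the finite-volume source of the uniformity
  used later.\<close>

lemma card_with_core:
 assumes S: "finite S" "W \<subseteq> A" "A \<subseteq> S" and z: "\<zeta> \<in> rec A (rim S k W A)"
 shows "card (with_core S k A \<zeta>) = trees (S - A) k"
proof -
 have SA: "S - (S - A) = A" using S by auto
 let ?R = "{h\<in>rec S k. burnt S (S - W) (\<lambda>_. 0) h = S - A}"
 have bij: "bij_betw (split_at S (\<lambda>_. 0) (S - A)) ?R (rec (S - A) k \<times> rec A (rim S k W A))"
  using bij_betw_split[of S "S - W" "S - A" "\<lambda>_. 0" k] S unfolding rec_resid_rim[OF S(2,3)] by auto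
 have im: "split_at S (\<lambda>_. 0) (S - A) ` with_core S k A \<zeta> = rec (S - A) k \<times> {\<zeta>}"
 proof (intro equalityI subsetI)
  fix p assume "p \<in> split_at S (\<lambda>_. 0) (S - A) ` with_core S k A \<zeta>"
  then obtain h where e: "h \<in> with_core S k A \<zeta>" "p = split_at S (\<lambda>_. 0) (S - A) h" by auto
  hence "h \<in> ?R" using with_core_burnt[OF S z e(1)] by (auto simp: with_core_def)
  hence "p \<in> rec (S - A) k \<times> rec A (rim S k W A)" using bij_betwE[OF bij] e(2) by blast
  moreover have "snd p = \<zeta>" using with_core_burnt(2)[OF S z e(1)] e(2) by (simp add: split_at_def SA)
  ultimately show "p \<in> rec (S - A) k \<times> {\<zeta>}" by (auto simp: mem_Times_iff)
 next
  fix p assume p: "p \<in> rec (S - A) k \<times> {\<zeta>}"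
  hence "p \<in> rec (S - A) k \<times> rec A (rim S k W A)" using z by auto
  then obtain h where e: "h \<in> ?R" "p = split_at S (\<lambda>_. 0) (S - A) h" using bij_betw_imp_surj_on[OF bij] by blast
  hence "cut A h = \<zeta>" using p by (auto simp: split_at_def SA)
  thus "p \<in> split_at S (\<lambda>_. 0) (S - A) ` with_core S k A \<zeta>" using with_coreI(2)[OF S, of h k] e by auto
 qed
 have "with_core S k A \<zeta> \<subseteq> ?R" using with_core_burnt(1)[OF S z] by (auto simp: with_core_def)
 hence "inj_on (split_at S (\<lambda>_. 0) (S - A)) (with_core S k A \<zeta>)" using bij_betw_imp_inj_on[OF bij] inj_on_subset by blast
 hence "card (with_core S k A \<zeta>) = card (rec (S - A) k \<times> {\<zeta>})" unfolding im[symmetric] by (rule card_image[symmetric])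
 thus ?thesis by (simp add: trees_def card_cartesian_product)
qed

text \<open>Splitting at the core and gluing in another pattern leaves the outside as it was; in
  particular adding a grain inside A is a bijection between two such classes.\<close>

lemma with_core_replace:
 assumes S: "finite S" "W \<subseteq> A" "A \<subseteq> S" and z: "\<zeta> \<in> rec A (rim S k W A)" "\<zeta>' \<in> rec A (rim S k W A)"
  and e: "h \<in> with_core S k A \<zeta>"
 shows "(\<lambda>y. if y \<in> A then \<zeta>' y else h y) \<in> with_core S k A \<zeta>'"
proof -
 let ?e = "\<lambda>y. if y \<in> A then \<zeta>' y else h y"
 have SA: "S - (S - A) = A" using S by auto
 have r: "h \<in> rec S k" and c: "clears A S h" using e by (auto simp: with_core_def)
 note b = with_core_burnt[OF S z(1) e]
 have sp: "split_at S (\<lambda>_. 0) (S - A) h \<in> rec (S - A) (\<lambda>y. k y - 0) \<times> rec (S - (S - A)) (resid (S - W) (S - A) k (\<lambda>_. 0))"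
  by (rule split_rec[OF S(1) _ _ r b(1)]) auto
 let ?x = "fst (split_at S (\<lambda>_. 0) (S - A) h)"
 have "glue_at S (\<lambda>_. 0) (S - A) (?x, \<zeta>') \<in> rec S k" by (rule glue_rec(1)[of S "S - W"])
   (use S sp z in \<open>auto simp: mem_Times_iff rec_resid_rim\<close>)
 moreover have "glue_at S (\<lambda>_. 0) (S - A) (?x, \<zeta>') = ?e"
  by (rule ext) (use S recD(1)[OF z(2)] recD(1)[OF r] in \<open>auto simp: glue_at_def split_at_def cut_def\<close>)
 ultimately have "?e \<in> rec S k" by simp
 moreover have "clears A S ?e" unfolding clears_def
 proof (intro allI impI)
  fix F assume F: "finite F \<and> F \<subseteq> S - A \<and> F \<noteq> {}"
  then obtain y where y: "y \<in> F" "int (dg (F \<union> A) y) < h y" using c unfolding clears_def by blast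
  thus "\<exists>y\<in>F. int (dg (F \<union> A) y) < ?e y" using F by (intro bexI[of _ y]) auto
 qed
 ultimately show ?thesis by (simp add: with_core_def)
qed

lemma rec_raise:
 assumes "\<zeta> \<in> rec A k" "z \<in> A" "\<zeta> z < int (dg A z + k z)"
 shows "\<zeta>(z := \<zeta> z + 1) \<in> rec A k" unfolding rec_def
proof (intro CollectI conjI allI impI ballI)
 fix F assume F: "F \<subseteq> A" "F \<noteq> {}"
 then obtain y where "y \<in> F" "int (dg F y) < \<zeta> y" using recD(3)[OF assms(1)] by blast
 thus "\<exists>y\<in>F. int (dg F y) < (\<zeta>(z := \<zeta> z + 1)) y" by (intro bexI[of _ y]) auto
qed (use assms recD(1,2)[OF assms(1)] in \<open>auto split: if_splits\<close>)

definition max_rec :: "'a set => ('a => nat) => 'a => int" where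
 "max_rec A k y = (if y \<in> A then int (dg A y + k y) else 0)"

text \<open>Raising a height preserves the burning test, so every pattern climbs to the maximal one
  by single additions without leaving \<open>rec A k\<close>. The total deficit below the maximal
  pattern decreases at each step.\<close>

lemma rec_raise_induct:
 assumes A: "finite A" and z: "\<zeta> \<in> rec A k" and base: "P (max_rec A k)"
  and step: "\<And>\<zeta> z. \<zeta> \<in> rec A k ==> z \<in> A ==> \<zeta>(z := \<zeta> z + 1) \<in> rec A k ==> P (\<zeta>(z := \<zeta> z + 1)) ==> P \<zeta>"
 shows "P \<zeta>" using z
proof (induction "\<Sum>y\<in>A. nat (int (dg A y + k y) - \<zeta> y)" arbitrary: \<zeta> rule: less_induct)
 case less
 show ?case
 proof (cases "\<exists>z\<in>A. \<zeta> z < int (dg A z + k z)")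
  case True
  then obtain z where zA: "z \<in> A" "\<zeta> z < int (dg A z + k z)" by blast
  have r: "\<zeta>(z := \<zeta> z + 1) \<in> rec A k" by (rule rec_raise[OF less.prems zA])
  have "(\<Sum>y\<in>A. nat (int (dg A y + k y) - (\<zeta>(z := \<zeta> z + 1)) y)) < (\<Sum>y\<in>A. nat (int (dg A y + k y) - \<zeta> y))"
   by (rule sum_strict_mono_ex1) (use A zA in auto)
  thus ?thesis using step[OF less.prems zA(1) r] less.hyps r by blast
 next
  case False
  hence "\<zeta> = max_rec A k" using recD(1,2)[OF less.prems] by (force simp: max_rec_def)
  thus ?thesis using base by simp
 qed
qed

end

section \<open>A flow of finite energy in the positive octant: the three-colour urn\<close>

definition simplex3 :: "nat => (nat \<times> nat \<times> nat) set" where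
 "simplex3 n = {(a, b, c). a + b + c = n}"

lemma simplex3_image: "simplex3 n = (\<lambda>(a, b). (a, b, n - a - b)) ` (SIGMA a:{..n}. {..n - a})"
 unfolding simplex3_def by (force simp: image_iff)

lemma finite_simplex3 [simp]: "finite (simplex3 n)" unfolding simplex3_image by auto

lemma card_simplex3: "real (card (simplex3 n)) = (real n + 1) * (real n + 2) / 2"
proof -
 have "card (simplex3 n) = card (SIGMA a:{..n}. {..n - a})" unfolding simplex3_image by (rule card_image) (auto simp: inj_on_def)
 also have "... = (\<Sum>a\<le>n. Suc (n - a))" by simp
 also have "... = (\<Sum>a\<le>n. Suc a)" by (rule sum.reindex_bij_witness[of _ "\<lambda>a. n - a" "\<lambda>a. n - a"]) auto
 finally have "real (card (simplex3 n)) = (\<Sum>a\<le>n. real a + 1)" by (simp add: add.commute)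
 also have "... = (real n + 1) * (real n + 2) / 2" by (induction n) (auto simp: field_simps)
 finally show ?thesis .
qed

text \<open>The reciprocal of the number of points of \<open>simplex3 n\<close>.\<close>

definition urn :: "nat => real" where "urn n = 2 / ((real n + 1) * (real n + 2))"

definition urn_mean :: "(nat \<times> nat \<times> nat => real) => nat => real" where
 "urn_mean f n = (\<Sum>x\<in>simplex3 n. urn n * f x)"

definition grad2 :: "(nat \<times> nat \<times> nat => real) => nat \<times> nat \<times> nat => real" where
 "grad2 f = (\<lambda>(a, b, c). (f (a, b, c) - f (Suc a, b, c))\<^sup>2 + (f (a, b, c) - f (a, Suc b, c))\<^sup>2
   + (f (a, b, c) - f (a, b, Suc c))\<^sup>2)"

text \<open>The three-colour Polya urn started with one ball of each colour is uniform on each simplex;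
 its transition probabilities give a unit flow from the origin to infinity of finite energy.\<close>

lemma urn_mean_Suc:
 "urn_mean f (Suc n) = (\<Sum>(a, b, c)\<in>simplex3 n. urn n / (real n + 3) *
   ((real a + 1) * f (Suc a, b, c) + (real b + 1) * f (a, Suc b, c) + (real c + 1) * f (a, b, Suc c)))"
proof -
 have 1: "(\<Sum>(a, b, c)\<in>simplex3 n. (real a + 1) * f (Suc a, b, c)) = (\<Sum>(a, b, c)\<in>simplex3 (Suc n). real a * f (a, b, c))"
  by (rule sum.reindex_bij_witness_not_neutral[where S'="{}" and T'="{(a, b, c). a = 0} \<inter> simplex3 (Suc n)" and i="\<lambda>(a, b, c). (a - 1, b, c)" and j="\<lambda>(a, b, c). (Suc a, b, c)"])
   (auto simp: simplex3_def intro: finite_subset[OF _ finite_simplex3[of "Suc n"]])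
 have 2: "(\<Sum>(a, b, c)\<in>simplex3 n. (real b + 1) * f (a, Suc b, c)) = (\<Sum>(a, b, c)\<in>simplex3 (Suc n). real b * f (a, b, c))"
  by (rule sum.reindex_bij_witness_not_neutral[where S'="{}" and T'="{(a, b, c). b = 0} \<inter> simplex3 (Suc n)" and i="\<lambda>(a, b, c). (a, b - 1, c)" and j="\<lambda>(a, b, c). (a, Suc b, c)"])
   (auto simp: simplex3_def intro: finite_subset[OF _ finite_simplex3[of "Suc n"]])
 have 3: "(\<Sum>(a, b, c)\<in>simplex3 n. (real c + 1) * f (a, b, Suc c)) = (\<Sum>(a, b, c)\<in>simplex3 (Suc n). real c * f (a, b, c))"
  by (rule sum.reindex_bij_witness_not_neutral[where S'="{}" and T'="{(a, b, c). c = 0} \<inter> simplex3 (Suc n)" and i="\<lambda>(a, b, c). (a, b, c - 1)" and j="\<lambda>(a, b, c). (a, b, Suc c)"])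
   (auto simp: simplex3_def intro: finite_subset[OF _ finite_simplex3[of "Suc n"]])
 define w where "w = urn n / (real n + 3)"
 have "(\<Sum>(a, b, c)\<in>simplex3 n. w *
   ((real a + 1) * f (Suc a, b, c) + (real b + 1) * f (a, Suc b, c) + (real c + 1) * f (a, b, Suc c)))
  = w * ((\<Sum>(a, b, c)\<in>simplex3 n. (real a + 1) * f (Suc a, b, c))
   + (\<Sum>(a, b, c)\<in>simplex3 n. (real b + 1) * f (a, Suc b, c)) + (\<Sum>(a, b, c)\<in>simplex3 n. (real c + 1) * f (a, b, Suc c)))"
  unfolding sum.distrib[symmetric] sum_distrib_left by (rule sum.cong) (auto simp: algebra_simps)
 also have "... = w * (\<Sum>(a, b, c)\<in>simplex3 (Suc n). (real n + 1) * f (a, b, c))"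
 proof -
  have "real a * f (a, b, c) + real b * f (a, b, c) + real c * f (a, b, c) = (real n + 1) * f (a, b, c)"
   if "(a, b, c) \<in> simplex3 (Suc n)" for a b c
  proof -
   have "real a + real b + real c = real n + 1" using that by (auto simp: simplex3_def simp flip: of_nat_add)
   thus ?thesis by (metis distrib_right)
  qed
  thus ?thesis unfolding 1 2 3 sum.distrib[symmetric] by (intro arg_cong2[where f="(*)"] refl sum.cong) auto
 qed
 also have "... = w * ((real n + 1) * (\<Sum>x\<in>simplex3 (Suc n). f x))"
  unfolding sum_distrib_left[of "real n + 1"] by (simp add: case_prod_unfold)
 also have "... = w * (real n + 1) * (\<Sum>x\<in>simplex3 (Suc n). f x)" by simp
 also have "w * (real n + 1) = urn (Suc n)"
 proof -
  have "real n + 1 \<noteq> 0" "real n + 2 \<noteq> 0" "real n + 3 \<noteq> 0" by linarith+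
  thus ?thesis by (simp add: w_def urn_def divide_simps) (simp add: algebra_simps)
 qed
 finally show ?thesis by (simp add: urn_mean_def sum_distrib_left w_def)
qed

lemma urn_sum: "L \<le> N ==> (\<Sum>n\<in>{L..<N}. urn n) = 2 / (real L + 1) - 2 / (real N + 1)"
proof (induction N rule: dec_induct)
 case base thus ?case by simp
next
 case (step N)
 have "urn N = 2 / (real N + 1) - 2 / (real (Suc N) + 1)" by (simp add: urn_def divide_simps)
 thus ?case using step by simp
qed

text \<open>Cauchy-Schwarz between the urn flow and the gradient of f. Each point of level n passes
  on mass \<open>urn n\<close>, so the squares of the flow on that level sum to at most
  \<open>urn n\<close>; the telescoping sum of these is below 2 / (L + 1).\<close>

lemma urn_mean_diff_sq:
 assumes "L \<le> N"
 shows "(urn_mean f L - urn_mean f N)\<^sup>2 \<le> 2 / (real L + 1) * (\<Sum>n\<in>{L..<N}. \<Sum>x\<in>simplex3 n. grad2 f x)"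
proof -
 define I where "I = (SIGMA n:{L..<N}. simplex3 n \<times> {..<3::nat})"
 \<comment> \<open>\<open>th\<close> is the flow along an edge, that is the mass of the point times
   the urn's transition probability, and \<open>df\<close> is the decrease of f along it; the index
   i is the colour drawn.\<close>
 define th where "th = (\<lambda>(n, (a, b, c), i::nat). urn n / (real n + 3) * (if i = 0 then real a + 1 else if i = 1 then real b + 1 else real c + 1))"
 define df where "df = (\<lambda>(n::nat, (a, b, c), i::nat). f (a, b, c) - (if i = 0 then f (Suc a, b, c) else if i = 1 then f (a, Suc b, c) else f (a, b, Suc c)))"
 have three: "(\<Sum>i<3. g i) = g 0 + g 1 + (g 2 :: real)" for g :: "nat => real" by (simp add: eval_nat_numeral)
 have sI: "(\<Sum>e\<in>I. h e) = (\<Sum>n\<in>{L..<N}. \<Sum>x\<in>simplex3 n. \<Sum>i<3. h (n, x, i))" for h :: "_ => real"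
  by (simp add: I_def sum.cartesian_product sum.Sigma case_prod_unfold)
 have st: "urn_mean f n - urn_mean f (Suc n) = (\<Sum>x\<in>simplex3 n. \<Sum>i<3. th (n, x, i) * df (n, x, i))" for n
 proof -
  define w where "w = urn n / (real n + 3)"
  have "urn n * f (a, b, c) = w * ((real a + 1) + (real b + 1) + (real c + 1)) * f (a, b, c)"
   if "(a, b, c) \<in> simplex3 n" for a b c
  proof -
   have e: "(real a + 1) + (real b + 1) + (real c + 1) = real n + 3" using that by (auto simp: simplex3_def simp flip: of_nat_add)
   moreover have "real n + 3 \<noteq> 0" by linarith
   ultimately show ?thesis unfolding e w_def by simp
  qed
  hence "urn_mean f n = (\<Sum>(a, b, c)\<in>simplex3 n. w * ((real a + 1) + (real b + 1) + (real c + 1)) * f (a, b, c))"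
   unfolding urn_mean_def by (intro sum.cong) auto
  moreover have "th (n, (a, b, c), 0) = w * (real a + 1)" "th (n, (a, b, c), 1) = w * (real b + 1)"
   "th (n, (a, b, c), 2) = w * (real c + 1)" for a b c by (auto simp: th_def w_def)
  ultimately show ?thesis unfolding urn_mean_Suc w_def[symmetric] by (simp only: sum_subtractf[symmetric])
    (auto simp: three df_def algebra_simps intro!: sum.cong)
 qed
 have "urn_mean f L - urn_mean f N = (\<Sum>n\<in>{L..<N}. urn_mean f n - urn_mean f (Suc n))"
  using sum_Suc_diff'[of L N "\<lambda>n. - urn_mean f n"] assms by (simp add: algebra_simps)
 also have "... = (\<Sum>e\<in>I. th e * df e)" unfolding sI by (simp add: st)
 finally have "(urn_mean f L - urn_mean f N)\<^sup>2 \<le> (\<Sum>e\<in>I. (th e)\<^sup>2) * (\<Sum>e\<in>I. (df e)\<^sup>2)"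
  using Cauchy_Schwarz_ineq_sum[of th df I] by simp
 also have "... \<le> 2 / (real L + 1) * (\<Sum>e\<in>I. (df e)\<^sup>2)"
 proof (rule mult_right_mono)
  have "(\<Sum>x\<in>simplex3 n. \<Sum>i<3. (th (n, x, i))\<^sup>2) \<le> urn n" for n
  proof -
   have "(\<Sum>i<3. (th (n, x, i))\<^sup>2) \<le> (urn n)\<^sup>2" if "x \<in> simplex3 n" for x
   proof -
    obtain a b c where x: "x = (a, b, c)" by (cases x)
    hence n: "real a + real b + real c = real n" using that by (auto simp: simplex3_def)
    define w where "w = urn n / (real n + 3)"
    have "(\<Sum>i<3. (th (n, x, i))\<^sup>2) = w\<^sup>2 * ((real a + 1)\<^sup>2 + (real b + 1)\<^sup>2 + (real c + 1)\<^sup>2)"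
    proof -
     have "th (n, x, i) = w * (if i = 0 then real a + 1 else if i = 1 then real b + 1 else real c + 1)" for i by (simp add: th_def x w_def)
     thus ?thesis by (simp add: three power_mult_distrib distrib_left)
    qed
    also have "... \<le> w\<^sup>2 * (real n + 3)\<^sup>2" by (rule mult_left_mono) (auto simp: n[symmetric] power2_eq_square algebra_simps)
    also have "... = (urn n)\<^sup>2"
    proof -
     have "real n + 3 \<noteq> 0" by linarith
     thus ?thesis by (simp add: w_def power_divide)
    qed
    finally show ?thesis .
   qed
   hence "(\<Sum>x\<in>simplex3 n. \<Sum>i<3. (th (n, x, i))\<^sup>2) \<le> (\<Sum>x\<in>simplex3 n. (urn n)\<^sup>2)" by (rule sum_mono)
   also have "... = urn n" by (simp add: card_simplex3 urn_def power2_eq_square)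
   finally show ?thesis .
  qed
  hence "(\<Sum>e\<in>I. (th e)\<^sup>2) \<le> (\<Sum>n\<in>{L..<N}. urn n)" unfolding sI by (rule sum_mono)
  also have "... \<le> 2 / (real L + 1)" unfolding urn_sum[OF assms] by simp
  finally show "(\<Sum>e\<in>I. (th e)\<^sup>2) \<le> 2 / (real L + 1)" .
 qed (auto intro: sum_nonneg)
 also have "(\<Sum>e\<in>I. (df e)\<^sup>2) = (\<Sum>n\<in>{L..<N}. \<Sum>x\<in>simplex3 n. grad2 f x)"
  unfolding sI by (intro sum.cong refl) (auto simp: three df_def grad2_def)
 finally show ?thesis .
qed

section \<open>The lattice\<close>

definition sh :: "int => 'd => 'd site => 'd site" where
 "sh \<sigma> i z = z(i := z i + \<sigma>)"

lemma sh_sh_minus [simp]: "sh \<sigma> i (sh (- \<sigma>) i z) = z" "sh (- \<sigma>) i (sh \<sigma> i z) = z" by (auto simp: sh_def)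

lemma sh_dir: "\<sigma> \<noteq> 0 ==> sh \<sigma> i z = sh \<sigma> i' z ==> i = i'"
 unfolding sh_def by (metis add_cancel_right_right fun_upd_apply)

lemma nbr_sh: "\<sigma> = 1 \<or> \<sigma> = -1 ==> nbr z (sh \<sigma> i z)"
proof -
 assume s: "\<sigma> = 1 \<or> \<sigma> = -1"
 have "(\<Sum>j\<in>UNIV. \<bar>z j - sh \<sigma> i z j\<bar>) = (\<Sum>j\<in>UNIV. if j = i then 1 else 0)"
  by (rule sum.cong) (use s in \<open>auto simp: sh_def\<close>)
 thus ?thesis by (simp add: nbr_def)
qed

lemma nbrE:
 assumes "nbr x y" obtains i \<sigma> where "\<sigma> = 1 \<or> \<sigma> = -1" "y = sh \<sigma> i x"
proof -
 have s: "(\<Sum>j\<in>UNIV. \<bar>x j - y j\<bar>) = 1" using assms by (simp add: nbr_def)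
 then obtain i where i: "\<bar>x i - y i\<bar> \<noteq> 0" by (metis sum.neutral zero_neq_one)
 have "(\<Sum>j\<in>UNIV. \<bar>x j - y j\<bar>) = \<bar>x i - y i\<bar> + (\<Sum>j\<in>UNIV - {i}. \<bar>x j - y j\<bar>)"
  by (rule sum.remove) auto
 moreover have "(\<Sum>j\<in>UNIV - {i}. \<bar>x j - y j\<bar>) \<ge> 0" by (rule sum_nonneg) auto
 ultimately have 1: "\<bar>x i - y i\<bar> = 1" "(\<Sum>j\<in>UNIV - {i}. \<bar>x j - y j\<bar>) = 0" using s i by linarith+
 have "y j = x j" if "j \<noteq> i" for j using 1(2) that by (subst (asm) sum_nonneg_eq_0_iff) auto
 hence "y = sh (y i - x i) i x" by (auto simp: sh_def)
 thus thesis using that[of "y i - x i" i] 1(1) by arith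
qed

interpretation symmetric_graph "nbr :: ('d::finite) site => 'd site => bool" by unfold_locales (auto simp: nbr_def abs_minus_commute)

lemma nbrs_image: "{z. nbr x z} = (\<lambda>(\<sigma>, i). sh \<sigma> i x) ` ({1, -1} \<times> UNIV)"
 by (auto elim!: nbrE simp: nbr_sh image_iff)

lemma finite_nbrs [simp]: "finite {z. nbr (x :: ('d::finite) site) z}" unfolding nbrs_image by auto

lemma finite_nbrs' [simp]: "finite {z. nbr (x :: ('d::finite) site) z \<and> P z}" "finite {z. P z \<and> nbr (x :: ('d::finite) site) z}"
 by (auto intro: finite_subset[OF _ finite_nbrs[of x]])

lemma card_nbrs: "card {z. nbr (x :: ('d::finite) site) z} = 2 * CARD('d)"
proof -
 have "i = i' \<and> \<sigma> = \<sigma>'" if "sh \<sigma> i x = sh \<sigma>' i' x" "\<sigma> \<noteq> 0" for \<sigma> \<sigma>' and i i' :: 'd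
  using fun_cong[OF that(1), of i] that(2) by (auto simp: sh_def split: if_splits)
 hence "inj_on (\<lambda>(\<sigma>, i). sh \<sigma> i x) ({1, -1} \<times> (UNIV :: 'd set))" by (intro inj_onI) fastforce
 thus ?thesis unfolding nbrs_image by (subst card_image) (auto simp: card_cartesian_product)
qed

abbreviation out :: "('d::finite) site set => 'd site => nat" where
 "out S y \<equiv> card {z. z \<notin> S \<and> nbr y z}"

lemma dg_out: "dg S y + out S y = 2 * CARD('d)" for y :: "('d::finite) site"
proof -
 have "{z. nbr y z} = {z\<in>S. nbr y z} \<union> {z. z \<notin> S \<and> nbr y z}" by auto
 hence "card {z. nbr y z} = card {z\<in>S. nbr y z} + card {z. z \<notin> S \<and> nbr y z}"
  by (metis (no_types, lifting) card_Un_disjoint disjoint_iff finite_nbrs'(2) mem_Collect_eq finite_Un finite_nbrs)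
 thus ?thesis by (simp add: dg_def card_nbrs)
qed

text \<open>Interface for all half-space estimates: H is closed under steps of sign \<sigma> in
  every coordinate, S exhausts V inside H, and at sites of H the sinks account for all edges leaving
  V. Outside H the set S may be anything, for instance partly burnt.\<close>

definition open_half :: "('d::finite) site set => 'd site set => ('d site => nat) => int => 'd site set => bool" where
 "open_half V S k \<sigma> H \<longleftrightarrow> finite S \<and> (\<sigma> = 1 \<or> \<sigma> = -1) \<and> (\<forall>z\<in>H. \<forall>i. sh \<sigma> i z \<in> H) \<and> V \<inter> H \<subseteq> S
   \<and> (\<forall>y\<in>S \<inter> H. out V y \<le> k y)"

text \<open>An edge inside H from S to its complement ends outside V, because S contains all of V in
  H; it is therefore charged to the sinks. So the gradient along steps within H costs no more than
  the energy on S.\<close>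

lemma half_energy:
 fixes u :: "('d::finite) site => real"
 assumes h: "open_half V S k \<sigma> H" and u0: "\<And>y. y \<notin> S ==> u y = 0"
  and Z: "finite Z" "Z \<subseteq> H"
 shows "(\<Sum>z\<in>Z. \<Sum>i\<in>UNIV. (u z - u (sh \<sigma> i z))\<^sup>2) \<le> en S k u"
proof -
 have S: "finite S" and s: "\<sigma> = 1 \<or> \<sigma> = -1" and H: "\<And>z i. z \<in> H ==> sh \<sigma> i z \<in> H"
  and VH: "V \<inter> H \<subseteq> S" and ky: "\<And>y. y \<in> S \<inter> H ==> out V y \<le> k y" using h unfolding open_half_def by auto
 define X where "X = S \<union> Z \<union> (\<lambda>(z, i). sh \<sigma> i z) ` (Z \<times> UNIV)"
 have fX: "finite X" unfolding X_def using S Z by auto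
 define P where "P = {(y, z). y \<in> X \<and> z \<in> X \<and> nbr y z \<and> y \<in> H \<and> z \<in> H}"
 have fP: "finite P" by (rule finite_subset[of _ "X \<times> X"]) (auto simp: P_def fX)
 define g where "g = (\<lambda>(y, z). (u y - u z)\<^sup>2)"
 have gpos: "0 \<le> g p" for p by (auto simp: g_def split: prod.splits)
 define E where "E = (\<lambda>(z, i). (z, sh \<sigma> i z)) ` (Z \<times> UNIV)"
 define E' where "E' = (\<lambda>(z, i). (sh \<sigma> i z, z)) ` (Z \<times> UNIV)"
 have s0: "\<sigma> \<noteq> 0" using s by auto
 have inj: "inj_on (\<lambda>(z, i). (z, sh \<sigma> i z)) (Z \<times> (UNIV::'d set))" "inj_on (\<lambda>(z, i). (sh \<sigma> i z, z)) (Z \<times> (UNIV::'d set))"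
  using sh_dir[OF s0] by (auto simp: inj_on_def)
 have sumE: "(\<Sum>p\<in>E. g p) = (\<Sum>z\<in>Z. \<Sum>i\<in>UNIV. (u z - u (sh \<sigma> i z))\<^sup>2)"
  unfolding E_def by (subst sum.reindex[OF inj(1)]) (simp add: sum.cartesian_product case_prod_unfold g_def)
 have sumE': "(\<Sum>p\<in>E'. g p) = (\<Sum>z\<in>Z. \<Sum>i\<in>UNIV. (u z - u (sh \<sigma> i z))\<^sup>2)"
  unfolding E'_def by (subst sum.reindex[OF inj(2)]) (simp add: sum.cartesian_product case_prod_unfold g_def power2_commute)
 \<comment> \<open>Each step is counted in both orientations to match the factor 1/2 in
   \<open>enb\<close>. The two families are disjoint because a step changes the sum of the
   coordinates by \<sigma>.\<close>
 have disj: "E \<inter> E' = {}"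
 proof -
  have "False" if "(z, sh \<sigma> i z) = (sh \<sigma> i' z', z')" for z z' :: "'d site" and i i'
  proof -
   from that have z: "z = sh \<sigma> i' (sh \<sigma> i z)" by auto
   have "(\<Sum>j\<in>UNIV. sh \<sigma> i' (sh \<sigma> i z) j) = (\<Sum>j\<in>UNIV. z j) + 2 * \<sigma>"
   proof -
    have "(\<Sum>j\<in>UNIV. sh \<sigma> k w j) = (\<Sum>j\<in>UNIV. w j + (if j = k then \<sigma> else 0))" for k and w :: "'d site"
     by (rule sum.cong) (auto simp: sh_def)
    thus ?thesis by (simp add: sum.distrib)
   qed
   thus False using z s0 by auto
  qed
  thus ?thesis unfolding E_def E'_def by auto
 qed
 have sub: "E \<union> E' \<subseteq> P"
 proof -
  have "(z, sh \<sigma> i z) \<in> P" "(sh \<sigma> i z, z) \<in> P" if "z \<in> Z" for z i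
   using that Z H[of z i] nbr_sh[OF s, of z i] adj_sym[of z "sh \<sigma> i z"] by (auto simp: P_def X_def)
  thus ?thesis unfolding E_def E'_def by auto
 qed
 have "2 * (\<Sum>z\<in>Z. \<Sum>i\<in>UNIV. (u z - u (sh \<sigma> i z))\<^sup>2) = (\<Sum>p\<in>E \<union> E'. g p)"
 proof -
  have "finite E" "finite E'" unfolding E_def E'_def using Z by auto
  thus ?thesis using sumE sumE' by (simp add: sum.union_disjoint disj)
 qed
 also have "... \<le> (\<Sum>p\<in>P. g p)" by (rule sum_mono2[OF fP sub]) (use gpos in auto)
 also have "... \<le> 2 * en S k u"
 proof -
  define P1 where "P1 = {p\<in>P. fst p \<in> S \<and> snd p \<in> S}"
  define P2 where "P2 = {p\<in>P. fst p \<in> S \<and> snd p \<notin> S}"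
  define P3 where "P3 = {p\<in>P. fst p \<notin> S \<and> snd p \<in> S}"
  define P4 where "P4 = {p\<in>P. fst p \<notin> S \<and> snd p \<notin> S}"
  have un: "P = P1 \<union> (P2 \<union> (P3 \<union> P4))" unfolding P1_def P2_def P3_def P4_def by auto
  have fin: "finite P1" "finite P2" "finite P3" "finite P4" using fP unfolding P1_def P2_def P3_def P4_def by auto
  have "(\<Sum>p\<in>P. g p) = (\<Sum>p\<in>P1. g p) + ((\<Sum>p\<in>P2. g p) + ((\<Sum>p\<in>P3. g p) + (\<Sum>p\<in>P4. g p)))"
   unfolding un by (subst sum.union_disjoint sum.union_disjoint, use fin in \<open>auto simp: P1_def P2_def P3_def P4_def\<close>)+
  moreover have "(\<Sum>p\<in>P4. g p) = 0" by (rule sum.neutral) (auto simp: P4_def g_def u0 split: prod.splits)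
  moreover have "(\<Sum>p\<in>P1. g p) \<le> (\<Sum>y\<in>S. \<Sum>z\<in>S. of_bool (nbr y z) * ((u y - u z) * (u y - u z)))"
  proof -
   have "(\<Sum>p\<in>P1. g p) \<le> (\<Sum>p\<in>{p\<in>S \<times> S. nbr (fst p) (snd p)}. g p)"
    by (rule sum_mono2) (use S gpos in \<open>auto simp: P1_def P_def\<close>)
   also have "... = (\<Sum>p\<in>S \<times> S. of_bool (nbr (fst p) (snd p)) * g p)" by (rule sum.mono_neutral_cong_left) (use S in auto)
   finally show ?thesis by (simp add: sum.cartesian_product case_prod_unfold g_def power2_eq_square)
  qed
  moreover have P2: "(\<Sum>p\<in>P2. g p) \<le> (\<Sum>y\<in>S. real (k y) * (u y * u y))"
  proof -
   let ?N = "\<lambda>y. {z. (y, z) \<in> P2}"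
   have P2S: "P2 = Sigma S ?N" unfolding P2_def by auto
   have fN: "finite (?N y)" for y by (rule finite_subset[of _ X]) (auto simp: P2_def P_def fX)
   have "(\<Sum>p\<in>P2. g p) = (\<Sum>y\<in>S. \<Sum>z\<in>?N y. g (y, z))"
    using arg_cong[OF P2S, of "sum g"] S fN by (simp add: sum.Sigma)
   also have "... = (\<Sum>y\<in>S. real (card (?N y)) * (u y * u y))" by (intro sum.cong refl) (simp add: g_def P2_def u0 power2_eq_square)
   also have "... \<le> (\<Sum>y\<in>S. real (k y) * (u y * u y))"
   proof (intro sum_mono mult_right_mono)
    fix y assume y: "y \<in> S"
    show "real (card (?N y)) \<le> real (k y)"
    proof (cases "y \<in> H")
     case True
     have "card (?N y) \<le> out V y" by (rule card_mono) (use VH in \<open>auto simp: P2_def P_def\<close>)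
     thus ?thesis using ky[of y] True y by simp
    next
     case False
     hence "?N y = {}" by (auto simp: P2_def P_def)
     thus ?thesis by simp
    qed
   qed auto
   finally show ?thesis .
  qed
  moreover have "(\<Sum>p\<in>P3. g p) = (\<Sum>p\<in>P2. g p)" by (rule sum.reindex_bij_witness[of _ prod.swap prod.swap])
    (auto simp: P2_def P3_def P_def g_def power2_commute intro: adj_sym)
  ultimately show ?thesis by (simp add: enb_def)
 qed
 finally show ?thesis by simp
qed


section \<open>Urns embedded in half-spaces and the resulting resistance bounds\<close>

definition emb :: "'d => 'd => 'd => int => 'd site => nat \<times> nat \<times> nat => 'd site" where
 "emb c1 c2 c3 \<sigma> s = (\<lambda>(a, b, c) j. s j + \<sigma> * (if j = c1 then int a else if j = c2 then int b else if j = c3 then int c else 0))"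

lemma emb_step:
 assumes "c1 \<noteq> c2" "c1 \<noteq> c3" "c2 \<noteq> c3"
 shows "emb c1 c2 c3 \<sigma> s (Suc a, b, c) = sh \<sigma> c1 (emb c1 c2 c3 \<sigma> s (a, b, c))"
  "emb c1 c2 c3 \<sigma> s (a, Suc b, c) = sh \<sigma> c2 (emb c1 c2 c3 \<sigma> s (a, b, c))"
  "emb c1 c2 c3 \<sigma> s (a, b, Suc c) = sh \<sigma> c3 (emb c1 c2 c3 \<sigma> s (a, b, c))"
 using assms by (auto simp: emb_def sh_def fun_eq_iff algebra_simps)

lemma emb_inj_s: "emb c1 c2 c3 \<sigma> s x = emb c1 c2 c3 \<sigma> s' x ==> s = s'" by (cases x) (auto simp: emb_def fun_eq_iff)

lemma emb_inj_x:
 assumes "c1 \<noteq> c2" "c1 \<noteq> c3" "c2 \<noteq> c3" "\<sigma> \<noteq> 0" "emb c1 c2 c3 \<sigma> s x = emb c1 c2 c3 \<sigma> s x'"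
 shows "x = x'"
proof -
 obtain a b c a' b' c' where x: "x = (a, b, c)" "x' = (a', b', c')" by (metis prod_cases3)
 show ?thesis using fun_cong[OF assms(5), of c1] fun_cong[OF assms(5), of c2] fun_cong[OF assms(5), of c3] assms(1-4)
  by (auto simp: emb_def x)
qed

lemma grad2_emb:
 fixes u :: "('d::finite) site => real"
 assumes c: "c1 \<noteq> c2" "c1 \<noteq> c3" "c2 \<noteq> c3"
 shows "grad2 (\<lambda>x. u (emb c1 c2 c3 \<sigma> s x)) x
  \<le> (\<Sum>i\<in>UNIV. (u (emb c1 c2 c3 \<sigma> s x) - u (sh \<sigma> i (emb c1 c2 c3 \<sigma> s x)))\<^sup>2)"
proof -
 obtain a b d where x: "x = (a, b, d)" by (metis prod_cases3)
 let ?z = "emb c1 c2 c3 \<sigma> s x"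
 have "grad2 (\<lambda>x. u (emb c1 c2 c3 \<sigma> s x)) x = (\<Sum>i\<in>{c1, c2, c3}. (u ?z - u (sh \<sigma> i ?z))\<^sup>2)"
  using c by (simp add: grad2_def x emb_step[OF c])
 also have "... \<le> (\<Sum>i\<in>UNIV. (u ?z - u (sh \<sigma> i ?z))\<^sup>2)" by (rule sum_mono2) auto
 finally show ?thesis .
qed

lemma emb_0 [simp]: "emb c1 c2 c3 \<sigma> s (0, 0, 0) = s" by (auto simp: emb_def fun_eq_iff)

lemma emb_in_half:
 assumes "\<And>z i. z \<in> H ==> sh \<sigma> i z \<in> H" "s \<in> H" and c: "c1 \<noteq> c2" "c1 \<noteq> c3" "c2 \<noteq> c3"
 shows "emb c1 c2 c3 \<sigma> s x \<in> H"
proof -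
 have 0: "emb c1 c2 c3 \<sigma> s (0, 0, 0) \<in> H" using assms(2) by simp
 have 1: "emb c1 c2 c3 \<sigma> s (a, 0, 0) \<in> H" for a by (induction a) (use 0 assms(1) in \<open>auto simp: emb_step[OF c]\<close>)
 have 2: "emb c1 c2 c3 \<sigma> s (a, b, 0) \<in> H" for a b by (induction b) (use 1 assms(1) in \<open>auto simp: emb_step[OF c]\<close>)
 have 3: "emb c1 c2 c3 \<sigma> s (a, b, d) \<in> H" for a b d by (induction d) (use 2 assms(1) in \<open>auto simp: emb_step[OF c]\<close>)
 show ?thesis using 3 by (cases x) auto
qed

lemma three_directions:
 assumes "CARD('d::finite) \<ge> 3"
 obtains c1 c2 c3 :: "'d::finite" where "c1 \<noteq> c2" "c1 \<noteq> c3" "c2 \<noteq> c3"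
proof -
 obtain T :: "'d set" where "card T = 3" using obtain_subset_with_card_n[OF assms] by metis
 thus thesis using that by (auto simp: card_Suc_eq eval_nat_numeral)
qed

lemma urn_energy:
 fixes u :: "('d::finite) site => real"
 assumes c: "c1 \<noteq> c2" "c1 \<noteq> c3" "c2 \<noteq> c3"
  and h: "open_half V S k \<sigma> H" and u0: "\<And>y. y \<notin> S ==> u y = 0" and s: "s \<in> H" and LN: "L \<le> N"
 defines "f \<equiv> \<lambda>x. u (emb c1 c2 c3 \<sigma> s x)"
 shows "(urn_mean f L - urn_mean f N)\<^sup>2 \<le> 2 / (real L + 1) * en S k u"
proof -
 have H: "\<And>z i. z \<in> H ==> sh \<sigma> i z \<in> H" and s0: "\<sigma> \<noteq> 0" using h unfolding open_half_def by auto
 let ?I = "SIGMA n:{L..<N}. simplex3 n"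
 let ?e = "emb c1 c2 c3 \<sigma> s"
 define g where "g = (\<lambda>z. \<Sum>i\<in>UNIV. (u z - u (sh \<sigma> i z))\<^sup>2)"
 have fI: "finite ?I" by auto
 have inj: "inj_on (\<lambda>(n, x). ?e x) ?I"
 proof (rule inj_onI)
  fix p q assume pq: "p \<in> ?I" "q \<in> ?I" "(case p of (n, x) => ?e x) = (case q of (n, x) => ?e x)"
  hence "snd p = snd q" using emb_inj_x[OF c s0, of s "snd p" "snd q"] by (auto split: prod.splits)
  thus "p = q" using pq(1,2) by (auto simp: simplex3_def)
 qed
 have "(\<Sum>n\<in>{L..<N}. \<Sum>x\<in>simplex3 n. grad2 f x)
   \<le> (\<Sum>n\<in>{L..<N}. \<Sum>x\<in>simplex3 n. g (?e x))" unfolding f_def g_def by (intro sum_mono grad2_emb[OF c])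
 also have "... = (\<Sum>p\<in>?I. g ((\<lambda>(n, x). ?e x) p))" by (simp add: sum.Sigma case_prod_unfold)
 also have "... = (\<Sum>z\<in>(\<lambda>(n, x). ?e x) ` ?I. g z)" by (subst sum.reindex[OF inj]) (simp add: o_def)
 also have "... \<le> en S k u" unfolding g_def by (rule half_energy[OF h u0]) (use fI emb_in_half[OF H s c] in auto)
 finally have "(\<Sum>n\<in>{L..<N}. \<Sum>x\<in>simplex3 n. grad2 f x) \<le> en S k u" .
 hence "2 / (real L + 1) * (\<Sum>n\<in>{L..<N}. \<Sum>x\<in>simplex3 n. grad2 f x) \<le> 2 / (real L + 1) * en S k u"
  by (intro mult_left_mono) auto
 thus ?thesis using urn_mean_diff_sq[OF LN, of f] by linarith
qed

lemma urn_mean_0 [simp]: "urn_mean f 0 = f (0, 0, 0)"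
proof -
 have "simplex3 0 = {(0, 0, 0)}" by (auto simp: simplex3_def)
 thus ?thesis by (simp add: urn_mean_def urn_def)
qed

lemma urn_mean_eventually_0:
 fixes u :: "('d::finite) site => real"
 assumes c: "c1 \<noteq> c2" "c1 \<noteq> c3" "c2 \<noteq> c3" and "\<sigma> \<noteq> 0" "finite S" and u0: "\<And>y. y \<notin> S ==> u y = 0"
 shows "\<exists>N\<ge>L. urn_mean (\<lambda>x. u (emb c1 c2 c3 \<sigma> s x)) N = 0"
proof -
 let ?X = "{x. emb c1 c2 c3 \<sigma> s x \<in> S}"
 have "finite ?X" by (rule finite_imageD[of "emb c1 c2 c3 \<sigma> s"])
   (use assms emb_inj_x[OF c, of \<sigma> s] in \<open>auto intro: finite_subset[of _ S] inj_onI\<close>)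
 hence "finite ((\<lambda>(a, b, c). a + b + c) ` ?X)" by simp
 then obtain m where m: "\<And>n. n \<in> (\<lambda>(a, b, c). a + b + c) ` ?X ==> n \<le> m" by (meson finite_nat_set_iff_bounded_le)
 have "emb c1 c2 c3 \<sigma> s x \<notin> S" if "x \<in> simplex3 (Suc (max L m))" for x
 proof
  assume "emb c1 c2 c3 \<sigma> s x \<in> S"
  hence "(\<lambda>(a, b, c). a + b + c) x \<le> m" by (intro m) auto
  thus False using that by (auto simp: simplex3_def)
 qed
 hence "urn_mean (\<lambda>x. u (emb c1 c2 c3 \<sigma> s x)) (Suc (max L m)) = 0"
  unfolding urn_mean_def by (intro sum.neutral) (auto simp: u0)
 thus ?thesis by (intro exI[of _ "Suc (max L m)"]) auto
qed

text \<open>Level 0 of the urn is s itself and a far level misses the finite support of u, so the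
  difference of means is \<open>u s\<close>. The constant 2 is the energy bound of the whole urn
  flow.\<close>

lemma half_capacity:
 fixes u :: "('d::finite) site => real"
 assumes d: "CARD('d) \<ge> 3" and h: "open_half V S k \<sigma> H" and u0: "\<And>y. y \<notin> S ==> u y = 0" and s: "s \<in> H"
 shows "(u s)\<^sup>2 \<le> 2 * en S k u"
proof -
 obtain c1 c2 c3 :: 'd where c: "c1 \<noteq> c2" "c1 \<noteq> c3" "c2 \<noteq> c3" using three_directions[OF d] .
 have "finite S" "\<sigma> \<noteq> 0" using h unfolding open_half_def by auto
 then obtain N where "urn_mean (\<lambda>x. u (emb c1 c2 c3 \<sigma> s x)) N = 0"
  using urn_mean_eventually_0[of c1 c2 c3 \<sigma> S u 0 s] c u0 by blast
 moreover have "(urn_mean (\<lambda>x. u (emb c1 c2 c3 \<sigma> s x)) 0 - urn_mean (\<lambda>x. u (emb c1 c2 c3 \<sigma> s x)) N)\<^sup>2 \<le> 2 / (real 0 + 1) * en S k u"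
  by (rule urn_energy[OF c h u0 s]) auto
 ultimately show ?thesis by simp
qed

text \<open>The effective resistance from y to the sinks is at most 2: apply
  \<open>half_capacity\<close> to the potential with pole y, whose energy is its value at the pole
  times the number of trees.\<close>

lemma half_trees_le:
 fixes S :: "('d::finite) site set"
 assumes d: "CARD('d) \<ge> 3" and h: "open_half V S k \<sigma> H" and y: "y \<in> S" "y \<in> H"
 shows "trees (S - {y}) (wire {y} k) \<le> 2 * trees S k"
proof -
 have S: "finite S" using h unfolding open_half_def by auto
 obtain u where u: "u y = real (trees (S - {y}) (wire {y} k))"
  "\<And>z. z \<in> S ==> lp S k u z = (if z = y then real (trees S k) else 0)" using potential[OF S y(1), of k] by metis
 define f where "f = (\<lambda>z. if z \<in> S then u z else 0)"
 have "en S k f = en S k u" unfolding enb_def f_def by simp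
 also have "... = (\<Sum>z\<in>S. u z * lp S k u z)" by (rule sum_lp[OF S, symmetric])
 also have "... = (\<Sum>z\<in>S. if z = y then u y * real (trees S k) else 0)" by (rule sum.cong) (auto simp: u(2))
 also have "... = u y * real (trees S k)" using S y by simp
 finally have "(u y)\<^sup>2 \<le> 2 * (u y * real (trees S k))" using half_capacity[OF d h, of f y] y by (simp add: f_def)
 hence "u y * u y \<le> u y * (2 * real (trees S k))" by (simp add: power2_eq_square mult_ac)
 hence "u y \<le> 2 * real (trees S k)" using u(1) by (cases "u y = 0") (auto simp: mult_le_cancel_left)
 thus ?thesis using u(1) by linarith
qed

text \<open>Each new unit sink multiplies the count by at most 3: 1 for trees avoiding the new edge,
  2 from the resistance bound for those using it.\<close>

lemma half_trees_sinks:
 fixes S :: "('d::finite) site set"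
 assumes d: "CARD('d) \<ge> 3" and h: "open_half V S k2 \<sigma> H" and M: "M \<subseteq> S \<inter> H"
 shows "trees S (\<lambda>y. of_bool (y \<in> M) + k2 y) \<le> 3 ^ card M * trees S k2"
proof -
 have S: "finite S" using h unfolding open_half_def by auto
 hence "finite M" using M by (meson finite_Int finite_subset)
 thus ?thesis using M
 proof (induction M rule: finite_induct)
  case empty
  thus ?case by simp
 next
  case (insert y M)
  let ?k = "\<lambda>z. of_bool (z \<in> M) + k2 z"
  have k: "(\<lambda>z. of_bool (z \<in> insert y M) + k2 z) = ?k(y := ?k y + 1)" by (rule ext) (use insert in auto)
  have "out V y \<le> ?k y" if "y \<in> S \<inter> H" for y using h that unfolding open_half_def by (metis trans_le_add2)
  hence h': "open_half V S ?k \<sigma> H" using h unfolding open_half_def by blast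
  have "trees S (\<lambda>z. of_bool (z \<in> insert y M) + k2 z) = trees S ?k + 1 * trees (S - {y}) (wire {y} ?k)"
   unfolding k by (rule trees_add_sink) (use S insert in auto)
  also have "... \<le> 3 * trees S ?k" using half_trees_le[OF d h', of y] insert by simp
  also have "... \<le> 3 * (3 ^ card M * trees S k2)" using insert by (intro mult_left_mono) auto
  finally show ?case using insert by simp
 qed
qed

text \<open>If there were many sinks in M, averaging the urn flows started at them would give a unit flow of small energy.\<close>

lemma half_sinks_bounded:
 fixes S :: "('d::finite) site set"
 assumes d: "CARD('d) \<ge> 3" and K: "0 \<le> K"
 obtains m :: nat where "\<And>V S k2 \<sigma> H M. open_half V S k2 \<sigma> H ==> M \<subseteq> S \<inter> H ==>
   0 < trees S (\<lambda>y::'d site. of_bool (y \<in> M) + k2 y) ==>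
   (\<Sum>y\<in>S. real (k2 y) * ign S (\<lambda>y. of_bool (y \<in> M)) k2 y) \<le> K * real (trees S (\<lambda>y. of_bool (y \<in> M) + k2 y)) ==>
   card M \<le> m"
proof -
 \<comment> \<open>With L at least 32 K the energy available beyond level L gives 2 K / (L + 1) at
   most the square of 1/4. \<open>cL\<close> is the number of urn points below level L.\<close>
 obtain L :: nat where L: "32 * K \<le> real L" using real_arch_simple by blast
 define cL where "cL = (\<Sum>n<L. real (card (simplex3 n)))"
 have cL0: "0 \<le> cL" unfolding cL_def by (rule sum_nonneg) auto
 obtain c1 c2 c3 :: 'd where c: "c1 \<noteq> c2" "c1 \<noteq> c3" "c2 \<noteq> c3" using three_directions[OF d] .
 obtain m :: nat where m: "2 * (K + 2 * cL * K) \<le> real m" using real_arch_simple by blast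
 show thesis
 proof (rule that[of m])
  fix V S k2 \<sigma> H and M :: "'d site set"
  assume h: "open_half V S k2 \<sigma> H" and MS: "M \<subseteq> S \<inter> H"
   and t0: "0 < trees S (\<lambda>y. of_bool (y \<in> M) + k2 y)"
   and cur: "(\<Sum>y\<in>S. real (k2 y) * ign S (\<lambda>y. of_bool (y \<in> M)) k2 y) \<le> K * real (trees S (\<lambda>y. of_bool (y \<in> M) + k2 y))"
  have S: "finite S" and s0: "\<sigma> \<noteq> 0" and H: "\<And>z i. z \<in> H ==> sh \<sigma> i z \<in> H" using h unfolding open_half_def by auto
  have fM: "finite M" using S MS by (meson finite_Int finite_subset)
  define k1 where "k1 = (\<lambda>y. of_bool (y \<in> M) :: nat)"
  let ?k = "\<lambda>y. k1 y + k2 y"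
  define t where "t = real (trees S ?k)"
  have t: "0 < t" using t0 by (simp add: t_def k1_def)
  define w where "w = ign S k1 k2"
  have wb: "0 \<le> w y" "w y \<le> t" for y using ign_bounds[OF S] by (auto simp: w_def t_def)
  define v where "v = (\<lambda>y. if y \<in> S then w y / t else 0)"
  have v0: "v y = 0" if "y \<notin> S" for y using that by (simp add: v_def)
  have vb: "0 \<le> v y" "v y \<le> 1" for y using wb[of y] t by (auto simp: v_def)
  have lpv: "lp S ?k v y = real (k1 y)" if y: "y \<in> S" for y
  proof -
   have "lp S ?k v y = lp S ?k w y / t" unfolding lp_def v_def using y by (simp add: sum_divide_distrib diff_divide_distrib)
   thus ?thesis using lp_ign[OF S y, of k1 k2] t by (simp add: w_def t_def)
  qed
  \<comment> \<open>v is the voltage with M at potential 1 and \<open>k2\<close> at 0; C is the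
    current from M to \<open>k2\<close>.\<close>
  define C where "C = (\<Sum>y\<in>S. real (k2 y) * v y)"
  have CK: "C \<le> K"
  proof -
   have "C = (\<Sum>y\<in>S. real (k2 y) * w y) / t" unfolding C_def sum_divide_distrib by (rule sum.cong) (auto simp: v_def)
   thus ?thesis using cur t by (simp add: w_def t_def k1_def divide_le_eq)
  qed
  have sumM: "(\<Sum>y\<in>S. real (k1 y) * g y) = (\<Sum>y\<in>M. g y)" for g
  proof -
   have "(\<Sum>y\<in>S. real (k1 y) * g y) = (\<Sum>y\<in>M. real (k1 y) * g y)"
    by (rule sum.mono_neutral_right) (use S MS in \<open>auto simp: k1_def\<close>)
   thus ?thesis by (simp add: k1_def)
  qed
  have C1: "C = (\<Sum>y\<in>M. 1 - v y)"
  proof -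
   have "(\<Sum>y\<in>S. 1 * lp S ?k v y) = enb S ?k (\<lambda>_. 1) v" by (rule sum_lp[OF S])
   hence "(\<Sum>y\<in>S. real (k1 y) * 1) = (\<Sum>y\<in>S. real (k1 y) * v y) + C"
    using lpv by (simp add: enb_def C_def distrib_right sum.distrib)
   thus ?thesis unfolding sumM by (simp add: sum_subtractf)
  qed
  have enC: "en S k2 v \<le> C"
  proof -
   have "(\<Sum>y\<in>S. v y * lp S ?k v y) = en S ?k v" by (rule sum_lp[OF S])
   hence "(\<Sum>y\<in>S. real (k1 y) * v y) = (\<Sum>y\<in>S. real (k1 y) * (v y * v y)) + en S k2 v"
    using lpv by (simp add: enb_def algebra_simps sum.distrib)
   hence "en S k2 v = (\<Sum>y\<in>M. v y * (1 - v y))" unfolding sumM by (simp add: sum_subtractf algebra_simps)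
   also have "... \<le> (\<Sum>y\<in>M. 1 - v y)" by (rule sum_mono) (use vb in \<open>auto intro: mult_left_le_one_le\<close>)
   finally show ?thesis using C1 by simp
  qed
  define f where "f = (\<lambda>s x. v (emb c1 c2 c3 \<sigma> s x))"
  define D where "D = (\<lambda>s. \<Sum>n\<in>{0..<L}. \<Sum>x\<in>simplex3 n. grad2 (f s) x)"
  \<comment> \<open>The mean of v over level L is at most 1/4, since little energy is left beyond.
    The drop X from s to level L satisfies X <= X^2 + 1/4, because (X - 1/2)^2 is nonnegative, and
    X^2 is bounded by the local energy \<open>D s\<close>.\<close>
  have one: "v s \<le> 1 / 2 + 2 * D s" if s: "s \<in> M" for s
  proof -
   have sH: "s \<in> H" using s MS by auto
   obtain N where N: "L \<le> N" "urn_mean (f s) N = 0"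
    using urn_mean_eventually_0[of c1 c2 c3 \<sigma> S v L s] c s0 S v0 unfolding f_def by blast
   have "(urn_mean (f s) L - urn_mean (f s) N)\<^sup>2 \<le> 2 / (real L + 1) * en S k2 v"
    unfolding f_def by (rule urn_energy[OF c h v0 sH N(1)])
   also have "... \<le> 2 / (real L + 1) * K" by (rule mult_left_mono) (use enC CK in auto)
   also have "... \<le> (1 / 4)\<^sup>2" using L by (simp add: power2_eq_square field_simps)
   finally have "urn_mean (f s) L \<le> 1 / 4" unfolding N(2) by (simp add: power2_le_iff_abs_le)
   moreover have "urn_mean (f s) 0 - urn_mean (f s) L \<le> 1 / 4 + 2 * D s"
   proof -
    let ?X = "urn_mean (f s) 0 - urn_mean (f s) L"
    have "?X\<^sup>2 \<le> 2 * D s" using urn_mean_diff_sq[of 0 L "f s"] by (simp add: D_def)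
    moreover have "0 \<le> (?X - 1 / 2)\<^sup>2" by simp
    ultimately show ?thesis by (simp add: power2_eq_square algebra_simps)
   qed
   ultimately show ?thesis by (simp add: f_def)
  qed
  \<comment> \<open>For a fixed urn point x the sites reached from different s are different, so
    summing over s costs one total energy per urn point.\<close>
  have DC: "(\<Sum>s\<in>M. D s) \<le> cL * C"
  proof -
   have "(\<Sum>s\<in>M. grad2 (f s) x) \<le> C" for x
   proof -
    let ?e = "\<lambda>s. emb c1 c2 c3 \<sigma> s x"
    have "(\<Sum>s\<in>M. grad2 (f s) x) \<le> (\<Sum>s\<in>M. \<Sum>i\<in>UNIV. (v (?e s) - v (sh \<sigma> i (?e s)))\<^sup>2)"
     unfolding f_def by (intro sum_mono grad2_emb[OF c])
    also have "... = (\<Sum>z\<in>?e ` M. \<Sum>i\<in>UNIV. (v z - v (sh \<sigma> i z))\<^sup>2)"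
     by (subst sum.reindex) (auto intro!: inj_onI dest: emb_inj_s)
    also have "... \<le> en S k2 v"
    proof (rule half_energy[OF h v0])
     show "?e ` M \<subseteq> H" using MS by (intro image_subsetI emb_in_half[OF H _ c]) auto
    qed (use fM in auto)
    finally show ?thesis using enC by simp
   qed
   hence "(\<Sum>n\<in>{0..<L}. \<Sum>x\<in>simplex3 n. \<Sum>s\<in>M. grad2 (f s) x) \<le> (\<Sum>n\<in>{0..<L}. \<Sum>x\<in>simplex3 n. C)"
    by (intro sum_mono)
   moreover have "(\<Sum>s\<in>M. D s) = (\<Sum>n\<in>{0..<L}. \<Sum>x\<in>simplex3 n. \<Sum>s\<in>M. grad2 (f s) x)"
    unfolding D_def by (subst sum.swap) (intro sum.cong refl sum.swap)
   ultimately show ?thesis by (simp add: cL_def sum_distrib_right atLeast0LessThan)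
  qed
  have "real (card M) = (\<Sum>s\<in>M. 1 - v s) + (\<Sum>s\<in>M. v s)" by (simp add: sum_subtractf)
  also have "... \<le> C + (\<Sum>s\<in>M. 1 / 2 + 2 * D s)" using C1 one by (intro add_mono sum_mono) auto
  also have "... = C + real (card M) / 2 + 2 * (\<Sum>s\<in>M. D s)" by (simp add: sum.distrib sum_distrib_left)
  also have "... \<le> C + real (card M) / 2 + 2 * (cL * C)" using DC by simp
  finally have "real (card M) \<le> 2 * (C + 2 * cL * C)" by simp
  also have "... \<le> 2 * (K + 2 * cL * K)" using CK cL0 by (intro mult_left_mono add_mono) auto
  finally show "card M \<le> m" using m by linarith
 qed
qed



section \<open>Exploring the burning from W slab by slab\<close>

lemma dg_le: "dg S (y :: ('d::finite) site) \<le> 2 * CARD('d)" using dg_out[of S y] by simp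

definition lev :: "int => 'd => 'd site => int" where "lev \<sigma> i z = \<sigma> * z i"

lemma lev_sh: "\<sigma> = 1 \<or> \<sigma> = -1 ==> lev \<sigma> i (sh \<sigma> j z) = lev \<sigma> i z + (if j = i then 1 else 0)"
 by (auto simp: lev_def sh_def algebra_simps)

lemma lev_nbr:
 assumes "\<sigma> = 1 \<or> \<sigma> = -1" "nbr y z" "lev \<sigma> i z < lev \<sigma> i y"
 shows "z = sh (-\<sigma>) i y" "lev \<sigma> i y = lev \<sigma> i z + 1"
proof -
 obtain j \<tau> where "\<tau> = 1 \<or> \<tau> = -1" "z = sh \<tau> j y" using nbrE[OF assms(2)] .
 thus "z = sh (-\<sigma>) i y" "lev \<sigma> i y = lev \<sigma> i z + 1" using assms(1,3) by (auto simp: lev_def sh_def split: if_splits)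
qed

text \<open>Two sinks: W, from which burning starts, and the boundary of V. Given the burnt part A
  of the first r layers, the rest is uniformly recurrent with unit sinks M just beyond the slab. If
  M has at most m sites, nothing further burns with conditional probability at least 3^-m. If M is
  larger, a current exceeding K flows to the boundary, and this is rare because the total current is
  at most 2d times the size of W.\<close>

lemma slab_decay:
 fixes V W :: "('d::finite) site set"
 assumes sg: "\<sigma> = 1 \<or> \<sigma> = -1" and V: "finite V" "W \<subseteq> V" and Wr: "\<And>w. w \<in> W ==> lev \<sigma> i w \<le> r0"
  and d: "CARD('d) \<ge> 3" and K: "0 < K"
  and m: "\<And>V S k2 \<sigma> H M. open_half V S k2 \<sigma> H ==> M \<subseteq> S \<inter> H ==>
   0 < trees S (\<lambda>y::'d site. of_bool (y \<in> M) + k2 y) ==>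
   (\<Sum>y\<in>S. real (k2 y) * ign S (\<lambda>y. of_bool (y \<in> M)) k2 y) \<le> K * real (trees S (\<lambda>y. of_bool (y \<in> M) + k2 y)) ==>
   card M \<le> m"
 defines "R \<equiv> rec (V - W) (\<lambda>y. dg W y + out V y)"
  and "full \<equiv> burnt (V - W) (V - W) (out V)"
 shows "real (card {h\<in>R. \<exists>y\<in>full h. lev \<sigma> i y > r0 + int r})
  \<le> real (card R) * (2 * real CARD('d) * real (card W) / K + (1 - 1 / 3 ^ m) ^ r)"
proof -
 define S0 where "S0 = V - W"
 define k1 where "k1 = dg W"
 define k2 where "k2 = out V"
 define B where "B = (\<lambda>r::nat. {y\<in>S0. lev \<sigma> i y \<le> r0 + int r})"
 \<comment> \<open>Sites of the next layer lying directly above A or W. The step back is their only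
   neighbour in the explored region, so the sink they see has multiplicity exactly 1; this is
   verified in \<open>resid\<close>.\<close>
 define M where "M = (\<lambda>r A. {y\<in>V. lev \<sigma> i y = r0 + int r + 1 \<and> sh (-\<sigma>) i y \<in> A \<union> W})"
 define Ar where "Ar = (\<lambda>r. burnt S0 (B r) k2)"
 define c where "c = (\<lambda>r. real (card {h\<in>R. M r (Ar r h) \<noteq> {}}))"
 define t0 where "t0 = real (card R)"
 define \<delta> where "\<delta> = 1 / (3::real) ^ m"
 define b where "b = 2 * real CARD('d) * real (card W) / K"
 have S0: "finite S0" unfolding S0_def using V by auto
 have fW: "finite W" using V finite_subset by auto
 have Rdef: "R = rec S0 (\<lambda>y. k1 y + k2 y)" unfolding R_def S0_def k1_def k2_def ..
 have fulldef: "full = burnt S0 S0 k2" unfolding full_def S0_def k2_def ..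
 have fR: "finite R" unfolding Rdef by (rule finite_rec[OF S0])
 have BS: "B r \<subseteq> S0" "finite (B r)" for r unfolding B_def using S0 by auto
 have ArB: "Ar r h \<subseteq> B r" for r h unfolding Ar_def by (rule burnt_subset)
 have sum_Ar: "(\<Sum>h\<in>R. f h) = (\<Sum>A\<in>Pow (B r). \<Sum>h\<in>{h\<in>R. Ar r h = A}. f h)" for f :: "_ => real" and r
  unfolding Rdef Ar_def by (rule sum_burnt[OF S0 BS(1)])
 have resid: "resid (B r) A (\<lambda>y. k1 y + k2 y) k2 y = of_bool (y \<in> M r A) + k2 y"
  if A: "A \<subseteq> B r" and y: "y \<in> S0 - A" for r A y
 proof (cases "y \<in> B r")
  case True
  thus ?thesis unfolding resid_def B_def M_def by auto
 next
  case False
  hence ly: "lev \<sigma> i y > r0 + int r" using y unfolding B_def by auto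
  have fA: "finite A" by (rule finite_subset[OF A BS(2)])
  have AW: "lev \<sigma> i z \<le> r0 + int r" if "z \<in> A \<union> W" for z using that A Wr[of z] unfolding B_def by auto
  have "W \<inter> A = {}" using A unfolding B_def S0_def by auto
  hence "k1 y + dg A y = dg (W \<union> A) y" unfolding k1_def using dg_Un[OF fW fA] by simp
  also have "dg (W \<union> A) y = of_bool (y \<in> M r A)"
  proof (cases "y \<in> M r A")
   case True
   have n: "nbr y (sh (-\<sigma>) i y)" by (rule nbr_sh) (use sg in auto)
   have "z = sh (-\<sigma>) i y" if "z \<in> W \<union> A" "nbr y z" for z
    by (rule lev_nbr(1)[OF sg that(2)]) (use AW[of z] that(1) ly in auto)
   hence "{z \<in> W \<union> A. nbr y z} = {sh (-\<sigma>) i y}" using True n unfolding M_def by blast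
   thus ?thesis using True unfolding dg_def by simp
  next
   case False
   have "False" if z: "z \<in> W \<union> A" "nbr y z" for z
   proof -
    have lz: "lev \<sigma> i z < lev \<sigma> i y" using AW[of z] z ly by auto
    have zz: "sh (-\<sigma>) i y = z" "lev \<sigma> i y = lev \<sigma> i z + 1" using lev_nbr[OF sg z(2) lz] by auto
    have "lev \<sigma> i y = r0 + int r + 1" using AW[of z] z(1) ly zz(2) by auto
    moreover have "y \<in> V" using y unfolding S0_def by simp
    ultimately have "y \<in> M r A" unfolding M_def using zz(1) z(1) by blast
    thus False using False by simp
   qed
   hence "{z \<in> W \<union> A. nbr y z} = {}" by auto
   thus ?thesis using False unfolding dg_def by (simp only: card.empty) simp
  qed
  finally show ?thesis using False unfolding resid_def by simp
 qed
 have half: "open_half V (S0 - A) k2 \<sigma> {z. lev \<sigma> i z > r0 + int r}" if A: "A \<subseteq> B r" for r A unfolding open_half_def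
 proof (intro conjI ballI allI)
  show "finite (S0 - A)" using S0 by simp
  show "\<sigma> = 1 \<or> \<sigma> = -1" by fact
  show "sh \<sigma> j z \<in> {z. lev \<sigma> i z > r0 + int r}" if "z \<in> {z. lev \<sigma> i z > r0 + int r}" for z j
   using that lev_sh[OF sg, of i j z] by auto
  show "V \<inter> {z. lev \<sigma> i z > r0 + int r} \<subseteq> S0 - A" using A Wr unfolding B_def S0_def by fastforce
 qed (simp add: k2_def)
 have MS: "M r A \<subseteq> (S0 - A) \<inter> {z. lev \<sigma> i z > r0 + int r}" if A: "A \<subseteq> B r" for r A
  using A Wr unfolding B_def S0_def M_def by fastforce
 have cA: "card {h\<in>R. Ar r h = A} = trees A k1 * trees (S0 - A) (\<lambda>y. of_bool (y \<in> M r A) + k2 y)"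
  if A: "A \<subseteq> B r" for r A
 proof -
  have "card {h\<in>R. Ar r h = A} = trees A (\<lambda>y. k1 y + k2 y - k2 y) * trees (S0 - A) (resid (B r) A (\<lambda>y. k1 y + k2 y) k2)"
   unfolding Rdef Ar_def by (rule card_burnt[OF S0 BS(1) A]) auto
  also have "trees (S0 - A) (resid (B r) A (\<lambda>y. k1 y + k2 y) k2) = trees (S0 - A) (\<lambda>y. of_bool (y \<in> M r A) + k2 y)"
   by (rule trees_cong) (rule resid[OF A])
  finally show ?thesis by simp
 qed
 have cfull: "card {h\<in>R. full h = A} = trees A k1 * trees (S0 - A) k2" if A: "A \<subseteq> S0" for A
 proof -
  have "card {h\<in>R. full h = A} = trees A (\<lambda>y. k1 y + k2 y - k2 y) * trees (S0 - A) (resid S0 A (\<lambda>y. k1 y + k2 y) k2)"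
   unfolding Rdef fulldef by (rule card_burnt[OF S0 subset_refl A]) auto
  also have "trees (S0 - A) (resid S0 A (\<lambda>y. k1 y + k2 y) k2) = trees (S0 - A) k2" by (rule trees_cong) (auto simp: resid_def)
  finally show ?thesis by simp
 qed
 have full_Ar: "Ar r h = A" if "full h = A" "A \<subseteq> B r" for r h A
  using burnt_eq_larger[OF S0 BS(1)[of r] subset_refl, of k2 h] that unfolding Ar_def fulldef by auto
 have dead: "full h = Ar r h" if e: "h \<in> R" "M r (Ar r h) = {}" for r h
 proof -
  let ?A = "Ar r h"
  have A: "?A \<subseteq> B r" by (rule ArB)
  have "split_at S0 k2 ?A h \<in> rec ?A (\<lambda>y. k1 y + k2 y - k2 y) \<times> rec (S0 - ?A) (resid (B r) ?A (\<lambda>y. k1 y + k2 y) k2)"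
   by (rule split_rec[OF S0 BS(1)]) (use e in \<open>auto simp: Rdef Ar_def\<close>)
  hence z: "cut (S0 - ?A) h \<in> rec (S0 - ?A) (resid (B r) ?A (\<lambda>y. k1 y + k2 y) k2)" by (simp add: split_at_def)
  have "h y \<le> int (dg (S0 - ?A) y + k2 y)" if y: "y \<in> S0 - ?A" for y
   using recD(2)[OF z y] resid[OF A y] e(2) y by (simp add: cut_def)
  moreover have "ignites S0 k2 h ?A" unfolding Ar_def by (rule ignites_burnt[OF S0 BS(1)])
  ultimately show ?thesis unfolding fulldef by (intro burnt_eqI[OF S0 subset_refl]) (use A BS(1) in auto)
 qed
 have k2_current: "(\<Sum>h\<in>R. \<Sum>y\<in>S0. real (k2 y) * of_bool (y \<in> full h)) \<le> t0 * (b * K)"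
 proof -
  have "(\<Sum>h\<in>R. \<Sum>y\<in>S0. real (k2 y) * of_bool (y \<in> full h)) = (\<Sum>y\<in>S0. real (k2 y) * ign S0 k1 k2 y)"
   unfolding ign_def sum_distrib_left Rdef fulldef by (rule sum.swap)
  also have "... \<le> t0 * (\<Sum>y\<in>S0. real (k1 y))" using sum_ign_total[OF S0, of k2 k1] unfolding t0_def Rdef trees_def by simp
  also have "(\<Sum>y\<in>S0. real (k1 y)) \<le> real (2 * CARD('d) * card W)"
   unfolding k1_def of_nat_sum[symmetric] of_nat_le_iff by (rule sum_dg_le[OF S0 fW dg_le])
  finally show ?thesis using K unfolding b_def by (simp add: t0_def mult_left_mono)
 qed
 \<comment> \<open>Markov's inequality for the current: on outcomes A with more than m sites in
   \<open>M r A\<close>, the conditional mean of the current into the boundary exceeds K, by the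
   contrapositive of the hypothesis on m.\<close>
 have big: "real (card {h\<in>R. m < card (M r (Ar r h))}) \<le> t0 * b" for r
 proof -
  have "K * real (card {h\<in>R. m < card (M r (Ar r h))}) = (\<Sum>h\<in>R. K * of_bool (m < card (M r (Ar r h))))"
   using fR by (simp add: sum_distrib_left[symmetric] of_bool_def sum.If_cases Int_def)
  also have "... = (\<Sum>A\<in>Pow (B r). \<Sum>h\<in>{h\<in>R. Ar r h = A}. K * of_bool (m < card (M r (Ar r h))))" by (rule sum_Ar)
  also have "... \<le> (\<Sum>A\<in>Pow (B r). \<Sum>h\<in>{h\<in>R. Ar r h = A}. \<Sum>y\<in>S0. real (k2 y) * of_bool (y \<in> full h))"
  proof (rule sum_mono)
   fix A assume "A \<in> Pow (B r)"
   hence A: "A \<subseteq> B r" by auto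
   let ?X = "{h\<in>R. Ar r h = A}"
   let ?t = "trees (S0 - A) (\<lambda>y. of_bool (y \<in> M r A) + k2 y)"
   let ?J = "\<Sum>y\<in>S0 - A. real (k2 y) * ign (S0 - A) (\<lambda>y. of_bool (y \<in> M r A)) k2 y"
   have pos: "0 \<le> (\<Sum>h\<in>?X. \<Sum>y\<in>S0. real (k2 y) * of_bool (y \<in> full h))" by (intro sum_nonneg) auto
   have "(\<Sum>h\<in>?X. K * of_bool (m < card (M r (Ar r h)))) = K * of_bool (m < card (M r A)) * real (card ?X)" by simp
   also have "... \<le> (\<Sum>h\<in>?X. \<Sum>y\<in>S0. real (k2 y) * of_bool (y \<in> full h))"
   proof (cases "m < card (M r A) \<and> 0 < ?t")
    case True
    hence "\<not> ?J \<le> K * real ?t" using m[OF half[OF A] MS[OF A]] by auto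
    hence "K * real ?t \<le> ?J" by simp
    hence "real (trees A k1) * (K * real ?t) \<le> real (trees A k1) * ?J" by (intro mult_left_mono) auto
    also have "... \<le> (\<Sum>h\<in>?X. \<Sum>y\<in>S0. real (k2 y) * of_bool (y \<in> full h))"
     unfolding Rdef Ar_def fulldef by (rule sum_ign_le[OF S0 BS(1) A]) (rule resid[OF A])
    finally show ?thesis using True cA[OF A] by (simp add: mult_ac)
   next
    case False
    hence "m < card (M r A) --> card ?X = 0" using cA[OF A] by auto
    thus ?thesis using pos by (auto simp del: card_eq_0_iff)
   qed
   finally show "(\<Sum>h\<in>?X. K * of_bool (m < card (M r (Ar r h)))) \<le> (\<Sum>h\<in>?X. \<Sum>y\<in>S0. real (k2 y) * of_bool (y \<in> full h))" .
  qed
  also have "... = (\<Sum>h\<in>R. \<Sum>y\<in>S0. real (k2 y) * of_bool (y \<in> full h))" by (rule sum_Ar[symmetric])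
  also have "... \<le> t0 * (b * K)" by (rule k2_current)
  finally have "K * real (card {h\<in>R. m < card (M r (Ar r h))}) \<le> K * (t0 * b)" by (simp add: mult_ac)
  thus ?thesis using K by simp
 qed
 \<comment> \<open>If the burning had stopped inside slab r, then \<open>Ar (Suc r) h\<close> would
   equal \<open>Ar r h\<close>, and no site two layers above the slab could be adjacent to it. So
   survival at the next stage implies that it did not stop.\<close>
 have rec_c: "c (Suc r) \<le> (1 - \<delta>) * c r + \<delta> * (t0 * b)" for r
 proof -
  have "{h\<in>R. M (Suc r) (Ar (Suc r) h) \<noteq> {}} \<subseteq> {h\<in>R. full h \<noteq> Ar r h}"
  proof safe
   fix h y assume "h \<in> R" and f: "full h = Ar r h" and y: "y \<in> M (Suc r) (Ar (Suc r) h)"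
   have BB: "B r \<subseteq> B (Suc r)" unfolding B_def by auto
   have "Ar (Suc r) h = Ar r h" by (rule full_Ar) (use f ArB[of r h] BB in auto)
   hence "sh (-\<sigma>) i y \<in> B r \<union> W" "lev \<sigma> i y = r0 + int r + 2" using y ArB[of r h] unfolding M_def by auto
   moreover from this(1) have "lev \<sigma> i (sh (-\<sigma>) i y) \<le> r0 + int r" using Wr unfolding B_def by force
   moreover have "lev \<sigma> i y = lev \<sigma> i (sh (-\<sigma>) i y) + 1" using lev_sh[OF sg, of i i "sh (-\<sigma>) i y"] by simp
   ultimately show False by auto
  qed
  hence "c (Suc r) \<le> real (card {h\<in>R. full h \<noteq> Ar r h})"
   unfolding c_def of_nat_le_iff by (rule card_mono[rotated]) (use fR in auto)
  also have "... = t0 - real (card {h\<in>R. full h = Ar r h})"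
  proof -
   have "R = {h\<in>R. full h \<noteq> Ar r h} \<union> {h\<in>R. full h = Ar r h}" by auto
   moreover have "card ({h\<in>R. full h \<noteq> Ar r h} \<union> {h\<in>R. full h = Ar r h}) = card {h\<in>R. full h \<noteq> Ar r h} + card {h\<in>R. full h = Ar r h}"
    by (rule card_Un_disjoint) (use fR in auto)
   ultimately have "card R = card {h\<in>R. full h \<noteq> Ar r h} + card {h\<in>R. full h = Ar r h}" by simp
   thus ?thesis by (simp add: t0_def)
  qed
  finally have 1: "c (Suc r) \<le> t0 - real (card {h\<in>R. full h = Ar r h})" .
  \<comment> \<open>The probability 1 / 3^|M| of stopping is bounded below by 1 if M is empty, by
    \<delta> if M has between 1 and m sites, and by 0 otherwise; \<open>al\<close> and
    \<open>bi\<close> encode the three cases linearly.\<close>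
  have "(t0 - c r) + \<delta> * (c r - t0 * b) \<le> real (card {h\<in>R. full h = Ar r h})"
  proof -
   define al where "al = (\<lambda>h. of_bool (M r (Ar r h) \<noteq> {}) :: real)"
   define bi where "bi = (\<lambda>h. of_bool (m < card (M r (Ar r h))) :: real)"
   have d01: "0 < \<delta>" "\<delta> \<le> 1" unfolding \<delta>_def by (auto simp: divide_le_eq)
   have "(t0 - c r) + \<delta> * (c r - t0 * b) \<le> (t0 - c r) + \<delta> * (c r - real (card {h\<in>R. m < card (M r (Ar r h))}))"
    using big[of r] d01 by (intro add_left_mono mult_left_mono) auto
   also have "... = (\<Sum>h\<in>R. 1 - al h + \<delta> * (al h - bi h))"
   proof -
    have "(\<Sum>h\<in>R. al h) = c r" "(\<Sum>h\<in>R. bi h) = real (card {h\<in>R. m < card (M r (Ar r h))})"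
     unfolding al_def bi_def c_def using fR by (auto simp: of_bool_def sum.If_cases Int_def)
    thus ?thesis by (simp add: sum.distrib sum_subtractf t0_def flip: sum_distrib_left)
   qed
   also have "... \<le> (\<Sum>h\<in>R. 1 / 3 ^ card (M r (Ar r h)))"
   proof (rule sum_mono)
    fix h assume "h \<in> R"
    show "1 - al h + \<delta> * (al h - bi h) \<le> 1 / 3 ^ card (M r (Ar r h))"
    proof (cases "card (M r (Ar r h)) \<le> m")
     case True
     hence "(3::real) ^ card (M r (Ar r h)) \<le> 3 ^ m" by (intro power_increasing) auto
     hence "\<delta> \<le> 1 / 3 ^ card (M r (Ar r h))" unfolding \<delta>_def by (intro divide_left_mono) auto
     thus ?thesis using True by (auto simp: al_def bi_def)
    next
     case False
     hence "M r (Ar r h) \<noteq> {}" by auto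
     thus ?thesis using False by (simp add: al_def bi_def)
    qed
   qed
   also have "... = (\<Sum>A\<in>Pow (B r). \<Sum>h\<in>{h\<in>R. Ar r h = A}. 1 / 3 ^ card (M r (Ar r h)))" by (rule sum_Ar)
   also have "... \<le> (\<Sum>A\<in>Pow (B r). \<Sum>h\<in>{h\<in>R. Ar r h = A}. of_bool (full h = Ar r h))"
   proof (rule sum_mono)
    fix A assume "A \<in> Pow (B r)"
    hence A: "A \<subseteq> B r" by auto
    have "trees A k1 * trees (S0 - A) (\<lambda>y. of_bool (y \<in> M r A) + k2 y) \<le> trees A k1 * (3 ^ card (M r A) * trees (S0 - A) k2)"
     by (intro mult_left_mono half_trees_sinks[OF d half[OF A] MS[OF A]]) auto
    also have "... = 3 ^ card (M r A) * card {h\<in>R. full h = A}" using cfull[of A] subset_trans[OF A BS(1)] by simp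
    finally have "real (card {h\<in>R. Ar r h = A}) \<le> real (3 ^ card (M r A) * card {h\<in>R. full h = A})"
     unfolding cA[OF A, symmetric] of_nat_le_iff .
    hence "real (card {h\<in>R. Ar r h = A}) \<le> 3 ^ card (M r A) * real (card {h\<in>R. full h = A})" by simp
    hence "real (card {h\<in>R. Ar r h = A}) / 3 ^ card (M r A) \<le> real (card {h\<in>R. full h = A})"
     by (simp add: divide_le_eq mult.commute)
    moreover have "{h\<in>R. full h = A} = {h\<in>R. Ar r h = A} \<inter> {h. full h = A}" using full_Ar A by auto
    moreover have "finite {h\<in>R. Ar r h = A}" using fR by auto
    ultimately show "(\<Sum>h\<in>{h\<in>R. Ar r h = A}. (1::real) / 3 ^ card (M r (Ar r h))) \<le> (\<Sum>h\<in>{h\<in>R. Ar r h = A}. of_bool (full h = Ar r h))"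
     by (simp add: of_bool_def sum.If_cases)
   qed
   also have "... = (\<Sum>h\<in>R. of_bool (full h = Ar r h))" by (rule sum_Ar[symmetric])
   also have "... = real (card {h\<in>R. full h = Ar r h})" using fR by (simp add: of_bool_def sum.If_cases Int_def)
   finally show ?thesis .
  qed
  thus ?thesis using 1 by (simp add: algebra_simps)
 qed
 have "\<delta> \<le> 1" "0 < \<delta>" unfolding \<delta>_def by (auto simp: divide_le_eq)
 have ind: "c r \<le> t0 * (b + (1 - \<delta>) ^ r)" for r
 proof (induction r)
  case 0
  have "c 0 \<le> t0" unfolding c_def t0_def of_nat_le_iff by (rule card_mono) (use fR in auto)
  moreover have "0 \<le> t0 * b" unfolding t0_def b_def using K by simp
  ultimately show ?case by (simp add: algebra_simps)
 next
  case (Suc r)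
  have "c (Suc r) \<le> (1 - \<delta>) * c r + \<delta> * (t0 * b)" by (rule rec_c)
  also have "... \<le> (1 - \<delta>) * (t0 * (b + (1 - \<delta>) ^ r)) + \<delta> * (t0 * b)"
   using Suc \<open>\<delta> \<le> 1\<close> by (intro add_right_mono mult_left_mono) auto
  also have "... = t0 * (b + (1 - \<delta>) ^ Suc r)" by (simp add: algebra_simps)
  finally show ?case .
 qed
 have "{h\<in>R. \<exists>y\<in>full h. lev \<sigma> i y > r0 + int r} \<subseteq> {h\<in>R. M r (Ar r h) \<noteq> {}}"
 proof (rule subsetI, rule CollectI, rule conjI)
  fix h assume e: "h \<in> {h\<in>R. \<exists>y\<in>full h. lev \<sigma> i y > r0 + int r}"
  thus "h \<in> R" by auto
  show "M r (Ar r h) \<noteq> {}"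
  proof
   assume "M r (Ar r h) = {}"
   hence "full h \<subseteq> B r" using dead[of h r] ArB[of r h] e by auto
   thus False using e unfolding B_def by fastforce
  qed
 qed
 hence "real (card {h\<in>R. \<exists>y\<in>full h. lev \<sigma> i y > r0 + int r}) \<le> c r"
  unfolding c_def of_nat_le_iff by (rule card_mono[rotated]) (use fR in auto)
 thus ?thesis using ind[of r] by (simp add: t0_def b_def \<delta>_def)
qed

section \<open>Tightness of the set burnt from a finite window\<close>

definition box :: "nat => ('d::finite) site set" where
 "box N = {z. \<forall>i. \<bar>z i\<bar> \<le> int N}"

lemma finite_box [simp]: "finite (box N :: ('d::finite) site set)"
proof -
 have "(box N :: 'd site set) \<subseteq> {f. \<forall>i. (i \<in> UNIV --> f i \<in> {- int N..int N}) \<and> (i \<notin> UNIV --> f i = 0)}"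
  by (auto simp: box_def abs_le_iff) (metis minus_le_iff)
 moreover have "finite {f. \<forall>i. (i \<in> (UNIV::'d set) --> f i \<in> {- int N..int N}) \<and> (i \<notin> UNIV --> f i = 0)}"
  by (rule finite_set_of_finite_funs) auto
 ultimately show ?thesis by (rule finite_subset)
qed

lemma box_mono: "M \<le> N ==> box M \<subseteq> box N" unfolding box_def by (auto intro: order_trans)

lemma finite_subset_box:
 assumes "finite W" obtains N where "W \<subseteq> box N"
proof -
 have "finite ((\<lambda>(z, i). nat \<bar>z i\<bar>) ` (W \<times> UNIV))" using assms by auto
 then obtain N where N: "\<And>n. n \<in> (\<lambda>(z, i). nat \<bar>z i\<bar>) ` (W \<times> UNIV) ==> n \<le> N"
  by (meson finite_nat_set_iff_bounded_le)
 have "W \<subseteq> box N"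
 proof
  fix z assume z: "z \<in> W"
  have "nat \<bar>z i\<bar> \<le> N" for i by (rule N) (use z in auto)
  thus "z \<in> box N" unfolding box_def by (auto simp: nat_le_iff)
 qed
 thus thesis by (rule that)
qed

text \<open>The order of choices matters: K makes large currents rare, m depends on K, and r on m,
  none of them on V. Each of the 2d coordinate directions contributes at most 2 \<epsilon>' to the
  union bound, which explains the value of \<epsilon>'.\<close>

theorem burnt_tight:
 fixes W :: "('d::finite) site set"
 assumes d: "CARD('d) \<ge> 3" and W: "finite W" and e: "0 < \<epsilon>"
 obtains N where "\<And>V. finite V ==> W \<subseteq> V ==>
  real (card {h\<in>rec (V - W) (\<lambda>y. dg W y + out V y). \<not> burnt (V - W) (V - W) (out V) h \<subseteq> box N})
  \<le> \<epsilon> * real (card (rec (V - W) (\<lambda>y. dg W y + out V y)))"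
proof -
 define D where "D = 2 * real CARD('d)"
 have D: "0 < D" unfolding D_def by simp
 define \<epsilon>' where "\<epsilon>' = \<epsilon> / (2 * D)"
 have e': "0 < \<epsilon>'" unfolding \<epsilon>'_def using e D by simp
 define K where "K = (D * real (card W) + 1) / \<epsilon>'"
 have K: "0 < K" unfolding K_def using e' D by (intro divide_pos_pos add_nonneg_pos) auto
 have bK: "D * real (card W) / K \<le> \<epsilon>'"
 proof -
  have "D * real (card W) \<le> \<epsilon>' * K" unfolding K_def using e' by simp
  thus ?thesis using K by (simp add: divide_le_eq)
 qed
 obtain m where m: "\<And>V S k2 \<sigma> H M. open_half V S k2 \<sigma> H ==> M \<subseteq> S \<inter> H ==>
   0 < trees S (\<lambda>y::'d site. of_bool (y \<in> M) + k2 y) ==>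
   (\<Sum>y\<in>S. real (k2 y) * ign S (\<lambda>y. of_bool (y \<in> M)) k2 y) \<le> K * real (trees S (\<lambda>y. of_bool (y \<in> M) + k2 y)) ==>
   card M \<le> m"
 proof -
  have "0 \<le> K" using K by simp
  from half_sinks_bounded[OF d this] show ?thesis using that by blast
 qed
 have "\<exists>r. (1 - 1 / 3 ^ m) ^ r < \<epsilon>'" by (rule real_arch_pow_inv[OF e']) simp
 then obtain r where r: "(1 - 1 / (3::real) ^ m) ^ r < \<epsilon>'" by blast
 obtain r0 where r0: "W \<subseteq> box r0" using finite_subset_box[OF W] .
 show thesis
 proof (rule that[of "r0 + r"])
  fix V assume V: "finite V" "W \<subseteq> V"
  let ?R = "rec (V - W) (\<lambda>y. dg W y + out V y)"
  let ?full = "burnt (V - W) (V - W) (out V)"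
  define X where "X = (\<lambda>\<sigma> i. {h\<in>?R. \<exists>y\<in>?full h. lev \<sigma> i y > int r0 + int r})"
  have fR: "finite ?R" by (rule finite_rec) (use V in auto)
  have "{h\<in>?R. \<not> ?full h \<subseteq> box (r0 + r)} \<subseteq> (\<Union>p\<in>{1, -1} \<times> UNIV. X (fst p) (snd p))"
  proof
   fix h assume e: "h \<in> {h\<in>?R. \<not> ?full h \<subseteq> box (r0 + r)}"
   then obtain y where y: "y \<in> ?full h" "y \<notin> box (r0 + r)" by blast
   then obtain i where "\<bar>y i\<bar> > int r0 + int r" unfolding box_def by (auto simp: not_le)
   hence "lev 1 i y > int r0 + int r \<or> lev (-1) i y > int r0 + int r" unfolding lev_def by linarith
   hence "h \<in> X 1 i \<or> h \<in> X (-1) i" using e y(1) unfolding X_def by blast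
   thus "h \<in> (\<Union>p\<in>{1, -1} \<times> UNIV. X (fst p) (snd p))" by force
  qed
  hence "card {h\<in>?R. \<not> ?full h \<subseteq> box (r0 + r)} \<le> card (\<Union>p\<in>{1, -1} \<times> (UNIV::'d set). X (fst p) (snd p))"
   by (rule card_mono[rotated]) (use fR in \<open>auto simp: X_def\<close>)
  also have "... \<le> (\<Sum>p\<in>{1, -1} \<times> (UNIV::'d set). card (X (fst p) (snd p)))" by (rule card_UN_le) auto
  finally have "real (card {h\<in>?R. \<not> ?full h \<subseteq> box (r0 + r)}) \<le> real (\<Sum>p\<in>{1, -1} \<times> (UNIV::'d set). card (X (fst p) (snd p)))"
   by (simp only: of_nat_le_iff)
  also have "... = (\<Sum>p\<in>{1::int, -1} \<times> (UNIV::'d set). real (card (X (fst p) (snd p))))" by simp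
  also have "... \<le> (\<Sum>p\<in>{1::int, -1} \<times> (UNIV::'d set). real (card ?R) * (2 * \<epsilon>'))"
  proof (rule sum_mono)
   fix p :: "int \<times> 'd" assume p: "p \<in> {1, -1} \<times> UNIV"
   have lw: "lev (fst p) (snd p) w \<le> int r0" if "w \<in> W" for w
   proof -
    have "\<bar>w (snd p)\<bar> \<le> int r0" using that r0 unfolding box_def by auto
    thus ?thesis using p unfolding lev_def by auto
   qed
   have "real (card (X (fst p) (snd p))) \<le> real (card ?R) * (2 * real CARD('d) * real (card W) / K + (1 - 1 / 3 ^ m) ^ r)"
    unfolding X_def by (rule slab_decay[OF _ V lw d K m]) (use p in auto)
   also have "... \<le> real (card ?R) * (2 * \<epsilon>')" using bK r unfolding D_def by (intro mult_left_mono) auto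
   finally show "real (card (X (fst p) (snd p))) \<le> real (card ?R) * (2 * \<epsilon>')" .
  qed
  also have "... = \<epsilon> * real (card ?R)" using D by (simp add: \<epsilon>'_def D_def)
  finally show "real (card {h\<in>?R. \<not> ?full h \<subseteq> box (r0 + r)}) \<le> \<epsilon> * real (card ?R)" .
 qed
qed

section \<open>Toppling in a finite volume whose outer boundary is the sink\<close>

abbreviation recV :: "('d::finite) site set => 'd config set" where
 "recV V \<equiv> rec V (out V)"

lemma int_dg: "finite S ==> int (dg S y) = (\<Sum>z\<in>S. of_bool (nbr y z))"
 using dg_sum[of S y] by (simp only: of_nat_sum of_nat_of_bool)

lemma topple_total_eq:
 fixes V :: "('d::finite) site set"
 assumes "finite V" "y \<in> V"
 shows "topple_total V n y = 2 * int CARD('d) * int (n y) - (\<Sum>z\<in>V. of_bool (nbr y z) * int (n z))"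
proof -
 have "topple_total V n y = (\<Sum>z\<in>V. (if z = y then 2 * int CARD('d) * int (n y) else 0) - of_bool (nbr y z) * int (n z))"
  unfolding topple_total_def by (rule sum.cong) (use assms adj_irrefl adj_sym in \<open>auto simp: lapV_def lap_def of_bool_def\<close>)
 thus ?thesis using assms by (simp add: sum_subtractf)
qed

lemma topple_total_outside: "y \<notin> V ==> topple_total V n y = 0" unfolding topple_total_def lapV_def by auto

lemma topple_total_add: "topple_total V (\<lambda>z. n z + m z) y = topple_total V n y + topple_total V m y"
 unfolding topple_total_def by (simp add: sum.distrib distrib_right)

lemma topple_total_indicator:
 fixes V :: "('d::finite) site set"
 assumes "finite V" "y \<in> V" "C \<subseteq> V"
 shows "topple_total V (\<lambda>z. of_bool (z \<in> C)) y = 2 * int CARD('d) * of_bool (y \<in> C) - int (dg C y)"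
proof -
 have "(\<Sum>z\<in>V. of_bool (nbr y z) * int (of_bool (z \<in> C))) = (\<Sum>z\<in>C. of_bool (nbr y z))"
  by (rule sum.mono_neutral_cong_right) (use assms in auto)
 thus ?thesis unfolding topple_total_eq[OF assms(1,2)] using int_dg[of C y] finite_subset[OF assms(3,1)] by simp
qed

section \<open>Least action\<close>

lemma topseq_outside: "topseq V \<xi> n ==> z \<notin> V ==> n z = 0" by (induction rule: topseq.induct) auto

text \<open>Induction along the legal sequence: a site that has already toppled \<open>m z\<close>
  times has received no more grains than under m, so it is stable there and cannot legally topple
  again.\<close>

lemma least_action:
 fixes V :: "('d::finite) site set"
 assumes "topseq V \<xi> n" "finite V" and m: "\<And>y. y \<in> V ==> \<xi> y - topple_total V m y \<le> 2 * int CARD('d)"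
 shows "n z \<le> m z" using assms(1)
proof (induction arbitrary: z rule: topseq.induct)
 case start
 thus ?case by simp
next
 case (step n w)
 have "n w < m w"
 proof (rule ccontr)
  assume "\<not> n w < m w"
  hence e: "n w = m w" using step.IH[of w] by simp
  have "(\<Sum>z\<in>V. of_bool (nbr w z) * int (n z)) \<le> (\<Sum>z\<in>V. of_bool (nbr w z) * int (m z))"
   using step.IH by (intro sum_mono mult_left_mono) auto
  hence "topple_total V m w \<le> topple_total V n w" unfolding topple_total_eq[OF assms(2) step.hyps(2)] e by simp
  thus False using m[OF step.hyps(2)] step.hyps(3) by simp
 qed
 thus ?case using step.IH[of z] by auto
qed

lemma odometer_eqI:
 assumes "finite V" "topseq V \<xi> n" "stable_on V (\<lambda>y. \<xi> y - topple_total V n y)"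
 shows "odometer V \<xi> = n" unfolding odometer_def
proof (rule the_equality)
 show "topseq V \<xi> n \<and> stable_on V (\<lambda>y. \<xi> y - topple_total V n y)" using assms by simp
 fix m assume m: "topseq V \<xi> m \<and> stable_on V (\<lambda>y. \<xi> y - topple_total V m y)"
 show "m = n"
 proof
  fix z
  have "m z \<le> n z" by (rule least_action[of V \<xi> m n]) (use assms m in \<open>auto simp: stable_on_def\<close>)
  moreover have "n z \<le> m z" by (rule least_action[of V \<xi> n m]) (use assms m in \<open>auto simp: stable_on_def\<close>)
  ultimately show "m z = n z" by simp
 qed
qed

lemma odometer_stable:
 assumes "finite V" "stable_on V \<xi>" shows "odometer V \<xi> = (\<lambda>_. 0)"
 by (rule odometer_eqI) (use assms in \<open>auto intro: topseq.start simp: topple_total_def\<close>)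

section \<open>Waves\<close>

lemma funpow_closed: "(\<And>x. x \<in> X ==> f x \<in> X) ==> x \<in> X ==> (f ^^ n) x \<in> X" by (induction n) auto

lemma funpow_cancel:
 assumes inj: "inj_on f X" and cl: "\<And>x. x \<in> X ==> f x \<in> X"
  and "x \<in> X" "y \<in> X" "i \<le> j" "(f ^^ i) x = (f ^^ j) y"
 shows "x = (f ^^ (j - i)) y" using assms(5,6)
proof (induction i arbitrary: j)
 case (Suc i)
 then obtain j' where j: "j = Suc j'" by (cases j) auto
 have "f ((f ^^ i) x) = f ((f ^^ j') y)" using Suc.prems j by simp
 hence "(f ^^ i) x = (f ^^ j') y" by (rule inj_onD[OF inj]) (use funpow_closed[of X f] cl assms(3,4) in blast)+
 thus ?case using Suc.IH[of j'] Suc.prems(1) j by simp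
qed simp

lemma funpow_periodic:
 assumes inj: "inj_on f X" and cl: "\<And>x. x \<in> X ==> f x \<in> X" and "finite X" "x \<in> X"
 obtains p where "p \<ge> 1" "(f ^^ p) x = x"
proof -
 have "\<not> inj (\<lambda>n. (f ^^ n) x)"
 proof
  assume "inj (\<lambda>n. (f ^^ n) x)"
  hence "infinite (range (\<lambda>n. (f ^^ n) x))" by (simp add: finite_image_iff)
  moreover have "range (\<lambda>n. (f ^^ n) x) \<subseteq> X" using funpow_closed[of X f x] cl assms(4) by blast
  ultimately show False using assms(3) finite_subset by blast
 qed
 then obtain i j where "i \<noteq> j" "(f ^^ i) x = (f ^^ j) x" unfolding inj_def by blast
 hence "\<exists>i j. i < j \<and> (f ^^ i) x = (f ^^ j) x" by (metis linorder_neqE_nat)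
 then obtain i j where ij: "i < j" "(f ^^ i) x = (f ^^ j) x" by blast
 have "x = (f ^^ (j - i)) x" by (rule funpow_cancel[OF inj cl assms(4,4) _ ij(2)]) (use ij in auto)
 thus thesis using that[of "j - i"] ij(1) by simp
qed

text \<open>The site x becomes sink 1 and the boundary of V sink 2. An avalanche started at x is
  then a succession of waves, and each wave is one firing of the sink x acting on R.\<close>

locale wave_site =
 fixes V :: "('d::finite) site set" and x :: "'d site"
 assumes fV: "finite V" and xV: "x \<in> V"
begin

abbreviation "S \<equiv> V - {x}"
abbreviation "k1 \<equiv> dg {x}"
abbreviation "k2 \<equiv> out V"
abbreviation "R \<equiv> rec S (\<lambda>y. k1 y + k2 y)"
abbreviation "T \<equiv> fire S k1 k2"
abbreviation "wave \<equiv> burnt S S k2"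

text \<open>The number of neighbours of x left unburnt by a burning from the boundary in which x is
  held unburnt: the height that x must exceed in order to burn next.\<close>

definition low :: "'d config => nat" where "low \<xi> = dg (S - burnt S S k1 \<xi>) x"

lemma fS: "finite S" using fV by auto

lemma dg_V_split: "dg V y = dg S y + dg {x} y"
proof -
 have "dg (S \<union> {x}) y = dg S y + dg {x} y" by (rule dg_Un) (use fV in auto)
 moreover have "S \<union> {x} = V" using xV by auto
 ultimately show ?thesis by simp
qed

text \<open>Burn from the boundary without x. Then x burns exactly when its height exceeds
  \<open>low\<close>; afterwards it serves as a burnt sink, and membership of the rest in R
  guarantees that everything else burns.\<close>

lemma recV_iff:
 "h \<in> recV V \<longleftrightarrow> (\<forall>y. y \<notin> V --> h y = 0) \<and> cut S h \<in> R \<and> int (low (cut S h)) < h x \<and> h x \<le> 2 * int CARD('d)"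
proof -
 let ?\<xi> = "cut S h"
 define D where "D = S - burnt S S k1 ?\<xi>"
 have DS: "D \<subseteq> S" "finite D" unfolding D_def using fS by auto
 have xD: "x \<notin> D" using DS by auto
 have dgi: "dg (insert x F) y = dg F y + dg {x} y" if "finite F" "x \<notin> F" for F y using dg_Un[of F "{x}" y] that by simp
 have SD: "S - burnt S S k1 ?\<xi> = D" by (simp add: D_def)
 have low: "low ?\<xi> = dg D x" by (simp add: low_def D_def)
 have cS: "?\<xi> y = h y" if "y \<in> S" for y using that by (simp add: cut_def)
 show ?thesis
 proof (intro iffI conjI)
  assume e: "h \<in> recV V"
  show "\<forall>y. y \<notin> V --> h y = 0" using recD(1)[OF e] by auto
  show "h x \<le> 2 * int CARD('d)" using recD(2)[OF e xV] dg_out[of V x] by simp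
  show "?\<xi> \<in> R" unfolding rec_def
  proof (intro CollectI conjI allI impI ballI)
   show "?\<xi> y \<le> int (dg S y + (k1 y + k2 y))" if y: "y \<in> S" for y
    using recD(2)[OF e, of y] y dg_V_split[of y] by (simp add: cut_def)
   fix F assume F: "F \<subseteq> S" "F \<noteq> {}"
   then obtain y where "y \<in> F" "int (dg F y) < h y" using recD(3)[OF e, of F] by auto
   thus "\<exists>y\<in>F. int (dg F y) < ?\<xi> y" using F by (intro bexI[of _ y]) (auto simp: cut_def)
  qed (auto simp: cut_def)
  obtain y where y: "y \<in> insert x D" "int (dg (insert x D) y) < h y" using recD(3)[OF e, of "insert x D"] DS xV by auto
  show "int (low ?\<xi>) < h x"
  proof (cases "y = x")
   case True
   thus ?thesis using y low dg_self[of x D] by simp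
  next
   case False
   hence yD: "y \<in> D" using y by simp
   hence "?\<xi> y \<le> int (dg D y + k1 y)" using burnt_stuck[OF fS subset_refl, of y k1 ?\<xi>] unfolding SD by (auto simp: D_def)
   thus ?thesis using y dgi[OF DS(2) xD, of y] cS[OF subsetD[OF DS(1) yD]] by linarith
  qed
 next
  assume a: "(\<forall>y. y \<notin> V --> h y = 0) \<and> ?\<xi> \<in> R \<and> int (low ?\<xi>) < h x \<and> h x \<le> 2 * int CARD('d)"
  hence x: "?\<xi> \<in> R" by auto
  show "h \<in> recV V" unfolding rec_def
  proof (intro CollectI conjI allI impI ballI)
   show "h y = 0" if "y \<notin> V" for y using a that by auto
   show "h y \<le> int (dg V y + out V y)" if "y \<in> V" for y
   proof (cases "y = x")
    case True
    thus ?thesis using a dg_out[of V x] by simp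
   next
    case False
    thus ?thesis using recD(2)[OF x, of y] that dg_V_split[of y] by (simp add: cut_def)
   qed
   fix F assume F: "F \<subseteq> V" "F \<noteq> {}"
   have fF: "finite F" by (rule finite_subset[OF F(1) fV])
   show "\<exists>y\<in>F. int (dg F y) < h y"
   proof (cases "x \<in> F")
    case False
    hence "F \<subseteq> S" using F by auto
    then obtain y where "y \<in> F" "int (dg F y) < ?\<xi> y" using recD(3)[OF x, of F] F by blast
    thus ?thesis using cS[OF subsetD[OF \<open>F \<subseteq> S\<close> \<open>y \<in> F\<close>]] by auto
   next
    case True
    define F' where "F' = F - {x}"
    have F': "F = insert x F'" "x \<notin> F'" "finite F'" "F' \<subseteq> S" using True fF F unfolding F'_def by auto
    show ?thesis
    proof (cases "F' \<subseteq> D")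
     case True
     hence "dg F' x \<le> dg D x" by (rule dg_mono[OF DS(2)])
     thus ?thesis using a low F' dg_self[of x F'] by (intro bexI[of _ x]) auto
    next
     case False
     let ?b = "burnt S S k1 ?\<xi>"
     have "F' \<inter> ?b \<noteq> {}" using False F' unfolding D_def by auto
     then obtain y where y: "y \<in> F' \<inter> ?b" "int (dg ((F' \<inter> ?b) \<union> D) y + k1 y) < ?\<xi> y"
      using ignites_burnt[OF fS subset_refl, of k1 ?\<xi>] unfolding ignites_def SD by (meson Int_lower2)
     have "dg F' y \<le> dg ((F' \<inter> ?b) \<union> D) y" by (rule dg_mono) (use F' DS in \<open>auto simp: D_def\<close>)
     moreover have "?\<xi> y = h y" by (rule cS) (use y F' in auto)
     moreover have "dg F y = dg F' y + dg {x} y" using dgi[OF F'(3,2), of y] F'(1) by simp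
     ultimately have "int (dg F y) < h y" using y(2) by linarith
     thus ?thesis using y F' by auto
    qed
   qed
  qed
 qed
qed

text \<open>Firing exchanges the two sinks: what burnt from x before is what fails to burn from the
  boundary afterwards. So \<open>low\<close> after a wave counts the grains that the wave returns to
  x.\<close>

lemma low_T: "\<xi> \<in> R ==> low (T \<xi>) = dg (wave \<xi>) x"
proof -
 assume x: "\<xi> \<in> R"
 have "S - (S - wave \<xi>) = wave \<xi>" using burnt_subset[of S S k2 \<xi>] by auto
 thus ?thesis unfolding low_def using fire_rec(2)[OF fS x] by simp
qed

lemma T_R: "\<xi> \<in> R ==> T \<xi> \<in> R" using fire_rec(1)[OF fS] by auto

lemma Tn_R: "\<xi> \<in> R ==> (T ^^ n) \<xi> \<in> R" by (induction n) (auto intro: T_R)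

lemma inj_T: "inj_on T R" using bij_betw_fire[OF fS, of k1 k2] by (rule bij_betw_imp_inj_on)

lemma Tn_eq: "\<xi> \<in> R ==> \<xi>' \<in> R ==> i \<le> j ==> (T ^^ i) \<xi> = (T ^^ j) \<xi>' ==> \<xi> = (T ^^ (j - i)) \<xi>'"
 by (rule funpow_cancel[OF inj_T]) (auto intro: T_R)

lemma T_periodic: assumes "\<xi> \<in> R" obtains p where "p \<ge> 1" "(T ^^ p) \<xi> = \<xi>"
 by (rule funpow_periodic[OF inj_T _ finite_rec[OF fS] assms]) (auto intro: T_R)

text \<open>The number of waves of the avalanche. A further wave starts precisely when all 2d
  neighbours of x have toppled, so that x has regained all its grains. The first wave always takes
  place, hence n starts at 1; existence follows from the periodicity of T.\<close>

definition nn :: "'d config => nat" where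
 "nn \<xi> = (LEAST n. 1 \<le> n \<and> low ((T ^^ n) \<xi>) < 2 * CARD('d))"

lemma nn:
 assumes "\<xi> \<in> R" "low \<xi> < 2 * CARD('d)"
 shows "1 \<le> nn \<xi>" "low ((T ^^ nn \<xi>) \<xi>) < 2 * CARD('d)"
  and "\<And>n. 1 \<le> n ==> n < nn \<xi> ==> low ((T ^^ n) \<xi>) = 2 * CARD('d)"
proof -
 obtain p where "p \<ge> 1" "(T ^^ p) \<xi> = \<xi>" using T_periodic[OF assms(1)] .
 hence ex: "\<exists>n. 1 \<le> n \<and> low ((T ^^ n) \<xi>) < 2 * CARD('d)" using assms by (intro exI[of _ p]) auto
 show "1 \<le> nn \<xi>" "low ((T ^^ nn \<xi>) \<xi>) < 2 * CARD('d)" unfolding nn_def using LeastI_ex[OF ex] by auto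
 fix n assume n: "1 \<le> n" "n < nn \<xi>"
 hence "\<not> low ((T ^^ n) \<xi>) < 2 * CARD('d)" using not_less_Least[of n] unfolding nn_def by auto
 moreover have "low ((T ^^ n) \<xi>) \<le> 2 * CARD('d)" unfolding low_def by (rule dg_le)
 ultimately show "low ((T ^^ n) \<xi>) = 2 * CARD('d)" by simp
qed

text \<open>A wave can be realised by legal topplings: x first, then the burning sites in an order
  of burning. Exceeding the unburnt degree means exceeding 2d once x and the already burnt
  neighbours have sent their grains.\<close>

lemma wave_topseq:
 assumes t: "topseq V \<zeta> n" and cx: "\<zeta> x - topple_total V n x = 2 * int CARD('d) + 1"
  and x: "cut S (\<lambda>y. \<zeta> y - topple_total V n y) = \<xi>" "\<xi> \<in> R"
 defines "n' \<equiv> (\<lambda>z. n z + of_bool (z \<in> insert x (wave \<xi>)))"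
 shows "topseq V \<zeta> n'" and "\<zeta> x - topple_total V n' x = int (low (T \<xi>)) + 1"
  and "cut S (\<lambda>y. \<zeta> y - topple_total V n' y) = T \<xi>"
proof -
 let ?A = "wave \<xi>"
 let ?c = "\<lambda>y. \<zeta> y - topple_total V n y"
 have AS: "?A \<subseteq> S" by (rule burnt_subset)
 have fA: "finite ?A" by (rule finite_subset[OF AS fS])
 have tt: "topple_total V (\<lambda>z. n z + of_bool (z \<in> insert x C)) y
   = topple_total V n y + 2 * int CARD('d) * of_bool (y \<in> insert x C) - int (dg C y) - int (dg {x} y)"
  if "C \<subseteq> ?A" "y \<in> V" for C y
 proof -
  have CS: "C \<subseteq> S" using that AS by auto
  have "dg (insert x C) y = dg C y + dg {x} y" using dg_Un[of C "{x}" y] finite_subset[OF CS fS] CS by auto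
  moreover have iV: "insert x C \<subseteq> V" using CS xV by auto
  ultimately show ?thesis unfolding topple_total_add topple_total_indicator[OF fV that(2) iV] by linarith
 qed
 have "topseq V \<zeta> (\<lambda>z. n z + of_bool (z \<in> insert x ?A))"
  if "topseq V \<zeta> (\<lambda>z. n z + of_bool (z \<in> insert x C))" "C \<subseteq> ?A" for C using that
 proof (induction "card (?A - C)" arbitrary: C rule: less_induct)
  case less
  show ?case
  proof (cases "C = ?A")
   case True
   thus ?thesis using less.prems by simp
  next
   case False
   hence "?A - C \<noteq> {}" using less.prems by auto
   then obtain y where y: "y \<in> ?A - C" "int (dg ((?A - C) \<union> (S - ?A)) y + k2 y) < \<xi> y"
    using ignites_burnt[OF fS subset_refl, of k2 \<xi>] unfolding ignites_def by (meson Diff_subset)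
   have CS: "C \<subseteq> S" using less.prems AS by auto
   have "(?A - C) \<union> (S - ?A) = S - C" using AS less.prems by auto
   hence y2: "int (dg (S - C) y + k2 y) < \<xi> y" using y by simp
   have yS: "y \<in> S" using y AS by auto
   have ds: "dg S y = dg C y + dg (S - C) y" by (rule dg_Diff[OF fS CS])
   have "\<xi> y = ?c y" using x(1) yS by (auto simp: cut_def)
   hence "\<zeta> y - topple_total V (\<lambda>z. n z + of_bool (z \<in> insert x C)) y > 2 * int CARD('d)"
    using tt[OF less.prems(2), of y] y2 y yS ds dg_V_split[of y] dg_out[of V y] by auto
   hence "topseq V \<zeta> ((\<lambda>z. n z + of_bool (z \<in> insert x C))(y := Suc (n y + of_bool (y \<in> insert x C))))"
    by (intro topseq.step[OF less.prems(1)]) (use yS in auto)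
   moreover have "(\<lambda>z. n z + of_bool (z \<in> insert x C))(y := Suc (n y + of_bool (y \<in> insert x C)))
     = (\<lambda>z. n z + of_bool (z \<in> insert x (insert y C)))" by (rule ext) (use y yS in auto)
   ultimately have "topseq V \<zeta> (\<lambda>z. n z + of_bool (z \<in> insert x (insert y C)))" by simp
   moreover have "card (?A - insert y C) < card (?A - C)" by (rule psubset_card_mono) (use fA y in auto)
   moreover have "insert y C \<subseteq> ?A" using y less.prems by auto
   ultimately show ?thesis by (intro less.hyps)
  qed
 qed
 moreover have "topseq V \<zeta> (\<lambda>z. n z + of_bool (z \<in> insert x {}))"
 proof -
  have "topseq V \<zeta> (n(x := Suc (n x)))" by (rule topseq.step[OF t xV]) (use cx in auto)
  moreover have "n(x := Suc (n x)) = (\<lambda>z. n z + of_bool (z \<in> insert x {}))" by (rule ext) auto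
  ultimately show ?thesis by simp
 qed
 ultimately show "topseq V \<zeta> n'" unfolding n'_def by blast
 show "\<zeta> x - topple_total V n' x = int (low (T \<xi>)) + 1"
  unfolding n'_def tt[OF subset_refl xV] low_T[OF x(2)] using cx dg_self[of x "{}"] by simp
 show "cut S (\<lambda>y. \<zeta> y - topple_total V n' y) = T \<xi>"
 proof
  fix y
  show "cut S (\<lambda>y. \<zeta> y - topple_total V n' y) y = T \<xi> y"
  proof (cases "y \<in> S")
   case True
   have xy: "\<xi> y = ?c y" using x(1) True by (auto simp: cut_def)
   have ds: "dg S y = dg ?A y + dg (S - ?A) y" by (rule dg_Diff[OF fS AS])
   show ?thesis unfolding n'_def cut_def using True tt[OF subset_refl, of y] xy ds dg_V_split[of y] dg_out[of V y]
    by (auto simp: fire_def Let_def)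
  next
   case False
   thus ?thesis using AS by (auto simp: cut_def fire_def Let_def)
  qed
 qed
qed

definition wsum :: "'d config => nat => 'd site => nat" where
 "wsum \<xi> m z = (\<Sum>i<m. of_bool (z \<in> insert x (wave ((T ^^ i) \<xi>))))"

lemma waves_topseq:
 assumes e: "h \<in> recV V" and ex: "h x = 2 * int CARD('d)"
 defines "\<xi> \<equiv> cut S h"
 shows "m \<le> nn \<xi> ==> topseq V (add_grain x h) (wsum \<xi> m) \<and>
   cut S (\<lambda>y. add_grain x h y - topple_total V (wsum \<xi> m) y) = (T ^^ m) \<xi> \<and>
   add_grain x h x - topple_total V (wsum \<xi> m) x = 1 + (if m = 0 then 2 * int CARD('d) else int (low ((T ^^ m) \<xi>)))"
proof (induction m)
 case 0
 have "wsum \<xi> 0 = (\<lambda>_. 0)" by (auto simp: wsum_def)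
 moreover have "topple_total V (\<lambda>_. 0) y = 0" for y by (simp add: topple_total_def)
 ultimately show ?case using ex by (auto simp: topseq.start cut_def add_grain_def \<xi>_def)
next
 case (Suc m)
 have xR: "\<xi> \<in> R" "low \<xi> < 2 * CARD('d)" using e ex recV_iff[of h] by (auto simp: \<xi>_def)
 have IH: "topseq V (add_grain x h) (wsum \<xi> m)"
  "cut S (\<lambda>y. add_grain x h y - topple_total V (wsum \<xi> m) y) = (T ^^ m) \<xi>"
  "add_grain x h x - topple_total V (wsum \<xi> m) x = 1 + (if m = 0 then 2 * int CARD('d) else int (low ((T ^^ m) \<xi>)))"
  using Suc by auto
 have "add_grain x h x - topple_total V (wsum \<xi> m) x = 2 * int CARD('d) + 1"
  using IH(3) nn(3)[OF xR, of m] Suc.prems by (auto split: if_splits)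
 note w = wave_topseq[OF IH(1) this IH(2) Tn_R[OF xR(1)]]
 have "wsum \<xi> (Suc m) = (\<lambda>z. wsum \<xi> m z + of_bool (z \<in> insert x (wave ((T ^^ m) \<xi>))))" by (auto simp: wsum_def)
 thus ?case using w by auto
qed

definition result :: "'d config => 'd config" where
 "result \<xi> = (\<lambda>y. if y = x then 1 + int (low \<xi>) else \<xi> y)"

lemma cut_result: "\<xi> \<in> R ==> cut S (result \<xi>) = \<xi>" using recD(1)[of \<xi> S] by (fastforce simp: cut_def result_def)

lemma odometer_wave:
 assumes e: "h \<in> recV V" and ex: "h x = 2 * int CARD('d)"
 shows "odometer V (add_grain x h) = wsum (cut S h) (nn (cut S h))"
  and "aV V x h = result ((T ^^ nn (cut S h)) (cut S h))"
  and "topseq V (add_grain x h) (odometer V (add_grain x h))"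
proof -
 let ?\<xi> = "cut S h"
 let ?n = "wsum ?\<xi> (nn ?\<xi>)"
 let ?f = "(T ^^ nn ?\<xi>) ?\<xi>"
 have xR: "?\<xi> \<in> R" "low ?\<xi> < 2 * CARD('d)" using e ex recV_iff[of h] by auto
 have w: "topseq V (add_grain x h) ?n" "cut S (\<lambda>y. add_grain x h y - topple_total V ?n y) = ?f"
  "add_grain x h x - topple_total V ?n x = 1 + int (low ?f)" using waves_topseq[OF e ex, of "nn ?\<xi>"] nn(1)[OF xR] by auto
 have fR: "?f \<in> R" by (rule Tn_R[OF xR(1)])
 have c: "(\<lambda>y. add_grain x h y - topple_total V ?n y) = result ?f"
 proof
  fix y
  show "add_grain x h y - topple_total V ?n y = result ?f y"
  proof (cases "y \<in> S")
   case True
   thus ?thesis using fun_cong[OF w(2), of y] by (auto simp: cut_def result_def)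
  next
   case False
   show ?thesis
   proof (cases "y = x")
    case True
    thus ?thesis using w(3) by (simp add: result_def)
   next
    case ne: False
    hence yV: "y \<notin> V" using False by auto
    have "h y = 0" "?f y = 0" using recD(1)[OF e yV] recD(1)[OF fR False] by auto
    thus ?thesis using ne topple_total_outside[OF yV] by (simp add: result_def add_grain_def)
   qed
  qed
 qed
 have "stable_on V (result ?f)" unfolding stable_on_def
 proof
  fix y assume y: "y \<in> V"
  show "result ?f y \<le> 2 * int CARD('d)"
  proof (cases "y = x")
   case True
   thus ?thesis using nn(2)[OF xR] by (simp add: result_def)
  next
   case False
   thus ?thesis using recD(2)[OF fR, of y] y dg_V_split[of y] dg_out[of V y] by (simp add: result_def)
  qed
 qed
 thus o: "odometer V (add_grain x h) = ?n" using odometer_eqI[OF fV w(1)] c by simp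
 show "aV V x h = result ?f" unfolding aV_def stabilize_def o by (rule c)
 show "topseq V (add_grain x h) (odometer V (add_grain x h))" using o w(1) by simp
qed

lemma odometer_no_wave:
 assumes e: "h \<in> recV V" and ex: "h x < 2 * int CARD('d)"
 shows "odometer V (add_grain x h) = (\<lambda>_. 0)" and "aV V x h = add_grain x h"
proof -
 have "h y \<le> 2 * int CARD('d)" if "y \<in> V" for y using recD(2)[OF e that] dg_out[of V y] by simp
 hence "stable_on V (add_grain x h)" using ex by (auto simp: stable_on_def add_grain_def)
 thus o: "odometer V (add_grain x h) = (\<lambda>_. 0)" by (rule odometer_stable[OF fV])
 show "aV V x h = add_grain x h" unfolding aV_def stabilize_def o by (simp add: topple_total_def)
qed

lemma recV_height: "h \<in> recV V ==> h x < 2 * int CARD('d) \<or> h x = 2 * int CARD('d)" using recV_iff[of h] by auto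

lemma topseq_odometer: "h \<in> recV V ==> topseq V (add_grain x h) (odometer V (add_grain x h))"
 using recV_height[of h] odometer_wave(3)[of h] odometer_no_wave(1)[of h] topseq.start[of V "add_grain x h"] by auto

lemma aV_recV:
 assumes e: "h \<in> recV V" shows "aV V x h \<in> recV V"
proof (cases "h x < 2 * int CARD('d)")
 case True
 have "cut S (add_grain x h) = cut S h" by (auto simp: cut_def add_grain_def)
 thus ?thesis unfolding odometer_no_wave(2)[OF e True] using e True xV unfolding recV_iff by (auto simp: add_grain_def)
next
 case False
 hence ex: "h x = 2 * int CARD('d)" using recV_height[OF e] by simp
 let ?\<xi> = "cut S h"
 have xR: "?\<xi> \<in> R" "low ?\<xi> < 2 * CARD('d)" using e ex recV_iff[of h] by auto
 have fR: "(T ^^ nn ?\<xi>) ?\<xi> \<in> R" by (rule Tn_R[OF xR(1)])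
 show ?thesis unfolding odometer_wave(2)[OF e ex] recV_iff cut_result[OF fR]
  using fR nn(2)[OF xR] recD(1)[OF fR] xV by (auto simp: result_def)
qed

text \<open>On an orbit of T the configurations with \<open>low\<close> below 2d mark the starts of
  avalanches, and none lies strictly between a start and its last wave. Two avalanches that meet
  therefore have the same start.\<close>

lemma nn_inj:
 assumes "\<xi> \<in> R" "low \<xi> < 2 * CARD('d)" "\<xi>' \<in> R" "low \<xi>' < 2 * CARD('d)"
  and "i \<le> j" "j \<le> nn \<xi>'" "i < nn \<xi> \<and> j < nn \<xi>' \<or> i = nn \<xi> \<and> j = nn \<xi>'" "(T ^^ i) \<xi> = (T ^^ j) \<xi>'"
 shows "\<xi> = \<xi>' \<and> i = j"
proof -
 have "\<xi> = (T ^^ (j - i)) \<xi>'" by (rule Tn_eq) (use assms in auto)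
 moreover have "j - i = 0"
 proof (rule ccontr)
  assume "j - i \<noteq> 0"
  moreover have "j - i < nn \<xi>'" using assms nn(1)[OF assms(1,2)] by auto
  ultimately have "low ((T ^^ (j - i)) \<xi>') = 2 * CARD('d)" by (intro nn(3)[OF assms(3,4)]) auto
  thus False using \<open>\<xi> = (T ^^ (j - i)) \<xi>'\<close> assms(2) by simp
 qed
 ultimately show ?thesis using assms(5) by auto
qed

lemma recV_eqI:
 assumes "h \<in> recV V" "h' \<in> recV V" "cut S h = cut S h'" "h x = h' x"
 shows "h = h'"
proof
 fix y
 show "h y = h' y" using fun_cong[OF assms(3), of y] assms(4) recD(1)[OF assms(1), of y] recD(1)[OF assms(2), of y]
  by (cases "y = x"; cases "y \<in> V") (auto simp: cut_def)
qed

lemma inj_aV: "inj_on (aV V x) (recV V)"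
proof -
 \<comment> \<open>An addition without toppling cannot give the outcome of an avalanche: the height
   at x before it would equal \<open>low\<close>, while recurrence demands more.\<close>
 have mixed: False if e: "c \<in> recV V" "c' \<in> recV V" "aV V x c = aV V x c'"
  and h: "c x < 2 * int CARD('d)" "c' x = 2 * int CARD('d)" for c c'
 proof -
  let ?\<xi>' = "cut S c'"
  let ?f = "(T ^^ nn ?\<xi>') ?\<xi>'"
  have "?\<xi>' \<in> R" using e(2) recV_iff[of c'] by auto
  hence fR: "?f \<in> R" by (rule Tn_R)
  have eq: "add_grain x c = result ?f" using e(3) odometer_no_wave(2)[OF e(1) h(1)] odometer_wave(2)[OF e(2) h(2)] by simp
  have "cut S c = cut S (add_grain x c)" by (auto simp: cut_def add_grain_def)
  hence "cut S c = ?f" using eq cut_result[OF fR] by simp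
  moreover have "c x = int (low ?f)" using fun_cong[OF eq, of x] by (auto simp: add_grain_def result_def)
  ultimately show False using e(1) recV_iff[of c] by auto
 qed
 show ?thesis
 proof (rule inj_onI)
  fix c c' assume e: "c \<in> recV V" "c' \<in> recV V" "aV V x c = aV V x c'"
  consider "c x < 2 * int CARD('d)" "c' x < 2 * int CARD('d)" | "c x = 2 * int CARD('d)" "c' x = 2 * int CARD('d)"
   using mixed[OF e] mixed[OF e(2,1) e(3)[symmetric]] recV_height[OF e(1)] recV_height[OF e(2)] by auto
  thus "c = c'"
  proof cases
   case 1
   hence "add_grain x c = add_grain x c'" using e(3) odometer_no_wave(2)[OF e(1)] odometer_no_wave(2)[OF e(2)] by simp
   hence eq: "add_grain x c y = add_grain x c' y" for y by simp
   show ?thesis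
   proof
    fix y show "c y = c' y" using eq[of y] by (cases "y = x") (auto simp: add_grain_def)
   qed
  next
   case 2
   let ?\<xi> = "cut S c" and ?\<xi>' = "cut S c'"
   have xR: "?\<xi> \<in> R" "low ?\<xi> < 2 * CARD('d)" "?\<xi>' \<in> R" "low ?\<xi>' < 2 * CARD('d)"
    using e 2 recV_iff[of c] recV_iff[of c'] by auto
   have "result ((T ^^ nn ?\<xi>) ?\<xi>) = result ((T ^^ nn ?\<xi>') ?\<xi>')"
    using e odometer_wave(2)[OF e(1) 2(1)] odometer_wave(2)[OF e(2) 2(2)] by simp
   hence eq: "(T ^^ nn ?\<xi>) ?\<xi> = (T ^^ nn ?\<xi>') ?\<xi>'"
    by (rule box_equals[OF arg_cong[where f="cut S"]]) (rule cut_result[OF Tn_R[OF xR(1)]] cut_result[OF Tn_R[OF xR(3)]])+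
   have "?\<xi> = ?\<xi>'"
   proof (cases "nn ?\<xi> \<le> nn ?\<xi>'")
    case True
    thus ?thesis using nn_inj[OF xR True order_refl _ eq] by blast
   next
    case False
    hence "nn ?\<xi>' \<le> nn ?\<xi>" by simp
    thus ?thesis using nn_inj[OF xR(3,4,1,2) _ order_refl _ eq[symmetric]] by simp
   qed
   thus ?thesis using recV_eqI[OF e(1,2)] 2 by simp
  qed
 qed
qed

lemma bij_aV: "bij_betw (aV V x) (recV V) (recV V)" unfolding bij_betw_def using inj_aV aV_recV
 by (meson endo_inj_surj image_subsetI finite_rec[OF fV])

text \<open>Distinct waves, of the same or of different avalanches, start from distinct configurations of R.\<close>

lemma card_odometer_le:
 "card {h\<in>recV V. \<exists>y\<in>Z. odometer V (add_grain x h) y \<noteq> 0} \<le> card {\<xi>\<in>R. insert x (wave \<xi>) \<inter> Z \<noteq> {}}"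
proof -
 let ?X = "{h\<in>recV V. \<exists>y\<in>Z. odometer V (add_grain x h) y \<noteq> 0}"
 have ex: "\<exists>i. i < nn (cut S h) \<and> insert x (wave ((T ^^ i) (cut S h))) \<inter> Z \<noteq> {} \<and> h x = 2 * int CARD('d)"
  if e: "h \<in> ?X" for h
 proof -
  have r: "h \<in> recV V" using e by auto
  have ex: "h x = 2 * int CARD('d)" using recV_height[OF r] odometer_no_wave(1)[OF r] e by auto
  obtain y where y: "y \<in> Z" "wsum (cut S h) (nn (cut S h)) y \<noteq> 0" using e odometer_wave(1)[OF r ex] by auto
  then obtain i where "i < nn (cut S h)" "y \<in> insert x (wave ((T ^^ i) (cut S h)))" unfolding wsum_def by auto
  thus ?thesis using ex y by auto
 qed
 hence "\<forall>h\<in>?X. \<exists>i. i < nn (cut S h) \<and> insert x (wave ((T ^^ i) (cut S h))) \<inter> Z \<noteq> {} \<and> h x = 2 * int CARD('d)" by blast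
 from bchoice[OF this] obtain I where I: "\<And>h. h \<in> ?X ==> I h < nn (cut S h) \<and> insert x (wave ((T ^^ I h) (cut S h))) \<inter> Z \<noteq> {} \<and> h x = 2 * int CARD('d)"
  by blast
 have xR: "cut S h \<in> R" "low (cut S h) < 2 * CARD('d)" if "h \<in> ?X" for h using I[OF that] that recV_iff[of h] by auto
 show ?thesis
 proof (rule card_inj_on_le[of "\<lambda>h. (T ^^ I h) (cut S h)"])
  show "inj_on (\<lambda>h. (T ^^ I h) (cut S h)) ?X"
  proof (rule inj_onI)
   fix h h' assume e: "h \<in> ?X" "h' \<in> ?X" and eq: "(T ^^ I h) (cut S h) = (T ^^ I h') (cut S h')"
   have "cut S h = cut S h'"
   proof (cases "I h \<le> I h'")
    case True
    thus ?thesis using nn_inj[OF xR[OF e(1)] xR[OF e(2)] True] I[OF e(1)] I[OF e(2)] eq by auto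
   next
    case False
    thus ?thesis using nn_inj[OF xR[OF e(2)] xR[OF e(1)], of "I h'" "I h"] I[OF e(1)] I[OF e(2)] eq by auto
   qed
   thus "h = h'" using recV_eqI[of h h'] e I[OF e(1)] I[OF e(2)] by auto
  qed
  show "(\<lambda>h. (T ^^ I h) (cut S h)) ` ?X \<subseteq> {\<xi>\<in>R. insert x (wave \<xi>) \<inter> Z \<noteq> {}}"
   using I Tn_R[OF xR(1)] by blast
  show "finite {\<xi>\<in>R. insert x (wave \<xi>) \<inter> Z \<noteq> {}}" using finite_rec[OF fS] by auto
 qed
qed

end

section \<open>Recurrent configurations\<close>

lemma extremal_site:
 fixes F :: "('d::finite) site set"
 assumes "finite F" "F \<noteq> {}"
 obtains y where "y \<in> F" "dg F y < 2 * CARD('d)"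
proof -
 obtain i :: 'd where True by simp
 have "Max ((\<lambda>z. z i) ` F) \<in> (\<lambda>z. z i) ` F" using assms by (intro Max_in) auto
 then obtain y where y: "y \<in> F" "Max ((\<lambda>z. z i) ` F) = y i" by auto
 have y2: "z i \<le> y i" if "z \<in> F" for z unfolding y(2)[symmetric] by (rule Max_ge) (use assms that in auto)
 have "sh 1 i y \<notin> F" using y2[of "sh 1 i y"] by (auto simp: sh_def)
 moreover have "nbr y (sh 1 i y)" by (rule nbr_sh) simp
 ultimately have "{z. z \<notin> F \<and> nbr y z} \<noteq> {}" by auto
 hence "0 < out F y" by (simp add: card_gt_0_iff)
 hence "dg F y < 2 * CARD('d)" using dg_out[of F y] by linarith
 thus thesis using that y(1) by blast
qed

definition full_config :: "('d::finite) site set => 'd config" where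
 "full_config V y = (if y \<in> V then 2 * int CARD('d) else 0)"

lemma full_config_recV:
 fixes V :: "('d::finite) site set"
 assumes "finite V" shows "full_config V \<in> recV V" unfolding rec_def
proof (intro CollectI conjI allI impI ballI)
 show "full_config V y \<le> int (dg V y + out V y)" if "y \<in> V" for y using that dg_out[of V y] by (simp add: full_config_def)
 fix F assume F: "F \<subseteq> V" "F \<noteq> {}"
 hence "finite F" using assms finite_subset by blast
 then obtain y where y: "y \<in> F" "dg F y < 2 * CARD('d)" using extremal_site F by metis
 hence "full_config V y = 2 * int CARD('d)" using F by (auto simp: full_config_def)
 thus "\<exists>y\<in>F. int (dg F y) < full_config V y" using y by (intro bexI[of _ y]) auto
qed (auto simp: full_config_def)

lemma trees_wired_pos: "finite V ==> 0 < trees V (out V)"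
 unfolding trees_def using full_config_recV[of V] finite_rec[of V "out V"] by (auto simp: card_gt_0_iff)

lemma recV_height_bounds:
 fixes V :: "('d::finite) site set"
 assumes "h \<in> recV V" "y \<in> V" shows "1 \<le> h y" "h y \<le> 2 * int CARD('d)"
 using rec_ge_1[OF assms] recD(2)[OF assms] dg_out[of V y] by auto

lemma recV_OmegaV: "recV V \<subseteq> OmegaV V" unfolding OmegaV_def using recV_height_bounds recD(1) by fastforce

lemma reach_full:
 fixes V :: "('d::finite) site set"
 assumes "finite V" "h \<in> OmegaV V"
 shows "(chain_step V)\<^sup>*\<^sup>* h (full_config V)" using assms(2)
proof (induction "\<Sum>y\<in>V. nat (2 * int CARD('d) - h y)" arbitrary: h rule: less_induct)
 case less
 have b: "\<And>y. y \<in> V ==> 1 \<le> h y \<and> h y \<le> 2 * int CARD('d)" "\<And>y. y \<notin> V ==> h y = 0"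
  using less.prems unfolding OmegaV_def by auto
 show ?case
 proof (cases "h = full_config V")
  case False
  then obtain x where "h x \<noteq> full_config V x" by auto
  hence x: "x \<in> V" "h x < 2 * int CARD('d)" using b[of x] by (auto simp: full_config_def split: if_splits)
  have "stable_on V (add_grain x h)" using b x by (auto simp: stable_on_def add_grain_def)
  hence o: "odometer V (add_grain x h) = (\<lambda>_. 0)" by (rule odometer_stable[OF assms(1)])
  have "aV V x h = add_grain x h" unfolding aV_def stabilize_def o by (simp add: topple_total_def)
  hence "chain_step V h (add_grain x h)" using x unfolding chain_step_def by metis
  moreover have "(chain_step V)\<^sup>*\<^sup>* (add_grain x h) (full_config V)"
  proof (rule less.hyps)
   show "add_grain x h \<in> OmegaV V" using less.prems x unfolding OmegaV_def add_grain_def by auto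
   show "(\<Sum>y\<in>V. nat (2 * int CARD('d) - add_grain x h y)) < (\<Sum>y\<in>V. nat (2 * int CARD('d) - h y))"
    by (rule sum_strict_mono_ex1) (use assms x in \<open>auto simp: add_grain_def\<close>)
  qed
  ultimately show ?thesis by (rule converse_rtranclp_into_rtranclp)
 qed simp
qed

lemma chain_recV:
 assumes "finite V" "(chain_step V)\<^sup>*\<^sup>* h \<zeta>" "h \<in> recV V"
 shows "\<zeta> \<in> recV V" using assms(2,3) by (induction rule: rtranclp_induct)
  (auto simp: chain_step_def intro: wave_site.aV_recV[unfolded wave_site_def] simp: assms(1))

text \<open>Addition at x permutes the finite set \<open>recV V\<close>, so iterating the same
  addition eventually undoes it.\<close>

lemma chain_back:
 assumes V: "finite V" and s: "chain_step V h \<zeta>" and e: "h \<in> recV V"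
 shows "(chain_step V)\<^sup>*\<^sup>* \<zeta> h"
proof -
 obtain x where x: "x \<in> V" "\<zeta> = aV V x h" using s unfolding chain_step_def by auto
 interpret wave_site V x using V x by unfold_locales
 obtain p where p: "p \<ge> 1" "(aV V x ^^ p) h = h" using funpow_periodic[OF inj_aV aV_recV finite_rec[OF V] e] .
 hence p2: "(aV V x ^^ (p - 1)) \<zeta> = h" using x(2) funpow_Suc_right[of "p - 1" "aV V x"] by simp
 have "(chain_step V)\<^sup>*\<^sup>* \<zeta> ((aV V x ^^ n) \<zeta>)" for n
 proof (induction n)
  case (Suc n)
  have "chain_step V ((aV V x ^^ n) \<zeta>) ((aV V x ^^ Suc n) \<zeta>)" unfolding chain_step_def using x(1) by auto
  thus ?case by (rule rtranclp.rtrancl_into_rtrancl[OF Suc])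
 qed simp
 thus ?thesis using p2 by metis
qed

text \<open>The full configuration is reachable from every stable one and passes the burning test;
  additions preserve the test and can be reversed on \<open>recV V\<close>.\<close>

theorem recurrentV_eq:
 assumes V: "finite V" shows "recurrentV V = recV V"
proof (intro equalityI subsetI)
 fix h assume "h \<in> recurrentV V"
 hence "h \<in> OmegaV V" and r: "\<And>\<zeta>. (chain_step V)\<^sup>*\<^sup>* h \<zeta> ==> (chain_step V)\<^sup>*\<^sup>* \<zeta> h"
  unfolding recurrentV_def by auto
 hence "(chain_step V)\<^sup>*\<^sup>* (full_config V) h" using reach_full[OF V] by auto
 thus "h \<in> recV V" using chain_recV[OF V _ full_config_recV[OF V]] by auto
next
 fix h assume e: "h \<in> recV V"
 have "(chain_step V)\<^sup>*\<^sup>* \<zeta> h" if "(chain_step V)\<^sup>*\<^sup>* h \<zeta>" for \<zeta> using that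
 proof (induction rule: rtranclp_induct)
  case (step \<zeta> \<zeta>')
  have "\<zeta> \<in> recV V" by (rule chain_recV[OF V step.hyps(1) e])
  thus ?case using chain_back[OF V step.hyps(2)] step.IH by (meson rtranclp_trans)
 qed simp
 thus "h \<in> recurrentV V" using e recV_OmegaV unfolding recurrentV_def by blast
qed

section \<open>Nested volumes\<close>

lemma restr_cut: "restr V h = cut V h" unfolding restr_def cut_def ..

lemma cut_recV:
 assumes e: "h \<in> rec V k" and B: "B \<subseteq> V" and k: "\<And>y. y \<in> V ==> k y \<le> out V y"
 shows "cut B h \<in> recV B" unfolding rec_def
proof (intro CollectI conjI allI impI ballI)
 show "cut B h y \<le> int (dg B y + out B y)" if "y \<in> B" for y
  using recD(2)[OF e, of y] that B k[of y] dg_out[of V y] dg_out[of B y] by (auto simp: cut_def)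
 fix F assume F: "F \<subseteq> B" "F \<noteq> {}"
 then obtain y where "y \<in> F" "int (dg F y) < h y" using recD(3)[OF e, of F] B by auto
 thus "\<exists>y\<in>F. int (dg F y) < cut B h y" using F by (intro bexI[of _ y]) (auto simp: cut_def)
qed (auto simp: cut_def)

lemma restr_mono_recV: "restr V h \<in> recV V ==> B \<subseteq> V ==> restr B h \<in> recV B"
proof -
 assume a: "restr V h \<in> recV V" "B \<subseteq> V"
 have "cut B (restr V h) = restr B h" by (rule ext) (use a(2) in \<open>auto simp: cut_def restr_def\<close>)
 thus ?thesis using cut_recV[OF a] by simp
qed

lemma topseq_NV:
 assumes "finite B" "x \<in> B" "restr B h \<in> recV B"
 shows "topseq B (add_grain x (restr B h)) (\<lambda>y. NV B x y h)"
 using wave_site.topseq_odometer[of B x] assms unfolding wave_site_def NV_def by simp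

lemma stable_NV:
 fixes B :: "('d::finite) site set"
 assumes "finite B" "x \<in> B" "restr B h \<in> recV B" "y \<in> B"
 shows "add_grain x (restr B h) y - topple_total B (\<lambda>y. NV B x y h) y \<le> 2 * int CARD('d)"
 using recV_height_bounds(2)[OF wave_site.aV_recV[of B x], of "restr B h" y] assms
 unfolding wave_site_def aV_def stabilize_def NV_def by auto

lemma NV_outside:
 assumes "finite B" "x \<notin> B" "restr B h \<in> recV B"
 shows "NV B x y h = 0"
proof -
 have "stable_on B (add_grain x (restr B h))" using recV_height_bounds(2)[OF assms(3)] assms(2) by (auto simp: stable_on_def add_grain_def)
 thus ?thesis unfolding NV_def using odometer_stable[OF assms(1)] by simp
qed

text \<open>The toppling numbers of V, used inside B, bring no more grains to a site of B than they
  do in V. They stabilise B, and least action applies.\<close>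

lemma NV_mono:
 fixes B V :: "('d::finite) site set"
 assumes V: "finite V" "B \<subseteq> V" "restr V h \<in> recV V"
 shows "NV B x y h \<le> NV V x y h"
proof (cases "x \<in> B")
 case False
 thus ?thesis using NV_outside[OF finite_subset[OF V(2,1)], of x h] restr_mono_recV[OF V(3,2)] by simp
next
 case True
 have fB: "finite B" by (rule finite_subset[OF V(2,1)])
 show ?thesis
 proof (rule least_action[OF topseq_NV[OF fB True restr_mono_recV[OF V(3,2)]] fB])
  fix z assume z: "z \<in> B"
  have "(\<Sum>w\<in>B. of_bool (nbr z w) * int (NV V x w h)) \<le> (\<Sum>w\<in>V. of_bool (nbr z w) * int (NV V x w h))"
   by (rule sum_mono2) (use V in auto)
  hence "topple_total V (\<lambda>y. NV V x y h) z \<le> topple_total B (\<lambda>y. NV V x y h) z"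
   using topple_total_eq[OF fB z] topple_total_eq[OF V(1), of z] z V by auto
  moreover have "add_grain x (restr B h) z = add_grain x (restr V h) z" using z V by (auto simp: add_grain_def restr_def)
  ultimately show "add_grain x (restr B h) z - topple_total B (\<lambda>y. NV V x y h) z \<le> 2 * int CARD('d)"
   using stable_NV[OF V(1) subsetD[OF V(2) True] V(3) subsetD[OF V(2) z]] by linarith
 qed
qed

text \<open>No site with a neighbour outside B topples, so no grain leaves B and the avalanche is
  the same in every larger volume.\<close>

definition contained :: "('d::finite) site set => 'd site => 'd config => bool" where
 "contained B x h \<longleftrightarrow> (\<forall>y\<in>B. out B y \<noteq> 0 --> NV B x y h = 0)"

lemma NV_contained:
 fixes B V :: "('d::finite) site set"
 assumes V: "finite V" "B \<subseteq> V" "restr V h \<in> recV V" and x: "x \<in> B" and c: "contained B x h"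
 shows "NV V x y h = NV B x y h"
proof (rule antisym)
 have fB: "finite B" by (rule finite_subset[OF V(2,1)])
 have rB: "restr B h \<in> recV B" by (rule restr_mono_recV[OF V(3,2)])
 have xV: "x \<in> V" using x V by auto
 have NB0: "NV B x z h = 0" if "z \<notin> B" for z using topseq_outside[OF topseq_NV[OF fB x rB] that] .
 show "NV B x y h \<le> NV V x y h" by (rule NV_mono[OF V])
 show "NV V x y h \<le> NV B x y h"
 proof (rule least_action[OF topseq_NV[OF V(1) xV V(3)] V(1)])
  fix z assume z: "z \<in> V"
  have s: "(\<Sum>w\<in>V. of_bool (nbr z w) * int (NV B x w h)) = (\<Sum>w\<in>B. of_bool (nbr z w) * int (NV B x w h))"
   by (rule sum.mono_neutral_right) (use V NB0 in auto)
  show "add_grain x (restr V h) z - topple_total V (\<lambda>y. NV B x y h) z \<le> 2 * int CARD('d)"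
  proof (cases "z \<in> B")
   case True
   have "topple_total V (\<lambda>y. NV B x y h) z = topple_total B (\<lambda>y. NV B x y h) z"
    using topple_total_eq[OF fB True] topple_total_eq[OF V(1) z] s by simp
   moreover have "add_grain x (restr V h) z = add_grain x (restr B h) z" using z True by (auto simp: add_grain_def restr_def)
   ultimately show ?thesis using stable_NV[OF fB x rB True] by simp
  next
   case False
   have "of_bool (nbr z w) * int (NV B x w h) = 0" if w: "w \<in> B" for w
   proof (cases "nbr z w")
    case True
    hence "z \<in> {z. z \<notin> B \<and> nbr w z}" using False adj_sym by blast
    hence "{z. z \<notin> B \<and> nbr w z} \<noteq> {}" by blast
    hence "out B w \<noteq> 0" by (subst card_0_eq) auto
    thus ?thesis using c w unfolding contained_def by simp
   qed simp
   hence "(\<Sum>w\<in>B. of_bool (nbr z w) * int (NV B x w h)) = 0" by (rule sum.neutral[OF ballI])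
   hence "topple_total V (\<lambda>y. NV B x y h) z = 0"
    using topple_total_eq[OF V(1) z, of "\<lambda>y. NV B x y h"] s NB0[OF False] by simp
   moreover have "z \<noteq> x" using False x by auto
   ultimately show ?thesis using recV_height_bounds(2)[OF V(3) z] by (simp add: add_grain_def)
  qed
 qed
qed

section \<open>Green function\<close>

text \<open>Let F be the set where a negative minimum is attained. An extremal site of F has a
  neighbour off F, either in V with a larger value or outside V where the value counts as 0; both
  contradict the sign of the Laplacian there.\<close>

lemma maximum_principle:
 fixes V :: "('d::finite) site set"
 assumes V: "finite V" and w: "\<And>y. y \<in> V ==> 0 \<le> lp V (out V) w y" and x: "x \<in> V"
 shows "0 \<le> w x"
proof (rule ccontr)
 assume neg: "\<not> 0 \<le> w x"
 define m where "m = Min (w ` V)"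
 have m: "m \<le> w y" if "y \<in> V" for y unfolding m_def using V that by auto
 have m0: "m < 0" using m[OF x] neg by simp
 define F where "F = {y\<in>V. w y = m}"
 have "m \<in> w ` V" unfolding m_def by (rule Min_in) (use V x in auto)
 hence "F \<noteq> {}" "finite F" "F \<subseteq> V" unfolding F_def using V by auto
 then obtain y where y: "y \<in> F" "dg F y < 2 * CARD('d)" using extremal_site by metis
 have yV: "y \<in> V" "w y = m" using y unfolding F_def by auto
 define b where "b = out V y"
 have "(\<Sum>z\<in>V. of_bool (nbr y z) * (w z - m)) + real b * (- m) = - lp V (out V) w y"
  unfolding lp_def yV(2) real_dg[OF V] b_def[symmetric]
  by (simp add: right_diff_distrib sum_subtractf flip: sum_distrib_right) (simp add: algebra_simps)
 hence le: "(\<Sum>z\<in>V. of_bool (nbr y z) * (w z - m)) + real b * (- m) \<le> 0" using w[OF yV(1)] by simp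
 have p1: "0 \<le> (\<Sum>z\<in>V. of_bool (nbr y z) * (w z - m))" by (intro sum_nonneg) (use m in auto)
 have p2: "0 \<le> real b * (- m)" using m0 by (intro mult_nonneg_nonneg) auto
 have o: "b = 0"
 proof (rule ccontr)
  assume "b \<noteq> 0"
  hence "0 < real b * (- m)" using m0 by (intro mult_pos_pos) auto
  thus False using le p1 by linarith
 qed
 have "(\<Sum>z\<in>V. of_bool (nbr y z) * (w z - m)) = 0" using le p1 p2 by linarith
 hence "\<forall>z\<in>V. of_bool (nbr y z) * (w z - m) = 0" by (subst (asm) sum_nonneg_eq_0_iff) (use V m in auto)
 hence "{z\<in>V. nbr y z} \<subseteq> {z\<in>F. nbr y z}" unfolding F_def by auto
 hence "dg V y \<le> dg F y" unfolding dg_def by (intro card_mono) (use \<open>finite F\<close> in auto)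
 thus False using y(2) dg_out[of V y, folded b_def] o by linarith
qed

lemma trees_wire1_le:
 fixes V :: "('d::finite) site set"
 assumes d: "CARD('d) \<ge> 3" and V: "finite V" "x \<in> V"
 shows "trees (V - {x}) (wire {x} (out V)) \<le> 2 * trees V (out V)"
 by (rule half_trees_le[OF d, where V=V and \<sigma>=1 and H=UNIV]) (use V in \<open>auto simp: open_half_def\<close>)

lemma rec_wire: "rec S (wire Q k) = rec S (\<lambda>y. dg Q y + k y)" by (rule rec_cong) (simp add: wire_def)

text \<open>Distinct avalanches through y contain distinct waves through y, and the waves through y
  are counted by \<open>ign\<close>. Normalised by the number of recurrent configurations this count
  is the Green function u of V with pole x.\<close>

lemma wave_green:
 fixes V :: "('d::finite) site set"
 assumes d: "CARD('d) \<ge> 3" and V: "finite V" "x \<in> V"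
 obtains u where "u x \<le> 2" and "\<forall>y. 0 \<le> u y \<and> u y \<le> u x"
  and "\<forall>y\<in>V. lp V (out V) u y = of_bool (y = x)"
  and "\<forall>y\<in>V. real (card {h\<in>recV V. odometer V (add_grain x h) y \<noteq> 0}) \<le> u y * real (trees V (out V))"
proof -
 interpret wave_site V x using V by unfold_locales
 show thesis
 proof (rule potential[OF V, of k2])
  fix u assume u: "u x = real (trees S (wire {x} k2))" "\<And>y. 0 \<le> u y" "\<And>y. u y \<le> u x"
   "\<And>y. y \<in> V ==> lp V k2 u y = (if y = x then real (trees V k2) else 0)"
   "\<And>y. y \<in> S ==> u y = ign S k1 k2 y"
  define t where "t = real (trees V k2)"
  have t: "0 < t" unfolding t_def using trees_wired_pos[OF V(1)] by simp
  have lp: "lp V k2 (\<lambda>y. u y / t) y = lp V k2 u y / t" for y by (simp add: lp_def sum_divide_distrib diff_divide_distrib)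
  show thesis
  proof (rule that[of "\<lambda>y. u y / t"])
   show "u x / t \<le> 2" using trees_wire1_le[OF d V] t unfolding u(1) t_def by (simp add: divide_le_eq)
   show "\<forall>y. 0 \<le> u y / t \<and> u y / t \<le> u x / t" using u(2,3) t by (simp add: divide_right_mono)
   show "\<forall>y\<in>V. lp V k2 (\<lambda>y. u y / t) y = of_bool (y = x)" unfolding lp using u(4) t by (simp add: t_def)
   show "\<forall>y\<in>V. real (card {h\<in>recV V. odometer V (add_grain x h) y \<noteq> 0}) \<le> u y / t * real (trees V k2)"
   proof
   fix y assume y: "y \<in> V"
   have "real (card {h\<in>recV V. odometer V (add_grain x h) y \<noteq> 0}) \<le> real (card {\<xi>\<in>R. insert x (wave \<xi>) \<inter> {y} \<noteq> {}})"
    using card_odometer_le[of "{y}"] by simp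
   also have "... = u y"
   proof (cases "y = x")
    case True
    hence "{\<xi>\<in>R. insert x (wave \<xi>) \<inter> {y} \<noteq> {}} = R" by auto
    thus ?thesis using True u(1) by (simp add: trees_def rec_wire)
   next
    case False
    hence "{\<xi>\<in>R. insert x (wave \<xi>) \<inter> {y} \<noteq> {}} = {\<xi>\<in>R. y \<in> wave \<xi>}" by auto
    thus ?thesis using u(5)[of y] False y finite_rec[OF fS, of "\<lambda>y. k1 y + k2 y"]
     by (simp add: ign_def of_bool_def sum.If_cases Int_def)
   qed
   finally show "real (card {h\<in>recV V. odometer V (add_grain x h) y \<noteq> 0}) \<le> u y / t * real (trees V k2)"
    using t by (simp add: t_def)
   qed
  qed
 qed
qed

text \<open>Terms of the series of \<open>green y x\<close>, with the pole x as first
  argument.\<close>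

definition gterm :: "('d::finite) site => 'd site => nat => real" where
 "gterm x y n = real (walks n y x) / (2 * real CARD('d)) ^ (n + 1)"

lemma gterm_Suc: "gterm x y (Suc n) = (\<Sum>z\<in>{z. nbr y z}. gterm x z n) / (2 * real CARD('d))"
 for x y :: "('d::finite) site" by (simp add: gterm_def flip: sum_divide_distrib)

lemma walks_far:
 assumes "walks n y x \<noteq> 0" shows "\<bar>y i - x i\<bar> \<le> int n" using assms
proof (induction n arbitrary: y)
 case (Suc n)
 then obtain z where z: "nbr y z" "walks n z x \<noteq> 0" by auto
 have "\<bar>z i - x i\<bar> \<le> int n" by (rule Suc.IH[OF z(2)])
 moreover obtain j \<sigma> where "\<sigma> = 1 \<or> \<sigma> = -1" "z = sh \<sigma> j y" using nbrE[OF z(1)] .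
 hence "\<bar>y i - z i\<bar> \<le> 1" by (auto simp: sh_def)
 ultimately show ?case by simp
qed (auto split: if_splits)

lemma sum_nbr_split:
 assumes "finite V"
 shows "(\<Sum>z\<in>{z. nbr y z}. f z) = (\<Sum>z\<in>V. of_bool (nbr y z) * f z) + (\<Sum>z\<in>{z. z \<notin> V \<and> nbr y z}. f z :: real)"
proof -
 have "{z. nbr y z} = {z\<in>V. nbr y z} \<union> {z. z \<notin> V \<and> nbr y z}" by auto
 hence "(\<Sum>z\<in>{z. nbr y z}. f z) = (\<Sum>z\<in>{z\<in>V. nbr y z}. f z) + (\<Sum>z\<in>{z. z \<notin> V \<and> nbr y z}. f z)"
  using sum.union_disjoint[of "{z\<in>V. nbr y z}" "{z. z \<notin> V \<and> nbr y z}" f] assms by auto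
 also have "(\<Sum>z\<in>{z\<in>V. nbr y z}. f z) = (\<Sum>z\<in>V. of_bool (nbr y z) * f z)"
  by (rule sum.mono_neutral_cong_left) (use assms in auto)
 finally show ?thesis .
qed

lemma real_dg_out: "real (dg V y) + real (out V y) = 2 * real CARD('d)" for y :: "('d::finite) site"
 using dg_out[of V y] by (metis of_nat_add of_nat_mult of_nat_numeral)

text \<open>A partial sum of the walk series is a subsolution supported in a large box, hence lies
  below the Green function of that box, which is at most its pole value, at most 2.\<close>

lemma gterm_partial_le:
 fixes x y :: "('d::finite) site"
 assumes d: "CARD('d) \<ge> 3"
 shows "(\<Sum>n\<le>N. gterm x y n) \<le> 2"
proof -
 define a where "a = (\<lambda>N y. \<Sum>n\<le>N. gterm x y n)"
 let ?D = "2 * real CARD('d)"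
 have D: "0 < ?D" by simp
 have g0: "0 \<le> gterm x y n" for y n unfolding gterm_def by simp
 have eq: "?D * a (Suc N) y = of_bool (y = x) + (\<Sum>z\<in>{z. nbr y z}. a N z)" for N y
 proof -
  have "a (Suc N) y = gterm x y 0 + (\<Sum>n\<le>N. gterm x y (Suc n))" unfolding a_def by (rule sum.atMost_Suc_shift)
  also have "(\<Sum>n\<le>N. gterm x y (Suc n)) = (\<Sum>z\<in>{z. nbr y z}. a N z) / ?D"
   unfolding gterm_Suc a_def sum_divide_distrib[symmetric] by (subst sum.swap) simp
  finally show ?thesis using D by (simp add: distrib_left gterm_def)
 qed
 have eq0: "?D * a 0 y = of_bool (y = x)" for y using D by (simp add: a_def gterm_def)
 have inc: "a N y \<le> a (Suc N) y" for N y unfolding a_def using g0 by simp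
 have sub: "?D * a N y \<le> of_bool (y = x) + (\<Sum>z\<in>{z. nbr y z}. a N z)" for N y
 proof (cases N)
  case 0
  have "0 \<le> (\<Sum>z\<in>{z. nbr y z}. a 0 z)" by (intro sum_nonneg) (simp add: a_def g0)
  thus ?thesis using eq0[of y] 0 by simp
 next
  case (Suc M)
  thus ?thesis using eq[of M y] sum_mono[of "{z. nbr y z}" "a M" "a N"] inc by auto
 qed
 obtain r where r: "{x} \<subseteq> box r" using finite_subset_box[of "{x}"] by auto
 define V where "V = (box (r + N) :: 'd site set)"
 have xV: "x \<in> V" using r box_mono[of r "r + N"] unfolding V_def by auto
 have far: "a N z = 0" if "z \<notin> V" for z
 proof -
  have "gterm x z n = 0" if "n \<le> N" for n
  proof (rule ccontr)
   assume "gterm x z n \<noteq> 0"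
   hence "walks n z x \<noteq> 0" by (auto simp: gterm_def)
   hence "\<bar>z i - x i\<bar> \<le> int n" for i by (rule walks_far)
   moreover have "\<bar>x i\<bar> \<le> int r" for i using r by (auto simp: box_def)
   ultimately have "\<bar>z i\<bar> \<le> int (r + N)" for i
   proof -
    have "\<bar>z i\<bar> \<le> \<bar>z i - x i\<bar> + \<bar>x i\<bar>" by linarith
    also have "... \<le> int n + int r" by (rule add_mono) fact+
    finally show ?thesis using \<open>n \<le> N\<close> by simp
   qed
   thus False using \<open>z \<notin> V\<close> by (auto simp: V_def box_def)
  qed
  thus ?thesis by (simp add: a_def)
 qed
 have fV: "finite V" by (simp add: V_def)
 obtain u where "u x \<le> 2" "\<forall>y. 0 \<le> u y \<and> u y \<le> u x"
  "\<forall>y\<in>V. lp V (out V) u y = of_bool (y = x)"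
  "\<forall>y\<in>V. real (card {h\<in>recV V. odometer V (add_grain x h) y \<noteq> 0}) \<le> u y * real (trees V (out V))"
  using wave_green[OF d fV xV] .
 hence u: "u x \<le> 2" "\<And>y. 0 \<le> u y" "\<And>y. u y \<le> u x"
  "\<And>y. y \<in> V ==> lp V (out V) u y = of_bool (y = x)" by auto
 have "0 \<le> u y - a N y" if "y \<in> V"
 proof (rule maximum_principle[OF fV _ that])
  fix z assume z: "z \<in> V"
  have "lp V (out V) (\<lambda>y. u y - a N y) z = lp V (out V) u z - lp V (out V) (a N) z"
   by (simp add: lp_def algebra_simps sum_subtractf)
  moreover have "lp V (out V) (a N) z \<le> of_bool (z = x)"
   using sub[of N z] sum_nbr_split[OF fV, where y=z and f="a N"] far by (simp add: lp_def real_dg_out)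
  ultimately show "0 \<le> lp V (out V) (\<lambda>y. u y - a N y) z" using u(4)[OF z] by simp
 qed
 hence "a N y \<le> 2" using far[of y] u(1) u(3)[of y] by (cases "y \<in> V") auto
 thus ?thesis by (simp add: a_def)
qed

lemma green_sums:
 fixes x y :: "('d::finite) site"
 assumes d: "CARD('d) \<ge> 3"
 shows "summable (gterm x y)" and "green y x = (\<Sum>n. gterm x y n)"
proof -
 show "summable (gterm x y)" by (rule bounded_imp_summable[of _ 2]) (use gterm_partial_le[OF d] in \<open>auto simp: gterm_def\<close>)
 show "green y x = (\<Sum>n. gterm x y n)" unfolding green_def gterm_def ..
qed

lemma green_nonneg:
 fixes x y :: "('d::finite) site"
 assumes d: "CARD('d) \<ge> 3" shows "0 \<le> green y x"
 unfolding green_sums(2)[OF d] by (rule suminf_nonneg[OF green_sums(1)[OF d]]) (simp add: gterm_def)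

lemma green_eq:
 fixes x y :: "('d::finite) site"
 assumes d: "CARD('d) \<ge> 3"
 shows "2 * real CARD('d) * green y x = of_bool (y = x) + (\<Sum>z\<in>{z. nbr y z}. green z x)"
proof -
 have s: "\<And>z. summable (gterm x z)" by (rule green_sums(1)[OF d])
 have "green y x = gterm x y 0 + (\<Sum>n. gterm x y (Suc n))"
  unfolding green_sums(2)[OF d] using suminf_split_initial_segment[OF s[of y], of 1] by simp
 also have "(\<Sum>n. gterm x y (Suc n)) = (\<Sum>n. \<Sum>z\<in>{z. nbr y z}. gterm x z n) / (2 * real CARD('d))"
  unfolding gterm_Suc by (rule suminf_divide) (use s in \<open>auto intro: summable_sum\<close>)
 also have "(\<Sum>n. \<Sum>z\<in>{z. nbr y z}. gterm x z n) = (\<Sum>z\<in>{z. nbr y z}. green z x)"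
  unfolding green_sums(2)[OF d] by (rule suminf_sum) (use s in auto)
 finally show ?thesis by (simp add: distrib_left gterm_def)
qed

text \<open>Comparison in the opposite direction: \<open>green\<close> is nonnegative outside V, so
  on V it is a supersolution and dominates the Green function of V.\<close>

lemma avalanche_le_green:
 fixes V :: "('d::finite) site set"
 assumes d: "CARD('d) \<ge> 3" and V: "finite V" "x \<in> V" "y \<in> V"
 shows "real (card {h\<in>recV V. odometer V (add_grain x h) y \<noteq> 0}) \<le> green y x * real (trees V (out V))"
proof -
 obtain u where "u x \<le> 2" "\<forall>y. 0 \<le> u y \<and> u y \<le> u x"
  and u: "\<forall>y\<in>V. lp V (out V) u y = of_bool (y = x)"
  "\<forall>y\<in>V. real (card {h\<in>recV V. odometer V (add_grain x h) y \<noteq> 0}) \<le> u y * real (trees V (out V))"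
  using wave_green[OF d V(1,2)] .
 have "0 \<le> green y x - u y"
 proof (rule maximum_principle[OF V(1) _ V(3)])
  fix z assume z: "z \<in> V"
  have "lp V (out V) (\<lambda>y. green y x - u y) z = lp V (out V) (\<lambda>y. green y x) z - lp V (out V) u z"
   by (simp add: lp_def algebra_simps sum_subtractf)
  moreover have "of_bool (z = x) \<le> lp V (out V) (\<lambda>y. green y x) z"
   using green_eq[OF d, of z x] sum_nbr_split[OF V(1), where y=z and f="\<lambda>z. green z x"]
    sum_nonneg[of "{w. w \<notin> V \<and> nbr z w}" "\<lambda>w. green w x"] green_nonneg[OF d] by (auto simp: lp_def real_dg_out)
  ultimately show "0 \<le> lp V (out V) (\<lambda>y. green y x - u y) z" using u(1) z by simp
 qed
 hence "u y * real (trees V (out V)) \<le> green y x * real (trees V (out V))" by (intro mult_right_mono) auto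
 thus ?thesis using u(2) V(3) by fastforce
qed

lemma green_nbr:
 fixes x y z :: "('d::finite) site"
 assumes d: "CARD('d) \<ge> 3" and "nbr y z"
 shows "green z x \<le> 2 * real CARD('d) * green y x"
proof -
 have "green z x \<le> (\<Sum>z\<in>{z. nbr y z}. green z x)" by (rule member_le_sum) (use assms green_nonneg[OF d] in auto)
 thus ?thesis using green_eq[OF d, of y x] by (auto simp: of_bool_def split: if_splits)
qed

text \<open>Walk from y to the origin, paying a factor 2d per step. The constant depends on y but
  not on x, so summability of the rates against the Green function at the origin transfers to every
  site.\<close>

lemma green_Harnack:
 fixes y :: "('d::finite) site"
 assumes d: "CARD('d) \<ge> 3"
 obtains C where "0 \<le> C" "\<And>x. green y x \<le> C * green (\<lambda>_. 0) x"
proof -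
 have "\<exists>C\<ge>0. \<forall>x. green y x \<le> C * green (\<lambda>_. 0) x"
 proof (induction "\<Sum>i\<in>UNIV. nat \<bar>y i\<bar>" arbitrary: y rule: less_induct)
  case less
  show ?case
  proof (cases "y = (\<lambda>_. 0)")
   case True
   thus ?thesis by (intro exI[of _ 1]) auto
  next
   case False
   then obtain i where i: "y i \<noteq> 0" by auto
   define \<sigma> :: int where "\<sigma> = (if y i > 0 then -1 else 1)"
   let ?y = "sh \<sigma> i y"
   have n: "nbr ?y y" by (rule adj_sym[OF nbr_sh]) (auto simp: \<sigma>_def)
   have "(\<Sum>j\<in>UNIV. nat \<bar>?y j\<bar>) < (\<Sum>j\<in>UNIV. nat \<bar>y j\<bar>)"
    by (rule sum_strict_mono_ex1) (use i in \<open>auto simp: sh_def \<sigma>_def intro!: exI[of _ i]\<close>)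
   then obtain C where C: "C \<ge> 0" "\<And>x. green ?y x \<le> C * green (\<lambda>_. 0) x" using less by blast
   have "green y x \<le> (2 * real CARD('d) * C) * green (\<lambda>_. 0) x" for x
   proof -
    have "green y x \<le> 2 * real CARD('d) * green ?y x" by (rule green_nbr[OF d n])
    also have "... \<le> 2 * real CARD('d) * (C * green (\<lambda>_. 0) x)" by (intro mult_left_mono C(2)) auto
    finally show ?thesis by simp
   qed
   thus ?thesis using C(1) by (intro exI[of _ "2 * real CARD('d) * C"]) auto
  qed
 qed
 thus thesis using that by blast
qed

section \<open>Tightness\<close>

lemma wire_out: "y \<notin> Q ==> Q \<subseteq> V ==> finite Q ==> wire Q (out V) y = out (V - Q) y"
proof -
 assume a: "y \<notin> Q" "Q \<subseteq> V" "finite Q"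
 have "{z. z \<notin> V - Q \<and> nbr y z} = {z. z \<notin> V \<and> nbr y z} \<union> {z\<in>Q. nbr y z}" using a by auto
 hence "out (V - Q) y = out V y + card {z\<in>Q. nbr y z}" by (simp add: card_Un_disjoint) (subst card_Un_disjoint, use a in auto)
 thus ?thesis by (simp add: wire_def dg_def)
qed

text \<open>Each site of Q moved into the sink costs the resistance bound 2.\<close>

lemma trees_wired_Diff:
 fixes V :: "('d::finite) site set"
 assumes d: "CARD('d) \<ge> 3" and V: "finite V" "Q \<subseteq> V"
 shows "trees (V - Q) (out (V - Q)) \<le> 2 ^ card Q * trees V (out V)"
proof -
 have "finite Q" using V finite_subset by blast
 thus ?thesis using V(2)
 proof (induction Q rule: finite_induct)
  case (insert x Q)
  have x: "x \<in> V - Q" using insert by auto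
  have "trees (V - Q - {x}) (wire {x} (out (V - Q))) \<le> 2 * trees (V - Q) (out (V - Q))" by (rule trees_wire1_le[OF d]) (use V x in auto)
  also have "... \<le> 2 * (2 ^ card Q * trees V (out V))" using insert by (intro mult_left_mono) auto
  finally have "trees (V - Q - {x}) (wire {x} (out (V - Q))) \<le> 2 ^ card (insert x Q) * trees V (out V)" using insert by simp
  moreover have "trees (V - Q - {x}) (wire {x} (out (V - Q))) = trees (V - Q - {x}) (out (V - Q - {x}))"
   by (rule trees_cong, rule wire_out) (use x in auto)
  moreover have "V - Q - {x} = V - insert x Q" by auto
  ultimately show ?case by simp
 qed simp
qed

text \<open>Avalanches leaving a box are no more numerous than waves leaving it, and waves are
  burnings from the window {x}. The halved \<epsilon> pays for the passage from the number of
  configurations in R to that of recurrent ones.\<close>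

lemma avalanche_tight:
 fixes x :: "('d::finite) site"
 assumes d: "CARD('d) \<ge> 3" and e: "0 < \<epsilon>"
 obtains N where "\<And>V. finite V ==> x \<in> V ==>
  real (card {h\<in>recV V. \<exists>y. y \<notin> box N \<and> odometer V (add_grain x h) y \<noteq> 0}) \<le> \<epsilon> * real (card (recV V))"
proof -
 have e2: "0 < \<epsilon> / 2" using e by simp
 obtain N where N: "\<And>V. finite V ==> {x} \<subseteq> V ==>
  real (card {h\<in>rec (V - {x}) (\<lambda>y. dg {x} y + out V y). \<not> burnt (V - {x}) (V - {x}) (out V) h \<subseteq> box N})
  \<le> \<epsilon> / 2 * real (card (rec (V - {x}) (\<lambda>y. dg {x} y + out V y)))" using burnt_tight[OF d _ e2, of "{x}"] by auto
 obtain r where r: "{x} \<subseteq> box r" using finite_subset_box[of "{x}"] by auto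
 show thesis
 proof (rule that[of "max r N"])
  fix V assume V: "finite V" "x \<in> V"
  interpret wave_site V x using V by unfold_locales
  have "card {h\<in>recV V. \<exists>y. y \<notin> box (max r N) \<and> odometer V (add_grain x h) y \<noteq> 0}
    = card {h\<in>recV V. \<exists>y\<in>- box (max r N). odometer V (add_grain x h) y \<noteq> 0}" by (intro arg_cong[where f=card]) auto
  also have "... \<le> card {\<xi>\<in>R. insert x (wave \<xi>) \<inter> - box (max r N) \<noteq> {}}" by (rule card_odometer_le)
  also have "... \<le> card {\<xi>\<in>R. \<not> wave \<xi> \<subseteq> box N}"
  proof (rule card_mono)
   show "finite {\<xi>\<in>R. \<not> wave \<xi> \<subseteq> box N}" using finite_rec[OF fS] by auto
   show "{\<xi>\<in>R. insert x (wave \<xi>) \<inter> - box (max r N) \<noteq> {}} \<subseteq> {\<xi>\<in>R. \<not> wave \<xi> \<subseteq> box N}"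
    using r box_mono[of r "max r N"] box_mono[of N "max r N"] by (auto simp: subset_iff)
  qed
  finally have "real (card {h\<in>recV V. \<exists>y. y \<notin> box (max r N) \<and> odometer V (add_grain x h) y \<noteq> 0})
   \<le> real (card {\<xi>\<in>R. \<not> wave \<xi> \<subseteq> box N})" by simp
  also have "... \<le> \<epsilon> / 2 * real (card R)" using N[of V] V by auto
  also have "real (card R) \<le> 2 * real (card (recV V))"
  proof -
   show ?thesis using trees_wire1_le[OF d V] unfolding trees_def rec_wire by simp
  qed
  finally show "real (card {h\<in>recV V. \<exists>y. y \<notin> box (max r N) \<and> odometer V (add_grain x h) y \<noteq> 0}) \<le> \<epsilon> * real (card (recV V))"
   using e by (simp add: mult_left_mono)
 qed
qed

text \<open>Everything except W may burn from the boundary; what remains is W together with the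
  sites that need W to burn first.\<close>

definition core :: "('d::finite) site set => 'd site set => 'd config => 'd site set" where
 "core V W h = V - burnt V (V - W) (\<lambda>_. 0) h"

lemma core_cut:
 assumes V: "finite V" "W \<subseteq> V"
 shows "core V W h - W = (V - W) - burnt (V - W) (V - W) (dg W) (cut (V - W) h)"
proof -
 let ?S = "V - W"
 have fW: "finite W" using V finite_subset by blast
 have ig: "ignites V (\<lambda>_. 0) h X \<longleftrightarrow> ignites ?S (dg W) (cut ?S h) X" if X: "X \<subseteq> ?S" for X
 proof -
  have iff: "int (dg (F \<union> (V - X)) y + 0) < h y \<longleftrightarrow> int (dg (F \<union> (?S - X)) y + dg W y) < cut ?S h y"
   if F: "F \<subseteq> X" and y: "y \<in> F" for F y
  proof -
   have "F \<union> (V - X) = (F \<union> (?S - X)) \<union> W" using X V F by auto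
   moreover have "dg ((F \<union> (?S - X)) \<union> W) y = dg (F \<union> (?S - X)) y + dg W y"
    by (rule dg_Un) (use V fW F X finite_subset[of F V] in auto)
   moreover have "cut ?S h y = h y" using F y X by (auto simp: cut_def)
   ultimately show ?thesis by simp
  qed
  have *: "(\<exists>y\<in>F. int (dg (F \<union> (V - X)) y + 0) < h y) \<longleftrightarrow> (\<exists>y\<in>F. int (dg (F \<union> (?S - X)) y + dg W y) < cut ?S h y)"
   if F: "F \<subseteq> X" for F by (rule bex_cong[OF refl]) (rule iff[OF F])
  show ?thesis unfolding ignites_def
  proof (intro iffI allI impI)
   fix F assume a: "\<forall>F\<subseteq>X. F \<noteq> {} --> (\<exists>y\<in>F. int (dg (F \<union> (V - X)) y + 0) < h y)" "F \<subseteq> X" "F \<noteq> {}"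
   show "\<exists>y\<in>F. int (dg (F \<union> (?S - X)) y + dg W y) < cut ?S h y" unfolding *[OF a(2), symmetric] using a by simp
  next
   fix F assume a: "\<forall>F\<subseteq>X. F \<noteq> {} --> (\<exists>y\<in>F. int (dg (F \<union> (?S - X)) y + dg W y) < cut ?S h y)" "F \<subseteq> X" "F \<noteq> {}"
   show "\<exists>y\<in>F. int (dg (F \<union> (V - X)) y + 0) < h y" unfolding *[OF a(2)] using a by simp
  qed
 qed
 have "burnt V ?S (\<lambda>_. 0) h = burnt ?S ?S (dg W) (cut ?S h)"
  unfolding burnt_def by (intro arg_cong[where f=Union] Collect_cong conj_cong refl ig)
 thus ?thesis unfolding core_def by auto
qed

text \<open>Off W the core is what fails to burn from the boundary. Firing the sink W maps this
  bijectively to what burns from W, controlled by \<open>burnt_tight\<close>. The constant c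
  accounts for the possible heights on W, at most (2d)^|W|, and for the ratio at most 2^|W| between
  the counts on V - W and on V.\<close>

lemma core_tight:
 fixes W :: "('d::finite) site set"
 assumes d: "CARD('d) \<ge> 3" and W: "finite W" and e: "0 < \<epsilon>"
 obtains N where "\<And>V. finite V ==> W \<subseteq> V ==>
  real (card {h\<in>recV V. \<not> core V W h \<subseteq> box N}) \<le> \<epsilon> * real (card (recV V))"
proof -
 define c where "c = (2 * real CARD('d)) ^ card W * 2 ^ card W"
 have c: "0 < c" unfolding c_def by simp
 have e2: "0 < \<epsilon> / c" using e c by simp
 obtain N where N: "\<And>V. finite V ==> W \<subseteq> V ==>
  real (card {h\<in>rec (V - W) (\<lambda>y. dg W y + out V y). \<not> burnt (V - W) (V - W) (out V) h \<subseteq> box N})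
  \<le> \<epsilon> / c * real (card (rec (V - W) (\<lambda>y. dg W y + out V y)))" using burnt_tight[OF d W e2] by auto
 obtain r where r: "W \<subseteq> box r" using finite_subset_box[OF W] by auto
 show thesis
 proof (rule that[of "max r N"])
  fix V assume V: "finite V" "W \<subseteq> V"
  let ?S = "V - W" and ?k1 = "dg W" and ?k2 = "out V"
  let ?R = "rec ?S (\<lambda>y. ?k1 y + ?k2 y)"
  have fS: "finite ?S" using V by auto
  have fR: "finite ?R" by (rule finite_rec[OF fS])
  let ?Y = "{\<xi>\<in>?R. \<not> ?S - burnt ?S ?S ?k1 \<xi> \<subseteq> box N}"
  let ?P = "PiE W (\<lambda>_. {1..2 * int CARD('d)})"
  let ?X = "{h\<in>recV V. \<not> core V W h \<subseteq> box (max r N)}"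
  have "card ?X \<le> card (?Y \<times> ?P)"
  proof (rule card_inj_on_le[of "\<lambda>h. (cut ?S h, restrict h W)"])
   show "inj_on (\<lambda>h. (cut ?S h, restrict h W)) ?X"
   proof (rule inj_onI)
    fix h h' assume a: "h \<in> ?X" "h' \<in> ?X" and "(cut ?S h, restrict h W) = (cut ?S h', restrict h' W)"
    hence eq: "cut ?S h = cut ?S h'" "restrict h W = restrict h' W" by auto
    show "h = h'"
    proof
     fix y
     consider "y \<in> W" | "y \<in> ?S" | "y \<notin> V" by auto
     thus "h y = h' y"
     proof cases
      case 1 thus ?thesis using fun_cong[OF eq(2), of y] by simp
     next
      case 2 thus ?thesis using fun_cong[OF eq(1), of y] by (simp add: cut_def)
     next
      case 3 thus ?thesis using a recD(1)[of h V _ y] recD(1)[of h' V _ y] by auto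
     qed
    qed
   qed
   show "(\<lambda>h. (cut ?S h, restrict h W)) ` ?X \<subseteq> ?Y \<times> ?P"
   proof (rule image_subsetI)
    fix h assume a: "h \<in> ?X"
    hence e: "h \<in> recV V" by auto
    have "cut ?S h \<in> recV ?S" by (rule cut_recV[OF e]) auto
    also have "recV ?S = ?R" using wire_out[OF _ V(2) W] unfolding wire_def by (intro rec_cong) (auto simp: add.commute)
    finally have 1: "cut ?S h \<in> ?R" .
    have "\<not> core V W h - W \<subseteq> box N" using a r box_mono[of r "max r N"] box_mono[of N "max r N"] by (auto simp: subset_iff)
    hence 2: "cut ?S h \<in> ?Y" using 1 core_cut[OF V, of h] by auto
    have "restrict h W \<in> ?P" using recV_height_bounds[OF e] V(2) by auto
    thus "(cut ?S h, restrict h W) \<in> ?Y \<times> ?P" using 2 by simp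
   qed
   show "finite (?Y \<times> ?P)" using fR W by (intro finite_cartesian_product finite_PiE) auto
  qed
  also have "card (?Y \<times> ?P) = card ?Y * (2 * CARD('d)) ^ card W"
   using W by (simp add: card_cartesian_product card_PiE nat_mult_distrib)
  also have "card ?Y = card {\<xi>\<in>?R. \<not> burnt ?S ?S ?k2 \<xi> \<subseteq> box N}"
  proof (rule bij_betw_same_card[symmetric, of "fire ?S ?k1 ?k2"])
   have b: "bij_betw (fire ?S ?k1 ?k2) ?R ?R" by (rule bij_betw_fire[OF fS])
   have i: "?S - burnt ?S ?S ?k1 (fire ?S ?k1 ?k2 \<xi>) = burnt ?S ?S ?k2 \<xi>" if "\<xi> \<in> ?R" for \<xi>
    using fire_rec(2)[OF fS that] burnt_subset[of ?S ?S ?k2 \<xi>] by auto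
   show "bij_betw (fire ?S ?k1 ?k2) {\<xi>\<in>?R. \<not> burnt ?S ?S ?k2 \<xi> \<subseteq> box N} ?Y" unfolding bij_betw_def
   proof
    show "inj_on (fire ?S ?k1 ?k2) {\<xi>\<in>?R. \<not> burnt ?S ?S ?k2 \<xi> \<subseteq> box N}"
     by (rule inj_on_subset[OF bij_betw_imp_inj_on[OF b]]) auto
    show "fire ?S ?k1 ?k2 ` {\<xi>\<in>?R. \<not> burnt ?S ?S ?k2 \<xi> \<subseteq> box N} = ?Y"
    proof (intro equalityI subsetI)
     fix \<zeta> assume "\<zeta> \<in> fire ?S ?k1 ?k2 ` {\<xi>\<in>?R. \<not> burnt ?S ?S ?k2 \<xi> \<subseteq> box N}"
     thus "\<zeta> \<in> ?Y" using i fire_rec(1)[OF fS] by auto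
    next
     fix \<zeta> assume z: "\<zeta> \<in> ?Y"
     then obtain \<xi> where "\<xi> \<in> ?R" "\<zeta> = fire ?S ?k1 ?k2 \<xi>" using bij_betw_imp_surj_on[OF b] by blast
     thus "\<zeta> \<in> fire ?S ?k1 ?k2 ` {\<xi>\<in>?R. \<not> burnt ?S ?S ?k2 \<xi> \<subseteq> box N}" using i z by auto
    qed
   qed
  qed
  finally have "real (card ?X) \<le> real (card {\<xi>\<in>?R. \<not> burnt ?S ?S ?k2 \<xi> \<subseteq> box N} * (2 * CARD('d)) ^ card W)"
   unfolding of_nat_le_iff .
  also have "... \<le> \<epsilon> / c * real (card ?R) * (2 * real CARD('d)) ^ card W"
   using mult_right_mono[OF N[OF V], of "(2 * real CARD('d)) ^ card W"] by simp
  also have "... \<le> \<epsilon> / c * (2 ^ card W * real (card (recV V))) * (2 * real CARD('d)) ^ card W"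
  proof (intro mult_right_mono mult_left_mono)
   have "card ?R = trees (V - W) (out (V - W))" unfolding trees_def using wire_out[OF _ V(2) W] unfolding wire_def
    by (intro arg_cong[where f=card] rec_cong) (auto simp: add.commute)
   hence "card ?R \<le> 2 ^ card W * card (recV V)" using trees_wired_Diff[OF d V] by (simp add: trees_def)
   hence "real (card ?R) \<le> real (2 ^ card W * card (recV V))" unfolding of_nat_le_iff .
   thus "real (card ?R) \<le> 2 ^ card W * real (card (recV V))" by simp
  qed (use e2 in auto)
  also have "... = \<epsilon> * real (card (recV V))" using c by (simp add: c_def)
  finally show "real (card ?X) \<le> \<epsilon> * real (card (recV V))" .
 qed
qed



lemma rim_out: "A \<subseteq> V ==> y \<in> A ==> finite V ==> rim V (out V) W A y = (if y \<in> W then out A y else 0)"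
proof -
 assume a: "A \<subseteq> V" "y \<in> A" "finite V"
 have "out V y + dg (V - A) y = out A y" using dg_out[of V y] dg_out[of A y] dg_Diff[OF a(3,1), of y] by simp
 thus ?thesis by (simp add: rim_def)
qed

section \<open>The infinite volume measure\<close>

text \<open>The sink of a core seen in infinite volume. For A inside V it agrees on A with
  \<open>rim\<close>, since edges to V - A and edges leaving V together are the edges leaving A; the
  admissible patterns thus do not depend on V.\<close>

definition kI :: "('d::finite) site set => 'd site set => 'd site => nat" where
 "kI W A y = (if y \<in> W then out A y else 0)"

lemma rec_rim: "A \<subseteq> V ==> finite V ==> rec A (rim V (out V) W A) = rec A (kI W A)" by (rule rec_cong) (simp add: rim_out kI_def)

section \<open>Local events, finite-volume frequencies and their limits\<close>

definition local_event :: "('d::finite) site set => ('d config => bool) => bool" where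
 "local_event W Q \<longleftrightarrow> finite W \<and> (\<forall>h h'. (\<forall>x\<in>W. h x = h' x) --> Q h = Q h')"

lemma local_eventI: "finite W ==> (\<And>h h'. \<forall>x\<in>W. h x = h' x ==> Q h = Q h') ==> local_event W Q"
 unfolding local_event_def by blast

lemma local_eventD: "local_event W Q ==> (\<And>x. x \<in> W ==> h x = h' x) ==> Q h = Q h'" unfolding local_event_def by blast

lemma local_event_conj: "local_event W Q ==> local_event W' Q' ==> local_event (W \<union> W') (\<lambda>h. Q h \<and> Q' h)"
proof (rule local_eventI)
 fix h h' :: "'a config"
 assume Q: "local_event W Q" "local_event W' Q'" and e: "\<forall>x\<in>W \<union> W'. h x = h' x"
 have "Q h = Q h'" by (rule local_eventD[OF Q(1)]) (use e in simp)
 moreover have "Q' h = Q' h'" by (rule local_eventD[OF Q(2)]) (use e in simp)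
 ultimately show "(Q h \<and> Q' h) = (Q h' \<and> Q' h')" by simp
qed (simp add: local_event_def)

lemma local_event_not: "local_event W Q ==> local_event W (\<lambda>h. \<not> Q h)" unfolding local_event_def by blast

lemma restr_eq: "(\<And>y. y \<in> B ==> h y = h' y) ==> restr B h = restr B h'" by (auto simp: restr_def)

lemma local_event_restr: "finite B ==> (\<And>h. Q h = Q' (restr B h)) ==> local_event B Q" by (rule local_eventI) (use restr_eq in metis)+

lemma restr_restr: "restr B (restr B h) = restr B h" by (auto simp: restr_def)

definition frac :: "('d::finite) site set => ('d config => bool) => real" where
 "frac V Q = real (card {h\<in>recV V. Q h}) / real (card (recV V))"

lemma recV_pos: "finite V ==> 0 < real (card (recV V))" using trees_wired_pos[of V] by (simp add: trees_def)

lemma finite_recV: "finite V ==> finite {h\<in>recV V. Q h}" using finite_rec[of V "out V"] by simp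

lemma frac_nonneg: "0 \<le> frac V Q" by (simp add: frac_def)

lemma frac_mono: "finite V ==> (\<And>h. h \<in> recV V ==> Q h ==> Q' h) ==> frac V Q \<le> frac V Q'"
 unfolding frac_def by (intro divide_right_mono, simp, rule card_mono) (auto simp: finite_rec)

lemma frac_True: "finite V ==> frac V (\<lambda>_. True) = 1" unfolding frac_def using recV_pos[of V] by simp

lemma frac_disj: "finite V ==> frac V (\<lambda>h. Q h \<or> Q' h) \<le> frac V Q + frac V Q'"
proof -
 assume V: "finite V"
 have "{h\<in>recV V. Q h \<or> Q' h} = {h\<in>recV V. Q h} \<union> {h\<in>recV V. Q' h}" by auto
 hence "card {h\<in>recV V. Q h \<or> Q' h} \<le> card {h\<in>recV V. Q h} + card {h\<in>recV V. Q' h}" by (simp only: card_Un_le)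
 hence "real (card {h\<in>recV V. Q h \<or> Q' h}) \<le> real (card {h\<in>recV V. Q h}) + real (card {h\<in>recV V. Q' h})"
  unfolding of_nat_add[symmetric] of_nat_le_iff .
 thus ?thesis unfolding frac_def add_divide_distrib[symmetric] by (rule divide_right_mono) simp
qed

lemma frac_bij:
 assumes "bij_betw f {h\<in>recV V. Q h} {h\<in>recV V. Q' h}"
 shows "frac V Q = frac V Q'" unfolding frac_def using bij_betw_same_card[OF assms] by simp

abbreviation "volumes \<equiv> finite_subsets_at_top UNIV"

lemma eventually_volumes: "finite X ==> (\<And>V. finite V ==> X \<subseteq> V ==> P V) ==> \<forall>\<^sub>F V in volumes. P V"
 unfolding eventually_finite_subsets_at_top by blast

locale sandpile_limit =
 fixes \<mu> :: "('d::finite) config measure"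
 assumes d3: "CARD('d) \<ge> 3" and mu: "is_sandpile_limit \<mu>"
begin

sublocale prob_space \<mu> using mu unfolding is_sandpile_limit_def by auto

lemma sets_mu: "sets \<mu> = sets (Omega_M :: 'd config measure)" using mu unfolding is_sandpile_limit_def by auto

lemma space_mu: "space \<mu> = {h. \<forall>x. h x \<in> {1..2 * int CARD('d)}}"
 using sets_eq_imp_space_eq[OF sets_mu] by (auto simp: Omega_M_def space_PiM PiE_def Pi_def)

lemma coord_measurable: "(\<lambda>h. h x) \<in> measurable \<mu> (count_space UNIV)"
proof -
 have "(\<lambda>h. h x) \<in> measurable (Omega_M :: 'd config measure) (count_space {1..2 * int CARD('d)})"
  unfolding Omega_M_def by (rule measurable_component_singleton) simp
 also have "measurable (Omega_M :: 'd config measure) (count_space {1..2 * int CARD('d)}) \<subseteq> measurable Omega_M (count_space UNIV)"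
  by (intro subsetI, elim measurable_compose) auto
 finally show ?thesis using measurable_cong_sets[OF sets_mu refl] by blast
qed

lemma cylinder_sets: "finite W ==> {h\<in>space \<mu>. \<forall>x\<in>W. h x = \<xi> x} \<in> sets \<mu>"
proof (induction W rule: finite_induct)
 case (insert x W)
 have "{h\<in>space \<mu>. \<forall>x\<in>insert x W. h x = \<xi> x} = ((\<lambda>h. h x) -` {\<xi> x} \<inter> space \<mu>) \<inter> {h\<in>space \<mu>. \<forall>x\<in>W. h x = \<xi> x}"
  by auto
 also have "... \<in> sets \<mu>" by (rule sets.Int[OF measurable_sets[OF coord_measurable] insert.IH]) simp
 finally show ?case .
qed simp

lemma cylinder_limit:
 "finite W ==> ((\<lambda>V. frac V (\<lambda>\<zeta>. \<forall>x\<in>W. \<zeta> x = \<xi> x)) \<longlongrightarrow> prob {h\<in>space \<mu>. \<forall>x\<in>W. h x = \<xi> x}) volumes"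
proof -
 assume W: "finite W"
 have "((\<lambda>V. real (card {\<zeta> \<in> recurrentV V. \<forall>x\<in>W. \<zeta> x = \<xi> x}) / real (card (recurrentV V)))
     \<longlongrightarrow> prob {h \<in> space \<mu>. \<forall>x\<in>W. h x = \<xi> x}) volumes"
  using mu W unfolding is_sandpile_limit_def by blast
 thus ?thesis by (rule tendsto_cong[THEN iffD1, rotated])
   (auto intro!: eventually_volumes[of "{}"] simp: frac_def recurrentV_eq)
qed

lemma local_decomp:
 assumes Q: "local_event W Q"
 defines "P \<equiv> {\<xi> \<in> PiE W (\<lambda>_. {1..2 * int CARD('d)}). Q \<xi>}"
 shows "finite P" and "{h\<in>space \<mu>. Q h} = (\<Union>\<xi>\<in>P. {h\<in>space \<mu>. \<forall>x\<in>W. h x = \<xi> x})"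
  and "disjoint_family_on (\<lambda>\<xi>. {h. \<forall>x\<in>W. h x = \<xi> x}) P"
  and "\<And>V. finite V ==> W \<subseteq> V ==> {h\<in>recV V. Q h} = (\<Union>\<xi>\<in>P. {h\<in>recV V. \<forall>x\<in>W. h x = \<xi> x})"
proof -
 have W: "finite W" using Q by (simp add: local_event_def)
 show "finite P" unfolding P_def using W by (auto intro!: finite_PiE)
 have key: "(\<exists>\<xi>\<in>P. \<forall>x\<in>W. h x = \<xi> x) \<longleftrightarrow> Q h" if e: "\<And>x. x \<in> W ==> h x \<in> {1..2 * int CARD('d)}" for h
 proof
  assume "Q h"
  hence "Q (restrict h W)" using local_eventD[OF Q, of h "restrict h W"] by simp
  hence "restrict h W \<in> P" unfolding P_def using e by auto
  thus "\<exists>\<xi>\<in>P. \<forall>x\<in>W. h x = \<xi> x" by (intro bexI[of _ "restrict h W"]) auto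
 next
  assume "\<exists>\<xi>\<in>P. \<forall>x\<in>W. h x = \<xi> x"
  then obtain \<xi> where x: "\<xi> \<in> P" "\<forall>x\<in>W. h x = \<xi> x" by (rule bexE)
  have "Q h = Q \<xi>" by (rule local_eventD[OF Q]) (use x(2) in simp)
  thus "Q h" using x(1) unfolding P_def by simp
 qed
 show "{h\<in>space \<mu>. Q h} = (\<Union>\<xi>\<in>P. {h\<in>space \<mu>. \<forall>x\<in>W. h x = \<xi> x})"
  using key unfolding space_mu by auto
 show "{h\<in>recV V. Q h} = (\<Union>\<xi>\<in>P. {h\<in>recV V. \<forall>x\<in>W. h x = \<xi> x})" if "finite V" "W \<subseteq> V" for V
 proof -
  have "(\<exists>\<xi>\<in>P. \<forall>x\<in>W. h x = \<xi> x) \<longleftrightarrow> Q h" if "h \<in> recV V" for h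
   by (rule key) (use recV_height_bounds[OF that] \<open>W \<subseteq> V\<close> in auto)
  thus ?thesis by auto
 qed
 show "disjoint_family_on (\<lambda>\<xi>. {h. \<forall>x\<in>W. h x = \<xi> x}) P" unfolding disjoint_family_on_def
 proof (intro ballI impI)
  fix \<xi> \<xi>' assume x: "\<xi> \<in> P" "\<xi>' \<in> P" "\<xi> \<noteq> \<xi>'"
  have "\<xi> = \<xi>'" if "\<forall>x\<in>W. h x = \<xi> x" "\<forall>x\<in>W. h x = \<xi>' x" for h
   by (rule PiE_ext[of \<xi> W "\<lambda>_. {1..2 * int CARD('d)}" \<xi>']) (use x that in \<open>auto simp: P_def\<close>)
  thus "{h. \<forall>x\<in>W. h x = \<xi> x} \<inter> {h. \<forall>x\<in>W. h x = \<xi>' x} = {}" using x(3) by blast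
 qed
qed

lemma local_sets: "local_event W Q ==> {h\<in>space \<mu>. Q h} \<in> sets \<mu>"
proof -
 assume Q: "local_event W Q"
 hence "finite W" by (simp add: local_event_def)
 thus ?thesis unfolding local_decomp(2)[OF Q] using local_decomp(1)[OF Q] by (intro sets.finite_UN) (auto simp: cylinder_sets)
qed

lemma local_limit:
 assumes Q: "local_event W Q"
 shows "((\<lambda>V. frac V Q) \<longlongrightarrow> prob {h\<in>space \<mu>. Q h}) volumes"
proof -
 have W: "finite W" using Q by (simp add: local_event_def)
 define P where "P = {\<xi> \<in> PiE W (\<lambda>_. {1..2 * int CARD('d)}). Q \<xi>}"
 note D = local_decomp[OF Q, folded P_def]
 have disj: "disjoint_family_on (\<lambda>\<xi>. {h\<in>Y. \<forall>x\<in>W. h x = \<xi> x}) P" for Y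
  using D(3) unfolding disjoint_family_on_def by blast
 have "prob {h\<in>space \<mu>. Q h} = (\<Sum>\<xi>\<in>P. prob {h\<in>space \<mu>. \<forall>x\<in>W. h x = \<xi> x})"
  unfolding D(2) by (rule finite_measure_finite_Union[OF D(1)]) (use disj cylinder_sets[OF W] in auto)
 moreover have "((\<lambda>V. \<Sum>\<xi>\<in>P. frac V (\<lambda>\<zeta>. \<forall>x\<in>W. \<zeta> x = \<xi> x)) \<longlongrightarrow> (\<Sum>\<xi>\<in>P. prob {h\<in>space \<mu>. \<forall>x\<in>W. h x = \<xi> x})) volumes"
  by (rule tendsto_sum) (rule cylinder_limit[OF W])
 moreover have "\<forall>\<^sub>F V in volumes. (\<Sum>\<xi>\<in>P. frac V (\<lambda>\<zeta>. \<forall>x\<in>W. \<zeta> x = \<xi> x)) = frac V Q"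
 proof (rule eventually_volumes[OF W])
  fix V :: "'d site set" assume V: "finite V" "W \<subseteq> V"
  have "card {h\<in>recV V. Q h} = (\<Sum>\<xi>\<in>P. card {h\<in>recV V. \<forall>x\<in>W. h x = \<xi> x})" unfolding D(4)[OF V]
   by (rule card_UN_disjoint) (use D(1) finite_recV[OF V(1)] disj[of "recV V"] in \<open>auto simp: disjoint_family_on_def\<close>)
  thus "(\<Sum>\<xi>\<in>P. frac V (\<lambda>\<zeta>. \<forall>x\<in>W. \<zeta> x = \<xi> x)) = frac V Q"
   by (simp add: frac_def sum_divide_distrib)
 qed
 ultimately show ?thesis by (simp add: tendsto_cong)
qed

lemma local_le:
 assumes "local_event W Q" and "\<forall>\<^sub>F V in volumes. frac V Q \<le> c"
 shows "prob {h\<in>space \<mu>. Q h} \<le> c" by (rule tendsto_upperbound[OF local_limit[OF assms(1)] assms(2)]) simp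

lemma AE_local_event:
 assumes Q: "local_event W Q" and z: "\<And>V. finite V ==> W \<subseteq> V ==> frac V (\<lambda>h. \<not> Q h) = 0"
 shows "AE h in \<mu>. Q h"
proof -
 have W: "finite W" using Q by (simp add: local_event_def)
 have "prob {h\<in>space \<mu>. \<not> Q h} \<le> 0"
  by (rule local_le[OF local_event_not[OF Q]], rule eventually_volumes[OF W]) (simp add: z)
 hence "prob {h\<in>space \<mu>. \<not> Q h} = 0" using measure_nonneg[of \<mu>] by (simp add: antisym)
 thus ?thesis
  by (intro AE_I[of _ _ "{h\<in>space \<mu>. \<not> Q h}"]) (use local_sets[OF local_event_not[OF Q]] in \<open>auto simp: emeasure_eq_measure\<close>)
qed

lemma prod_emb_local:
 assumes J: "finite J" and X: "\<And>i. i \<in> J ==> X i \<in> sets (count_space {1..2 * int CARD('d)})"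
 obtains C where "local_event J C"
  "prod_emb UNIV (\<lambda>_. count_space {1..2 * int CARD('d)}) J (Pi\<^sub>E J X) = {h\<in>space \<mu>. C h}"
proof (rule that)
 show "local_event J (\<lambda>h. \<forall>j\<in>J. h j \<in> X j)" by (rule local_eventI[OF J]) auto
 show "prod_emb UNIV (\<lambda>_. count_space {1..2 * int CARD('d)}) J (Pi\<^sub>E J X) = {h\<in>space \<mu>. \<forall>j\<in>J. h j \<in> X j}"
  unfolding prod_emb_def space_mu using X by (auto simp: PiE_def Pi_def extensional_def)
qed

lemma measure_eq_local:
 assumes M: "finite_measure M" "sets M = sets \<mu>" "sets M' = sets \<mu>"
  and e: "\<And>U C. local_event U C ==> emeasure M {h\<in>space \<mu>. C h} = emeasure M' {h\<in>space \<mu>. C h}"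
 shows "M = M'"
proof (rule measure_eqI_PiM_infinite[where I=UNIV and M="\<lambda>_. count_space {1..2 * int CARD('d)}"])
 fix J :: "'d site set" and X assume J: "finite J" "\<And>i. i \<in> J ==> X i \<in> sets (count_space {1..2 * int CARD('d)})"
 obtain C where C: "local_event J C"
  "prod_emb UNIV (\<lambda>_. count_space {1..2 * int CARD('d)}) J (Pi\<^sub>E J X) = {h\<in>space \<mu>. C h}"
  by (rule prod_emb_local[OF J])
 show "emeasure M (prod_emb UNIV (\<lambda>_. count_space {1..2 * int CARD('d)}) J (Pi\<^sub>E J X))
   = emeasure M' (prod_emb UNIV (\<lambda>_. count_space {1..2 * int CARD('d)}) J (Pi\<^sub>E J X))" unfolding C(2) by (rule e[OF C(1)])
qed (use M sets_mu in \<open>auto simp: Omega_M_def\<close>)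

lemma local_measurable:
 fixes f :: "'d config => int"
 assumes "\<And>a. local_event U (\<lambda>h. f h = a)" shows "f \<in> measurable \<mu> (count_space UNIV)"
 unfolding measurable_count_space_eq2_countable using local_sets[OF assms] by (auto simp: vimage_def Int_def conj_commute)

lemma config_measurableI:
 assumes "\<And>h. h \<in> space \<mu> ==> T h \<in> space \<mu>" "\<And>z. (\<lambda>h. T h z) \<in> measurable \<mu> (count_space UNIV)"
 shows "T \<in> measurable \<mu> \<mu>"
proof -
 have "T \<in> measurable \<mu> (Omega_M :: 'd config measure)" unfolding Omega_M_def
 proof (rule measurable_PiM_single')
  fix z
  have "(\<lambda>h. T h z) \<in> space \<mu> \<rightarrow> {1..2 * int CARD('d)}" using assms(1) by (auto simp: space_mu)
  thus "(\<lambda>h. T h z) \<in> measurable \<mu> (count_space {1..2 * int CARD('d)})"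
   using measurable_sets[OF assms(2)[of z]] by (subst measurable_count_space_eq2) auto
 qed (use assms(1) in \<open>auto simp: space_mu\<close>)
 thus ?thesis using measurable_cong_sets[OF refl sets_mu] by blast
qed

lemma restr_recV_AE: "AE h in \<mu>. \<forall>B. finite B --> restr B h \<in> recV B"
proof -
 have "AE h in \<mu>. \<forall>B\<in>Collect finite. restr B h \<in> recV B"
 proof (rule AE_ball_countable[THEN iffD2, OF countable_Collect_finite], rule ballI)
  fix B :: "'d site set" assume "B \<in> Collect finite"
  hence B: "finite B" by simp
  show "AE h in \<mu>. restr B h \<in> recV B"
  proof (rule AE_local_event)
   show "local_event B (\<lambda>h. restr B h \<in> recV B)"
    by (rule local_event_restr[OF B, where Q'="\<lambda>h. restr B h \<in> recV B"]) (simp add: restr_restr)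
   fix V :: "'d site set" assume V: "finite V" "B \<subseteq> V"
   have "restr B h \<in> recV B" if "h \<in> recV V" for h unfolding restr_cut by (rule cut_recV[OF that V(2)]) simp
   hence e: "{h\<in>recV V. \<not> restr B h \<in> recV B} = {}" by auto
   show "frac V (\<lambda>h. \<not> restr B h \<in> recV B) = 0" unfolding frac_def e by simp
  qed
 qed
 thus ?thesis by simp
qed

section \<open>The events with prescribed core and pattern, and additions on them\<close>

definition EE :: "'d site set => 'd config => 'd config set" where
 "EE A \<zeta> = {h\<in>space \<mu>. (\<forall>y\<in>A. h y = \<zeta> y) \<and> clears A UNIV h}"

text \<open>\<open>EE\<close> involves infinitely many sites, so weak convergence does not reach it
  directly. This truncation of the burning condition to a box is a local event, and it decreases to
  \<open>EE\<close>.\<close>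

definition EEn :: "nat => 'd site set => 'd config => 'd config => bool" where
 "EEn N A \<zeta> h \<longleftrightarrow> (\<forall>y\<in>A. h y = \<zeta> y) \<and> clears A (box N) h"

lemma clears_box: "clears A UNIV (h :: 'd config) \<longleftrightarrow> (\<forall>N. clears A (box N) h)"
proof
 assume *: "\<forall>N. clears A (box N) h"
 show "clears A UNIV h" unfolding clears_def
 proof (intro allI impI)
  fix F :: "'d site set" assume F: "finite F \<and> F \<subseteq> UNIV - A \<and> F \<noteq> {}"
  then obtain N where "F \<subseteq> box N" using finite_subset_box by blast
  thus "\<exists>y\<in>F. int (dg (F \<union> A) y) < h y" using * F unfolding clears_def by blast
 qed
qed (auto simp: clears_def)

lemma clears_mono: "clears A B h ==> B' \<subseteq> B ==> clears A B' h" unfolding clears_def by (meson Diff_mono order_refl subset_trans)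

lemma local_EEn: "finite A ==> local_event (A \<union> box N) (EEn N A \<zeta>)"
proof (rule local_eventI)
 fix h h' :: "'d config" assume e: "\<forall>x\<in>A \<union> box N. h x = h' x"
 have "(\<exists>y\<in>F. int (dg (F \<union> A) y) < h y) = (\<exists>y\<in>F. int (dg (F \<union> A) y) < h' y)" if "F \<subseteq> box N - A" for F
  by (rule bex_cong[OF refl]) (use e that in auto)
 hence "clears A (box N) h = clears A (box N) h'" unfolding clears_def by (metis (no_types, lifting))
 thus "EEn N A \<zeta> h = EEn N A \<zeta> h'" using e by (auto simp: EEn_def)
qed simp

lemma EE_Int: "EE A \<zeta> = (\<Inter>N. {h\<in>space \<mu>. EEn N A \<zeta> h})" unfolding EE_def EEn_def by (auto simp: clears_box)

lemma EE_sets: "finite A ==> EE A \<zeta> \<in> sets \<mu>"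
 unfolding EE_Int by (intro sets.countable_INT) (auto intro: local_sets[OF local_EEn])

lemma EEn_limit:
 assumes A: "finite A" and C: "local_event U C"
 shows "(\<lambda>N. prob {h\<in>space \<mu>. EEn N A \<zeta> h \<and> C h}) \<longlonglongrightarrow> prob {h\<in>EE A \<zeta>. C h}"
proof -
 have "(\<lambda>N. prob {h\<in>space \<mu>. EEn N A \<zeta> h \<and> C h}) \<longlonglongrightarrow> prob (\<Inter>N. {h\<in>space \<mu>. EEn N A \<zeta> h \<and> C h})"
 proof (rule finite_Lim_measure_decseq)
  show "range (\<lambda>N. {h\<in>space \<mu>. EEn N A \<zeta> h \<and> C h}) \<subseteq> sets \<mu>"
   using local_sets[OF local_event_conj[OF local_EEn[OF A] C]] by auto
  show "decseq (\<lambda>N. {h\<in>space \<mu>. EEn N A \<zeta> h \<and> C h})"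
  proof (rule decseq_SucI, rule subsetI)
   fix N h assume "h \<in> {h\<in>space \<mu>. EEn (Suc N) A \<zeta> h \<and> C h}"
   thus "h \<in> {h\<in>space \<mu>. EEn N A \<zeta> h \<and> C h}"
    using box_mono[of N "Suc N"] unfolding EEn_def by (auto intro: clears_mono)
  qed
 qed
 also have "(\<Inter>N. {h\<in>space \<mu>. EEn N A \<zeta> h \<and> C h}) = {h\<in>EE A \<zeta>. C h}" unfolding EE_Int by auto
 finally show ?thesis .
qed

text \<open>Sites of A do not burn, because off W their heights are at most \<open>dg A\<close>.
  Unburnt sites outside A would form a set inside the box, which the truncated condition excludes;
  hence the core is exactly A.\<close>

lemma EEn_core:
 assumes V: "finite V" "box N \<subseteq> V" and A: "W \<subseteq> A" "A \<subseteq> box N" and z: "\<zeta> \<in> rec A (kI W A)"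
  and e: "h \<in> recV V" "EEn N A \<zeta> h" and D: "core V W h \<subseteq> box N"
 shows "h \<in> with_core V (out V) A \<zeta>"
proof -
 let ?X = "burnt V (V - W) (\<lambda>_. 0) h"
 have AV: "A \<subseteq> V" "W \<subseteq> V" using A V by auto
 have XV: "?X \<subseteq> V - W" by (rule burnt_subset)
 have ig: "ignites V (\<lambda>_. 0) h ?X" by (rule ignites_burnt) (use V in auto)
 have Ddef: "core V W h = V - ?X" by (simp add: core_def)
 have eA: "\<And>y. y \<in> A ==> h y = \<zeta> y" and cl: "clears A (box N) h" using e(2) by (auto simp: EEn_def)
 have "A \<inter> ?X = {}"
 proof (rule ccontr)
  assume "A \<inter> ?X \<noteq> {}"
  then obtain y where y: "y \<in> A \<inter> ?X" "int (dg ((A \<inter> ?X) \<union> (V - ?X)) y + 0) < h y"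
   using ig unfolding ignites_def by (meson Int_lower2)
  have "dg A y \<le> dg ((A \<inter> ?X) \<union> (V - ?X)) y" by (rule dg_mono) (use V AV in \<open>auto intro: finite_subset\<close>)
  moreover have "h y \<le> int (dg A y)" using recD(2)[OF z, of y] eA[of y] y XV by (auto simp: kI_def)
  ultimately show False using y(2) by simp
 qed
 hence AD: "A \<subseteq> V - ?X" using AV by auto
 have "V - ?X - A = {}"
 proof (rule ccontr)
  assume ne: "V - ?X - A \<noteq> {}"
  have "finite (V - ?X - A)" "V - ?X - A \<subseteq> box N - A" using V D Ddef by auto
  then obtain y where y: "y \<in> V - ?X - A" "int (dg ((V - ?X - A) \<union> A) y) < h y" using cl ne unfolding clears_def by blast
  have "(V - ?X - A) \<union> A = V - ?X" using AD by auto
  moreover have "h y \<le> int (dg (V - ?X) y + 0)" by (rule burnt_stuck) (use V y A in auto)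
  ultimately show False using y(2) by simp
 qed
 hence X: "?X = V - A" using AD XV by auto
 hence "clears A V h" using ig clears_ignites[OF V(1) AV(1)] by simp
 thus ?thesis using e(1) eA by (simp add: with_core_def)
qed

lemma with_core_EEn: "h \<in> with_core V (out V) A \<zeta> ==> box N \<subseteq> V ==> EEn N A \<zeta> h"
 unfolding with_core_def EEn_def clears_def by blast

text \<open>Interchange of two limits: for a large box the truncated event differs from the exact
  one, uniformly in V, only when the core leaves the box, and core tightness bounds that. One third
  of e goes to the box under \<mu>, one to weak convergence, one to tightness.\<close>

lemma EE_limit:
 assumes A: "finite A" "W \<subseteq> A" and z: "\<zeta> \<in> rec A (kI W A)" and C: "local_event U C"
 shows "((\<lambda>V. frac V (\<lambda>h. h \<in> with_core V (out V) A \<zeta> \<and> C h)) \<longlongrightarrow> prob {h\<in>EE A \<zeta>. C h}) volumes"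
proof (rule tendstoI)
 fix e :: real assume "0 < e"
 hence e: "0 < e / 3" by simp
 have fW: "finite W" using A finite_subset by blast
 obtain N0 where N0: "\<And>V. finite V ==> W \<subseteq> V ==> real (card {h\<in>recV V. \<not> core V W h \<subseteq> box N0}) \<le> e / 3 * real (card (recV V))"
  using core_tight[OF d3 fW e] by auto
 obtain N1 where N1: "A \<subseteq> box N1" using finite_subset_box[OF A(1)] .
 have "\<forall>\<^sub>F N in sequentially. dist (prob {h\<in>space \<mu>. EEn N A \<zeta> h \<and> C h}) (prob {h\<in>EE A \<zeta>. C h}) < e / 3"
  by (rule tendstoD[OF EEn_limit[OF A(1) C] e])
 then obtain N2 where N2: "\<And>N. N \<ge> N2 ==> dist (prob {h\<in>space \<mu>. EEn N A \<zeta> h \<and> C h}) (prob {h\<in>EE A \<zeta>. C h}) < e / 3"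
  unfolding eventually_sequentially by blast
 define N where "N = max N0 (max N1 N2)"
 have "box N1 \<subseteq> box N" by (rule box_mono) (simp add: N_def)
 hence AN: "A \<subseteq> box N" using N1 by (rule subset_trans[rotated])
 let ?b = "\<lambda>V. frac V (\<lambda>h. EEn N A \<zeta> h \<and> C h)"
 let ?a = "\<lambda>V. frac V (\<lambda>h. h \<in> with_core V (out V) A \<zeta> \<and> C h)"
 have "\<forall>\<^sub>F V in volumes. dist (?b V) (prob {h\<in>space \<mu>. EEn N A \<zeta> h \<and> C h}) < e / 3"
  by (rule tendstoD[OF local_limit[OF local_event_conj[OF local_EEn[OF A(1)] C]] e])
 moreover have "\<forall>\<^sub>F V in volumes. ?a V \<le> ?b V \<and> ?b V \<le> ?a V + e / 3"
 proof (rule eventually_volumes[of "box N"])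
  fix V :: "'d site set" assume V: "finite V" "box N \<subseteq> V"
  have WV: "W \<subseteq> V" using A AN V by auto
  have "?b V \<le> frac V (\<lambda>h. (h \<in> with_core V (out V) A \<zeta> \<and> C h) \<or> \<not> core V W h \<subseteq> box N)"
   by (rule frac_mono[OF V(1)]) (use EEn_core[OF V A(2) AN z] in auto)
  also have "... \<le> ?a V + frac V (\<lambda>h. \<not> core V W h \<subseteq> box N)" by (rule frac_disj[OF V(1)])
  also have "frac V (\<lambda>h. \<not> core V W h \<subseteq> box N) \<le> frac V (\<lambda>h. \<not> core V W h \<subseteq> box N0)"
   by (rule frac_mono[OF V(1)]) (use box_mono[of N0 N] in \<open>auto simp: N_def\<close>)
  also have "... \<le> e / 3" unfolding frac_def using N0[OF V(1) WV] recV_pos[OF V(1)] by (simp add: divide_le_eq)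
  finally have "?b V \<le> ?a V + e / 3" by simp
  moreover have "?a V \<le> ?b V" by (rule frac_mono[OF V(1)]) (use with_core_EEn[OF _ V(2)] in auto)
  ultimately show "?a V \<le> ?b V \<and> ?b V \<le> ?a V + e / 3" by simp
 qed simp
 ultimately show "\<forall>\<^sub>F V in volumes. dist (?a V) (prob {h\<in>EE A \<zeta>. C h}) < e"
 proof eventually_elim
  case (elim V)
  have "dist (prob {h\<in>space \<mu>. EEn N A \<zeta> h \<and> C h}) (prob {h\<in>EE A \<zeta>. C h}) < e / 3"
   by (rule N2) (simp add: N_def)
  thus ?case using elim unfolding dist_real_def abs_less_iff by linarith
 qed
qed

lemma EE_limit_trees:
 assumes A: "finite A" "W \<subseteq> A" and z: "\<zeta> \<in> rec A (kI W A)"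
 shows "((\<lambda>V. real (trees (V - A) (out V)) / real (trees V (out V))) \<longlongrightarrow> prob (EE A \<zeta>)) volumes"
proof -
 have T: "local_event {} (\<lambda>_. True)" by (rule local_eventI) auto
 have "((\<lambda>V. frac V (\<lambda>h. h \<in> with_core V (out V) A \<zeta> \<and> True)) \<longlongrightarrow> prob {h\<in>EE A \<zeta>. True}) volumes"
  by (rule EE_limit[OF A z T])
 moreover have "\<forall>\<^sub>F V in volumes. frac V (\<lambda>h. h \<in> with_core V (out V) A \<zeta> \<and> True) = real (trees (V - A) (out V)) / real (trees V (out V))"
 proof (rule eventually_volumes[OF A(1)])
  fix V :: "'d site set" assume V: "finite V" "A \<subseteq> V"
  have "{h\<in>recV V. h \<in> with_core V (out V) A \<zeta> \<and> True} = with_core V (out V) A \<zeta>" by (auto simp: with_core_def)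
  thus "frac V (\<lambda>h. h \<in> with_core V (out V) A \<zeta> \<and> True) = real (trees (V - A) (out V)) / real (trees V (out V))"
   unfolding frac_def using card_with_core[OF V(1) A(2) V(2), of \<zeta> "out V"] z rec_rim[OF V(2,1)] by (simp add: trees_def)
 qed
 ultimately show ?thesis by (simp add: tendsto_cong)
qed

text \<open>The common probability of all \<open>EE A \<zeta>\<close> with admissible \<zeta>,
  defined through counts so that no pattern has to be chosen. If no pattern is admissible, the value
  is later multiplied by 0 in \<open>wt\<close>.\<close>

definition ee :: "'d site set => real" where
 "ee A = Lim volumes (\<lambda>V. real (trees (V - A) (out V)) / real (trees V (out V)))"

lemma measure_EE:
 assumes "finite A" "W \<subseteq> A" "\<zeta> \<in> rec A (kI W A)"
 shows "prob (EE A \<zeta>) = ee A" unfolding ee_def by (rule tendsto_Lim[OF _ EE_limit_trees[OF assms], symmetric]) simp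

definition raise :: "'d site => 'd config => 'd config" where
 "raise z h = (if h z < 2 * int CARD('d) then h(z := h z + 1) else h)"

lemma raise_space: "h \<in> space \<mu> ==> raise z h \<in> space \<mu>" unfolding space_mu raise_def by (auto intro: order_trans[of 0 1])

lemma raise_measurable: "raise z \<in> measurable \<mu> \<mu>"
proof (rule config_measurableI[OF raise_space])
 fix x
 show "(\<lambda>h. raise z h x) \<in> measurable \<mu> (count_space UNIV)"
  by (rule local_measurable[of "{x, z}"], rule local_eventI) (auto simp: raise_def)
qed

text \<open>In every large volume the addition is a bijection between the two classes of
  configurations, so the frequencies agree exactly and only the limit has to be taken.\<close>

lemma raise_cylinder:
 assumes A: "finite A" "W \<subseteq> A" and z: "\<zeta> \<in> rec A (kI W A)" "x \<in> A" "\<zeta>(x := \<zeta> x + 1) \<in> rec A (kI W A)"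
  and C: "local_event U C"
 shows "prob {h\<in>EE A \<zeta>. C (h(x := h x + 1))} = prob {h\<in>EE A (\<zeta>(x := \<zeta> x + 1)). C h}"
proof -
 let ?z = "\<zeta>(x := \<zeta> x + 1)"
 have C': "local_event U (\<lambda>h. C (h(x := h x + 1)))"
 proof (rule local_eventI)
  show "finite U" using C by (simp add: local_event_def)
  fix h h' :: "'d config" assume "\<forall>y\<in>U. h y = h' y"
  thus "C (h(x := h x + 1)) = C (h'(x := h' x + 1))" by (intro local_eventD[OF C]) auto
 qed
 have l1: "((\<lambda>V. frac V (\<lambda>h. h \<in> with_core V (out V) A \<zeta> \<and> C (h(x := h x + 1)))) \<longlongrightarrow> prob {h\<in>EE A \<zeta>. C (h(x := h x + 1))}) volumes"
  by (rule EE_limit[OF A z(1) C'])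
 have l2: "((\<lambda>V. frac V (\<lambda>h. h \<in> with_core V (out V) A ?z \<and> C h)) \<longlongrightarrow> prob {h\<in>EE A ?z. C h}) volumes"
  by (rule EE_limit[OF A z(3) C])
 have "\<forall>\<^sub>F V in volumes. frac V (\<lambda>h. h \<in> with_core V (out V) A \<zeta> \<and> C (h(x := h x + 1)))
   = frac V (\<lambda>h. h \<in> with_core V (out V) A ?z \<and> C h)"
 proof (rule eventually_volumes[OF A(1)])
  fix V :: "'d site set" assume V: "finite V" "A \<subseteq> V"
  have zr: "\<zeta> \<in> rec A (rim V (out V) W A)" "?z \<in> rec A (rim V (out V) W A)" using z rec_rim[OF V(2,1)] by auto
  have up: "h(x := h x + 1) \<in> with_core V (out V) A ?z" if e: "h \<in> with_core V (out V) A \<zeta>" for h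
  proof -
   have "(\<lambda>y. if y \<in> A then ?z y else h y) = h(x := h x + 1)" using e z(2) by (auto simp: with_core_def)
   thus ?thesis using with_core_replace[OF V(1) A(2) V(2) zr e] by simp
  qed
  have down: "h(x := h x - 1) \<in> with_core V (out V) A \<zeta>" if e: "h \<in> with_core V (out V) A ?z" for h
  proof -
   have "(\<lambda>y. if y \<in> A then \<zeta> y else h y) = h(x := h x - 1)" using e z(2) by (fastforce simp: with_core_def)
   thus ?thesis using with_core_replace[OF V(1) A(2) V(2) zr(2,1) e] by simp
  qed
  have rec: "h \<in> recV V" if "h \<in> with_core V (out V) A \<xi>" for h \<xi> using that by (simp add: with_core_def)
  show "frac V (\<lambda>h. h \<in> with_core V (out V) A \<zeta> \<and> C (h(x := h x + 1))) = frac V (\<lambda>h. h \<in> with_core V (out V) A ?z \<and> C h)"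
  proof (rule frac_bij, rule bij_betw_byWitness[where f'="\<lambda>h. h(x := h x - 1)"])
   show "(\<lambda>h. h(x := h x + 1)) ` {h\<in>recV V. h \<in> with_core V (out V) A \<zeta> \<and> C (h(x := h x + 1))}
     \<subseteq> {h\<in>recV V. h \<in> with_core V (out V) A ?z \<and> C h}"
   proof (rule image_subsetI)
    fix h assume e: "h \<in> {h\<in>recV V. h \<in> with_core V (out V) A \<zeta> \<and> C (h(x := h x + 1))}"
    show "h(x := h x + 1) \<in> {h\<in>recV V. h \<in> with_core V (out V) A ?z \<and> C h}" using e up[of h] rec[OF up[of h]] by blast
   qed
   show "(\<lambda>h. h(x := h x - 1)) ` {h\<in>recV V. h \<in> with_core V (out V) A ?z \<and> C h}
     \<subseteq> {h\<in>recV V. h \<in> with_core V (out V) A \<zeta> \<and> C (h(x := h x + 1))}"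
   proof (rule image_subsetI)
    fix h assume e: "h \<in> {h\<in>recV V. h \<in> with_core V (out V) A ?z \<and> C h}"
    have "(h(x := h x - 1))(x := (h(x := h x - 1)) x + 1) = h" by simp
    thus "h(x := h x - 1) \<in> {h\<in>recV V. h \<in> with_core V (out V) A \<zeta> \<and> C (h(x := h x + 1))}"
     using e down[of h] rec[OF down[of h]] by simp
   qed
  qed simp_all
 qed
 hence "((\<lambda>V. frac V (\<lambda>h. h \<in> with_core V (out V) A ?z \<and> C h)) \<longlongrightarrow> prob {h\<in>EE A \<zeta>. C (h(x := h x + 1))}) volumes"
  using l1 by (simp add: tendsto_cong)
 thus ?thesis using l2 tendsto_unique[OF finite_subsets_at_top_neq_bot] by blast
qed

lemma EE_raise:
 assumes A: "finite A" "W \<subseteq> A" and z: "\<zeta> \<in> rec A (kI W A)" "x \<in> A" "\<zeta>(x := \<zeta> x + 1) \<in> rec A (kI W A)"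
 shows "\<And>h. h \<in> EE A \<zeta> ==> raise x h = h(x := h x + 1)"
  and "\<And>h. h \<in> EE A \<zeta> ==> h x < 2 * int CARD('d)"
proof -
 have "(\<zeta>(x := \<zeta> x + 1)) x \<le> int (dg A x + kI W A x)" by (rule recD(2)[OF z(3,2)])
 also have "... \<le> 2 * int CARD('d)" using dg_out[of A x] by (auto simp: kI_def)
 finally show *: "\<And>h. h \<in> EE A \<zeta> ==> h x < 2 * int CARD('d)" using z(2) by (auto simp: EE_def)
 thus "\<And>h. h \<in> EE A \<zeta> ==> raise x h = h(x := h x + 1)" by (simp add: raise_def)
qed

lemma distr_raise:
 assumes A: "finite A" "W \<subseteq> A" and z: "\<zeta> \<in> rec A (kI W A)" "x \<in> A" "\<zeta>(x := \<zeta> x + 1) \<in> rec A (kI W A)"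
 shows "distr (density \<mu> (indicator (EE A \<zeta>))) \<mu> (raise x) = density \<mu> (indicator (EE A (\<zeta>(x := \<zeta> x + 1))))"
  (is "?P = ?Q")
proof (rule measure_eq_local)
 have m: "raise x \<in> measurable (density \<mu> (indicator (EE A \<zeta>))) \<mu>" using raise_measurable by simp
 have emP: "emeasure ?P X = emeasure \<mu> (EE A \<zeta> \<inter> (raise x -` X \<inter> space \<mu>))" if X: "X \<in> sets \<mu>" for X
  using emeasure_distr[OF m X] EE_sets[OF A(1)] measurable_sets[OF raise_measurable X]
  by (simp add: emeasure_density indicator_inter_arith[symmetric])
 show "finite_measure ?P" by (rule finite_measureI) (use emP[of "space \<mu>"] in \<open>auto simp: emeasure_eq_measure\<close>)
 fix U C assume C: "local_event U (C :: 'd config => bool)"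
 let ?Y = "{h\<in>space \<mu>. C h}"
 note Y = local_sets[OF C]
 have 1: "EE A \<zeta> \<inter> (raise x -` ?Y \<inter> space \<mu>) = {h\<in>EE A \<zeta>. C (h(x := h x + 1))}"
  using EE_raise(1)[OF A z] raise_space[of _ x] by (auto simp: EE_def)
 have 2: "EE A (\<zeta>(x := \<zeta> x + 1)) \<inter> ?Y = {h\<in>EE A (\<zeta>(x := \<zeta> x + 1)). C h}" unfolding EE_def by auto
 have "emeasure ?Q ?Y = emeasure \<mu> (EE A (\<zeta>(x := \<zeta> x + 1)) \<inter> ?Y)"
  using EE_sets[OF A(1)] Y by (simp add: emeasure_density indicator_inter_arith[symmetric])
 thus "emeasure ?P ?Y = emeasure ?Q ?Y" unfolding emP[OF Y] 1 2 using raise_cylinder[OF A z C] by (simp add: emeasure_eq_measure)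
qed simp_all

lemma integral_raise:
 fixes h :: "'d config => real"
 assumes A: "finite A" "W \<subseteq> A" and z: "\<zeta> \<in> rec A (kI W A)" "x \<in> A" "\<zeta>(x := \<zeta> x + 1) \<in> rec A (kI W A)"
  and h: "h \<in> borel_measurable \<mu>"
 shows "(\<integral>c. indicator (EE A \<zeta>) c * h (raise x c) \<partial>\<mu>) = (\<integral>c. indicator (EE A (\<zeta>(x := \<zeta> x + 1))) c * h c \<partial>\<mu>)"
  and "integrable \<mu> h ==> integrable \<mu> (\<lambda>c. indicator (EE A \<zeta>) c * h (raise x c))"
proof -
 let ?P = "distr (density \<mu> (indicator (EE A \<zeta>))) \<mu> (raise x)"
 have m: "raise x \<in> measurable (density \<mu> (\<lambda>c. ennreal (indicator (EE A \<zeta>) c))) \<mu>" using raise_measurable by simp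
 have ind: "(\<lambda>c. ennreal (indicator B c)) = indicator B" for B :: "'d config set" by (auto simp: indicator_def)
 have [measurable]: "EE A \<xi> \<in> sets \<mu>" for \<xi> by (rule EE_sets[OF A(1)])
 have hr: "(\<lambda>c. h (raise x c)) \<in> borel_measurable \<mu>" by (rule measurable_compose[OF raise_measurable h])
 have 1: "integral\<^sup>L ?P h = (\<integral>c. indicator (EE A \<zeta>) c * h (raise x c) \<partial>\<mu>)"
  using integral_distr[OF m h] integral_density[OF hr, of "indicator (EE A \<zeta>)"] by (simp add: ind)
 have 2: "integral\<^sup>L (density \<mu> (indicator (EE A (\<zeta>(x := \<zeta> x + 1))))) h = (\<integral>c. indicator (EE A (\<zeta>(x := \<zeta> x + 1))) c * h c \<partial>\<mu>)"
  using integral_density[OF h, of "indicator (EE A (\<zeta>(x := \<zeta> x + 1)))"] by (simp add: ind)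
 show "(\<integral>c. indicator (EE A \<zeta>) c * h (raise x c) \<partial>\<mu>) = (\<integral>c. indicator (EE A (\<zeta>(x := \<zeta> x + 1))) c * h c \<partial>\<mu>)"
  using 1 2 distr_raise[OF A z] by simp
 assume i: "integrable \<mu> h"
 have "integrable \<mu> (\<lambda>c. indicator (EE A (\<zeta>(x := \<zeta> x + 1))) c *\<^sub>R h c)"
  by (rule integrable_mult_indicator[OF _ i]) simp
 hence "integrable (density \<mu> (indicator (EE A (\<zeta>(x := \<zeta> x + 1))))) h"
  using integrable_density[OF h, of "indicator (EE A (\<zeta>(x := \<zeta> x + 1)))"] by (simp add: ind)
 hence "integrable ?P h" using distr_raise[OF A z] by simp
 hence "integrable (density \<mu> (indicator (EE A \<zeta>))) (\<lambda>c. h (raise x c))"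
  using integrable_distr[OF m, of h] by (simp add: ind)
 thus "integrable \<mu> (\<lambda>c. indicator (EE A \<zeta>) c * h (raise x c))"
  using integrable_density[OF hr, of "indicator (EE A \<zeta>)"] by (simp add: ind)
qed

text \<open>For fixed W the core is determined by the configuration: a surplus A - A' would have a
  site burning with A' unburnt, whereas off W the heights of an admissible pattern on A are at most
  \<open>dg A\<close>.\<close>

lemma EE_disjoint:
 assumes A: "finite A" "W \<subseteq> A" "\<zeta> \<in> rec A (kI W A)" and A': "finite A'" "W \<subseteq> A'" "\<zeta>' \<in> rec A' (kI W A')"
  and e: "h \<in> EE A \<zeta>" "h \<in> EE A' \<zeta>'"
 shows "A = A' \<and> \<zeta> = \<zeta>'"
proof -
 have sub: "A \<subseteq> A'" if A: "finite A" "W \<subseteq> A" "\<zeta> \<in> rec A (kI W A)" and A': "finite A'" "W \<subseteq> A'"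
  and e: "h \<in> EE A \<zeta>" "h \<in> EE A' \<zeta>'" for A A' and \<zeta> \<zeta>' :: "'d config"
 proof (rule ccontr)
  assume "\<not> A \<subseteq> A'"
  hence "finite (A - A')" "A - A' \<subseteq> UNIV - A'" "A - A' \<noteq> {}" using A by auto
  then obtain y where y: "y \<in> A - A'" "int (dg ((A - A') \<union> A') y) < h y" using e(2) unfolding EE_def clears_def by blast
  have "dg A y \<le> dg ((A - A') \<union> A') y" by (rule dg_mono) (use A A' in auto)
  moreover have "y \<notin> W" using y A' by blast
  hence "h y \<le> int (dg A y)" using recD(2)[OF A(3), of y] y e(1) by (auto simp: kI_def EE_def)
  ultimately show False using y(2) by simp
 qed
 have "A = A'" using sub[OF A A'(1,2) e] sub[OF A' A(1,2) e(2,1)] by auto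
 moreover have "\<zeta> = \<zeta>'"
 proof
  fix y show "\<zeta> y = \<zeta>' y"
   using e recD(1)[OF A(3), of y] recD(1)[OF A'(3), of y] \<open>A = A'\<close> by (cases "y \<in> A") (auto simp: EE_def)
 qed
 ultimately show ?thesis by simp
qed

section \<open>Weights of the possible cores of a window\<close>

definition cores :: "'d site set => nat => 'd site set set" where
 "cores W N = {A. W \<subseteq> A \<and> A \<subseteq> box N}"

lemma finite_cores [simp]: "finite (cores W N)" by (rule finite_subset[of _ "Pow (box N)"]) (auto simp: cores_def)

lemma cores_finite: "A \<in> cores W N ==> finite A" "A \<in> cores W N ==> W \<subseteq> A"
 unfolding cores_def using finite_subset[of A "box N"] by auto

text \<open>The probability that the core of W is A: number of admissible patterns times their
  common probability.\<close>

definition wt :: "'d site set => 'd site set => real" where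
 "wt W A = real (trees A (kI W A)) * ee A"

lemma wt_sum: "finite A ==> W \<subseteq> A ==> wt W A = (\<Sum>\<zeta>\<in>rec A (kI W A). prob (EE A \<zeta>))"
 by (simp add: wt_def trees_def measure_EE)

lemma wt_nonneg: "finite A ==> W \<subseteq> A ==> 0 \<le> wt W A" by (simp add: wt_sum sum_nonneg)

text \<open>In finite volume the classes \<open>with_core\<close> cover all configurations whose
  core lies in the box; tightness makes the exceptions rare uniformly in V, so no mass is lost in
  the limit.\<close>

lemma cores_mass:
 assumes W: "finite W" and e: "0 < \<epsilon>"
 obtains N where "\<And>M. N \<le> M ==> 1 - \<epsilon> \<le> (\<Sum>A\<in>cores W M. wt W A)"
proof -
 obtain N0 where N0: "\<And>V. finite V ==> W \<subseteq> V ==> real (card {h\<in>recV V. \<not> core V W h \<subseteq> box N0}) \<le> \<epsilon> * real (card (recV V))"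
  using core_tight[OF d3 W e] by auto
 show thesis
 proof (rule that[of N0])
  fix M assume M: "N0 \<le> M"
  have T: "local_event {} (\<lambda>_. True)" by (rule local_eventI) auto
  let ?s = "\<lambda>V. \<Sum>A\<in>cores W M. \<Sum>\<zeta>\<in>rec A (kI W A). frac V (\<lambda>h. h \<in> with_core V (out V) A \<zeta> \<and> True)"
  have "(?s \<longlongrightarrow> (\<Sum>A\<in>cores W M. \<Sum>\<zeta>\<in>rec A (kI W A). prob {h\<in>EE A \<zeta>. True})) volumes"
   by (intro tendsto_sum EE_limit[OF _ _ _ T]) (auto dest: cores_finite)
  hence lim: "(?s \<longlongrightarrow> (\<Sum>A\<in>cores W M. wt W A)) volumes" using cores_finite by (simp add: wt_sum)
  have "\<forall>\<^sub>F V in volumes. 1 - \<epsilon> \<le> ?s V"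
  proof (rule eventually_volumes[of "W \<union> box M"])
   fix V :: "'d site set" assume V: "finite V" "W \<union> box M \<subseteq> V"
   let ?n = "real (card (recV V))"
   have "{h\<in>recV V. core V W h \<subseteq> box M} \<subseteq> (\<Union>A\<in>cores W M. \<Union>\<zeta>\<in>rec A (kI W A). with_core V (out V) A \<zeta>)"
   proof
    fix h assume e: "h \<in> {h\<in>recV V. core V W h \<subseteq> box M}"
    let ?A = "core V W h"
    have sub: "burnt V (V - W) (\<lambda>_. 0) h \<subseteq> V - W" by (rule burnt_subset)
    have A: "W \<subseteq> ?A" "?A \<subseteq> V" using V sub unfolding core_def by auto
    have b: "burnt V (V - W) (\<lambda>_. 0) h = V - ?A" using sub unfolding core_def by auto
    have "cut ?A h \<in> rec ?A (kI W ?A)" "h \<in> with_core V (out V) ?A (cut ?A h)"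
     using with_coreI[OF V(1) A, of h "out V"] e b rec_rim[OF A(2) V(1)] by auto
    moreover have "?A \<in> cores W M" using A e by (auto simp: cores_def)
    ultimately show "h \<in> (\<Union>A\<in>cores W M. \<Union>\<zeta>\<in>rec A (kI W A). with_core V (out V) A \<zeta>)" by blast
   qed
   hence "card {h\<in>recV V. core V W h \<subseteq> box M} \<le> card (\<Union>A\<in>cores W M. \<Union>\<zeta>\<in>rec A (kI W A). with_core V (out V) A \<zeta>)"
    by (rule card_mono[rotated]) (use finite_rec[OF V(1)] in \<open>auto simp: with_core_def cores_finite finite_rec\<close>)
   also have "... \<le> (\<Sum>A\<in>cores W M. card (\<Union>\<zeta>\<in>rec A (kI W A). with_core V (out V) A \<zeta>))"
    by (rule card_UN_le) simp
   also have "... \<le> (\<Sum>A\<in>cores W M. \<Sum>\<zeta>\<in>rec A (kI W A). card (with_core V (out V) A \<zeta>))"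
    by (intro sum_mono card_UN_le finite_rec) (auto intro: cores_finite)
   finally have "real (card {h\<in>recV V. core V W h \<subseteq> box M}) \<le> real (\<Sum>A\<in>cores W M. \<Sum>\<zeta>\<in>rec A (kI W A). card (with_core V (out V) A \<zeta>))"
    by (simp only: of_nat_le_iff)
   also have "... = ?n * ?s V"
   proof -
    have "{h\<in>recV V. h \<in> with_core V (out V) A \<zeta> \<and> True} = with_core V (out V) A \<zeta>" for A \<zeta> by (auto simp: with_core_def)
    thus ?thesis using recV_pos[OF V(1)] by (simp add: frac_def sum_distrib_left)
   qed
   finally have 1: "real (card {h\<in>recV V. core V W h \<subseteq> box M}) \<le> ?n * ?s V" .
   have "recV V = {h\<in>recV V. core V W h \<subseteq> box M} \<union> {h\<in>recV V. \<not> core V W h \<subseteq> box M}" by auto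
   hence "card (recV V) \<le> card {h\<in>recV V. core V W h \<subseteq> box M} + card {h\<in>recV V. \<not> core V W h \<subseteq> box M}"
    by (metis (no_types, lifting) card_Un_le)
   moreover have "card {h\<in>recV V. \<not> core V W h \<subseteq> box M} \<le> card {h\<in>recV V. \<not> core V W h \<subseteq> box N0}"
    by (rule card_mono[OF finite_recV[OF V(1)]]) (use box_mono[OF M] in auto)
   ultimately have "card (recV V) \<le> card {h\<in>recV V. core V W h \<subseteq> box M} + card {h\<in>recV V. \<not> core V W h \<subseteq> box N0}" by linarith
   hence "?n \<le> real (card {h\<in>recV V. core V W h \<subseteq> box M}) + real (card {h\<in>recV V. \<not> core V W h \<subseteq> box N0})"
    unfolding of_nat_add[symmetric] of_nat_le_iff .
   moreover have "real (card {h\<in>recV V. \<not> core V W h \<subseteq> box N0}) \<le> \<epsilon> * ?n" using N0[OF V(1)] V(2) by blast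
   ultimately have "?n \<le> real (card {h\<in>recV V. core V W h \<subseteq> box M}) + \<epsilon> * ?n" by linarith
   hence "?n * (1 - \<epsilon>) \<le> ?n * ?s V" using 1 by (simp add: algebra_simps)
   thus "1 - \<epsilon> \<le> ?s V" using recV_pos[OF V(1)] by simp
  qed (use W in auto)
  thus "1 - \<epsilon> \<le> (\<Sum>A\<in>cores W M. wt W A)" by (rule tendsto_lowerbound[OF lim]) simp
 qed
qed

end

section \<open>Addition in infinite volume\<close>

text \<open>A local certificate that the avalanche from x ends inside the box without touching its
  rim. It includes recurrence of the restriction, so that toppling numbers in the box are well
  behaved.\<close>

definition settled :: "nat => ('d::finite) site => 'd config => bool" where
 "settled N x h \<longleftrightarrow> x \<in> box N \<and> restr (box N) h \<in> recV (box N) \<and> contained (box N) x h"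

definition patch :: "nat => ('d::finite) site => 'd config => 'd config" where
 "patch N x h z = (if z \<in> box N then aV (box N) x (restr (box N) h) z else h z)"

lemma settled_NV_outside:
 assumes "settled N x h" "y \<notin> box N" shows "NV (box N) x y h = 0"
 using topseq_outside[OF topseq_NV[of "box N" x h] assms(2)] assms by (auto simp: settled_def)

lemma settled_NV_rim:
 assumes s: "settled N x h" and z: "z \<notin> box N" "nbr w z" shows "NV (box N) x w h = 0"
proof (cases "w \<in> box N")
 case True
 have "{z. z \<notin> box N \<and> nbr w z} \<noteq> {}" using z by auto
 hence "out (box N) w \<noteq> 0" by simp
 thus ?thesis using s True unfolding settled_def contained_def by blast
qed (rule settled_NV_outside[OF s])

lemma patch_eq:
 fixes x z :: "('d::finite) site"
 assumes s: "settled N x h"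
 shows "patch N x h z = h z + of_bool (z = x)
  - (2 * int CARD('d) * int (NV (box N) x z h) - (\<Sum>w\<in>{w. nbr z w}. int (NV (box N) x w h)))"
proof (cases "z \<in> box N")
 case True
 have "(\<Sum>w\<in>box N. of_bool (nbr z w) * int (NV (box N) x w h)) = (\<Sum>w\<in>{w. nbr z w} \<inter> box N. int (NV (box N) x w h))"
  by (simp add: sum.If_cases of_bool_def if_distrib[of "\<lambda>a. a * _"] Int_commute cong: if_cong)
 also have "... = (\<Sum>w\<in>{w. nbr z w}. int (NV (box N) x w h))" by (rule sum.mono_neutral_left) (auto simp: settled_NV_outside[OF s])
 finally have sm: "(\<Sum>w\<in>box N. of_bool (nbr z w) * int (NV (box N) x w h)) = (\<Sum>w\<in>{w. nbr z w}. int (NV (box N) x w h))" .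
 have "aV (box N) x (restr (box N) h) z = add_grain x (restr (box N) h) z - topple_total (box N) (\<lambda>w. NV (box N) x w h) z"
  unfolding aV_def stabilize_def NV_def ..
 thus ?thesis using True s topple_total_eq[OF finite_box True] sm by (simp add: patch_def add_grain_def restr_def settled_def)
next
 case False
 have "NV (box N) x w h = 0" if "nbr z w" for w by (rule settled_NV_rim[OF s False]) (use that adj_sym in blast)
 hence "(\<Sum>w\<in>{w. nbr z w}. int (NV (box N) x w h)) = 0" by simp
 moreover have "z \<noteq> x" using False s by (auto simp: settled_def)
 ultimately show ?thesis using False settled_NV_outside[OF s False] by (simp add: patch_def)
qed

lemma aV_settled:
 assumes V: "finite V" "box N \<subseteq> V" and e: "h \<in> recV V" and s: "settled N x h"
 shows "aV V x h = patch N x h"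
proof
 fix z
 have re: "restr V h = h" using recD(1)[OF e] by (auto simp: restr_def)
 have x: "x \<in> box N" "contained (box N) x h" using s by (auto simp: settled_def)
 have n: "NV V x y h = NV (box N) x y h" for y by (rule NV_contained) (use V e re x in auto)
 have a: "aV V x h z = add_grain x h z - topple_total V (\<lambda>w. NV (box N) x w h) z"
 proof -
  have "odometer V (add_grain x h) = (\<lambda>w. NV (box N) x w h)" by (rule ext) (use n in \<open>simp add: NV_def re\<close>)
  thus ?thesis unfolding aV_def stabilize_def by simp
 qed
 have o: "NV (box N) x w h = 0" if "w \<notin> V" for w by (rule settled_NV_outside[OF s]) (use that V in auto)
 show "aV V x h z = patch N x h z"
 proof (cases "z \<in> V")
  case True
  have "(\<Sum>w\<in>V. of_bool (nbr z w) * int (NV (box N) x w h)) = (\<Sum>w\<in>{w. nbr z w} \<inter> V. int (NV (box N) x w h))"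
   using V by (simp add: sum.If_cases of_bool_def if_distrib[of "\<lambda>a. a * _"] Int_commute cong: if_cong)
  also have "... = (\<Sum>w\<in>{w. nbr z w}. int (NV (box N) x w h))"
   by (rule sum.mono_neutral_left) (use V in \<open>auto simp: o\<close>)
  finally show ?thesis unfolding a patch_eq[OF s] topple_total_eq[OF V(1) True] by (simp add: add_grain_def)
 next
  case False
  thus ?thesis using V x unfolding a by (auto simp: topple_total_outside patch_def add_grain_def)
 qed
qed

text \<open>Any volume can be enlarged to contain the box; there the toppling numbers are those of
  the box. So the supremum over volumes is attained and finite.\<close>

lemma ainf_settled:
 fixes x :: "('d::finite) site"
 assumes r: "\<And>B. finite B ==> restr B h \<in> recV B" and s: "settled N x h"
 shows "ainf x h = patch N x h"
proof
 fix z :: "'d site"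
 have x: "x \<in> box N" "contained (box N) x h" using s by (auto simp: settled_def)
 have N: "Ntop x y h = enat (NV (box N) x y h)" for y unfolding Ntop_def
 proof (rule antisym)
  show "(SUP V\<in>{V. finite V}. enat (NV V x y h)) \<le> enat (NV (box N) x y h)"
  proof (rule SUP_least)
   fix V :: "'d site set" assume "V \<in> {V. finite V}"
   hence V: "finite (V \<union> box N)" by simp
   have "NV V x y h \<le> NV (V \<union> box N) x y h" by (rule NV_mono[OF V _ r[OF V]]) simp
   also have "... = NV (box N) x y h" by (rule NV_contained[OF V _ r[OF V] x]) simp
   finally show "enat (NV V x y h) \<le> enat (NV (box N) x y h)" by simp
  qed
  show "enat (NV (box N) x y h) \<le> (SUP V\<in>{V. finite V}. enat (NV V x y h))" by (rule SUP_upper) simp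
 qed
 have irr: "\<not> nbr z z" by (rule adj_irrefl)
 have "{y. y = z \<or> nbr z y} = insert z {y. nbr z y}" by auto
 hence "(\<Sum>y\<in>{y. y = z \<or> nbr z y}. lap z y * int (NV (box N) x y h))
   = lap z z * int (NV (box N) x z h) + (\<Sum>y\<in>{y. nbr z y}. lap z y * int (NV (box N) x y h))" using irr by simp
 also have "(\<Sum>y\<in>{y. nbr z y}. lap z y * int (NV (box N) x y h)) = (\<Sum>y\<in>{y. nbr z y}. - int (NV (box N) x y h))"
  by (rule sum.cong) (use irr in \<open>auto simp: lap_def\<close>)
 finally show "ainf x h z = patch N x h z" unfolding patch_eq[OF s] ainf_def by (simp add: N lap_def sum_negf of_bool_def)
qed

lemma patch_range:
 fixes x :: "('d::finite) site"
 assumes s: "settled N x h" and e: "\<And>z. 1 \<le> h z \<and> h z \<le> 2 * int CARD('d)"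
 shows "1 \<le> patch N x h z \<and> patch N x h z \<le> 2 * int CARD('d)"
proof (cases "z \<in> box N")
 case True
 have "aV (box N) x (restr (box N) h) \<in> recV (box N)"
  by (rule wave_site.aV_recV) (use s in \<open>auto simp: wave_site_def settled_def\<close>)
 thus ?thesis using recV_height_bounds[of _ "box N" z] True by (simp add: patch_def)
qed (simp add: patch_def e)

lemma local_settled: "local_event (box N) (settled N x)" by (rule local_event_restr[where Q'="settled N x"])
  (simp_all add: settled_def contained_def NV_def restr_restr)

lemma local_patch: "local_event U C ==> local_event (box N \<union> U) (\<lambda>h. settled N x h \<and> C (patch N x h))"
proof (rule local_eventI)
 assume C: "local_event U C"
 thus "finite (box N \<union> U)" by (simp add: local_event_def)
 fix h h' :: "'a config" assume e: "\<forall>y\<in>box N \<union> U. h y = h' y"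
 have "settled N x h = settled N x h'" by (rule local_eventD[OF local_settled]) (use e in simp)
 moreover have "restr (box N) h = restr (box N) h'" by (rule restr_eq) (use e in simp)
 hence "C (patch N x h) = C (patch N x h')" by (intro local_eventD[OF C]) (use e in \<open>simp add: patch_def\<close>)
 ultimately show "(settled N x h \<and> C (patch N x h)) = (settled N x h' \<and> C (patch N x h'))" by simp
qed

text \<open>One extra layer is taken: sites of \<open>box N\<close> have all neighbours in
  \<open>box (Suc N)\<close>, so an avalanche confined to the former never topples at the rim of the
  latter.\<close>

lemma settledI:
 fixes x :: "('d::finite) site"
 assumes V: "finite V" "box (Suc N) \<subseteq> V" and e: "h \<in> recV V" and x: "x \<in> box N"
  and o: "\<And>y. y \<notin> box N ==> odometer V (add_grain x h) y = 0"
 shows "settled (Suc N) x h"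
proof -
 have re: "restr V h = h" using recD(1)[OF e] by (auto simp: restr_def)
 have r: "restr (box (Suc N)) h \<in> recV (box (Suc N))" by (rule restr_mono_recV[OF _ V(2)]) (simp add: re e)
 have out: "out (box (Suc N)) y = 0" if yN: "y \<in> box N" for y :: "'d site"
 proof -
  have "z \<in> box (Suc N)" if nz: "nbr y z" for z unfolding box_def
  proof (intro CollectI allI)
   fix i
   have "\<bar>y i - z i\<bar> \<le> (\<Sum>i\<in>UNIV. \<bar>y i - z i\<bar>)" by (rule member_le_sum) auto
   hence "\<bar>y i - z i\<bar> \<le> 1" using nz by (simp add: nbr_def)
   moreover have "\<bar>y i\<bar> \<le> int N" using yN by (simp add: box_def)
   ultimately show "\<bar>z i\<bar> \<le> int (Suc N)" by linarith
  qed
  hence "{z. z \<notin> box (Suc N) \<and> nbr y z} = {}" by blast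
  thus ?thesis by simp
 qed
 have "NV (box (Suc N)) x y h = 0" if y: "out (box (Suc N)) y \<noteq> 0" for y
 proof -
  have "NV (box (Suc N)) x y h \<le> NV V x y h" by (rule NV_mono) (use V re e in auto)
  also have "NV V x y h = 0" unfolding NV_def re by (rule o) (use out[of y] y in auto)
  finally show ?thesis by simp
 qed
 thus ?thesis using r x box_mono[of N "Suc N"] by (auto simp: settled_def contained_def)
qed

context sandpile_limit
begin

lemma settled_tight:
 assumes e: "0 < \<epsilon>"
 obtains N where "\<And>V. finite V ==> box N \<subseteq> V ==> frac V (\<lambda>h. \<not> settled N x h) \<le> \<epsilon>"
  and "prob {h\<in>space \<mu>. \<not> settled N x h} \<le> \<epsilon>"
proof -
 obtain N0 where N0: "\<And>V. finite V ==> x \<in> V ==>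
  real (card {h\<in>recV V. \<exists>y. y \<notin> box N0 \<and> odometer V (add_grain x h) y \<noteq> 0}) \<le> \<epsilon> * real (card (recV V))"
  using avalanche_tight[OF d3 e, of x] by auto
 obtain N1 where N1: "{x} \<subseteq> box N1" using finite_subset_box[of "{x}"] by auto
 define N where "N = max N0 N1"
 have sub: "box N0 \<subseteq> (box N :: 'd site set)" "box N1 \<subseteq> (box N :: 'd site set)" by (auto intro!: box_mono simp: N_def)
 have x: "x \<in> box N" using N1 sub by auto
 have f: "frac V (\<lambda>h. \<not> settled (Suc N) x h) \<le> \<epsilon>" if V: "finite V" "box (Suc N) \<subseteq> V" for V
 proof -
  have xV: "x \<in> V" using x V box_mono[of N "Suc N"] by auto
  have "frac V (\<lambda>h. \<not> settled (Suc N) x h) \<le> frac V (\<lambda>h. \<exists>y. y \<notin> box N0 \<and> odometer V (add_grain x h) y \<noteq> 0)"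
   by (rule frac_mono[OF V(1)]) (use settledI[OF V _ x] sub in blast)
  also have "... \<le> \<epsilon>" unfolding frac_def using N0[OF V(1) xV] recV_pos[OF V(1)] by (simp add: divide_le_eq)
  finally show ?thesis .
 qed
 show thesis by (rule that[OF f local_le[OF local_event_not[OF local_settled] eventually_volumes[OF finite_box f]]])
qed

text \<open>A version of \<open>ainf\<close> assembled from countably many local maps, measurable by
  construction; the two agree almost surely.\<close>

definition add_inf :: "'d site => 'd config => 'd config" where
 "add_inf x h = (if \<exists>N. settled N x h then patch (LEAST N. settled N x h) x h else h)"

lemma pred_settled [measurable]: "Measurable.pred \<mu> (settled n x)" using local_sets[OF local_settled] by (simp add: pred_def)

lemma AE_settled: "AE h in \<mu>. \<forall>x. \<exists>N. settled N x h"
proof (rule AE_all_countable[THEN iffD2], rule allI)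
 fix x :: "'d site"
 let ?X = "{h\<in>space \<mu>. \<not> (\<exists>N. settled N x h)}"
 have X: "?X \<in> sets \<mu>" by measurable
 have "prob ?X \<le> 0 + e" if "0 < e" for e
 proof -
  obtain N where "prob {h\<in>space \<mu>. \<not> settled N x h} \<le> e" using settled_tight[OF \<open>0 < e\<close>] .
  moreover have "prob ?X \<le> prob {h\<in>space \<mu>. \<not> settled N x h}" by (rule finite_measure_mono) auto
  ultimately show ?thesis by simp
 qed
 hence "prob ?X \<le> 0" by (rule field_le_epsilon)
 hence "prob ?X = 0" using measure_nonneg[of \<mu>] by (simp add: antisym)
 thus "AE h in \<mu>. \<exists>N. settled N x h" by (intro AE_I[of _ _ ?X]) (use X in \<open>auto simp: emeasure_eq_measure\<close>)
qed

lemma add_inf_space: "h \<in> space \<mu> ==> add_inf x h \<in> space \<mu>"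
 using patch_range[of "LEAST N. settled N x h" x h] LeastI[of "\<lambda>N. settled N x h"] by (auto simp: space_mu add_inf_def)

lemma add_inf_measurable: "add_inf x \<in> measurable \<mu> \<mu>"
proof (rule config_measurableI[OF add_inf_space])
 fix z
 have p: "(\<lambda>h. patch n x h z) \<in> measurable \<mu> (count_space UNIV)" for n
 proof (rule local_measurable[of "insert z (box n)"], rule local_eventI)
  fix a and h h' :: "'d config" assume e: "\<forall>y\<in>insert z (box n). h y = h' y"
  hence "restr (box n) h = restr (box n) h'" by (intro restr_eq) simp
  thus "(patch n x h z = a) = (patch n x h' z = a)" using e by (simp add: patch_def)
 qed simp
 have "(\<lambda>h. if \<exists>n. settled n x h then patch (LEAST n. settled n x h) x h z else h z) \<in> measurable \<mu> (count_space UNIV)"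
  by (rule measurable_If[OF measurable_compose_countable[where f="\<lambda>n h. patch n x h z", OF p] coord_measurable]) measurable
 thus "(\<lambda>h. add_inf x h z) \<in> measurable \<mu> (count_space UNIV)" by (simp add: add_inf_def if_distrib if_distribR)
qed

lemma add_inf_sets: "local_event U C ==> {h\<in>space \<mu>. C (add_inf x h)} \<in> sets \<mu>"
 using measurable_sets[OF add_inf_measurable local_sets, of U C x] add_inf_space
 by (simp add: vimage_def Int_def conj_commute cong: conj_cong)

lemma AE_patch:
 "AE h in \<mu>. \<forall>x N. settled N x h --> add_inf x h = patch N x h \<and> ainf x h = patch N x h" using restr_recV_AE
proof eventually_elim
 case (elim h)
 show ?case
 proof (intro allI impI)
  fix x N assume s: "settled N x h"
  hence "settled (LEAST N. settled N x h) x h" by (rule LeastI)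
  hence "add_inf x h = ainf x h" using s ainf_settled[of h _ x] elim by (auto simp: add_inf_def)
  moreover have "ainf x h = patch N x h" using ainf_settled[OF _ s] elim by blast
  ultimately show "add_inf x h = patch N x h \<and> ainf x h = patch N x h" by simp
 qed
qed

lemma AE_ainf: "AE h in \<mu>. \<forall>x. ainf x h = add_inf x h" using AE_settled AE_patch by eventually_elim metis

lemma AE_raise: "AE c in \<mu>. c x < 2 * int CARD('d) --> add_inf x c = raise x c" using AE_settled AE_patch
proof eventually_elim
 case (elim c)
 show ?case
 proof
  assume h: "c x < 2 * int CARD('d)"
  obtain N where s: "settled N x c" using elim(1) by blast
  have w: "wave_site (box N) x" using s by (simp add: wave_site_def settled_def)
  have "aV (box N) x (restr (box N) c) = add_grain x (restr (box N) c)"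
   by (rule wave_site.odometer_no_wave(2)[OF w]) (use s h in \<open>auto simp: settled_def restr_def\<close>)
  hence "patch N x c = raise x c" using s h by (auto simp: patch_def raise_def add_grain_def restr_def settled_def)
  thus "add_inf x c = raise x c" using elim(2) s by auto
 qed
qed

text \<open>In finite volume addition permutes the recurrent configurations and agrees with
  \<open>patch\<close> on the settled event. The unsettled part costs e/2 once in the volume and
  once under \<mu>.\<close>

lemma add_inf_cylinder:
 assumes C: "local_event U C"
 shows "prob {h\<in>space \<mu>. C (add_inf x h)} = prob {h\<in>space \<mu>. C h}"
proof -
 have "\<bar>prob {h\<in>space \<mu>. C (add_inf x h)} - prob {h\<in>space \<mu>. C h}\<bar> \<le> 0 + e" if "0 < e" for e
 proof -
  have "0 < e / 2" using that by simp
  then obtain N where N: "\<And>V. finite V ==> box N \<subseteq> V ==> frac V (\<lambda>h. \<not> settled N x h) \<le> e / 2"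
   "prob {h\<in>space \<mu>. \<not> settled N x h} \<le> e / 2" using settled_tight[of "e / 2" x] by blast
  let ?p = "\<lambda>h. settled N x h \<and> C (patch N x h)"
  have lp: "local_event (box N \<union> U) ?p" by (rule local_patch[OF C])
  have ev: "\<forall>\<^sub>F V in volumes. \<bar>frac V ?p - frac V C\<bar> \<le> e / 2"
  proof (rule eventually_volumes[OF finite_box])
   fix V :: "'d site set" assume V: "finite V" "box N \<subseteq> V"
   show "\<bar>frac V ?p - frac V C\<bar> \<le> e / 2"
   proof (cases "x \<in> V")
    case True
    then interpret wave_site V x using V by unfold_locales
    have "bij_betw (aV V x) {h\<in>recV V. C (aV V x h)} {h\<in>recV V. C h}" using bij_aV unfolding bij_betw_def inj_on_def by (auto 0 3)
    hence eq: "frac V (\<lambda>h. C (aV V x h)) = frac V C" by (rule frac_bij)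
    have "frac V ?p \<le> frac V (\<lambda>h. C (aV V x h))" by (rule frac_mono[OF V(1)]) (use aV_settled[OF V] in auto)
    moreover have "frac V (\<lambda>h. C (aV V x h)) \<le> frac V (\<lambda>h. ?p h \<or> \<not> settled N x h)"
     by (rule frac_mono[OF V(1)]) (use aV_settled[OF V] in auto)
    moreover have "... \<le> frac V ?p + frac V (\<lambda>h. \<not> settled N x h)" by (rule frac_disj[OF V(1)])
    ultimately show ?thesis using eq N(1)[OF V] by simp
   next
    case False
    hence ns: "\<not> settled N x h" for h using V by (auto simp: settled_def)
    have "1 \<le> e / 2" using N(1)[OF V] frac_True[OF V(1)] by (simp add: ns)
    moreover have "frac V C \<le> 1" using frac_mono[OF V(1), of C "\<lambda>_. True"] frac_True[OF V(1)] by simp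
    moreover have "frac V ?p = 0" by (simp add: ns frac_def)
    ultimately show ?thesis using frac_nonneg[of V C] by simp
   qed
  qed
  have "\<bar>prob {h\<in>space \<mu>. ?p h} - prob {h\<in>space \<mu>. C h}\<bar> \<le> e / 2"
   by (rule tendsto_upperbound[OF tendsto_rabs[OF tendsto_diff[OF local_limit[OF lp] local_limit[OF C]]] ev]) simp
  moreover have "prob {h\<in>space \<mu>. ?p h} \<le> prob {h\<in>space \<mu>. C (add_inf x h)}"
   by (rule finite_measure_mono_AE[OF _ add_inf_sets[OF C]]) (use AE_patch in eventually_elim, auto)
  moreover have "prob {h\<in>space \<mu>. C (add_inf x h)} \<le> prob ({h\<in>space \<mu>. ?p h} \<union> {h\<in>space \<mu>. \<not> settled N x h})"
   by (rule finite_measure_mono_AE)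
    (use AE_patch in eventually_elim, auto intro!: local_sets[OF lp] local_sets[OF local_event_not[OF local_settled]])
  moreover have "... \<le> prob {h\<in>space \<mu>. ?p h} + prob {h\<in>space \<mu>. \<not> settled N x h}"
   by (rule measure_Un_le) (auto intro!: local_sets[OF lp] local_sets[OF local_event_not[OF local_settled]])
  ultimately show ?thesis using N(2) unfolding abs_le_iff by linarith
 qed
 hence "\<bar>prob {h\<in>space \<mu>. C (add_inf x h)} - prob {h\<in>space \<mu>. C h}\<bar> \<le> 0" by (rule field_le_epsilon)
 thus ?thesis by simp
qed

lemma distr_add_inf: "distr \<mu> \<mu> (add_inf x) = \<mu>"
proof (rule measure_eq_local)
 show "finite_measure (distr \<mu> \<mu> (add_inf x))" by (rule finite_measure_distr[OF add_inf_measurable])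
 fix U C assume C: "local_event U (C :: 'd config => bool)"
 have "add_inf x -` {h\<in>space \<mu>. C h} \<inter> space \<mu> = {h\<in>space \<mu>. C (add_inf x h)}" using add_inf_space by auto
 thus "emeasure (distr \<mu> \<mu> (add_inf x)) {h\<in>space \<mu>. C h} = emeasure \<mu> {h\<in>space \<mu>. C h}"
  using emeasure_distr[OF add_inf_measurable local_sets[OF C], of x] add_inf_cylinder[OF C] by (simp add: emeasure_eq_measure)
qed simp_all

lemma integral_add_inf:
 fixes h :: "'d config => real"
 assumes "h \<in> borel_measurable \<mu>"
 shows "(\<integral>c. h (add_inf x c) \<partial>\<mu>) = expectation h"
  and "integrable \<mu> h ==> integrable \<mu> (\<lambda>c. h (add_inf x c))"
 using integral_distr[OF add_inf_measurable[of x] assms] integrable_distr[OF add_inf_measurable[of x], of h] unfolding distr_add_inf by auto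

lemma NV_prob:
 assumes x: "x \<in> box N" and Y: "finite Y"
 shows "prob {h\<in>space \<mu>. \<exists>y\<in>Y. restr (box N) h \<in> recV (box N) \<and> NV (box N) x y h \<noteq> 0} \<le> (\<Sum>y\<in>Y. green y x)"
proof (rule local_le)
 show "local_event (box N) (\<lambda>h. \<exists>y\<in>Y. restr (box N) h \<in> recV (box N) \<and> NV (box N) x y h \<noteq> 0)"
  by (rule local_event_restr[where Q'="\<lambda>h. \<exists>y\<in>Y. restr (box N) h \<in> recV (box N) \<and> NV (box N) x y h \<noteq> 0"])
   (simp_all add: NV_def restr_restr)
 show "\<forall>\<^sub>F V in volumes. frac V (\<lambda>h. \<exists>y\<in>Y. restr (box N) h \<in> recV (box N) \<and> NV (box N) x y h \<noteq> 0) \<le> (\<Sum>y\<in>Y. green y x)"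
 proof (rule eventually_volumes[of "box N \<union> Y"])
  fix V :: "'d site set" assume V: "finite V" "box N \<union> Y \<subseteq> V"
  hence V': "box N \<subseteq> V" "x \<in> V" using x by auto
  have "{h\<in>recV V. \<exists>y\<in>Y. restr (box N) h \<in> recV (box N) \<and> NV (box N) x y h \<noteq> 0}
    \<subseteq> (\<Union>y\<in>Y. {h\<in>recV V. odometer V (add_grain x h) y \<noteq> 0})"
  proof
   fix h assume "h \<in> {h\<in>recV V. \<exists>y\<in>Y. restr (box N) h \<in> recV (box N) \<and> NV (box N) x y h \<noteq> 0}"
   then obtain y where y: "h \<in> recV V" "y \<in> Y" "NV (box N) x y h \<noteq> 0" by blast
   have re: "restr V h = h" using recD(1)[OF y(1)] by (auto simp: restr_def)
   have "NV (box N) x y h \<le> NV V x y h" by (rule NV_mono) (use V V' re y in auto)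
   hence "odometer V (add_grain x h) y \<noteq> 0" using y(3) by (simp add: NV_def re)
   thus "h \<in> (\<Union>y\<in>Y. {h\<in>recV V. odometer V (add_grain x h) y \<noteq> 0})" using y by blast
  qed
  hence "card {h\<in>recV V. \<exists>y\<in>Y. restr (box N) h \<in> recV (box N) \<and> NV (box N) x y h \<noteq> 0}
    \<le> card (\<Union>y\<in>Y. {h\<in>recV V. odometer V (add_grain x h) y \<noteq> 0})"
   by (rule card_mono[rotated]) (use finite_recV[OF V(1)] in \<open>intro finite_UN_I[OF Y]\<close>)
  also have "... \<le> (\<Sum>y\<in>Y. card {h\<in>recV V. odometer V (add_grain x h) y \<noteq> 0})" by (rule card_UN_le[OF Y])
  finally have "real (card {h\<in>recV V. \<exists>y\<in>Y. restr (box N) h \<in> recV (box N) \<and> NV (box N) x y h \<noteq> 0})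
    \<le> real (\<Sum>y\<in>Y. card {h\<in>recV V. odometer V (add_grain x h) y \<noteq> 0})" by (simp only: of_nat_le_iff)
  also have "... \<le> (\<Sum>y\<in>Y. green y x * real (card (recV V)))" unfolding of_nat_sum
   by (rule sum_mono) (use avalanche_le_green[OF d3 V(1) V'(2)] V in \<open>auto simp: trees_def\<close>)
  finally show "frac V (\<lambda>h. \<exists>y\<in>Y. restr (box N) h \<in> recV (box N) \<and> NV (box N) x y h \<noteq> 0) \<le> (\<Sum>y\<in>Y. green y x)"
   unfolding frac_def using recV_pos[OF V(1)] by (simp add: divide_le_eq sum_distrib_right)
 qed (use Y in simp)
qed

text \<open>With x outside W, a height on W changes only if a site of W or one of its neighbours
  topples; each of these has probability at most the Green function.\<close>

lemma add_inf_moves: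
 assumes W: "finite W" "x \<notin> W"
 shows "prob {h\<in>space \<mu>. \<exists>z\<in>W. add_inf x h z \<noteq> h z} \<le> (\<Sum>y\<in>W \<union> (\<Union>z\<in>W. {y. nbr z y}). green y x)"
proof (rule field_le_epsilon)
 fix e :: real assume "0 < e"
 let ?Y = "W \<union> (\<Union>z\<in>W. {y. nbr z y})"
 obtain N where N: "prob {h\<in>space \<mu>. \<not> settled N x h} \<le> e" using settled_tight[OF \<open>0 < e\<close>] .
 show "prob {h\<in>space \<mu>. \<exists>z\<in>W. add_inf x h z \<noteq> h z} \<le> (\<Sum>y\<in>?Y. green y x) + e"
 proof (cases "x \<in> box N")
  case True
  let ?A = "{h\<in>space \<mu>. \<exists>y\<in>?Y. restr (box N) h \<in> recV (box N) \<and> NV (box N) x y h \<noteq> 0}"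
  let ?B = "{h\<in>space \<mu>. \<not> settled N x h}"
  have "local_event (box N) (\<lambda>h. \<exists>y\<in>?Y. restr (box N) h \<in> recV (box N) \<and> NV (box N) x y h \<noteq> 0)"
   by (rule local_event_restr[where Q'="\<lambda>h. \<exists>y\<in>?Y. restr (box N) h \<in> recV (box N) \<and> NV (box N) x y h \<noteq> 0"])
    (simp_all add: NV_def restr_restr)
  hence A: "?A \<in> sets \<mu>" by (rule local_sets)
  have B: "?B \<in> sets \<mu>" by (rule local_sets[OF local_event_not[OF local_settled]])
  have "prob {h\<in>space \<mu>. \<exists>z\<in>W. add_inf x h z \<noteq> h z} \<le> prob (?A \<union> ?B)"
  proof (rule finite_measure_mono_AE[OF _ sets.Un[OF A B]])
   show "AE h in \<mu>. h \<in> {h\<in>space \<mu>. \<exists>z\<in>W. add_inf x h z \<noteq> h z} --> h \<in> ?A \<union> ?B" using AE_patch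
   proof eventually_elim
    case (elim h)
    show ?case
    proof
     assume e: "h \<in> {h\<in>space \<mu>. \<exists>z\<in>W. add_inf x h z \<noteq> h z}"
     then obtain z where z: "z \<in> W" "add_inf x h z \<noteq> h z" by auto
     show "h \<in> ?A \<union> ?B"
     proof (cases "settled N x h")
      case s: True
      have "patch N x h z \<noteq> h z" using elim s z by auto
      moreover have "z \<noteq> x" using z W by auto
      ultimately have "NV (box N) x z h \<noteq> 0 \<or> (\<exists>w\<in>{w. nbr z w}. NV (box N) x w h \<noteq> 0)"
       unfolding patch_eq[OF s] by (auto intro: ccontr)
      hence "\<exists>y\<in>?Y. NV (box N) x y h \<noteq> 0" using z(1) by blast
      thus ?thesis using e s by (auto simp: settled_def)
     qed (use e in simp)
    qed
   qed
  qed
  also have "... \<le> prob ?A + prob ?B" by (rule measure_Un_le[OF A B])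
  also have "prob ?A \<le> (\<Sum>y\<in>?Y. green y x)" by (rule NV_prob[OF True]) (use W in auto)
  finally show ?thesis using N by simp
 next
  case False
  hence "{h\<in>space \<mu>. \<not> settled N x h} = space \<mu>" by (auto simp: settled_def)
  hence "1 \<le> e" using N prob_space by simp
  moreover have "0 \<le> (\<Sum>y\<in>?Y. green y x)" by (rule sum_nonneg) (rule green_nonneg[OF d3])
  ultimately show ?thesis using prob_le_1[of "{h\<in>space \<mu>. \<exists>z\<in>W. add_inf x h z \<noteq> h z}"] by linarith
 qed
qed

lemma local_fun_bounded:
 fixes F :: "'d config => real"
 assumes "local_fun F" obtains K where "0 \<le> K" "\<And>h. h \<in> space \<mu> ==> \<bar>F h\<bar> \<le> K"
proof -
 obtain W where W: "finite W" "\<And>h h'. \<forall>x\<in>W. h x = h' x ==> F h = F h'" using assms unfolding local_fun_def by blast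
 let ?R = "PiE W (\<lambda>_. {1..2 * int CARD('d)})"
 have fR: "finite ?R" using W(1) by (auto intro: finite_PiE)
 show thesis
 proof (rule that[of "\<Sum>\<xi>\<in>?R. \<bar>F \<xi>\<bar>"])
  fix h assume e: "h \<in> space \<mu>"
  have "F h = F (restrict h W)" by (rule W(2)) simp
  moreover have "restrict h W \<in> ?R" using e by (auto simp: space_mu)
  ultimately show "\<bar>F h\<bar> \<le> (\<Sum>\<xi>\<in>?R. \<bar>F \<xi>\<bar>)" using member_le_sum[of "restrict h W" ?R "\<lambda>\<xi>. \<bar>F \<xi>\<bar>"] fR by simp
 qed (simp add: sum_nonneg)
qed

text \<open>An L1 bound on increments in terms of the Green function at the origin: this is what
  makes the generator series converge under the hypothesis on \<phi>. For x in the window the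
  trivial bound 2 K is absorbed because 2d times \<open>green x x\<close> is at least 1.\<close>

lemma local_fun_moves:
 fixes F :: "'d config => real"
 assumes F: "local_fun F" "F \<in> borel_measurable \<mu>"
 obtains C where "0 \<le> C" "\<And>x. (\<integral>h. \<bar>F (add_inf x h) - F h\<bar> \<partial>\<mu>) \<le> C * green (\<lambda>_. 0) x"
proof -
 obtain W where W: "finite W" "\<And>h h'. \<forall>x\<in>W. h x = h' x ==> F h = F h'" using F(1) unfolding local_fun_def by blast
 obtain K where K: "0 \<le> K" "\<And>h. h \<in> space \<mu> ==> \<bar>F h\<bar> \<le> K" using local_fun_bounded[OF F(1)] by blast
 let ?Y = "W \<union> (\<Union>z\<in>W. {y. nbr z y})"
 have Y: "finite ?Y" using W(1) by auto
 have "\<forall>y. \<exists>C\<ge>0. \<forall>x. green y x \<le> C * green (\<lambda>_. 0) (x :: 'd site)" using green_Harnack[OF d3] by metis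
 then obtain H where H: "\<And>y. 0 \<le> H y" "\<And>y x. green y x \<le> H y * green (\<lambda>_. 0) (x :: 'd site)" by metis
 let ?D = "2 * real CARD('d)"
 have D: "1 \<le> ?D" using d3 by simp
 have g0: "0 \<le> green y x" for y x :: "'d site" by (rule green_nonneg[OF d3])
 define S where "S x = (\<Sum>y\<in>?Y. green y x)" for x
 have S0: "0 \<le> S x" for x unfolding S_def by (rule sum_nonneg) (rule g0)
 have S: "S x \<le> (\<Sum>y\<in>?Y. H y) * green (\<lambda>_. 0) x" for x unfolding S_def sum_distrib_right by (rule sum_mono) (rule H)
 show thesis
 proof (rule that[of "2 * K * ?D * (\<Sum>y\<in>?Y. H y)"])
  show "0 \<le> 2 * K * ?D * (\<Sum>y\<in>?Y. H y)" using K D H by (auto intro!: mult_nonneg_nonneg sum_nonneg)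
  fix x
  let ?d = "\<lambda>h. \<bar>F (add_inf x h) - F h\<bar>"
  have m: "(\<lambda>h. F (add_inf x h)) \<in> borel_measurable \<mu>" by (rule measurable_compose[OF add_inf_measurable F(2)])
  have b: "?d h \<le> 2 * K" if "h \<in> space \<mu>" for h using K(2)[OF that] K(2)[OF add_inf_space[OF that, of x]] by linarith
  have int: "integrable \<mu> ?d" by (rule integrable_const_bound[where B="2 * K"]) (use m F(2) b in \<open>auto intro!: AE_I2\<close>)
  have "(\<integral>h. ?d h \<partial>\<mu>) \<le> 2 * K * (?D * S x)"
  proof (cases "x \<in> W")
   case True
   have "1 \<le> ?D * green x x" unfolding green_eq[OF d3, of x x] by (simp add: sum_nonneg g0)
   also have "... \<le> ?D * S x" unfolding S_def by (rule mult_left_mono, rule member_le_sum) (use True Y g0 D in auto)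
   finally have 1: "1 \<le> ?D * S x" .
   have "(\<integral>h. ?d h \<partial>\<mu>) \<le> (\<integral>h. 2 * K \<partial>\<mu>)" by (rule integral_mono[OF int]) (use b in auto)
   also have "... = 2 * K * 1" by (simp add: prob_space)
   also have "... \<le> 2 * K * (?D * S x)" using 1 K by (intro mult_left_mono) auto
   finally show ?thesis .
  next
   case False
   let ?E = "{h\<in>space \<mu>. \<exists>z\<in>W. add_inf x h z \<noteq> h z}"
   have E: "?E \<in> sets \<mu>"
   proof -
    have c: "{h\<in>space \<mu>. add_inf x h z \<noteq> h z} \<in> sets \<mu>" for z
    proof -
     have [measurable]: "(\<lambda>h. h z) \<in> measurable \<mu> (count_space UNIV)" by (rule coord_measurable)
     have [measurable]: "(\<lambda>h. add_inf x h z) \<in> measurable \<mu> (count_space UNIV)"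
      by (rule measurable_compose[OF add_inf_measurable coord_measurable])
     show ?thesis by measurable
    qed
    have "?E = (\<Union>z\<in>W. {h\<in>space \<mu>. add_inf x h z \<noteq> h z})" by auto
    also have "... \<in> sets \<mu>" using W(1) c by (intro sets.finite_UN) auto
    finally show ?thesis .
   qed
   have "(\<integral>h. ?d h \<partial>\<mu>) \<le> (\<integral>h. 2 * K * indicator ?E h \<partial>\<mu>)"
   proof (rule integral_mono[OF int])
    show "integrable \<mu> (\<lambda>h. 2 * K * indicator ?E h)" using E by (auto simp: emeasure_eq_measure)
    fix h assume e: "h \<in> space \<mu>"
    show "?d h \<le> 2 * K * indicator ?E h"
    proof (cases "h \<in> ?E")
     case True
     thus ?thesis using b[OF e] by simp
    next
     case False
     hence "F (add_inf x h) = F h" by (intro W(2)) (use e in auto)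
     thus ?thesis using K by simp
    qed
   qed
   also have "... = 2 * K * prob ?E" using E by simp
   also have "... \<le> 2 * K * S x" using add_inf_moves[OF W(1) False] K by (auto intro!: mult_left_mono simp: S_def)
   also have "... \<le> 2 * K * (?D * S x)" using K D S0[of x] by (intro mult_left_mono) (auto simp: mult_le_cancel_right1)
   finally show ?thesis .
  qed
  also have "... \<le> 2 * K * (?D * ((\<Sum>y\<in>?Y. H y) * green (\<lambda>_. 0) x))" using S[of x] K D by (intro mult_left_mono) auto
  finally show "(\<integral>h. ?d h \<partial>\<mu>) \<le> 2 * K * ?D * (\<Sum>y\<in>?Y. H y) * green (\<lambda>_. 0) x" by (simp add: mult.assoc)
 qed
qed

end

section \<open>Functions in L2 and semigroups\<close>

lemma AE_summable:
 fixes f :: "nat => 'a => real"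
 assumes f: "\<And>i. integrable M (f i)" and s: "summable (\<lambda>i. \<integral>x. \<bar>f i x\<bar> \<partial>M)"
 shows "AE x in M. summable (\<lambda>i. \<bar>f i x\<bar>)"
proof -
 have m: "(\<lambda>x. ennreal \<bar>f i x\<bar>) \<in> borel_measurable M" for i using f[of i] by measurable
 have "(\<integral>\<^sup>+x. (\<Sum>i. ennreal \<bar>f i x\<bar>) \<partial>M) = (\<Sum>i. \<integral>\<^sup>+x. ennreal \<bar>f i x\<bar> \<partial>M)"
  by (rule nn_integral_suminf[OF m])
 also have "... = (\<Sum>i. ennreal (\<integral>x. \<bar>f i x\<bar> \<partial>M))"
  by (intro suminf_cong nn_integral_eq_integral) (use f in auto)
 also have "... = ennreal (\<Sum>i. \<integral>x. \<bar>f i x\<bar> \<partial>M)" by (rule suminf_ennreal2[OF _ s]) simp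
 also have "... \<noteq> \<infinity>" by simp
 finally have "(\<integral>\<^sup>+x. (\<Sum>i. ennreal \<bar>f i x\<bar>) \<partial>M) \<noteq> \<infinity>" .
 hence "AE x in M. (\<Sum>i. ennreal \<bar>f i x\<bar>) \<noteq> \<infinity>" by (rule nn_integral_PInf_AE[rotated]) (use m in measurable)
 thus ?thesis by eventually_elim (auto intro: summable_suminf_not_top)
qed

lemma integrable_square_sum:
 fixes f g :: "'a => real"
 assumes "L2 M f" "L2 M g" shows "integrable M (\<lambda>x. f x * g x)"
proof (rule Bochner_Integration.integrable_bound[of M "\<lambda>x. (f x)\<^sup>2 + (g x)\<^sup>2"])
 show "integrable M (\<lambda>x. (f x)\<^sup>2 + (g x)\<^sup>2)" using assms by (auto simp: L2_def)
 show "(\<lambda>x. f x * g x) \<in> borel_measurable M" using assms by (auto simp: L2_def)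
 have "\<bar>a * b\<bar> \<le> a\<^sup>2 + b\<^sup>2" for a b :: real
 proof -
  have "2 * (\<bar>a\<bar> * \<bar>b\<bar>) \<le> a\<^sup>2 + b\<^sup>2" using sum_squares_bound[of "\<bar>a\<bar>" "\<bar>b\<bar>"] by simp
  moreover have "0 \<le> \<bar>a\<bar> * \<bar>b\<bar>" by simp
  ultimately show ?thesis unfolding abs_mult by linarith
 qed
 thus "AE x in M. norm (f x * g x) \<le> norm ((f x)\<^sup>2 + (g x)\<^sup>2)" by (intro AE_I2) (simp add: abs_mult)
qed

lemma L2_lin:
 assumes "L2 M f" "L2 M g" shows "L2 M (\<lambda>x. a * f x + b * g x)"
proof -
 have "integrable M (\<lambda>x. a\<^sup>2 * (f x)\<^sup>2 + 2 * a * b * (f x * g x) + b\<^sup>2 * (g x)\<^sup>2)"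
  using assms integrable_square_sum[OF assms] by (auto simp: L2_def)
 moreover have "(\<lambda>x. (a * f x + b * g x)\<^sup>2) = (\<lambda>x. a\<^sup>2 * (f x)\<^sup>2 + 2 * a * b * (f x * g x) + b\<^sup>2 * (g x)\<^sup>2)"
  by (auto simp: power2_eq_square algebra_simps)
 ultimately show ?thesis using assms by (auto simp: L2_def)
qed

lemma L2_cmult: "L2 M f ==> L2 M (\<lambda>x. a * f x)" using L2_lin[of M f f a 0] by simp

lemma L2_diff: "L2 M f ==> L2 M g ==> L2 M (\<lambda>x. f x - g x)" using L2_lin[of M f g 1 "-1"] by simp

lemma L2_add: "L2 M f ==> L2 M g ==> L2 M (\<lambda>x. f x + g x)" using L2_lin[of M f g 1 1] by simp

lemma L2_zero: "L2 M (\<lambda>x. 0)" by (simp add: L2_def)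

lemma L2_sum: "finite I ==> (\<And>i. i \<in> I ==> L2 M (f i)) ==> L2 M (\<lambda>x. \<Sum>i\<in>I. f i x)"
 by (induction I rule: finite_induct) (auto simp: L2_zero L2_add)

lemma L2_sq: "L2 M f ==> integrable M (\<lambda>x. (f x)\<^sup>2)" and L2_measurable: "L2 M f ==> f \<in> borel_measurable M"
 by (auto simp: L2_def)

lemma nrm2_nonneg [simp]: "0 \<le> nrm2 M f" by (simp add: nrm2_def)

lemma nrm2_sq: "(nrm2 M f)\<^sup>2 = (\<integral>x. (f x)\<^sup>2 \<partial>M)" by (simp add: nrm2_def)

lemma L2_Cauchy_Schwarz:
 assumes f: "L2 M f" and g: "L2 M g"
 shows "\<bar>\<integral>x. f x * g x \<partial>M\<bar> \<le> nrm2 M f * nrm2 M g"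
proof -
 have "(\<integral>x. f x * g x \<partial>M)\<^sup>2 \<le> (\<integral>x. (f x)\<^sup>2 \<partial>M) * (\<integral>x. (g x)\<^sup>2 \<partial>M)"
 proof (rule discriminant_le)
  fix a
  have "0 \<le> (\<integral>x. (f x - a * g x)\<^sup>2 \<partial>M)" by simp
  also have "(\<lambda>x. (f x - a * g x)\<^sup>2) = (\<lambda>x. (f x)\<^sup>2 - 2 * a * (f x * g x) + a\<^sup>2 * (g x)\<^sup>2)"
   by (auto simp: power2_eq_square algebra_simps)
  also have "(\<integral>x. (f x)\<^sup>2 - 2 * a * (f x * g x) + a\<^sup>2 * (g x)\<^sup>2 \<partial>M)
    = (\<integral>x. (f x)\<^sup>2 \<partial>M) - 2 * a * (\<integral>x. f x * g x \<partial>M) + a\<^sup>2 * (\<integral>x. (g x)\<^sup>2 \<partial>M)"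
   using L2_sq[OF f] L2_sq[OF g] integrable_square_sum[OF f g] by simp
  finally show "0 \<le> (\<integral>x. (f x)\<^sup>2 \<partial>M) - 2 * a * (\<integral>x. f x * g x \<partial>M) + a\<^sup>2 * (\<integral>x. (g x)\<^sup>2 \<partial>M)" .
 qed simp
 hence "\<bar>\<integral>x. f x * g x \<partial>M\<bar>\<^sup>2 \<le> (nrm2 M f * nrm2 M g)\<^sup>2"
  by (simp add: power_mult_distrib nrm2_sq)
 thus ?thesis by (rule power2_le_imp_le) simp
qed

lemma nrm2_expand:
 assumes "L2 M f" "L2 M g"
 shows "(nrm2 M (\<lambda>x. f x + g x))\<^sup>2 = (nrm2 M f)\<^sup>2 + 2 * (\<integral>x. f x * g x \<partial>M) + (nrm2 M g)\<^sup>2"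
proof -
 have "(\<lambda>x. (f x + g x)\<^sup>2) = (\<lambda>x. (f x)\<^sup>2 + 2 * (f x * g x) + (g x)\<^sup>2)"
  by (auto simp: power2_eq_square algebra_simps)
 thus ?thesis using L2_sq[OF assms(1)] L2_sq[OF assms(2)] integrable_square_sum[OF assms] by (simp add: nrm2_sq)
qed

lemma nrm2_triangle:
 assumes "L2 M f" "L2 M g"
 shows "nrm2 M (\<lambda>x. f x + g x) \<le> nrm2 M f + nrm2 M g"
proof (rule power2_le_imp_le)
 show "(nrm2 M (\<lambda>x. f x + g x))\<^sup>2 \<le> (nrm2 M f + nrm2 M g)\<^sup>2"
  using L2_Cauchy_Schwarz[OF assms] unfolding nrm2_expand[OF assms] by (simp add: power2_sum)
qed simp

lemma nrm2_cmult: "nrm2 M (\<lambda>x. c * f x) = \<bar>c\<bar> * nrm2 M f" by (simp add: nrm2_def power_mult_distrib real_sqrt_mult)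

lemma nrm2_minus_commute: "nrm2 M (\<lambda>x. f x - g x) = nrm2 M (\<lambda>x. g x - f x)" by (simp add: nrm2_def power2_commute)

lemma nrm2_dist_triangle:
 assumes "L2 M f" "L2 M g" "L2 M h"
 shows "nrm2 M (\<lambda>x. f x - h x) \<le> nrm2 M (\<lambda>x. f x - g x) + nrm2 M (\<lambda>x. g x - h x)"
 using nrm2_triangle[OF L2_diff[OF assms(1,2)] L2_diff[OF assms(2,3)]] by simp

lemma nrm2_diff_le:
 assumes "L2 M f" "L2 M g" shows "\<bar>nrm2 M f - nrm2 M g\<bar> \<le> nrm2 M (\<lambda>x. f x - g x)"
 using nrm2_dist_triangle[OF assms L2_zero] nrm2_dist_triangle[OF assms(2,1) L2_zero] nrm2_minus_commute[of M f g] by simp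

lemma nrm2_cong_AE:
 assumes "L2 M f" "L2 M g" "AE x in M. f x = g x" shows "nrm2 M f = nrm2 M g"
proof -
 have "(\<integral>x. (f x)\<^sup>2 \<partial>M) = (\<integral>x. (g x)\<^sup>2 \<partial>M)"
  by (rule integral_cong_AE) (use assms in \<open>auto simp: L2_def\<close>)
 thus ?thesis by (simp add: nrm2_def)
qed

lemma nrm2_sum:
 assumes "finite I" "\<And>i. i \<in> I ==> L2 M (f i)"
 shows "nrm2 M (\<lambda>x. \<Sum>i\<in>I. f i x) \<le> (\<Sum>i\<in>I. nrm2 M (f i))" using assms
proof (induction I rule: finite_induct)
 case empty
 thus ?case by (simp add: nrm2_def)
next
 case (insert i I)
 have "nrm2 M (\<lambda>x. f i x + (\<Sum>i\<in>I. f i x)) \<le> nrm2 M (f i) + nrm2 M (\<lambda>x. \<Sum>i\<in>I. f i x)"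
  by (rule nrm2_triangle) (use insert in \<open>auto intro: L2_sum\<close>)
 thus ?case using insert by simp
qed

context prob_space
begin

lemma L2_const: "L2 M (\<lambda>x. c)" by (simp add: L2_def)

lemma nrm2_const: "nrm2 M (\<lambda>x. c) = \<bar>c\<bar>" by (simp add: nrm2_def prob_space)

lemma L2_integrable: "L2 M f ==> integrable M f" using integrable_square_sum[OF _ L2_const[of 1]] by simp

lemma L2_integral_le: "L2 M f ==> \<bar>\<integral>x. f x \<partial>M\<bar> \<le> nrm2 M f"
 using L2_Cauchy_Schwarz[OF _ L2_const[of 1]] by (simp add: nrm2_const)

lemma L2_bounded:
 assumes "f \<in> borel_measurable M" "\<And>x. x \<in> space M ==> \<bar>f x\<bar> \<le> K"
 shows "L2 M f"
proof -
 have "integrable M (\<lambda>x. (f x)\<^sup>2)"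
 proof (rule integrable_const_bound[where B="K\<^sup>2"])
  show "AE x in M. norm ((f x)\<^sup>2) \<le> K\<^sup>2"
  proof (rule AE_I2)
   fix x assume "x \<in> space M"
   hence "\<bar>f x\<bar>\<^sup>2 \<le> K\<^sup>2" by (intro power_mono assms(2)) auto
   thus "norm ((f x)\<^sup>2) \<le> K\<^sup>2" by simp
  qed
 qed (use assms in auto)
 thus ?thesis using assms(1) by (simp add: L2_def)
qed

text \<open>Riesz-Fischer for functions instead of classes: the limit is the pointwise limit along a
  subsequence with summable increments, and Fatou's lemma gives the norm estimate.\<close>

lemma L2_complete:
 assumes f: "\<And>n. L2 M (f n)"
  and c: "\<And>e. 0 < e ==> \<exists>K. \<forall>m\<ge>K. \<forall>n\<ge>K. nrm2 M (\<lambda>x. f m x - f n x) \<le> e"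
 obtains g where "L2 M g" "(\<lambda>n. nrm2 M (\<lambda>x. f n x - g x)) \<longlonglongrightarrow> 0"
proof -
 have "\<forall>j. \<exists>K. \<forall>m\<ge>K. \<forall>n\<ge>K. nrm2 M (\<lambda>x. f m x - f n x) \<le> (1 / 2) ^ j" using c by simp
 then obtain K where K: "\<And>j m n. K j \<le> m ==> K j \<le> n ==> nrm2 M (\<lambda>x. f m x - f n x) \<le> (1 / 2) ^ j" by metis
 \<comment> \<open>A sum of the thresholds dominates all earlier ones, so the subsequence meets
   every \<open>K i\<close> with i at most j.\<close>
 define k where "k j = (\<Sum>i\<le>j. K i)" for j
 have kK: "K i \<le> k j" if "i \<le> j" for i j unfolding k_def by (rule member_le_sum) (use that in auto)
 define d where "d j = (\<lambda>x. f (k (Suc j)) x - f (k j) x)" for j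
 have Ld: "L2 M (d j)" for j unfolding d_def by (rule L2_diff[OF f f])
 have id: "(\<integral>x. \<bar>d j x\<bar> \<partial>M) \<le> (1 / 2) ^ j" for j
 proof -
  have "(\<lambda>x. \<bar>d j x\<bar>) \<in> borel_measurable M" by (rule borel_measurable_abs[OF L2_measurable[OF Ld]])
  hence "L2 M (\<lambda>x. \<bar>d j x\<bar>)" using Ld[of j] by (simp add: L2_def)
  hence "(\<integral>x. \<bar>d j x\<bar> \<partial>M) \<le> nrm2 M (\<lambda>x. \<bar>d j x\<bar>)" using L2_integral_le by fastforce
  also have "... = nrm2 M (d j)" by (simp add: nrm2_def)
  also have "... \<le> (1 / 2) ^ j" unfolding d_def by (rule K) (simp_all add: kK)
  finally show ?thesis .
 qed
 have "summable (\<lambda>j. \<integral>x. \<bar>d j x\<bar> \<partial>M)"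
  by (rule summable_comparison_test'[of "\<lambda>j. (1 / 2) ^ j" 0]) (use id in auto)
 hence "AE x in M. summable (\<lambda>j. \<bar>d j x\<bar>)" by (rule AE_summable[rotated]) (rule L2_integrable[OF Ld])
 define g where "g x = lim (\<lambda>j. f (k j) x)" for x
 have gm: "g \<in> borel_measurable M" unfolding g_def by (rule borel_measurable_lim_metric) (rule L2_measurable[OF f])
 have lim: "AE x in M. (\<lambda>j. f (k j) x) \<longlonglongrightarrow> g x"
  using \<open>AE x in M. summable (\<lambda>j. \<bar>d j x\<bar>)\<close>
 proof eventually_elim
  case (elim x)
  hence "summable (\<lambda>j. d j x)" by (rule summable_rabs_cancel)
  hence "(\<lambda>n. f (k 0) x + (\<Sum>j<n. d j x)) \<longlonglongrightarrow> f (k 0) x + (\<Sum>j. d j x)"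
   by (intro tendsto_add tendsto_const summable_LIMSEQ)
  moreover have "f (k 0) x + (\<Sum>j<n. d j x) = f (k n) x" for n
   unfolding d_def by (simp add: sum_lessThan_telescope[of "\<lambda>j. f (k j) x"])
  ultimately show ?case unfolding g_def by (simp add: limI)
 qed
 have fat: "integrable M (\<lambda>x. (f m x - g x)\<^sup>2) \<and> nrm2 M (\<lambda>x. f m x - g x) \<le> (1 / 2) ^ i" if m: "K i \<le> m" for m i
 proof -
  let ?u = "\<lambda>j x. ennreal ((f m x - f (k j) x)\<^sup>2)"
  have um: "?u j \<in> borel_measurable M" for j using L2_measurable[OF f] by measurable
  have "(\<integral>\<^sup>+x. ennreal ((f m x - g x)\<^sup>2) \<partial>M) = (\<integral>\<^sup>+x. liminf (\<lambda>j. ?u j x) \<partial>M)"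
  proof (rule nn_integral_cong_AE)
   show "AE x in M. ennreal ((f m x - g x)\<^sup>2) = liminf (\<lambda>j. ?u j x)" using lim
   proof eventually_elim
    case (elim x)
    have "(\<lambda>j. ?u j x) \<longlonglongrightarrow> ennreal ((f m x - g x)\<^sup>2)" by (intro tendsto_ennrealI tendsto_intros elim)
    thus ?case using lim_imp_Liminf[OF trivial_limit_sequentially] by metis
   qed
  qed
  also have "... \<le> liminf (\<lambda>j. \<integral>\<^sup>+x. ?u j x \<partial>M)" by (rule nn_integral_liminf[OF um])
  also have "... \<le> ennreal (((1 / 2) ^ i)\<^sup>2)"
  proof (rule Liminf_le)
   show "\<forall>\<^sub>F j in sequentially. (\<integral>\<^sup>+x. ?u j x \<partial>M) \<le> ennreal (((1 / 2) ^ i)\<^sup>2)"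
    unfolding eventually_sequentially
   proof (intro exI[of _ i] allI impI)
    fix j assume "i \<le> j"
    have "(\<integral>\<^sup>+x. ?u j x \<partial>M) = ennreal ((nrm2 M (\<lambda>x. f m x - f (k j) x))\<^sup>2)"
     unfolding nrm2_sq by (rule nn_integral_eq_integral) (use L2_sq[OF L2_diff[OF f f]] in auto)
    also have "... \<le> ennreal (((1 / 2) ^ i)\<^sup>2)"
     by (intro ennreal_leI power_mono K m) (use kK[OF \<open>i \<le> j\<close>] in auto)
    finally show "(\<integral>\<^sup>+x. ?u j x \<partial>M) \<le> ennreal (((1 / 2) ^ i)\<^sup>2)" .
   qed
  qed simp
  finally have le: "(\<integral>\<^sup>+x. ennreal ((f m x - g x)\<^sup>2) \<partial>M) \<le> ennreal (((1 / 2) ^ i)\<^sup>2)" .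
  have "integrable M (\<lambda>x. (f m x - g x)\<^sup>2)"
   by (rule integrableI_bounded) (use le gm L2_measurable[OF f] in \<open>auto intro: le_less_trans\<close>)
  moreover have "(nrm2 M (\<lambda>x. f m x - g x))\<^sup>2 \<le> ((1 / 2) ^ i)\<^sup>2"
   unfolding nrm2_sq by (rule integral_real_bounded[OF _ le]) simp
  hence "nrm2 M (\<lambda>x. f m x - g x) \<le> (1 / 2) ^ i" by (rule power2_le_imp_le) simp
  ultimately show ?thesis by simp
 qed
 have "L2 M (\<lambda>x. f (K 0) x - g x)" using fat[of 0 "K 0"] gm L2_measurable[OF f] by (auto simp: L2_def)
 from L2_diff[OF f[of "K 0"] this] have g: "L2 M g" by simp
 have "(\<lambda>n. nrm2 M (\<lambda>x. f n x - g x)) \<longlonglongrightarrow> 0"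
 proof (rule LIMSEQ_I)
  fix r :: real assume "0 < r"
  then obtain i where i: "(1 / 2) ^ i < r" using real_arch_pow_inv[of r "1 / 2"] by auto
  show "\<exists>no. \<forall>n\<ge>no. norm (nrm2 M (\<lambda>x. f n x - g x) - 0) < r"
   by (rule exI[of _ "K i"]) (use fat i in \<open>auto intro: le_less_trans\<close>)
 qed
 thus thesis using that g by blast
qed

end

section \<open>Contraction semigroups: dissipation and density of the domain\<close>

locale l2_semigroup = prob_space M for M :: "'a measure" +
 fixes P :: "real => ('a => real) => ('a => real)"
 assumes sg: "C0_contraction_semigroup M P"
begin

abbreviation "N \<equiv> nrm2 M"

lemma P_L2: "0 \<le> t ==> L2 M f ==> L2 M (P t f)" using sg unfolding C0_contraction_semigroup_def by blast

lemma P_lin: "0 \<le> t ==> L2 M f ==> L2 M g ==> AE x in M. P t (\<lambda>y. a * f y + b * g y) x = a * P t f x + b * P t g x"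
 using sg unfolding C0_contraction_semigroup_def by blast

lemma P_zero: "L2 M f ==> AE x in M. P 0 f x = f x" using sg unfolding C0_contraction_semigroup_def by blast

lemma P_add: "0 \<le> s ==> 0 \<le> t ==> L2 M f ==> AE x in M. P (s + t) f x = P s (P t f) x"
 using sg unfolding C0_contraction_semigroup_def by blast

lemma P_contract: "0 \<le> t ==> L2 M f ==> N (P t f) \<le> N f" using sg unfolding C0_contraction_semigroup_def by blast

lemma P_cont: "L2 M f ==> ((\<lambda>t. N (\<lambda>x. P t f x - f x)) \<longlongrightarrow> 0) (at_right 0)"
 using sg unfolding C0_contraction_semigroup_def by blast

lemma P_diff: "0 \<le> t ==> L2 M f ==> L2 M g ==> AE x in M. P t (\<lambda>y. f y - g y) x = P t f x - P t g x"
 using P_lin[of t f g 1 "-1"] by simp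

lemma P_dist: "0 \<le> t ==> L2 M f ==> L2 M g ==> N (\<lambda>x. P t f x - P t g x) \<le> N (\<lambda>x. f x - g x)"
proof -
 assume a: "0 \<le> t" "L2 M f" "L2 M g"
 have "N (\<lambda>x. P t f x - P t g x) = N (P t (\<lambda>x. f x - g x))"
  by (rule nrm2_cong_AE) (use P_diff[OF a] a in \<open>auto intro!: L2_diff P_L2\<close>)
 also have "... \<le> N (\<lambda>x. f x - g x)" using a by (intro P_contract L2_diff)
 finally show ?thesis .
qed

lemma P_sum:
 assumes t: "0 \<le> t" and I: "finite I" and f: "\<And>i. i \<in> I ==> L2 M (f i)"
 shows "AE x in M. P t (\<lambda>y. c * (\<Sum>i\<in>I. f i y)) x = c * (\<Sum>i\<in>I. P t (f i) x)" using I f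
proof (induction I rule: finite_induct)
 case empty
 show ?case using P_lin[OF t L2_zero L2_zero, of 0 0] by simp
next
 case (insert i I)
 have L: "L2 M (f i)" "L2 M (\<lambda>y. c * (\<Sum>i\<in>I. f i y))" using insert by (auto intro!: L2_cmult L2_sum)
 have "AE x in M. P t (\<lambda>y. c * (\<Sum>i\<in>I. f i y)) x = c * (\<Sum>i\<in>I. P t (f i) x)" using insert by simp
 moreover have "AE x in M. P t (\<lambda>y. c * f i y + 1 * (c * (\<Sum>i\<in>I. f i y))) x = c * P t (f i) x + 1 * P t (\<lambda>y. c * (\<Sum>i\<in>I. f i y)) x"
  by (rule P_lin[OF t L])
 ultimately show ?case by eventually_elim (use insert(1,2) in \<open>simp add: distrib_left\<close>)
qed

lemma generator_P:
 assumes t: "0 \<le> t" and g: "generator_graph M P f h"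
 shows "generator_graph M P (P t f) (P t h)"
proof -
 have L: "L2 M f" "L2 M h" and lim: "((\<lambda>s. N (\<lambda>x. (P s f x - f x) / s - h x)) \<longlongrightarrow> 0) (at_right 0)"
  using g unfolding generator_graph_def by auto
 have "((\<lambda>s. N (\<lambda>x. (P s (P t f) x - P t f x) / s - P t h x)) \<longlongrightarrow> 0) (at_right 0)"
 proof (rule tendsto_sandwich[OF _ _ tendsto_const lim])
  show "\<forall>\<^sub>F s in at_right 0. N (\<lambda>x. (P s (P t f) x - P t f x) / s - P t h x) \<le> N (\<lambda>x. (P s f x - f x) / s - h x)"
   using eventually_at_right_less[of 0]
  proof eventually_elim
   case (elim s)
   hence s: "0 \<le> s" by simp
   let ?u = "\<lambda>x. (1 / s) * (P s f x - f x)"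
   have Lu: "L2 M ?u" using L s by (intro L2_cmult L2_diff P_L2)
   have "AE x in M. P s (P t f) x = P t (P s f) x" using P_add[OF s t L(1)] P_add[OF t s L(1)] by eventually_elim (simp add: add.commute)
   moreover have e: "(\<lambda>x. (1 / s) * P s f x + (- 1 / s) * f x) = ?u" by (simp add: diff_divide_distrib)
   have "AE x in M. P t (\<lambda>x. (1 / s) * P s f x + (- 1 / s) * f x) x = (1 / s) * P t (P s f) x + (- 1 / s) * P t f x"
    by (rule P_lin) (use t L s in \<open>auto intro: P_L2\<close>)
   note this[unfolded e]
   ultimately have ae: "AE x in M. (P s (P t f) x - P t f x) / s = P t ?u x" by eventually_elim (simp add: diff_divide_distrib)
   have "N (\<lambda>x. (P s (P t f) x - P t f x) / s - P t h x) = N (\<lambda>x. P t ?u x - P t h x)"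
   proof (rule nrm2_cong_AE)
    have "L2 M (\<lambda>x. (1 / s) * (P s (P t f) x - P t f x) - P t h x)" using L s t by (intro L2_cmult L2_diff P_L2)
    thus "L2 M (\<lambda>x. (P s (P t f) x - P t f x) / s - P t h x)" by simp
    show "L2 M (\<lambda>x. P t ?u x - P t h x)" using Lu L t by (intro L2_diff P_L2)
    show "AE x in M. (P s (P t f) x - P t f x) / s - P t h x = P t ?u x - P t h x" using ae by eventually_elim simp
   qed
   also have "... \<le> N (\<lambda>x. ?u x - h x)" by (rule P_dist[OF t Lu L(2)])
   finally show ?case by simp
  qed
 qed simp
 thus ?thesis using L t by (auto simp: generator_graph_def P_L2)
qed

lemma P_cont_uniform:
 assumes "L2 M f" "0 < e"
 obtains b where "0 < b" "\<And>s. 0 \<le> s ==> s < b ==> N (\<lambda>x. P s f x - f x) < e"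
proof -
 have "\<forall>\<^sub>F s in at_right 0. N (\<lambda>x. P s f x - f x) < e" using order_tendstoD(2)[OF P_cont[OF assms(1)] assms(2)] .
 then obtain b where b: "0 < b" "\<And>s. 0 < s ==> s < b ==> N (\<lambda>x. P s f x - f x) < e"
  unfolding eventually_at_right[OF zero_less_one] by blast
 have "N (\<lambda>x. P 0 f x - f x) = N (\<lambda>x. 0)"
  by (rule nrm2_cong_AE[OF _ L2_zero]) (use P_zero[OF assms(1)] assms(1) P_L2[of 0] in \<open>auto intro: L2_diff\<close>)
 hence "N (\<lambda>x. P 0 f x - f x) < e" using assms(2) by (simp add: nrm2_def)
 thus thesis using that[of b] b by (metis order_le_less)
qed

lemma P_dist_shift:
 assumes "L2 M f" "0 \<le> s" "0 \<le> t"
 shows "N (\<lambda>x. P (s + t) f x - P s f x) \<le> N (\<lambda>x. P t f x - f x)"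
proof -
 have "N (\<lambda>x. P (s + t) f x - P s f x) = N (\<lambda>x. P s (P t f) x - P s f x)"
  by (rule nrm2_cong_AE) (use P_add[OF assms(2,3,1)] assms in \<open>auto intro!: L2_diff P_L2\<close>)
 also have "... \<le> N (\<lambda>x. P t f x - f x)" using assms by (intro P_dist P_L2)
 finally show ?thesis .
qed

end

lemma sum_shift_diff:
 fixes F :: "nat => real"
 shows "(\<Sum>k<n. F (J + k)) - (\<Sum>k<n. F k) = (\<Sum>i<J. F (i + n) - F i)"
proof (induction J)
 case (Suc J)
 have "(\<Sum>k<n. F (Suc J + k)) + F J = (\<Sum>k<Suc n. F (J + k))" unfolding sum.lessThan_Suc_shift by simp
 also have "... = (\<Sum>k<n. F (J + k)) + F (J + n)" by simp
 finally show ?case using Suc by simp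
qed simp

lemma nrm2_triangle5:
 assumes "L2 M a" "L2 M b" "L2 M c" "L2 M d" "L2 M e"
 shows "nrm2 M (\<lambda>x. a x + (b x + (c x + (d x + e x)))) \<le> nrm2 M a + (nrm2 M b + (nrm2 M c + (nrm2 M d + nrm2 M e)))"
proof -
 have L: "L2 M (\<lambda>x. d x + e x)" "L2 M (\<lambda>x. c x + (d x + e x))" "L2 M (\<lambda>x. b x + (c x + (d x + e x)))"
  by (intro L2_add assms)+
 show ?thesis
  using nrm2_triangle[OF assms(1) L(3)] nrm2_triangle[OF assms(2) L(2)] nrm2_triangle[OF assms(3) L(1)] nrm2_triangle[OF assms(4,5)]
  by linarith
qed

context l2_semigroup
begin

text \<open>The remainder of the first-order expansion at time t is \<open>P t\<close> applied to
  the remainder at time 0; contractivity makes it uniform in t.\<close>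

lemma generator_step:
 assumes g: "generator_graph M P g h" and e: "0 < e"
 obtains b where "0 < b" "\<And>s t. 0 < s ==> s < b ==> 0 \<le> t ==>
  N (\<lambda>x. P (t + s) g x - P t g x - s * P t h x) \<le> s * e"
proof -
 have L: "L2 M g" "L2 M h" and lim: "((\<lambda>s. N (\<lambda>x. (P s g x - g x) / s - h x)) \<longlongrightarrow> 0) (at_right 0)"
  using g unfolding generator_graph_def by auto
 obtain b where b: "0 < b" "\<And>s. 0 < s ==> s < b ==> N (\<lambda>x. (P s g x - g x) / s - h x) < e"
  using order_tendstoD(2)[OF lim e] unfolding eventually_at_right[OF zero_less_one] by blast
 show thesis
 proof (rule that[OF b(1)])
  fix s t :: real assume s: "0 < s" "s < b" and t: "0 \<le> t"
  let ?r = "\<lambda>x. 1 * P s g x + (- 1) * (1 * g x + s * h x)"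
  have Ls: "L2 M (P s g)" using s L by (intro P_L2) auto
  have Lg: "L2 M (\<lambda>x. 1 * g x + s * h x)" by (rule L2_lin[OF L])
  have Lr: "L2 M ?r" by (rule L2_lin[OF Ls Lg])
  have "AE x in M. P t ?r x = 1 * P t (P s g) x + (- 1) * P t (\<lambda>x. 1 * g x + s * h x) x" by (rule P_lin[OF t Ls Lg])
  moreover have "AE x in M. P t (\<lambda>x. 1 * g x + s * h x) x = 1 * P t g x + s * P t h x" by (rule P_lin[OF t L])
  moreover have "AE x in M. P (t + s) g x = P t (P s g) x" by (rule P_add) (use s t L in auto)
  ultimately have ae: "AE x in M. P (t + s) g x - P t g x - s * P t h x = P t ?r x" by eventually_elim simp
  have "N (\<lambda>x. P (t + s) g x - P t g x - s * P t h x) = N (P t ?r)"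
   by (rule nrm2_cong_AE[OF _ P_L2[OF t Lr] ae]) (use s t L in \<open>auto intro!: L2_diff L2_cmult P_L2\<close>)
  also have "... \<le> N ?r" by (rule P_contract[OF t Lr])
  also have "?r = (\<lambda>x. s * ((P s g x - g x) / s - h x))" by (rule ext) (use s in \<open>simp add: field_simps\<close>)
  also have "N ... = s * N (\<lambda>x. (P s g x - g x) / s - h x)" unfolding nrm2_cmult using s by simp
  also have "... \<le> s * e" using b(2)[OF s] s by (intro mult_left_mono) auto
  finally show "N (\<lambda>x. P (t + s) g x - P t g x - s * P t h x) \<le> s * e" .
 qed
qed

lemma P_antimono: "L2 M g ==> 0 \<le> s ==> 0 \<le> t ==> N (P (t + s) g) \<le> N (P t g)"
proof -
 assume a: "L2 M g" "0 \<le> s" "0 \<le> t"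
 have "N (P (t + s) g) = N (P s (P t g))"
  by (rule nrm2_cong_AE) (use P_add[OF a(2,3,1)] a in \<open>auto intro!: P_L2 simp: add.commute\<close>)
 also have "... \<le> N (P t g)" using a by (intro P_contract P_L2)
 finally show ?thesis .
qed

text \<open>The squared norm of \<open>P t g\<close> decreases and is bounded below, while a step of
  length s lowers it by about s times q. Once it is within s \<epsilon> / 4 of its infimum, q must
  be below \<epsilon> at every later time. Working with a fixed small step avoids any regularity of
  q in time.\<close>

lemma energy_decay:
 assumes g: "generator_graph M P g h"
  and q: "\<And>u v. generator_graph M P u v ==> 2 * (\<integral>x. u x * v x \<partial>M) \<le> - q u" "\<And>u. 0 \<le> q u"
 shows "((\<lambda>t. q (P t g)) \<longlongrightarrow> 0) at_top"
proof (rule order_tendstoI)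
 fix a :: real assume "a < 0"
 thus "\<forall>\<^sub>F t in at_top. a < q (P t g)" using q(2) by (intro always_eventually allI) (rule less_le_trans)
next
 fix \<epsilon> :: real assume e: "0 < \<epsilon>"
 have L: "L2 M g" "L2 M h" using g by (auto simp: generator_graph_def)
 \<comment> \<open>Chosen so that the first-order remainder contributes at most s \<epsilon> / 4 to
   the change of the squared norm; the added 1 avoids division by zero.\<close>
 define e' where "e' = \<epsilon> / (8 * (N g + 1))"
 have e': "0 < e'" unfolding e'_def using e by (intro divide_pos_pos) (auto intro: add_nonneg_pos)
 have Ng: "2 * N g * e' \<le> \<epsilon> / 4"
 proof -
  have c: "0 < N g + 1" by (simp add: add_nonneg_pos)
  hence "N g / (N g + 1) \<le> 1" by (simp add: divide_le_eq_1)
  hence "(\<epsilon> / 4) * (N g / (N g + 1)) \<le> (\<epsilon> / 4) * 1" using e by (intro mult_left_mono) auto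
  moreover have "2 * a * (\<epsilon> / (8 * c)) = (\<epsilon> / 4) * (a / c)" if "0 < c" for a c :: real using that by (simp add: field_simps)
  from this[OF c, of "N g"] have "2 * N g * e' = (\<epsilon> / 4) * (N g / (N g + 1))" unfolding e'_def .
  ultimately show ?thesis by linarith
 qed
 obtain b where b: "0 < b" "\<And>s t. 0 < s ==> s < b ==> 0 \<le> t ==>
  N (\<lambda>x. P (t + s) g x - P t g x - s * P t h x) \<le> s * e'" using generator_step[OF g e'] by blast
 define K where "K = (N h + e')\<^sup>2 + 1"
 have K: "0 < K" unfolding K_def by (simp add: add_nonneg_pos)
 \<comment> \<open>Small enough for the expansion and for the second-order term, the squared norm of
   the increment, to be at most s \<epsilon> / 4.\<close>
 define s where "s = min (b / 2) (\<epsilon> / (4 * K))"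
 have s: "0 < s" "s < b" "s * K \<le> \<epsilon> / 4" using b(1) e K unfolding s_def by (auto simp: min_def field_simps)
 have step: "s * q (P t g) \<le> (N (P t g))\<^sup>2 - (N (P (t + s) g))\<^sup>2 + s * (\<epsilon> / 2)" if t: "0 \<le> t" for t
 proof -
  let ?u = "P t g" and ?v = "P t h" and ?r = "\<lambda>x. P (t + s) g x - P t g x - s * P t h x"
  let ?w = "\<lambda>x. P (t + s) g x - P t g x"
  have Lu: "L2 M ?u" "L2 M ?v" "L2 M (P (t + s) g)" using t s L by (auto intro: P_L2)
  have Lw: "L2 M ?w" by (rule L2_diff[OF Lu(3,1)])
  have Lr: "L2 M ?r" by (rule L2_diff[OF Lw L2_cmult[OF Lu(2)]])
  have Nr: "N ?r \<le> s * e'" using b(2) s t by blast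
  have Nu: "N ?u \<le> N g" "N ?v \<le> N h" using P_contract t L by auto
  have "N (\<lambda>x. s * ?v x + ?r x) \<le> N (\<lambda>x. s * ?v x) + N ?r" by (rule nrm2_triangle[OF L2_cmult[OF Lu(2)] Lr])
  also have "N (\<lambda>x. s * ?v x) = s * N ?v" unfolding nrm2_cmult using s by simp
  also have "s * N ?v + N ?r \<le> s * N h + s * e'" using Nr Nu s by (intro add_mono mult_left_mono) auto
  finally have "N ?w \<le> s * (N h + e')" by (simp add: distrib_left)
  hence "(N ?w)\<^sup>2 \<le> (s * (N h + e'))\<^sup>2" by (intro power_mono) auto
  also have "... = s * (s * (N h + e')\<^sup>2)" by (simp add: power2_eq_square)
  also have "... \<le> s * (s * K)" using s by (intro mult_left_mono) (auto simp: K_def)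
  also have "... \<le> s * (\<epsilon> / 4)" using s by (intro mult_left_mono) auto
  finally have Nw: "(N ?w)\<^sup>2 \<le> s * (\<epsilon> / 4)" .
  have "(\<integral>x. ?u x * ?w x \<partial>M) = (\<integral>x. s * (?u x * ?v x) + ?u x * ?r x \<partial>M)"
   by (rule Bochner_Integration.integral_cong) (auto simp: algebra_simps)
  also have "... = s * (\<integral>x. ?u x * ?v x \<partial>M) + (\<integral>x. ?u x * ?r x \<partial>M)"
   using integrable_square_sum[OF Lu(1,2)] integrable_square_sum[OF Lu(1) Lr] by simp
  finally have "2 * (\<integral>x. ?u x * ?w x \<partial>M) = s * (2 * (\<integral>x. ?u x * ?v x \<partial>M)) + 2 * (\<integral>x. ?u x * ?r x \<partial>M)" by simp
  moreover have "s * (2 * (\<integral>x. ?u x * ?v x \<partial>M)) \<le> - (s * q ?u)"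
   using mult_left_mono[OF q(1)[OF generator_P[OF t g]], of s] s by simp
  moreover have "(\<integral>x. ?u x * ?r x \<partial>M) \<le> N g * (s * e')"
  proof -
   have "(\<integral>x. ?u x * ?r x \<partial>M) \<le> N ?u * N ?r" using L2_Cauchy_Schwarz[OF Lu(1) Lr] by linarith
   also have "... \<le> N g * (s * e')" using Nu Nr by (intro mult_mono) auto
   finally show ?thesis .
  qed
  moreover have "2 * (N g * (s * e')) \<le> s * (\<epsilon> / 4)" using mult_left_mono[OF Ng, of s] s by (simp add: algebra_simps)
  moreover have "(N (P (t + s) g))\<^sup>2 = (N ?u)\<^sup>2 + 2 * (\<integral>x. ?u x * ?w x \<partial>M) + (N ?w)\<^sup>2"
   using nrm2_expand[OF Lu(1) Lw] by simp
  moreover have "s * (\<epsilon> / 2) = s * (\<epsilon> / 4) + s * (\<epsilon> / 4)" by simp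
  ultimately show ?thesis using Nw by linarith
 qed
 define A where "A = (INF t\<in>{0..}. (N (P t g))\<^sup>2)"
 have bdd: "bdd_below ((\<lambda>t. (N (P t g))\<^sup>2) ` {0..})" by (rule bdd_belowI[of _ 0]) auto
 have "A < A + s * (\<epsilon> / 4)" using s e by simp
 then obtain T where T: "0 \<le> T" "(N (P T g))\<^sup>2 < A + s * (\<epsilon> / 4)"
  unfolding A_def using cINF_less_iff[OF _ bdd, of "A + s * (\<epsilon> / 4)"] by (auto simp: A_def)
 show "\<forall>\<^sub>F t in at_top. q (P t g) < \<epsilon>" using eventually_ge_at_top[of T]
 proof eventually_elim
  case (elim t)
  hence t: "0 \<le> t" using T by simp
  have "(N (P t g))\<^sup>2 \<le> (N (P T g))\<^sup>2" using P_antimono[OF L(1), of "t - T" T] elim T by (intro power_mono) auto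
  moreover have "A \<le> (N (P (t + s) g))\<^sup>2" unfolding A_def by (rule cINF_lower[OF bdd]) (use t s in auto)
  ultimately have "s * q (P t g) < s * (\<epsilon> / 4) + s * (\<epsilon> / 2)" using step[OF t] T by linarith
  hence "s * q (P t g) < s * (\<epsilon> / 4 + \<epsilon> / 2)" by (simp only: distrib_left)
  hence "q (P t g) < \<epsilon> / 4 + \<epsilon> / 2" using s by (simp only: mult_less_cancel_left_pos)
  thus ?case using e by simp
 qed
qed

text \<open>The mean has derivative zero. The interval from 0 to t is cut into n equal steps, each
  changing the mean by at most s \<epsilon> / t, which replaces integration in time.\<close>

lemma mean_const:
 assumes g: "generator_graph M P g h" and z: "\<And>u v. generator_graph M P u v ==> (\<integral>x. v x \<partial>M) = 0" and t: "0 \<le> t"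
 shows "(\<integral>x. P t g x \<partial>M) = (\<integral>x. g x \<partial>M)"
proof -
 have L: "L2 M g" "L2 M h" using g by (auto simp: generator_graph_def)
 have "\<bar>(\<integral>x. P t g x \<partial>M) - (\<integral>x. P 0 g x \<partial>M)\<bar> \<le> 0 + \<epsilon>" if e: "0 < \<epsilon>" for \<epsilon>
 proof (cases "t = 0")
  case False
  hence t: "0 < t" using t by simp
  have "0 < \<epsilon> / t" using e t by simp
  then obtain b where b: "0 < b" "\<And>s r. 0 < s ==> s < b ==> 0 \<le> r ==>
   N (\<lambda>x. P (r + s) g x - P r g x - s * P r h x) \<le> s * (\<epsilon> / t)" using generator_step[OF g] by blast
  obtain n where n: "t / b < real n" using reals_Archimedean2 by blast
  have "0 < t / b" using t b by simp
  hence n0: "0 < real n" using n by linarith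
  define s where "s = t / real n"
  have s: "0 < s" "s < b" using n n0 t b by (auto simp: s_def field_simps)
  have st: "\<bar>(\<integral>x. P (r + s) g x \<partial>M) - (\<integral>x. P r g x \<partial>M)\<bar> \<le> s * (\<epsilon> / t)" if r: "0 \<le> r" for r
  proof -
   have Lu: "L2 M (P r g)" "L2 M (P r h)" "L2 M (P (r + s) g)" using r s L by (auto intro: P_L2)
   have "(\<integral>x. P (r + s) g x - P r g x - s * P r h x \<partial>M) = (\<integral>x. P (r + s) g x \<partial>M) - (\<integral>x. P r g x \<partial>M) - s * (\<integral>x. P r h x \<partial>M)"
    using Lu[THEN L2_integrable] by simp
   moreover have "(\<integral>x. P r h x \<partial>M) = 0" by (rule z[OF generator_P[OF r g]])
   moreover have "\<bar>\<integral>x. P (r + s) g x - P r g x - s * P r h x \<partial>M\<bar> \<le> N (\<lambda>x. P (r + s) g x - P r g x - s * P r h x)"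
    by (rule L2_integral_le) (intro L2_diff L2_cmult Lu)
   ultimately show ?thesis using b(2)[OF s r] by simp
  qed
  have "\<bar>(\<integral>x. P (real k * s) g x \<partial>M) - (\<integral>x. P 0 g x \<partial>M)\<bar> \<le> real k * (s * (\<epsilon> / t))" for k
  proof (induction k)
   case (Suc k)
   have e: "real (Suc k) * s = real k * s + s" "real (Suc k) * (s * (\<epsilon> / t)) = real k * (s * (\<epsilon> / t)) + s * (\<epsilon> / t)"
    unfolding of_nat_Suc distrib_right by simp_all
   have "\<bar>(\<integral>x. P (real k * s + s) g x \<partial>M) - (\<integral>x. P (real k * s) g x \<partial>M)\<bar> \<le> s * (\<epsilon> / t)" by (rule st) (use s in simp)
   thus ?case unfolding e using Suc by linarith
  qed simp
  from this[of n] show ?thesis using n0 t by (simp add: s_def)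
 qed (use e in simp)
 hence "\<bar>(\<integral>x. P t g x \<partial>M) - (\<integral>x. P 0 g x \<partial>M)\<bar> \<le> 0" by (rule field_le_epsilon)
 moreover have "(\<integral>x. P 0 g x \<partial>M) = (\<integral>x. g x \<partial>M)"
  by (rule integral_cong_AE) (use P_zero[OF L(1)] P_L2[of 0 g] L in \<open>auto intro: L2_measurable\<close>)
 ultimately show ?thesis by simp
qed

section \<open>Dyadic averages along orbits, standing for a vector-valued integral\<close>

definition avg :: "real => ('a => real) => nat => 'a => real" where
 "avg s g n x = (1 / 2 ^ n) * (\<Sum>k<2 ^ n. P (real k * (s / 2 ^ n)) g x)"

lemma avg_L2: "0 \<le> s ==> L2 M g ==> L2 M (avg s g n)" unfolding avg_def by (intro L2_cmult L2_sum P_L2) auto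

text \<open>Shifting the Riemann sum by J nodes adds J terms at the end and drops J at the start.
  Paired with distance s they are the increments w transported to the first J nodes.\<close>

lemma avg_shift:
 fixes n :: nat
 assumes s: "0 < s" and g: "L2 M g"
 defines "h \<equiv> s / 2 ^ n" and "w \<equiv> \<lambda>x. P s g x - g x"
 shows "AE x in M. P (real J * h) (avg s g n) x - avg s g n x = (1 / 2 ^ n) * (\<Sum>i<J. P (real i * h) w x)"
proof -
 have h: "0 < h" "real (2 ^ n) * h = s" using s by (auto simp: h_def)
 have Lg: "L2 M (P (real k * h) g)" for k by (rule P_L2) (use h g in auto)
 have 1: "AE x in M. P (real J * h) (avg s g n) x = (1 / 2 ^ n) * (\<Sum>k<2 ^ n. P (real J * h) (P (real k * h) g) x)"
  unfolding avg_def h_def[symmetric] by (rule P_sum) (use h Lg in auto)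
 have 2: "AE x in M. \<forall>i k. P (real (i + k) * h) g x = P (real i * h) (P (real k * h) g) x" unfolding AE_all_countable
 proof (intro allI)
  fix i k
  have "AE x in M. P (real i * h + real k * h) g x = P (real i * h) (P (real k * h) g) x" by (rule P_add) (use h g in auto)
  thus "AE x in M. P (real (i + k) * h) g x = P (real i * h) (P (real k * h) g) x" by (simp add: distrib_right)
 qed
 have 3: "AE x in M. \<forall>i. P (real i * h) w x = P (real i * h) (P s g) x - P (real i * h) g x"
  unfolding AE_all_countable w_def by (intro allI P_diff) (use h g s in \<open>auto intro: P_L2\<close>)
 show ?thesis using 1 2 3
 proof eventually_elim
  case (elim x)
  have "P (real i * h) w x = P (real (i + 2 ^ n) * h) g x - P (real i * h) g x" for i
   using elim(2)[rule_format, of i "2 ^ n"] elim(3) h(2) by simp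
  hence "(\<Sum>i<J. P (real i * h) w x) = (\<Sum>i<J. P (real (i + 2 ^ n) * h) g x - P (real i * h) g x)" by simp
  also have "... = (\<Sum>k<2 ^ n. P (real (J + k) * h) g x) - (\<Sum>k<2 ^ n. P (real k * h) g x)" by (rule sum_shift_diff[symmetric])
  also have "(\<Sum>k<2 ^ n. P (real (J + k) * h) g x) = (\<Sum>k<2 ^ n. P (real J * h) (P (real k * h) g) x)" using elim(2) by simp
  finally show ?case unfolding elim(1) avg_def h_def[symmetric] by (simp add: right_diff_distrib)
 qed
qed

lemma nrm2_average:
 assumes "\<And>i. i < K ==> L2 M (f i)" "L2 M w" "\<And>i. i < K ==> N (\<lambda>x. f i x - w x) \<le> e" "0 \<le> c"
 shows "N (\<lambda>x. c * (\<Sum>i<K. f i x) - c * real K * w x) \<le> c * real K * e"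
proof -
 have "(\<lambda>x. c * (\<Sum>i<K. f i x) - c * real K * w x) = (\<lambda>x. c * (\<Sum>i<K. f i x - w x))"
  by (simp add: sum_subtractf right_diff_distrib mult.assoc)
 hence "N (\<lambda>x. c * (\<Sum>i<K. f i x) - c * real K * w x) = \<bar>c\<bar> * N (\<lambda>x. \<Sum>i<K. f i x - w x)"
  by (simp only: nrm2_cmult)
 hence "N (\<lambda>x. c * (\<Sum>i<K. f i x) - c * real K * w x) = c * N (\<lambda>x. \<Sum>i<K. f i x - w x)"
  using assms(4) by (simp only: abs_of_nonneg)
 also have "... \<le> c * (\<Sum>i<K. N (\<lambda>x. f i x - w x))"
  by (intro mult_left_mono nrm2_sum) (use assms in \<open>auto intro: L2_diff\<close>)
 also have "... \<le> c * (\<Sum>i<K. e)" by (intro mult_left_mono sum_mono) (use assms in auto)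
 finally show ?thesis by simp
qed

lemma avg_near:
 assumes s: "0 < s" and g: "L2 M g" and e: "\<And>r. 0 \<le> r ==> r < s ==> N (\<lambda>x. P r g x - g x) \<le> e"
 shows "N (\<lambda>x. avg s g n x - g x) \<le> e"
proof -
 have "N (\<lambda>x. (1 / 2 ^ n) * (\<Sum>k<2 ^ n. P (real k * (s / 2 ^ n)) g x) - (1 / 2 ^ n) * real (2 ^ n) * g x) \<le> (1 / 2 ^ n) * real (2 ^ n) * e"
 proof (rule nrm2_average[OF P_L2 g e])
  fix i :: nat assume "i < 2 ^ n"
  hence "real i < 2 ^ n" using of_nat_less_iff[of i "2 ^ n", where ?'a=real] by simp
  thus "real i * (s / 2 ^ n) < s" using s by (simp add: field_simps)
 qed (use s g in auto)
 thus ?thesis by (simp add: avg_def)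
qed

text \<open>On the finer mesh each old node is replaced by the average over its cell, whose points
  lie within one old mesh width; contractivity carries the bound at time 0 to every node.\<close>

lemma avg_refine:
 assumes s: "0 < s" and g: "L2 M g" and e: "\<And>r. 0 \<le> r ==> r < s / 2 ^ n ==> N (\<lambda>x. P r g x - g x) \<le> e"
 shows "N (\<lambda>x. avg s g (n + m) x - avg s g n x) \<le> e"
proof -
 define h where "h = s / 2 ^ n"
 have h: "0 < h" using s by (simp add: h_def)
 have hh: "h / 2 ^ m = s / 2 ^ (n + m)" by (simp add: h_def power_add)
 let ?f = "\<lambda>k x. (1 / 2 ^ m) * (\<Sum>j<2 ^ m. P (real k * h + real j * (h / 2 ^ m)) g x)"
 have regroup: "avg s g (n + m) x = (1 / 2 ^ n) * (\<Sum>k<2 ^ n. ?f k x)" for x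
 proof -
  have "(\<Sum>k<2 ^ n. \<Sum>j\<in>{k * 2 ^ m..<k * 2 ^ m + 2 ^ m}. P (real j * (h / 2 ^ m)) g x) = (\<Sum>j<2 ^ n * 2 ^ m. P (real j * (h / 2 ^ m)) g x)"
   by (rule sum.nat_group)
  moreover have "(\<Sum>j\<in>{k * 2 ^ m..<k * 2 ^ m + 2 ^ m}. P (real j * (h / 2 ^ m)) g x) = (\<Sum>j<2 ^ m. P (real k * h + real j * (h / 2 ^ m)) g x)" for k
  proof -
   have "(\<Sum>j\<in>{0 + k * 2 ^ m..<2 ^ m + k * 2 ^ m}. P (real j * (h / 2 ^ m)) g x) = (\<Sum>j\<in>{0..<2 ^ m}. P (real (j + k * 2 ^ m) * (h / 2 ^ m)) g x)"
    by (rule sum.shift_bounds_nat_ivl)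
   moreover have "real (j + k * 2 ^ m) * (h / 2 ^ m) = real k * h + real j * (h / 2 ^ m)" for j by (simp add: field_simps)
   ultimately show ?thesis by (simp add: add.commute atLeast0LessThan)
  qed
  ultimately have "(\<Sum>j<2 ^ (n + m). P (real j * (h / 2 ^ m)) g x) = (\<Sum>k<2 ^ n. \<Sum>j<2 ^ m. P (real k * h + real j * (h / 2 ^ m)) g x)"
   by (simp only: power_add)
  hence A: "avg s g (n + m) x = (1 / 2 ^ (n + m)) * (\<Sum>k<2 ^ n. \<Sum>j<2 ^ m. P (real k * h + real j * (h / 2 ^ m)) g x)"
   by (simp only: avg_def hh)
  have "(1 / 2 ^ n) * ((1 / 2 ^ m) * T) = (1 / 2 ^ (n + m)) * T" for T :: real by (simp add: power_add)
  thus ?thesis unfolding A sum_distrib_left[symmetric] by (simp only:)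
 qed
 have f: "N (\<lambda>x. ?f k x - P (real k * h) g x) \<le> e" for k
 proof -
  have "N (\<lambda>x. (1 / 2 ^ m) * (\<Sum>j<2 ^ m. P (real k * h + real j * (h / 2 ^ m)) g x) - (1 / 2 ^ m) * real (2 ^ m) * P (real k * h) g x) \<le> (1 / 2 ^ m) * real (2 ^ m) * e"
  proof (rule nrm2_average[OF P_L2 P_L2])
   fix j :: nat assume "j < 2 ^ m"
   hence "real j < 2 ^ m" using of_nat_less_iff[of j "2 ^ m", where ?'a=real] by simp
   hence j: "0 \<le> real j * (h / 2 ^ m)" "real j * (h / 2 ^ m) < s / 2 ^ n" using h by (auto simp: h_def[symmetric] field_simps)
   have "N (\<lambda>x. P (real k * h + real j * (h / 2 ^ m)) g x - P (real k * h) g x) \<le> N (\<lambda>x. P (real j * (h / 2 ^ m)) g x - g x)"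
    by (rule P_dist_shift[OF g]) (use h in auto)
   also have "... \<le> e" by (rule e[OF j])
   finally show "N (\<lambda>x. P (real k * h + real j * (h / 2 ^ m)) g x - P (real k * h) g x) \<le> e" .
  qed (use h g in auto)
  thus ?thesis by simp
 qed
 have Lf: "L2 M (?f k)" for k by (intro L2_cmult L2_sum P_L2) (use h g in auto)
 have "(\<lambda>x. avg s g (n + m) x - avg s g n x) = (\<lambda>x. (1 / 2 ^ n) * (\<Sum>k<2 ^ n. ?f k x - P (real k * h) g x))"
  unfolding regroup by (simp add: avg_def h_def[symmetric] sum_subtractf right_diff_distrib)
 hence "N (\<lambda>x. avg s g (n + m) x - avg s g n x) = (1 / 2 ^ n) * N (\<lambda>x. \<Sum>k<2 ^ n. ?f k x - P (real k * h) g x)"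
  by (simp only: nrm2_cmult) simp
 also have "... \<le> (1 / 2 ^ n) * (\<Sum>k<2 ^ n. N (\<lambda>x. ?f k x - P (real k * h) g x))"
  by (intro mult_left_mono nrm2_sum) (use Lf h g in \<open>auto intro!: L2_diff P_L2\<close>)
 also have "... \<le> (1 / 2 ^ n) * (\<Sum>k<2 ^ n::nat. e)" by (intro mult_left_mono sum_mono f) auto
 also have "... = e" by simp
 finally show ?thesis .
qed

text \<open>The time average y of the orbit over the interval from 0 to b is close to g and lies in
  the domain, with image (\<open>P b g\<close> - g) / b. Here y is the L2 limit of the dyadic
  averages.\<close>

lemma generator_dense:
 assumes g: "L2 M g" and e: "0 < e"
 obtains g' h' where "generator_graph M P g' h'" "N (\<lambda>x. g x - g' x) \<le> e"
proof -
 obtain b where b: "0 < b" "\<And>s. 0 \<le> s ==> s < b ==> N (\<lambda>x. P s g x - g x) < e" using P_cont_uniform[OF g e] by blast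
 let ?y = "avg b g"
 have Ly: "L2 M (?y n)" for n by (rule avg_L2) (use b g in auto)
 have cauchy: "\<exists>K. \<forall>m\<ge>K. \<forall>n\<ge>K. N (\<lambda>x. ?y m x - ?y n x) \<le> d" if "0 < d" for d
 proof -
  have "0 < d / 2" using that by simp
  from P_cont_uniform[OF g this]
  obtain c where c: "0 < c" "\<And>s. 0 \<le> s ==> s < c ==> N (\<lambda>x. P s g x - g x) < d / 2" by blast
  obtain K where K: "(1 / 2) ^ K < c / b" using real_arch_pow_inv[of "c / b" "1 / 2"] b c by auto
  have near: "N (\<lambda>x. ?y m x - ?y K x) \<le> d / 2" if "K \<le> m" for m
  proof -
   have "N (\<lambda>x. avg b g (K + (m - K)) x - avg b g K x) \<le> d / 2"
   proof (rule avg_refine[OF b(1) g])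
    fix r assume r: "0 \<le> r" "r < b / 2 ^ K"
    have "b / 2 ^ K < c" using K b by (simp add: field_simps)
    thus "N (\<lambda>x. P r g x - g x) \<le> d / 2" using c(2)[of r] r by simp
   qed
   thus ?thesis using that by simp
  qed
  have "N (\<lambda>x. ?y m x - ?y n x) \<le> d" if "K \<le> m" "K \<le> n" for m n
   using nrm2_dist_triangle[OF Ly[of m] Ly[of K] Ly[of n]] near[OF that(1)] near[OF that(2)] nrm2_minus_commute[of M "?y K" "?y n"] by simp
  thus ?thesis by blast
 qed
 obtain y where y: "L2 M y" "(\<lambda>n. N (\<lambda>x. ?y n x - y x)) \<longlonglongrightarrow> 0" by (rule L2_complete[OF Ly cauchy])
 have small: "\<exists>n0. \<forall>n\<ge>n0. N (\<lambda>x. ?y n x - y x) < d" if "0 < d" for d using LIMSEQ_D[OF y(2) that] by simp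
 have "N (\<lambda>x. g x - y x) \<le> e + d" if d: "0 < d" for d
 proof -
  obtain n where n: "N (\<lambda>x. ?y n x - y x) < d" using small[OF d] by blast
  have "N (\<lambda>x. ?y n x - g x) \<le> e" by (rule avg_near[OF b(1) g]) (use b(2) in \<open>auto intro: less_imp_le\<close>)
  thus ?thesis using nrm2_dist_triangle[OF g Ly[of n] y(1)] n nrm2_minus_commute[of M g "?y n"] by simp
 qed
 hence gy: "N (\<lambda>x. g x - y x) \<le> e" by (rule field_le_epsilon)
 define w where "w = (\<lambda>x. P b g x - g x)"
 have Lw: "L2 M w" unfolding w_def by (rule L2_diff[OF P_L2 g]) (use b g in auto)
 \<comment> \<open>The time t is rounded down to J nodes of mesh h. The five terms are: rounding t
   on the left, replacing y by an average, the exact shift identity \<open>avg_shift\<close>,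
   returning from the average to y, and undoing the rounding in the multiple of w. Only the third
   one survives as \<delta> tends to 0.\<close>
 have main: "N (\<lambda>x. (P t y x - y x) - (t / b) * w x) \<le> (t / b) * u"
  if t: "0 < t" "t < c" and c: "\<And>r. 0 \<le> r ==> r < c ==> N (\<lambda>x. P r w x - w x) < u" for t c u
 proof (rule field_le_epsilon)
  have eta: "0 \<le> u" using c[of 0] t nrm2_nonneg[of M "\<lambda>x. P 0 w x - w x"] by linarith
  fix \<delta>' :: real assume "0 < \<delta>'"
  define \<delta> where "\<delta> = \<delta>' / (4 + N w / b)"
  have Nwb: "0 \<le> N w / b" using b by simp
  hence den: "0 < 4 + N w / b" by linarith
  have d: "0 < \<delta>" "\<delta> * (4 + N w / b) = \<delta>'" using \<open>0 < \<delta>'\<close> den by (auto simp: \<delta>_def)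
  obtain n0 where n0: "\<And>n. n0 \<le> n ==> N (\<lambda>x. ?y n x - y x) < \<delta>" using small[OF d(1)] by blast
  obtain c' where c': "0 < c'" "\<And>r. 0 \<le> r ==> r < c' ==> N (\<lambda>x. P r y x - y x) < \<delta>" using P_cont_uniform[OF y(1) d(1)] by blast
  have "0 < min c' \<delta> / b" using c' d b by simp
  then obtain n1 where n1: "(1 / 2) ^ n1 < min c' \<delta> / b" using real_arch_pow_inv[of "min c' \<delta> / b" "1 / 2"] by auto
  define n where "n = max n0 n1"
  define h where "h = b / 2 ^ n"
  have h0: "0 < h" using b by (simp add: h_def)
  have "(1 / 2 :: real) ^ n \<le> (1 / 2) ^ n1" by (rule power_decreasing) (auto simp: n_def)
  hence "(1 / 2) ^ n < min c' \<delta> / b" using n1 by linarith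
  hence "(1 / 2) ^ n * b < min c' \<delta>" using b by (simp only: pos_less_divide_eq)
  hence "h < min c' \<delta>" by (simp add: h_def power_one_over)
  hence h: "h < c'" "h < \<delta>" by auto
  define J where "J = nat \<lfloor>t / h\<rfloor>"
  define \<rho> where "\<rho> = t - real J * h"
  have "real J \<le> t / h" "t / h < real J + 1" using t h0 unfolding J_def by (auto simp: of_nat_nat)
  hence rho: "0 \<le> \<rho>" "\<rho> < h" using h0 by (auto simp: \<rho>_def field_simps)
  have Jh: "0 \<le> real J * h" "real J * h \<le> t" "t = real J * h + \<rho>" using h0 rho by (auto simp: \<rho>_def)
  have LP: "L2 M (P t y)" "L2 M (P (real J * h) y)" "L2 M (P (real J * h) (?y n))" using t Jh y(1) Ly by (auto intro: P_L2)
  let ?w = "\<lambda>x. (real J * h / b) * w x" and ?w' = "\<lambda>x. (t / b) * w x"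
  have Lw': "L2 M ?w" "L2 M ?w'" by (rule L2_cmult[OF Lw])+
  have a1: "N (\<lambda>x. P t y x - P (real J * h) y x) \<le> \<delta>"
   using P_dist_shift[OF y(1) Jh(1) rho(1)] c'(2)[of \<rho>] rho h Jh(3) by simp
  have a2: "N (\<lambda>x. P (real J * h) y x - P (real J * h) (?y n) x) \<le> \<delta>"
   using P_dist[OF Jh(1) y(1) Ly[of n]] n0[of n] nrm2_minus_commute[of M y "?y n"] by (simp add: n_def)
  have a3: "N (\<lambda>x. (P (real J * h) (?y n) x - ?y n x) - ?w x) \<le> (t / b) * u"
  proof -
   have "N (\<lambda>x. (P (real J * h) (?y n) x - ?y n x) - ?w x) = N (\<lambda>x. (1 / 2 ^ n) * (\<Sum>i<J. P (real i * h) w x) - (1 / 2 ^ n) * real J * w x)"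
   proof (rule nrm2_cong_AE)
    show "L2 M (\<lambda>x. (1 / 2 ^ n) * (\<Sum>i<J. P (real i * h) w x) - (1 / 2 ^ n) * real J * w x)"
     by (intro L2_diff L2_cmult L2_sum P_L2 Lw) (use h0 in auto)
    have "real J * h / b = (1 / 2 ^ n) * real J" using b by (simp add: h_def)
    thus "AE x in M. (P (real J * h) (?y n) x - ?y n x) - ?w x = (1 / 2 ^ n) * (\<Sum>i<J. P (real i * h) w x) - (1 / 2 ^ n) * real J * w x"
     using avg_shift[OF b(1) g, of J n, folded h_def w_def] by (simp only:) (elim AE_mp, simp)
   qed (use LP Ly Lw' in \<open>auto intro!: L2_diff\<close>)
   also have "... \<le> (1 / 2 ^ n) * real J * u"
   proof (rule nrm2_average[OF P_L2[OF _ Lw] Lw])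
    fix i assume "i < J"
    hence "real i * h \<le> real J * h" using h0 by (intro mult_right_mono) auto
    hence "real i * h < c" using Jh t by linarith
    thus "N (\<lambda>x. P (real i * h) w x - w x) \<le> u" using c[of "real i * h"] h0 by (simp add: less_imp_le)
   qed (use h0 in auto)
   also have "... = (real J * h / b) * u" using b by (simp add: h_def)
   also have "... \<le> (t / b) * u" using Jh b eta by (intro mult_right_mono divide_right_mono) auto
   finally show ?thesis .
  qed
  have a4: "N (\<lambda>x. ?y n x - y x) \<le> \<delta>" using n0[of n] by (simp add: n_def)
  have a5: "N (\<lambda>x. ?w x - ?w' x) \<le> \<delta> * (N w / b)"
  proof -
   have "(\<lambda>x. ?w x - ?w' x) = (\<lambda>x. (- (\<rho> / b)) * w x)" using b by (auto simp: \<rho>_def field_simps)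
   hence "N (\<lambda>x. ?w x - ?w' x) = (\<rho> / b) * N w" using rho b by (simp only: nrm2_cmult) simp
   also have "... = \<rho> * (N w / b)" by simp
   also have "... \<le> \<delta> * (N w / b)" by (rule mult_right_mono) (use rho h Nwb in auto)
   finally show ?thesis .
  qed
  let ?f = "\<lambda>x. P t y x - P (real J * h) y x" and ?f' = "\<lambda>x. P (real J * h) y x - P (real J * h) (?y n) x"
   and ?g = "\<lambda>x. (P (real J * h) (?y n) x - ?y n x) - ?w x" and ?g' = "\<lambda>x. ?y n x - y x" and ?k = "\<lambda>x. ?w x - ?w' x"
  have Lf: "L2 M ?f" "L2 M ?f'" "L2 M ?g" "L2 M ?g'" "L2 M ?k" by (intro L2_diff LP Ly Lw' y(1))+
  have "N (\<lambda>x. (P t y x - y x) - ?w' x) = N (\<lambda>x. ?f x + (?f' x + (?g x + (?g' x + ?k x))))"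
   by (rule arg_cong[where f=N], rule ext) simp
  also have "... \<le> N ?f + (N ?f' + (N ?g + (N ?g' + N ?k)))" by (rule nrm2_triangle5[OF Lf])
  also have "... \<le> \<delta> + (\<delta> + ((t / b) * u + (\<delta> + \<delta> * (N w / b))))" by (intro add_mono a1 a2 a3 a4 a5)
  also have "... \<le> (t / b) * u + \<delta> * (4 + N w / b)" using d(1) by (simp add: algebra_simps)
  finally show "N (\<lambda>x. (P t y x - y x) - ?w' x) \<le> (t / b) * u + \<delta>'" unfolding d(2) .
 qed
 let ?h = "\<lambda>x. (1 / b) * w x"
 have "generator_graph M P y ?h" unfolding generator_graph_def
 proof (intro conjI y(1) L2_cmult Lw)
  show "((\<lambda>t. N (\<lambda>x. (P t y x - y x) / t - ?h x)) \<longlongrightarrow> 0) (at_right 0)"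
  proof (rule order_tendstoI)
   fix a :: real assume "a < 0"
   thus "\<forall>\<^sub>F t in at_right 0. a < N (\<lambda>x. (P t y x - y x) / t - ?h x)"
    by (intro always_eventually allI less_le_trans[OF _ nrm2_nonneg])
  next
   fix d :: real assume "0 < d"
   hence "0 < b * (d / 2)" using b by simp
   then obtain c where c: "0 < c" "\<And>r. 0 \<le> r ==> r < c ==> N (\<lambda>x. P r w x - w x) < b * (d / 2)"
    using P_cont_uniform[OF Lw] by blast
   show "\<forall>\<^sub>F t in at_right 0. N (\<lambda>x. (P t y x - y x) / t - ?h x) < d" unfolding eventually_at_right[OF zero_less_one]
   proof (intro exI[of _ c] conjI allI impI c(1))
    fix t assume t: "0 < t" "t < c"
    have "(\<lambda>x. (P t y x - y x) / t - ?h x) = (\<lambda>x. (1 / t) * ((P t y x - y x) - (t / b) * w x))"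
     using t b by (auto simp: field_simps)
    hence "N (\<lambda>x. (P t y x - y x) / t - ?h x) = (1 / t) * N (\<lambda>x. (P t y x - y x) - (t / b) * w x)"
     using t by (simp only: nrm2_cmult) simp
    also have "... \<le> (1 / t) * ((t / b) * (b * (d / 2)))" using main[OF t c(2)] t by (intro mult_left_mono) auto
    also have "... = d / 2" using t b by simp
    finally show "N (\<lambda>x. (P t y x - y x) / t - ?h x) < d" using \<open>0 < d\<close> by simp
   qed
  qed
 qed
 thus thesis using that gy by blast
qed

end

section \<open>Energy dissipation\<close>

lemma infinite_sites: "infinite (UNIV :: ('d::finite) site set)"
proof
 assume "finite (UNIV :: 'd site set)"
 hence "finite (range (\<lambda>n::int. (\<lambda>_. n) :: 'd site))" by (rule rev_finite_subset) simp
 moreover have "inj (\<lambda>n::int. (\<lambda>_. n) :: 'd site)" by (rule injI) (metis)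
 ultimately have "finite (UNIV :: int set)" by (rule finite_imageD)
 thus False by simp
qed

lemma site_enumeration: obtains e :: "nat => ('d::finite) site" where "bij e"
 using bij_betw_from_nat_into[OF countableI_type infinite_sites] by blast

lemma infsum_bij_nat:
 fixes f :: "'a => real" and e :: "nat => 'a"
 assumes e: "bij e" and s: "summable (\<lambda>n. \<bar>f (e n)\<bar>)"
 shows "(\<Sum>\<^sub>\<infinity>x. f x) = (\<Sum>n. f (e n))"
proof -
 have "(\<lambda>n. f (e n)) summable_on UNIV" using s by (intro norm_summable_imp_summable_on) simp
 hence "((\<lambda>n. f (e n)) has_sum (\<Sum>\<^sub>\<infinity>n. f (e n))) UNIV" by (rule has_sum_infsum)
 hence "(\<lambda>n. f (e n)) sums (\<Sum>\<^sub>\<infinity>n. f (e n))" by (rule has_sum_imp_sums)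
 thus ?thesis using infsum_reindex_bij_betw[OF e, of f] by (simp add: sums_iff)
qed

lemma nrm2_LIMSEQ:
 assumes "\<And>n. L2 M (F n)" "L2 M f" "(\<lambda>n. nrm2 M (\<lambda>x. F n x - f x)) \<longlonglongrightarrow> 0"
 shows "(\<lambda>n. nrm2 M (F n)) \<longlonglongrightarrow> nrm2 M f"
proof -
 have "(\<lambda>n. nrm2 M (F n) - nrm2 M f) \<longlonglongrightarrow> 0"
  by (rule Lim_null_comparison[OF _ assms(3)]) (use nrm2_diff_le[OF assms(1,2)] in auto)
 thus ?thesis by (simp add: LIM_zero_iff)
qed

lemma inner_LIMSEQ:
 assumes F: "\<And>n. L2 M (F n)" "L2 M f" "(\<lambda>n. nrm2 M (\<lambda>x. F n x - f x)) \<longlonglongrightarrow> 0"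
  and G: "\<And>n. L2 M (G n)" "L2 M g" "(\<lambda>n. nrm2 M (\<lambda>x. G n x - g x)) \<longlonglongrightarrow> 0"
 shows "(\<lambda>n. \<integral>x. F n x * G n x \<partial>M) \<longlonglongrightarrow> (\<integral>x. f x * g x \<partial>M)"
proof -
 have "(\<lambda>n. nrm2 M (F n) * nrm2 M (\<lambda>x. G n x - g x) + nrm2 M (\<lambda>x. F n x - f x) * nrm2 M g) \<longlonglongrightarrow> nrm2 M f * 0 + 0 * nrm2 M g"
  by (intro tendsto_intros nrm2_LIMSEQ[OF F] F G)
 hence lim: "(\<lambda>n. nrm2 M (F n) * nrm2 M (\<lambda>x. G n x - g x) + nrm2 M (\<lambda>x. F n x - f x) * nrm2 M g) \<longlonglongrightarrow> 0" by simp
 have "\<bar>(\<integral>x. F n x * G n x \<partial>M) - (\<integral>x. f x * g x \<partial>M)\<bar> \<le> nrm2 M (F n) * nrm2 M (\<lambda>x. G n x - g x) + nrm2 M (\<lambda>x. F n x - f x) * nrm2 M g" for n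
 proof -
  have L: "L2 M (\<lambda>x. G n x - g x)" "L2 M (\<lambda>x. F n x - f x)" by (intro L2_diff F G)+
  have "(\<integral>x. F n x * (G n x - g x) \<partial>M) + (\<integral>x. (F n x - f x) * g x \<partial>M) = (\<integral>x. F n x * (G n x - g x) + (F n x - f x) * g x \<partial>M)"
   using integrable_square_sum[OF F(1) L(1)] integrable_square_sum[OF L(2) G(2)] by simp
  also have "... = (\<integral>x. F n x * G n x - f x * g x \<partial>M)" by (simp add: algebra_simps)
  also have "... = (\<integral>x. F n x * G n x \<partial>M) - (\<integral>x. f x * g x \<partial>M)"
   using integrable_square_sum[OF F(1) G(1)] integrable_square_sum[OF F(2) G(2)] by simp
  finally show ?thesis using L2_Cauchy_Schwarz[OF F(1)[of n] L(1)] L2_Cauchy_Schwarz[OF L(2) G(2)] by linarith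
 qed
 hence "(\<lambda>n. (\<integral>x. F n x * G n x \<partial>M) - (\<integral>x. f x * g x \<partial>M)) \<longlonglongrightarrow> 0"
  by (intro Lim_null_comparison[OF _ lim]) auto
 thus ?thesis by (simp add: LIM_zero_iff)
qed

locale sandpile_process = sandpile_limit \<mu> for \<mu> :: "('d::finite) config measure" +
 fixes \<phi> :: "'d site => real" and P :: "real => ('d config => real) => ('d config => real)"
 assumes phi_pos: "\<And>x. \<phi> x > 0"
  and phi_G: "(\<lambda>x. \<phi> x * green (\<lambda>_. 0) x) summable_on UNIV"
  and semigroup: "C0_contraction_semigroup \<mu> P"
  and gen: "\<And>f h. generator_graph \<mu> P f h \<longleftrightarrow> closure_graph \<mu> \<phi> f h"
begin

sublocale l2_semigroup \<mu> P by unfold_locales (rule semigroup)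

text \<open>The L1 bounds of \<open>local_fun_moves\<close> are summable against \<phi>, so for
  bounded H sum and integral may be exchanged; an enumeration of the sites turns the unordered sum
  into a series.\<close>

lemma core_integral:
 fixes F H :: "'d config => real" and e :: "nat => 'd site"
 assumes F: "local_fun F" "L2 \<mu> F" "L2 \<mu> (genL \<phi> F)" and e: "bij e"
  and H: "H \<in> borel_measurable \<mu>" "\<And>h. h \<in> space \<mu> ==> \<bar>H h\<bar> \<le> K" "0 \<le> K"
 shows "summable (\<lambda>n. \<phi> (e n) * (\<integral>h. H h * (F (add_inf (e n) h) - F h) \<partial>\<mu>))"
  and "(\<integral>h. H h * genL \<phi> F h \<partial>\<mu>) = (\<Sum>n. \<phi> (e n) * (\<integral>h. H h * (F (add_inf (e n) h) - F h) \<partial>\<mu>))"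
proof -
 have Fm: "F \<in> borel_measurable \<mu>" using F(2) by (rule L2_measurable)
 obtain C where C: "0 \<le> C" "\<And>x. (\<integral>h. \<bar>F (add_inf x h) - F h\<bar> \<partial>\<mu>) \<le> C * green (\<lambda>_. 0) x"
  using local_fun_moves[OF F(1) Fm] by blast
 let ?D = "\<lambda>n h. \<phi> (e n) * (F (add_inf (e n) h) - F h)"
 have Fi: "integrable \<mu> F" by (rule L2_integrable[OF F(2)])
 have Di: "integrable \<mu> (?D n)" for n using integral_add_inf(2)[OF Fm Fi, of "e n"] Fi by simp
 have pe: "0 \<le> \<phi> (e n)" for n using phi_pos[of "e n"] by simp
 have gs: "summable (\<lambda>n. \<phi> (e n) * green (\<lambda>_. 0) (e n))"
  using phi_G summable_on_reindex_bij_betw[OF e, of "\<lambda>x. \<phi> x * green (\<lambda>_. 0) x"] summable_on_imp_summable by blast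
 have Dn: "(\<integral>h. \<bar>?D n h\<bar> \<partial>\<mu>) \<le> C * (\<phi> (e n) * green (\<lambda>_. 0) (e n))" for n
 proof -
  have "(\<integral>h. \<bar>?D n h\<bar> \<partial>\<mu>) = \<phi> (e n) * (\<integral>h. \<bar>F (add_inf (e n) h) - F h\<bar> \<partial>\<mu>)" using pe[of n] by (simp add: abs_mult)
  also have "... \<le> \<phi> (e n) * (C * green (\<lambda>_. 0) (e n))" by (rule mult_left_mono[OF C(2) pe])
  finally show ?thesis by (simp add: algebra_simps)
 qed
 have Ds: "summable (\<lambda>n. \<integral>h. \<bar>?D n h\<bar> \<partial>\<mu>)"
  by (rule summable_comparison_test'[OF summable_mult[OF gs, of C], of 0]) (use Dn in auto)
 have AEs: "AE h in \<mu>. summable (\<lambda>n. \<bar>?D n h\<bar>)" by (rule AE_summable[OF Di Ds])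
 have AEg: "AE h in \<mu>. genL \<phi> F h = (\<Sum>n. ?D n h)" using AEs AE_ainf
 proof eventually_elim
  case (elim h)
  thus ?case using infsum_bij_nat[OF e, of "\<lambda>x. \<phi> x * (F (add_inf x h) - F h)"] by (simp add: genL_def)
 qed
 let ?f = "\<lambda>n h. H h * ?D n h"
 have fi: "integrable \<mu> (?f n)" and fn: "(\<integral>h. norm (?f n h) \<partial>\<mu>) \<le> K * (\<integral>h. \<bar>?D n h\<bar> \<partial>\<mu>)" for n
 proof -
  have b: "norm (?f n h) \<le> K * \<bar>?D n h\<bar>" if "h \<in> space \<mu>" for h
   unfolding real_norm_def abs_mult[of "H h"] by (rule mult_right_mono[OF H(2)[OF that]]) simp
  show fi: "integrable \<mu> (?f n)"
  proof (rule Bochner_Integration.integrable_bound[of \<mu> "\<lambda>h. K * \<bar>?D n h\<bar>"])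
   show "integrable \<mu> (\<lambda>h. K * \<bar>?D n h\<bar>)" by (intro integrable_mult_right integrable_abs Di)
   show "?f n \<in> borel_measurable \<mu>" by (rule borel_measurable_times[OF H(1) borel_measurable_integrable[OF Di]])
   show "AE h in \<mu>. norm (?f n h) \<le> norm (K * \<bar>?D n h\<bar>)" using b H(3) by (intro AE_I2) (auto simp: abs_mult)
  qed
  have "(\<integral>h. norm (?f n h) \<partial>\<mu>) \<le> (\<integral>h. K * \<bar>?D n h\<bar> \<partial>\<mu>)"
   by (rule integral_mono[OF integrable_norm[OF fi]]) (use b in \<open>auto intro!: integrable_mult_right integrable_abs Di\<close>)
  thus "(\<integral>h. norm (?f n h) \<partial>\<mu>) \<le> K * (\<integral>h. \<bar>?D n h\<bar> \<partial>\<mu>)" by simp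
 qed
 have fs: "summable (\<lambda>n. \<integral>h. norm (?f n h) \<partial>\<mu>)"
  by (rule summable_comparison_test'[OF summable_mult[OF Ds, of K], of 0]) (use fn in auto)
 have fA: "AE h in \<mu>. summable (\<lambda>n. norm (?f n h))" using AEs
 proof eventually_elim
  case (elim h)
  thus ?case using summable_mult[of "\<lambda>n. \<bar>?D n h\<bar>" "\<bar>H h\<bar>"] by (simp add: abs_mult)
 qed
 have int: "(\<integral>h. ?f n h \<partial>\<mu>) = \<phi> (e n) * (\<integral>h. H h * (F (add_inf (e n) h) - F h) \<partial>\<mu>)" for n
  by (subst integral_mult_right_zero[symmetric]) (simp add: algebra_simps)
 show "summable (\<lambda>n. \<phi> (e n) * (\<integral>h. H h * (F (add_inf (e n) h) - F h) \<partial>\<mu>))"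
  using summable_integral[OF fi fA fs] unfolding int .
 have "(\<integral>h. H h * genL \<phi> F h \<partial>\<mu>) = (\<integral>h. (\<Sum>n. ?f n h) \<partial>\<mu>)"
 proof (rule integral_cong_AE)
  show "(\<lambda>h. H h * genL \<phi> F h) \<in> borel_measurable \<mu>" by (rule borel_measurable_times[OF H(1) L2_measurable[OF F(3)]])
  show "(\<lambda>h. \<Sum>n. ?f n h) \<in> borel_measurable \<mu>" by (rule borel_measurable_integrable[OF integrable_suminf[OF fi fA fs]])
  show "AE h in \<mu>. H h * genL \<phi> F h = (\<Sum>n. ?f n h)" using AEs AEg
  proof eventually_elim
   case (elim h)
   thus ?case using suminf_mult[OF summable_rabs_cancel[OF elim(1)], of "H h"] by simp
  qed
 qed
 also have "... = (\<Sum>n. \<integral>h. ?f n h \<partial>\<mu>)" by (rule integral_suminf[OF fi fA fs])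
 finally show "(\<integral>h. H h * genL \<phi> F h \<partial>\<mu>) = (\<Sum>n. \<phi> (e n) * (\<integral>h. H h * (F (add_inf (e n) h) - F h) \<partial>\<mu>))"
  unfolding int .
qed

lemma core_mean:
 assumes F: "local_fun F" "L2 \<mu> F" "L2 \<mu> (genL \<phi> F)"
 shows "(\<integral>h. genL \<phi> F h \<partial>\<mu>) = 0"
proof -
 obtain e :: "nat => 'd site" where e: "bij e" by (rule site_enumeration)
 have "(\<integral>h. 1 * (F (add_inf x h) - F h) \<partial>\<mu>) = 0" for x
  using integral_add_inf[OF L2_measurable[OF F(2)], of x] L2_integrable[OF F(2)] by simp
 thus ?thesis using core_integral(2)[OF F e, of "\<lambda>_. 1" 1] by simp
qed

text \<open>Since each addition preserves \<mu>, the pairing of F with its increment is minus half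
  the squared norm of the increment. All terms of the series have the same sign, so the single site
  z may be kept.\<close>

lemma core_energy:
 assumes F: "local_fun F" "L2 \<mu> F" "L2 \<mu> (genL \<phi> F)"
 shows "2 * (\<integral>h. F h * genL \<phi> F h \<partial>\<mu>) \<le> - (\<phi> z * (\<integral>h. (F (add_inf z h) - F h)\<^sup>2 \<partial>\<mu>))"
proof -
 obtain e :: "nat => 'd site" where e: "bij e" by (rule site_enumeration)
 obtain K where K: "0 \<le> K" "\<And>h. h \<in> space \<mu> ==> \<bar>F h\<bar> \<le> K" using local_fun_bounded[OF F(1)] by blast
 have Fm: "F \<in> borel_measurable \<mu>" using F(2) by (rule L2_measurable)
 let ?q = "\<lambda>x. \<integral>h. (F (add_inf x h) - F h)\<^sup>2 \<partial>\<mu>"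
 have LF: "L2 \<mu> (\<lambda>h. F (add_inf x h))" for x
  using measurable_compose[OF add_inf_measurable Fm, of x] integral_add_inf(2)[of "\<lambda>h. (F h)\<^sup>2" x] L2_sq[OF F(2)] Fm by (auto simp: L2_def)
 have sq: "(\<integral>h. F h * (F (add_inf x h) - F h) \<partial>\<mu>) = - (1 / 2) * ?q x" for x
 proof -
  have LD: "L2 \<mu> (\<lambda>h. F (add_inf x h) - F h)" by (rule L2_diff[OF LF F(2)])
  have "(N (\<lambda>h. F h + (F (add_inf x h) - F h)))\<^sup>2 = (N F)\<^sup>2 + 2 * (\<integral>h. F h * (F (add_inf x h) - F h) \<partial>\<mu>) + (N (\<lambda>h. F (add_inf x h) - F h))\<^sup>2"
   by (rule nrm2_expand[OF F(2) LD])
  hence "(\<integral>h. (F (add_inf x h))\<^sup>2 \<partial>\<mu>) = (\<integral>h. (F h)\<^sup>2 \<partial>\<mu>) + 2 * (\<integral>h. F h * (F (add_inf x h) - F h) \<partial>\<mu>) + ?q x"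
   unfolding nrm2_sq by simp
  moreover have "(\<integral>h. (F (add_inf x h))\<^sup>2 \<partial>\<mu>) = (\<integral>h. (F h)\<^sup>2 \<partial>\<mu>)"
   by (rule integral_add_inf(1)) (use Fm in measurable)
  ultimately show ?thesis by simp
 qed
 note ci = core_integral[OF F e Fm K(2,1), unfolded sq]
 have s: "summable (\<lambda>n. \<phi> (e n) * ?q (e n))" using summable_mult[OF ci(1), of "-2"] by simp
 have "2 * (\<integral>h. F h * genL \<phi> F h \<partial>\<mu>) = - (\<Sum>n. \<phi> (e n) * ?q (e n))"
 proof -
  have fe: "(\<lambda>n. \<phi> (e n) * (- (1 / 2) * ?q (e n))) = (\<lambda>n. (- (1 / 2)) * (\<phi> (e n) * ?q (e n)))"
   by (rule ext) (rule mult.left_commute)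
  have "(\<integral>h. F h * genL \<phi> F h \<partial>\<mu>) = (\<Sum>n. (- (1 / 2)) * (\<phi> (e n) * ?q (e n)))" using ci(2) unfolding fe .
  also have "... = (- (1 / 2)) * (\<Sum>n. \<phi> (e n) * ?q (e n))" by (rule suminf_mult[OF s])
  finally show ?thesis by simp
 qed
 moreover have "\<phi> z * ?q z \<le> (\<Sum>n. \<phi> (e n) * ?q (e n))"
 proof -
  obtain m where m: "e m = z" using bij_is_surj[OF e] by (metis surjD)
  have "(\<Sum>n\<in>{m}. \<phi> (e n) * ?q (e n)) \<le> (\<Sum>n. \<phi> (e n) * ?q (e n))"
   by (rule sum_le_suminf[OF s]) (auto intro!: mult_nonneg_nonneg less_imp_le[OF phi_pos])
  thus ?thesis using m by simp
 qed
 ultimately show ?thesis by simp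
qed

section \<open>Increments on the events \<open>EE\<close> and their decay along the
  semigroup\<close>

definition jump :: "'d site set => 'd config => 'd site => ('d config => real) => 'd config => real" where
 "jump A \<zeta> z f h = indicator (EE A \<zeta>) h * (f (raise z h) - f h)"

context
 fixes W A :: "'d site set" and \<zeta> :: "'d config" and z :: "'d site"
 assumes A: "finite A" "W \<subseteq> A" and z: "\<zeta> \<in> rec A (kI W A)" "z \<in> A" "\<zeta>(z := \<zeta> z + 1) \<in> rec A (kI W A)"
begin

lemma L2_indicator_mult:
 assumes "B \<in> sets \<mu>" "L2 \<mu> f" shows "L2 \<mu> (\<lambda>h. indicator B h * f h)" "N (\<lambda>h. indicator B h * f h) \<le> N f"
proof -
 have i: "integrable \<mu> (\<lambda>h. indicator B h * (f h)\<^sup>2)"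
  using integrable_mult_indicator[OF assms(1) L2_sq[OF assms(2)]] by simp
 have e: "(\<lambda>h. (indicator B h * f h)\<^sup>2) = (\<lambda>h. indicator B h * (f h)\<^sup>2)" by (auto simp: indicator_def)
 show "L2 \<mu> (\<lambda>h. indicator B h * f h)" using i e assms L2_measurable[OF assms(2)] by (auto simp: L2_def)
 have "(\<integral>h. indicator B h * (f h)\<^sup>2 \<partial>\<mu>) \<le> (\<integral>h. (f h)\<^sup>2 \<partial>\<mu>)"
  by (rule integral_mono[OF i L2_sq[OF assms(2)]]) (auto simp: indicator_def)
 thus "N (\<lambda>h. indicator B h * f h) \<le> N f" unfolding nrm2_def e by simp
qed

text \<open>\<open>raise z\<close> carries \<mu> on \<open>EE A \<zeta>\<close> to \<mu> on the
  event with the raised pattern, so composing with it does not increase the norm. This continuity is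
  what lets the dissipation estimate pass to the closure of the generator.\<close>

lemma jump_bounds:
 assumes f: "L2 \<mu> f"
 shows "L2 \<mu> (jump A \<zeta> z f)" "N (jump A \<zeta> z f) \<le> 2 * N f"
proof -
 have E: "EE A \<xi> \<in> sets \<mu>" for \<xi> by (rule EE_sets[OF A(1)])
 have fm: "f \<in> borel_measurable \<mu>" by (rule L2_measurable[OF f])
 let ?r = "\<lambda>h. indicator (EE A \<zeta>) h * f (raise z h)"
 have rm: "?r \<in> borel_measurable \<mu>"
  by (rule borel_measurable_times[OF borel_measurable_indicator[OF E] measurable_compose[OF raise_measurable fm]])
 have sq: "(\<lambda>h. (?r h)\<^sup>2) = (\<lambda>h. indicator (EE A \<zeta>) h * (f (raise z h))\<^sup>2)" by (auto simp: indicator_def)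
 have f2: "(\<lambda>h. (f h)\<^sup>2) \<in> borel_measurable \<mu>" using fm by measurable
 have Lr: "L2 \<mu> ?r" unfolding L2_def sq using rm integral_raise(2)[OF A z f2 L2_sq[OF f]] by simp
 have "(N ?r)\<^sup>2 = (\<integral>h. indicator (EE A (\<zeta>(z := \<zeta> z + 1))) h * (f h)\<^sup>2 \<partial>\<mu>)"
  unfolding nrm2_sq sq by (rule integral_raise(1)[OF A z f2])
 also have "... \<le> (\<integral>h. (f h)\<^sup>2 \<partial>\<mu>)" by (rule integral_mono[OF _ L2_sq[OF f]])
   (use integrable_mult_indicator[OF E L2_sq[OF f]] in \<open>auto simp: indicator_def\<close>)
 finally have "(N ?r)\<^sup>2 \<le> (N f)\<^sup>2" by (simp add: nrm2_sq)
 hence nr: "N ?r \<le> N f" by (rule power2_le_imp_le) simp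
 note Li = L2_indicator_mult[OF E f, of \<zeta>]
 have j: "jump A \<zeta> z f = (\<lambda>h. ?r h - indicator (EE A \<zeta>) h * f h)" by (rule ext) (simp add: jump_def right_diff_distrib)
 show "L2 \<mu> (jump A \<zeta> z f)" unfolding j by (rule L2_diff[OF Lr Li(1)])
 have "N (jump A \<zeta> z f) \<le> N (\<lambda>h. ?r h - 0) + N (\<lambda>h. 0 - indicator (EE A \<zeta>) h * f h)"
  unfolding j by (rule nrm2_dist_triangle[OF Lr L2_zero Li(1)])
 also have "... = N ?r + N (\<lambda>h. indicator (EE A \<zeta>) h * f h)" by (simp add: nrm2_def)
 finally show "N (jump A \<zeta> z f) \<le> 2 * N f" using nr Li(2) by simp
qed

lemma jump_diff: "jump A \<zeta> z (\<lambda>h. f h - g h) = (\<lambda>h. jump A \<zeta> z f h - jump A \<zeta> z g h)"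
 by (rule ext) (simp add: jump_def algebra_simps)

lemma core_jump:
 assumes F: "local_fun F" "L2 \<mu> F" "L2 \<mu> (genL \<phi> F)"
 shows "2 * (\<integral>h. F h * genL \<phi> F h \<partial>\<mu>) \<le> - (\<phi> z * (N (jump A \<zeta> z F))\<^sup>2)"
proof -
 have Fm: "F \<in> borel_measurable \<mu>" by (rule L2_measurable[OF F(2)])
 have LF: "L2 \<mu> (\<lambda>h. F (add_inf z h))"
  using measurable_compose[OF add_inf_measurable Fm, of z] integral_add_inf(2)[of "\<lambda>h. (F h)\<^sup>2" z] L2_sq[OF F(2)] Fm by (auto simp: L2_def)
 have "(N (jump A \<zeta> z F))\<^sup>2 \<le> (\<integral>h. (F (add_inf z h) - F h)\<^sup>2 \<partial>\<mu>)" unfolding nrm2_sq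
 proof (rule integral_mono_AE[OF L2_sq[OF jump_bounds(1)[OF F(2)]] L2_sq[OF L2_diff[OF LF F(2)]]])
  show "AE h in \<mu>. (jump A \<zeta> z F h)\<^sup>2 \<le> (F (add_inf z h) - F h)\<^sup>2" using AE_raise[of z]
  proof eventually_elim
   case (elim h)
   show ?case
   proof (cases "h \<in> EE A \<zeta>")
    case True
    hence "add_inf z h = raise z h" using elim EE_raise(2)[OF A z] by blast
    thus ?thesis using True by (simp add: jump_def)
   qed (simp add: jump_def)
  qed
 qed
 hence "\<phi> z * (N (jump A \<zeta> z F))\<^sup>2 \<le> \<phi> z * (\<integral>h. (F (add_inf z h) - F h)\<^sup>2 \<partial>\<mu>)"
  by (intro mult_left_mono less_imp_le[OF phi_pos])
 thus ?thesis using core_energy[OF F, of z] by linarith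
qed

lemma generator_jump:
 assumes "generator_graph \<mu> P u v"
 shows "2 * (\<integral>h. u h * v h \<partial>\<mu>) \<le> - (\<phi> z * (N (jump A \<zeta> z u))\<^sup>2)"
proof -
 obtain F where L: "L2 \<mu> u" "L2 \<mu> v" and F: "\<And>n. local_fun (F n)" "\<And>n. L2 \<mu> (F n)" "\<And>n. L2 \<mu> (genL \<phi> (F n))"
  and lim: "(\<lambda>n. N (\<lambda>h. F n h - u h)) \<longlonglongrightarrow> 0" "(\<lambda>n. N (\<lambda>h. genL \<phi> (F n) h - v h)) \<longlonglongrightarrow> 0"
  using assms unfolding gen closure_graph_def by blast
 have l1: "(\<lambda>n. 2 * (\<integral>h. F n h * genL \<phi> (F n) h \<partial>\<mu>)) \<longlonglongrightarrow> 2 * (\<integral>h. u h * v h \<partial>\<mu>)"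
  by (intro tendsto_mult tendsto_const inner_LIMSEQ F L lim)
 have "(\<lambda>n. N (\<lambda>h. jump A \<zeta> z (F n) h - jump A \<zeta> z u h)) \<longlonglongrightarrow> 0"
 proof (rule Lim_null_comparison)
  show "\<forall>\<^sub>F n in sequentially. norm (N (\<lambda>h. jump A \<zeta> z (F n) h - jump A \<zeta> z u h)) \<le> 2 * N (\<lambda>h. F n h - u h)"
   unfolding jump_diff[symmetric] using jump_bounds(2)[OF L2_diff[OF F(2) L(1)]] by simp
  show "(\<lambda>n. 2 * N (\<lambda>h. F n h - u h)) \<longlonglongrightarrow> 0" using tendsto_mult[OF tendsto_const lim(1), of 2] by simp
 qed
 hence "(\<lambda>n. N (jump A \<zeta> z (F n))) \<longlonglongrightarrow> N (jump A \<zeta> z u)"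
  by (rule nrm2_LIMSEQ[OF jump_bounds(1)[OF F(2)] jump_bounds(1)[OF L(1)]])
 hence "(\<lambda>n. - (\<phi> z * (N (jump A \<zeta> z (F n)))\<^sup>2)) \<longlonglongrightarrow> - (\<phi> z * (N (jump A \<zeta> z u))\<^sup>2)"
  by (intro tendsto_intros)
 from tendsto_le[OF _ this l1] show ?thesis using core_jump[OF F] by simp
qed

lemma jump_decay:
 assumes g: "generator_graph \<mu> P g h"
 shows "((\<lambda>t. N (jump A \<zeta> z (P t g))) \<longlongrightarrow> 0) at_top"
proof -
 have "((\<lambda>t. \<phi> z * (N (jump A \<zeta> z (P t g)))\<^sup>2) \<longlongrightarrow> 0) at_top"
  by (rule energy_decay[OF g generator_jump]) (auto intro: mult_nonneg_nonneg less_imp_le[OF phi_pos])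
 from tendsto_mult[OF tendsto_const this, of "1 / \<phi> z"]
 have "((\<lambda>t. (N (jump A \<zeta> z (P t g)))\<^sup>2) \<longlongrightarrow> 0) at_top" using phi_pos[of z] by simp
 from tendsto_real_sqrt[OF this] show ?thesis by simp
qed

lemma EE_raise_decay:
 assumes g: "generator_graph \<mu> P g h"
 shows "((\<lambda>t. (\<integral>c. indicator (EE A \<zeta>) c * P t g c \<partial>\<mu>) - (\<integral>c. indicator (EE A (\<zeta>(z := \<zeta> z + 1))) c * P t g c \<partial>\<mu>)) \<longlongrightarrow> 0) at_top"
proof (rule Lim_null_comparison[OF _ jump_decay[OF g]])
 show "\<forall>\<^sub>F t in at_top. norm ((\<integral>c. indicator (EE A \<zeta>) c * P t g c \<partial>\<mu>) - (\<integral>c. indicator (EE A (\<zeta>(z := \<zeta> z + 1))) c * P t g c \<partial>\<mu>)) \<le> N (jump A \<zeta> z (P t g))"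
  using eventually_ge_at_top[of 0]
 proof eventually_elim
  case (elim t)
  have L: "L2 \<mu> (P t g)" using P_L2[OF elim] g by (simp add: generator_graph_def)
  have i: "integrable \<mu> (P t g)" by (rule L2_integrable[OF L])
  have i1: "integrable \<mu> (\<lambda>c. indicator (EE A \<zeta>) c * P t g c)"
   using integrable_mult_indicator[OF EE_sets[OF A(1)] i] by simp
  note ir = integral_raise[OF A z L2_measurable[OF L]]
  have "(\<integral>c. jump A \<zeta> z (P t g) c \<partial>\<mu>) = (\<integral>c. indicator (EE A \<zeta>) c * P t g (raise z c) - indicator (EE A \<zeta>) c * P t g c \<partial>\<mu>)"
   by (simp add: jump_def right_diff_distrib)
  also have "... = (\<integral>c. indicator (EE A (\<zeta>(z := \<zeta> z + 1))) c * P t g c \<partial>\<mu>) - (\<integral>c. indicator (EE A \<zeta>) c * P t g c \<partial>\<mu>)"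
   using ir(1) Bochner_Integration.integral_diff[OF ir(2)[OF i] i1] by simp
  finally show ?case using L2_integral_le[OF jump_bounds(1)[OF L]] by simp
 qed
qed

end

lemma generator_mean:
 assumes "generator_graph \<mu> P u v" shows "expectation v = 0"
proof -
 obtain F where L: "L2 \<mu> u" "L2 \<mu> v" and F: "\<And>n. local_fun (F n)" "\<And>n. L2 \<mu> (F n)" "\<And>n. L2 \<mu> (genL \<phi> (F n))"
  and lim: "(\<lambda>n. N (\<lambda>h. genL \<phi> (F n) h - v h)) \<longlonglongrightarrow> 0"
  using assms unfolding gen closure_graph_def by blast
 have z: "(\<lambda>n. N (\<lambda>h. (1::real) - 1)) \<longlonglongrightarrow> 0" by (simp add: nrm2_def)
 have "(\<lambda>n. \<integral>h. 1 * genL \<phi> (F n) h \<partial>\<mu>) \<longlonglongrightarrow> (\<integral>h. 1 * v h \<partial>\<mu>)"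
  by (rule inner_LIMSEQ[OF L2_const L2_const z F(3) L(2) lim])
 thus ?thesis using core_mean[OF F] LIMSEQ_unique[OF _ tendsto_const] by (simp add: LIMSEQ_const_iff)
qed

text \<open>Both patterns are joined to \<open>max_rec\<close> by single additions, and every such
  step changes the integral by a quantity that tends to 0.\<close>

lemma EE_balance:
 assumes g: "generator_graph \<mu> P g h" and A: "finite A" "W \<subseteq> A"
  and z: "\<zeta> \<in> rec A (kI W A)" "\<zeta>' \<in> rec A (kI W A)"
 shows "((\<lambda>t. (\<integral>c. indicator (EE A \<zeta>) c * P t g c \<partial>\<mu>) - (\<integral>c. indicator (EE A \<zeta>') c * P t g c \<partial>\<mu>)) \<longlongrightarrow> 0) at_top"
proof -
 let ?I = "\<lambda>\<zeta> t. \<integral>c. indicator (EE A \<zeta>) c * P t g c \<partial>\<mu>"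
 let ?m = "max_rec A (kI W A)"
 have m: "((\<lambda>t. ?I \<zeta> t - ?I ?m t) \<longlongrightarrow> 0) at_top" if "\<zeta> \<in> rec A (kI W A)" for \<zeta>
 proof (rule rec_raise_induct[OF A(1) that, where P="\<lambda>\<zeta>. ((\<lambda>t. ?I \<zeta> t - ?I ?m t) \<longlongrightarrow> 0) at_top"])
  fix \<zeta> x assume *: "\<zeta> \<in> rec A (kI W A)" "x \<in> A" "\<zeta>(x := \<zeta> x + 1) \<in> rec A (kI W A)"
   and ih: "((\<lambda>t. ?I (\<zeta>(x := \<zeta> x + 1)) t - ?I ?m t) \<longlongrightarrow> 0) at_top"
  from tendsto_add[OF EE_raise_decay[OF A * g] ih] show "((\<lambda>t. ?I \<zeta> t - ?I ?m t) \<longlongrightarrow> 0) at_top" by simp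
 qed simp
 from tendsto_diff[OF m[OF z(1)] m[OF z(2)]] show ?thesis by simp
qed

end

section \<open>Concentration\<close>

text \<open>The product of effective resistances met when the sites of Q are wired one after
  another; classically the determinant of the Green function of V restricted to Q.\<close>

definition rr :: "('d::finite) site set => 'd site set => real" where
 "rr Q V = real (trees (V - Q) (wire Q (out V))) / real (trees V (out V))"

definition rho :: "('d::finite) site set => 'd site set => 'd site set => real" where
 "rho W Q A = real (trees (A - Q) (wire Q (kI W A))) / real (trees A (kI W A))"

text \<open>By \<open>rr_mono\<close> the supremum is also the limit along growing volumes.\<close>

definition rstar :: "('d::finite) site set => real" where
 "rstar Q = (SUP V\<in>{V. finite V \<and> Q \<subseteq> V}. rr Q V)"

definition rim_sites :: "('d::finite) site set => 'd site set" where
 "rim_sites A = (\<Union>y\<in>A. {z. nbr y z}) - A"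

lemma finite_rim_sites: "finite A ==> finite (rim_sites A)" by (auto simp: rim_sites_def)

lemma dg_out_Diff: "finite V ==> W \<subseteq> V ==> out W y = out V y + dg (V - W) y" for y :: "('d::finite) site"
 using dg_out[of V y] dg_out[of W y] dg_Diff[of V W y] by simp

lemma frac_le_cross:
 fixes a b c d :: nat
 assumes "a * d \<le> c * b" "0 < b" "0 < d"
 shows "real a / real b \<le> real c / real d"
proof -
 have "real a * real d \<le> real c * real b" using assms(1) by (metis of_nat_le_iff of_nat_mult)
 thus ?thesis using assms(2,3) by (simp add: field_simps)
qed

lemma rr_mono:
 assumes "finite V" "W \<subseteq> V" "Q \<subseteq> W" shows "rr Q W \<le> rr Q V" unfolding rr_def
proof (rule frac_le_cross)
 show "trees (W - Q) (wire Q (out W)) * trees V (out V) \<le> trees (V - Q) (wire Q (out V)) * trees W (out W)"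
  by (rule trees_wires_mono) (use assms dg_out_Diff in auto)
qed (rule trees_wired_pos, rule finite_subset[OF assms(2,1)], rule trees_wired_pos[OF assms(1)])

text \<open>Seen from a core A, the volume W has the rest of A wired to its sink: on W,
  \<open>out W\<close> is \<open>kI W A\<close> plus the degree into A - W. Wiring lowers
  resistances, which gives a lower bound valid for every core with an admissible pattern.\<close>

lemma rr_rho:
 assumes "finite A" "W \<subseteq> A" "Q \<subseteq> W" "0 < trees A (kI W A)" shows "rr Q W \<le> rho W Q A" unfolding rr_def rho_def
proof (rule frac_le_cross)
 show "trees (W - Q) (wire Q (out W)) * trees A (kI W A) \<le> trees (A - Q) (wire Q (kI W A)) * trees W (out W)"
  by (rule trees_wires_mono) (use assms dg_out_Diff in \<open>auto simp: kI_def\<close>)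
qed (rule trees_wired_pos, rule finite_subset[OF assms(2,1)], rule assms(4))

context sandpile_limit
begin

lemma rr_le: "finite V ==> Q \<subseteq> V ==> rr Q V \<le> 2 ^ card Q" for V :: "'d site set"
proof -
 assume V: "finite V" "Q \<subseteq> V"
 have "trees (V - Q) (wire Q (out V)) = trees (V - Q) (out (V - Q))"
  by (rule trees_cong, rule wire_out) (use V finite_subset[OF V(2,1)] in auto)
 hence "real (trees (V - Q) (wire Q (out V))) \<le> real (2 ^ card Q * trees V (out V))"
  unfolding of_nat_le_iff using trees_wired_Diff[OF d3 V] by simp
 thus ?thesis unfolding rr_def using trees_wired_pos[OF V(1)] by (simp add: divide_le_eq)
qed

lemma rr_rstar: "finite V ==> Q \<subseteq> V ==> rr Q V \<le> rstar Q" for V :: "'d site set"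
 unfolding rstar_def by (rule cSUP_upper) (auto intro!: bdd_aboveI[of _ "2 ^ card Q"] rr_le)

lemma rstar_approx:
 fixes Q :: "'d site set"
 assumes "finite Q" "0 < \<delta>" obtains V where "finite V" "Q \<subseteq> V" "rstar Q - \<delta> < rr Q V"
proof -
 have "bdd_above (rr Q ` {V. finite V \<and> Q \<subseteq> V})" by (auto intro!: bdd_aboveI[of _ "2 ^ card Q"] rr_le)
 moreover have "{V. finite V \<and> Q \<subseteq> V} \<noteq> {}" using assms(1) by blast
 moreover have "rstar Q - \<delta> < rstar Q" using assms(2) by simp
 ultimately obtain V where "V \<in> {V. finite V \<and> Q \<subseteq> V}" "rstar Q - \<delta> < rr Q V"
  unfolding rstar_def using less_cSUP_iff by (metis (no_types, lifting))
 thus thesis using that by blast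
qed

lemma rr_nonneg: "0 \<le> rr Q V" by (simp add: rr_def)

lemma rstar_nonneg: "finite Q ==> 0 \<le> rstar Q" for Q :: "'d site set" using rr_rstar[of Q Q] rr_nonneg[of Q Q] by simp

lemma trees_ratio_limit:
 assumes A: "finite A" "W \<subseteq> A"
 shows "((\<lambda>V. real (trees A (kI W A)) * (real (trees (V - A) (out V)) / real (trees V (out V)))) \<longlongrightarrow> wt W A) volumes"
proof (cases "rec A (kI W A) = {}")
 case True
 thus ?thesis by (simp add: wt_def trees_def)
next
 case False
 then obtain \<zeta> where z: "\<zeta> \<in> rec A (kI W A)" by blast
 have "((\<lambda>V. real (trees (V - A) (out V)) / real (trees V (out V))) \<longlongrightarrow> ee A) volumes"
  using EE_limit_trees[OF A z] unfolding measure_EE[OF A z] .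
 thus ?thesis unfolding wt_def by (intro tendsto_intros)
qed

text \<open>In finite volume the sum over all cores is exactly \<open>rr Q V\<close>, by
  \<open>trees_core_sum\<close>; dropping cores outside the box only decreases it. Having
  \<open>rim_sites Q\<close> inside W makes the wiring of Q invisible beyond W.\<close>

lemma rho_sum_le:
 assumes W: "finite W" "Q \<subseteq> W" "rim_sites Q \<subseteq> W"
 shows "(\<Sum>A\<in>cores W n. wt W A * rho W Q A) \<le> rstar Q"
proof -
 let ?t = "\<lambda>V A. real (trees A (kI W A)) * (real (trees (V - A) (out V)) / real (trees V (out V)))"
 have lim: "((\<lambda>V. \<Sum>A\<in>cores W n. ?t V A * rho W Q A) \<longlongrightarrow> (\<Sum>A\<in>cores W n. wt W A * rho W Q A)) volumes"
  by (intro tendsto_sum tendsto_mult trees_ratio_limit tendsto_const) (auto dest: cores_finite)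
 have ev: "\<forall>\<^sub>F V in volumes. (\<Sum>A\<in>cores W n. ?t V A * rho W Q A) \<le> rstar Q"
 proof (rule eventually_volumes[of "W \<union> box n"])
  fix V :: "'d site set" assume V: "finite V" "W \<union> box n \<subseteq> V"
  let ?v = "real (trees V (out V))"
  have v: "0 < ?v" using trees_wired_pos[OF V(1)] by simp
  have QV: "Q \<subseteq> V" using W V by blast
  have dg0: "dg Q y = 0" if "y \<in> V - W" for y
  proof -
   have "{z\<in>Q. nbr y z} = {}"
   proof (rule ccontr)
    assume "{z\<in>Q. nbr y z} \<noteq> {}"
    then obtain q where q: "q \<in> Q" "nbr q y" using adj_sym by blast
    hence "y \<in> rim_sites Q" using that W(2) unfolding rim_sites_def by blast
    thus False using that W(3) by blast
   qed
   thus ?thesis by (simp only: dg_def card.empty)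
  qed
  have bd: "?t V A * rho W Q A \<le> (1 / ?v) * (real (trees (V - A) (out V)) * real (trees (A - Q) (wire Q (kI W A))))" for A
  proof -
   have "real (trees A (kI W A)) * rho W Q A \<le> real (trees (A - Q) (wire Q (kI W A)))" by (simp add: rho_def)
   hence "(real (trees (V - A) (out V)) / ?v) * (real (trees A (kI W A)) * rho W Q A)
     \<le> (real (trees (V - A) (out V)) / ?v) * real (trees (A - Q) (wire Q (kI W A)))" by (rule mult_left_mono) simp
   thus ?thesis by (simp add: mult_ac)
  qed
  have "(\<Sum>A\<in>cores W n. ?t V A * rho W Q A)
    \<le> (\<Sum>A\<in>cores W n. (1 / ?v) * (real (trees (V - A) (out V)) * real (trees (A - Q) (wire Q (kI W A)))))"
   by (rule sum_mono) (rule bd)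
  also have "... \<le> (\<Sum>A\<in>{A. W \<subseteq> A \<and> A \<subseteq> V}. (1 / ?v) * (real (trees (V - A) (out V)) * real (trees (A - Q) (wire Q (kI W A)))))"
  proof (rule sum_mono2)
   show "finite {A. W \<subseteq> A \<and> A \<subseteq> V}" by (rule finite_subset[of _ "Pow V"]) (use V in auto)
  qed (use V in \<open>auto simp: cores_def\<close>)
  also have "... = (1 / ?v) * real (\<Sum>A\<in>{A. W \<subseteq> A \<and> A \<subseteq> V}. trees (V - A) (out V) * trees (A - Q) (wire Q (rim V (out V) W A)))"
   unfolding sum_distrib_left of_nat_sum of_nat_mult
  proof (rule sum.cong[OF refl])
   fix A assume A: "A \<in> {A. W \<subseteq> A \<and> A \<subseteq> V}"
   have "trees (A - Q) (wire Q (kI W A)) = trees (A - Q) (wire Q (rim V (out V) W A))"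
    by (rule trees_cong) (use A rim_out[OF _ _ V(1), of A] in \<open>simp add: wire_def kI_def\<close>)
   thus "1 / ?v * (real (trees (V - A) (out V)) * real (trees (A - Q) (wire Q (kI W A))))
     = 1 / ?v * (real (trees (V - A) (out V)) * real (trees (A - Q) (wire Q (rim V (out V) W A))))" by simp
  qed
  also have "... = rr Q V" using trees_core_sum[OF V(1) _ W(2) dg0, of "out V"] V(2) by (simp add: rr_def)
  also have "... \<le> rstar Q" by (rule rr_rstar[OF V(1) QV])
  finally show "(\<Sum>A\<in>cores W n. ?t V A * rho W Q A) \<le> rstar Q" .
 qed (use W in simp)
 show ?thesis by (rule tendsto_upperbound[OF lim ev]) simp
qed

section \<open>Patterns on cores as an almost complete partition\<close>

definition patterns :: "'d site set => nat => ('d site set \<times> 'd config) set" where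
 "patterns W n = Sigma (cores W n) (\<lambda>A. rec A (kI W A))"

lemma patternsD:
 assumes "(A, \<zeta>) \<in> patterns W n"
 shows "finite A" "W \<subseteq> A" "\<zeta> \<in> rec A (kI W A)" "A \<in> cores W n"
 using assms cores_finite[of A W n] by (auto simp only: patterns_def mem_Sigma_iff)

lemma finite_patterns [simp]: "finite (patterns W n)" unfolding patterns_def by (rule finite_SigmaI) (auto intro: finite_rec cores_finite)

lemma sum_patterns: "(\<Sum>A\<in>cores W n. \<Sum>\<zeta>\<in>rec A (kI W A). f A \<zeta>) = (\<Sum>(A, \<zeta>)\<in>patterns W n. f A \<zeta>)"
 unfolding patterns_def by (rule sum.Sigma) (auto intro: finite_rec cores_finite)

lemma pattern_sum_in:
 fixes c :: "'d site set => 'd config => real"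
 assumes p: "(A, \<zeta>) \<in> patterns W n" and e: "h \<in> EE A \<zeta>"
 shows "(\<Sum>(B, \<xi>)\<in>patterns W n. c B \<xi> * indicator (EE B \<xi>) h) = c A \<zeta>"
proof -
 have "(\<Sum>(B, \<xi>)\<in>patterns W n. c B \<xi> * indicator (EE B \<xi>) h) = (\<Sum>(B, \<xi>)\<in>{(A, \<zeta>)}. c B \<xi> * indicator (EE B \<xi>) h)"
 proof (rule sum.mono_neutral_right)
  show "\<forall>i\<in>patterns W n - {(A, \<zeta>)}. (case i of (B, \<xi>) => c B \<xi> * indicator (EE B \<xi>) h) = 0"
  proof
   fix i assume i: "i \<in> patterns W n - {(A, \<zeta>)}"
   obtain B \<xi> where B: "i = (B, \<xi>)" by fastforce
   have "h \<notin> EE B \<xi>" using EE_disjoint[OF patternsD(1-3)[OF p] patternsD(1-3)[of B \<xi> W n] e] i B by auto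
   thus "(case i of (B, \<xi>) => c B \<xi> * indicator (EE B \<xi>) h) = 0" using B by simp
  qed
 qed (use p in auto)
 thus ?thesis using e by simp
qed

lemma pattern_sum_out:
 fixes c :: "'d site set => 'd config => real"
 assumes "\<And>A \<zeta>. (A, \<zeta>) \<in> patterns W n ==> h \<notin> EE A \<zeta>"
 shows "(\<Sum>(B, \<xi>)\<in>patterns W n. c B \<xi> * indicator (EE B \<xi>) h) = 0" by (rule sum.neutral) (use assms in auto)

lemma wt_total: "(\<Sum>A\<in>cores W n. wt W A) = (\<Sum>(A, \<zeta>)\<in>patterns W n. prob (EE A \<zeta>))"
 unfolding sum_patterns[symmetric] by (rule sum.cong[OF refl], rule wt_sum) (rule cores_finite, assumption)+

lemma pattern_integral:
 fixes c :: "'d site set => 'd config => real"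
 shows "integrable \<mu> (\<lambda>h. \<Sum>(A, \<zeta>)\<in>patterns W n. c A \<zeta> * indicator (EE A \<zeta>) h)"
  and "(\<integral>h. (\<Sum>(A, \<zeta>)\<in>patterns W n. c A \<zeta> * indicator (EE A \<zeta>) h) \<partial>\<mu>) = (\<Sum>(A, \<zeta>)\<in>patterns W n. c A \<zeta> * prob (EE A \<zeta>))"
proof -
 have i: "integrable \<mu> (\<lambda>h. case i of (A, \<zeta>) => c A \<zeta> * indicator (EE A \<zeta>) h)"
  and v: "(\<integral>h. (case i of (A, \<zeta>) => c A \<zeta> * indicator (EE A \<zeta>) h) \<partial>\<mu>) = (case i of (A, \<zeta>) => c A \<zeta> * prob (EE A \<zeta>))"
  if "i \<in> patterns W n" for i
 proof -
  obtain A \<zeta> where A: "i = (A, \<zeta>)" by fastforce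
  have E: "EE A \<zeta> \<in> sets \<mu>" by (rule EE_sets) (use that A patternsD in blast)
  show "integrable \<mu> (\<lambda>h. case i of (A, \<zeta>) => c A \<zeta> * indicator (EE A \<zeta>) h)"
   and "(\<integral>h. (case i of (A, \<zeta>) => c A \<zeta> * indicator (EE A \<zeta>) h) \<partial>\<mu>) = (case i of (A, \<zeta>) => c A \<zeta> * prob (EE A \<zeta>))"
   using E sets.sets_into_space[OF E] by (auto simp: A emeasure_eq_measure Int_absorb2)
 qed
 show "integrable \<mu> (\<lambda>h. \<Sum>(A, \<zeta>)\<in>patterns W n. c A \<zeta> * indicator (EE A \<zeta>) h)"
  by (rule Bochner_Integration.integrable_sum) (rule i)
 show "(\<integral>h. (\<Sum>(A, \<zeta>)\<in>patterns W n. c A \<zeta> * indicator (EE A \<zeta>) h) \<partial>\<mu>) = (\<Sum>(A, \<zeta>)\<in>patterns W n. c A \<zeta> * prob (EE A \<zeta>))"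
  by (rule trans[OF Bochner_Integration.integral_sum[OF i] sum.cong[OF refl v]])
qed

lemma wt_total_le: "(\<Sum>A\<in>cores W n. wt W A) \<le> 1"
proof -
 have "(\<Sum>A\<in>cores W n. wt W A) = (\<integral>h. (\<Sum>(A, \<zeta>)\<in>patterns W n. 1 * indicator (EE A \<zeta>) h) \<partial>\<mu>)"
  unfolding wt_total pattern_integral(2) by simp
 also have "... \<le> (\<integral>h. 1 \<partial>\<mu>)"
 proof (rule integral_mono[OF pattern_integral(1)])
  fix h assume "h \<in> space \<mu>"
  show "(\<Sum>(A, \<zeta>)\<in>patterns W n. 1 * indicator (EE A \<zeta>) h) \<le> (1::real)"
  proof (cases "\<exists>A \<zeta>. (A, \<zeta>) \<in> patterns W n \<and> h \<in> EE A \<zeta>")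
   case True
   then obtain A \<zeta> where "(A, \<zeta>) \<in> patterns W n" "h \<in> EE A \<zeta>" by blast
   from pattern_sum_in[OF this, of "\<lambda>_ _. 1"] show ?thesis by simp
  next
   case False
   thus ?thesis by (subst pattern_sum_out) auto
  qed
 qed simp
 also have "... = 1" by (simp add: prob_space)
 finally show ?thesis .
qed

text \<open>A quantity that is nowhere below the limit minus \<delta>, and whose mean is not above
  the limit, is close to the limit in mean. The missing mass \<delta>' enters with weight
  \<open>rstar Q\<close>.\<close>

lemma rho_concentrated:
 assumes W: "finite W" "Q \<subseteq> W" "rim_sites Q \<subseteq> W" and d: "rstar Q - \<delta> \<le> rr Q W" and m: "1 - \<delta>' \<le> (\<Sum>A\<in>cores W n. wt W A)"
 shows "(\<Sum>A\<in>cores W n. wt W A * \<bar>rho W Q A - rstar Q\<bar>) \<le> 2 * \<delta> + \<delta>' * rstar Q"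
proof -
 let ?r = "rr Q W" and ?s = "rstar Q" and ?m = "\<Sum>A\<in>cores W n. wt W A"
 have rs: "?r \<le> ?s" by (rule rr_rstar[OF W(1,2)])
 have r0: "0 \<le> ?r" by (rule rr_nonneg)
 have bd: "wt W A * \<bar>rho W Q A - ?s\<bar> \<le> wt W A * rho W Q A - ?r * wt W A + (?s - ?r) * wt W A" if A: "A \<in> cores W n" for A
 proof (cases "trees A (kI W A) = 0")
  case True
  thus ?thesis by (simp add: wt_def)
 next
  case False
  have "?r \<le> rho W Q A" by (rule rr_rho) (use W cores_finite[OF A] False in auto)
  hence "\<bar>rho W Q A - ?s\<bar> \<le> rho W Q A - ?r + (?s - ?r)" using rs by linarith
  hence "wt W A * \<bar>rho W Q A - ?s\<bar> \<le> wt W A * (rho W Q A - ?r + (?s - ?r))"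
   by (rule mult_left_mono) (rule wt_nonneg[OF cores_finite[OF A]])
  thus ?thesis by (simp add: algebra_simps)
 qed
 have "(\<Sum>A\<in>cores W n. wt W A * \<bar>rho W Q A - ?s\<bar>) \<le> (\<Sum>A\<in>cores W n. wt W A * rho W Q A - ?r * wt W A + (?s - ?r) * wt W A)"
  by (rule sum_mono) (rule bd)
 also have "... = (\<Sum>A\<in>cores W n. wt W A * rho W Q A) - ?r * ?m + (?s - ?r) * ?m"
  by (simp add: sum.distrib sum_subtractf sum_distrib_left)
 also have "... \<le> ?s - ?r * (1 - \<delta>') + (?s - ?r) * 1"
  by (intro add_mono diff_mono rho_sum_le[OF W] mult_left_mono m wt_total_le) (use rs r0 in auto)
 also have "... = 2 * (?s - ?r) + \<delta>' * ?r" by (simp add: algebra_simps)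
 also have "... \<le> 2 * \<delta> + \<delta>' * ?s" using d rs m wt_total_le[of W n] by (intro add_mono mult_left_mono) auto
 finally show ?thesis .
qed

text \<open>The share of admissible patterns on A that lie in a fixed event
  \<open>EE A0 \<zeta>0\<close>; by \<open>card_subpatterns\<close> it is the same for every
  admissible \<zeta>0.\<close>

definition rate :: "'d site set => 'd site set => 'd site set => real" where
 "rate A0 W A = real (trees (A - A0) (kI W A)) / real (trees A (kI W A))"

definition coeff :: "'d site set => 'd site set => real" where
 "coeff A0 Q = (\<Prod>y\<in>Q. - real (dg A0 y))"

definition limit_rate :: "'d site set => real" where
 "limit_rate A0 = (\<Sum>Q\<in>Pow (rim_sites A0). coeff A0 Q * rstar (A0 \<union> Q))"

text \<open>In the numerator A0 is deleted, not wired. \<open>trees_expand\<close> with c the degree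
  into A0, supported on \<open>rim_sites A0\<close>, rewrites deletion by wirings of A0 together
  with a subset Q of its rim, to which concentration applies.\<close>

lemma rate_expand:
 assumes A: "finite A" "W \<subseteq> A" "A0 \<union> rim_sites A0 \<subseteq> W"
 shows "rate A0 W A = (\<Sum>Q\<in>Pow (rim_sites A0). coeff A0 Q * rho W (A0 \<union> Q) A)"
proof -
 let ?Y = "rim_sites A0"
 have f: "finite A0" "finite ?Y" using A finite_subset[of "A0 \<union> ?Y" A] by auto
 have "real (trees (A - A0) (kI W A)) = (\<Sum>Q\<in>Pow ?Y. coeff A0 Q *
   real (trees (A - A0 - Q) (\<lambda>z. kI W A z + (if z \<in> ?Y then dg A0 z else 0) + dg Q z)))"
  unfolding coeff_def by (rule trees_expand) (use A f in \<open>auto simp: rim_sites_def\<close>)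
 also have "... = (\<Sum>Q\<in>Pow ?Y. coeff A0 Q * real (trees (A - (A0 \<union> Q)) (wire (A0 \<union> Q) (kI W A))))"
 proof (rule sum.cong[OF refl])
  fix Q assume Q: "Q \<in> Pow ?Y"
  hence fQ: "finite Q" "A0 \<inter> Q = {}" using f(2) finite_subset[of Q ?Y] unfolding rim_sites_def by blast+
  have "A - A0 - Q = A - (A0 \<union> Q)" by auto
  moreover have "trees (A - (A0 \<union> Q)) (\<lambda>z. kI W A z + (if z \<in> ?Y then dg A0 z else 0) + dg Q z)
    = trees (A - (A0 \<union> Q)) (wire (A0 \<union> Q) (kI W A))"
  proof (rule trees_cong)
   fix y assume y: "y \<in> A - (A0 \<union> Q)"
   have "dg A0 y = 0" if "y \<notin> ?Y"
   proof -
    have "{z\<in>A0. nbr y z} = {}" using that y adj_sym unfolding rim_sites_def by blast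
    thus ?thesis by (simp only: dg_def card.empty)
   qed
   thus "kI W A y + (if y \<in> ?Y then dg A0 y else 0) + dg Q y = wire (A0 \<union> Q) (kI W A) y"
    using dg_Un[OF f(1) fQ(1,2)] by (simp add: wire_def)
  qed
  ultimately show "coeff A0 Q * real (trees (A - A0 - Q) (\<lambda>z. kI W A z + (if z \<in> ?Y then dg A0 z else 0) + dg Q z))
    = coeff A0 Q * real (trees (A - (A0 \<union> Q)) (wire (A0 \<union> Q) (kI W A)))" by simp
 qed
 finally show ?thesis unfolding rate_def rho_def by (simp add: sum_divide_distrib)
qed

lemma rate_concentrated:
 assumes A0: "finite A0" and X: "finite X" and d: "0 < \<delta>"
 obtains W n where "finite W" "X \<subseteq> W" "A0 \<union> rim_sites A0 \<subseteq> W" "1 - \<delta> \<le> (\<Sum>A\<in>cores W n. wt W A)"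
  "(\<Sum>A\<in>cores W n. wt W A * \<bar>rate A0 W A - limit_rate A0\<bar>) \<le> \<delta>"
proof -
 let ?Y = "rim_sites A0"
 have fY: "finite ?Y" by (rule finite_rim_sites[OF A0])
 have fQ: "finite (A0 \<union> Q)" if "Q \<in> Pow ?Y" for Q using that A0 fY finite_subset by auto
 define S where "S = (\<Sum>Q\<in>Pow ?Y. \<bar>coeff A0 Q\<bar> * (2 + rstar (A0 \<union> Q)))"
 have S0: "0 \<le> S" unfolding S_def by (intro sum_nonneg mult_nonneg_nonneg add_nonneg_nonneg rstar_nonneg fQ) auto
 \<comment> \<open>S collects the absolute coefficients with the error factor 2 plus
   \<open>rstar\<close> of each Q; the added 1 also makes \<epsilon> at most \<delta>.\<close>
 define \<epsilon> where "\<epsilon> = \<delta> / (1 + S)"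
 have e: "0 < \<epsilon>" using d S0 by (simp add: \<epsilon>_def)
 have eS: "\<epsilon> * S \<le> \<delta>" "\<epsilon> \<le> \<delta>" using d S0 by (auto simp: \<epsilon>_def field_simps)
 have "\<forall>Q\<in>Pow ?Y. \<exists>V. finite V \<and> A0 \<union> Q \<subseteq> V \<and> rstar (A0 \<union> Q) - \<epsilon> < rr (A0 \<union> Q) V"
 proof
  fix Q assume q: "Q \<in> Pow ?Y"
  obtain V where "finite V" "A0 \<union> Q \<subseteq> V" "rstar (A0 \<union> Q) - \<epsilon> < rr (A0 \<union> Q) V"
   by (rule rstar_approx[OF fQ[OF q] e])
  thus "\<exists>V. finite V \<and> A0 \<union> Q \<subseteq> V \<and> rstar (A0 \<union> Q) - \<epsilon> < rr (A0 \<union> Q) V" by (intro exI conjI)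
 qed
 from bchoice[OF this] obtain V where V: "\<And>Q. Q \<in> Pow ?Y ==> finite (V Q) \<and> A0 \<union> Q \<subseteq> V Q \<and> rstar (A0 \<union> Q) - \<epsilon> < rr (A0 \<union> Q) (V Q)"
  by blast
 \<comment> \<open>One window for all Q: it contains a nearly optimal volume for each, and the
   second rim, so that \<open>rim_sites (A0 \<union> Q)\<close> stays inside.\<close>
 define W where "W = X \<union> A0 \<union> ?Y \<union> rim_sites ?Y \<union> (\<Union>Q\<in>Pow ?Y. V Q)"
 have W: "finite W" unfolding W_def using X A0 fY V by (auto intro: finite_rim_sites)
 have sub: "X \<subseteq> W" "A0 \<union> ?Y \<subseteq> W" unfolding W_def by auto
 obtain n where n: "1 - \<epsilon> \<le> (\<Sum>A\<in>cores W n. wt W A)" using cores_mass[OF W e] by blast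
 have Q: "(\<Sum>A\<in>cores W n. wt W A * \<bar>rho W (A0 \<union> Q) A - rstar (A0 \<union> Q)\<bar>) \<le> 2 * \<epsilon> + \<epsilon> * rstar (A0 \<union> Q)" if q: "Q \<in> Pow ?Y" for Q
 proof (rule rho_concentrated[OF W _ _ _ n])
  show "A0 \<union> Q \<subseteq> W" using q sub by auto
  have "rim_sites (A0 \<union> Q) \<subseteq> A0 \<union> ?Y \<union> rim_sites ?Y" using q unfolding rim_sites_def by blast
  thus "rim_sites (A0 \<union> Q) \<subseteq> W" unfolding W_def by blast
  have "rr (A0 \<union> Q) (V Q) \<le> rr (A0 \<union> Q) W" by (rule rr_mono[OF W]) (use V[OF q] q in \<open>auto simp: W_def\<close>)
  thus "rstar (A0 \<union> Q) - \<epsilon> \<le> rr (A0 \<union> Q) W" using V[OF q] by linarith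
 qed
 have "(\<Sum>A\<in>cores W n. wt W A * \<bar>rate A0 W A - limit_rate A0\<bar>)
   \<le> (\<Sum>A\<in>cores W n. \<Sum>Q\<in>Pow ?Y. \<bar>coeff A0 Q\<bar> * (wt W A * \<bar>rho W (A0 \<union> Q) A - rstar (A0 \<union> Q)\<bar>))"
 proof (rule sum_mono)
  fix A assume A: "A \<in> cores W n"
  have "rate A0 W A - limit_rate A0 = (\<Sum>Q\<in>Pow ?Y. coeff A0 Q * (rho W (A0 \<union> Q) A - rstar (A0 \<union> Q)))"
   unfolding rate_expand[OF cores_finite[OF A] sub(2)] limit_rate_def by (simp add: sum_subtractf right_diff_distrib)
  hence "\<bar>rate A0 W A - limit_rate A0\<bar> \<le> (\<Sum>Q\<in>Pow ?Y. \<bar>coeff A0 Q * (rho W (A0 \<union> Q) A - rstar (A0 \<union> Q))\<bar>)"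
   by (simp only: sum_abs)
  hence "wt W A * \<bar>rate A0 W A - limit_rate A0\<bar> \<le> wt W A * (\<Sum>Q\<in>Pow ?Y. \<bar>coeff A0 Q * (rho W (A0 \<union> Q) A - rstar (A0 \<union> Q))\<bar>)"
   by (rule mult_left_mono) (rule wt_nonneg[OF cores_finite[OF A]])
  also have "... = (\<Sum>Q\<in>Pow ?Y. \<bar>coeff A0 Q\<bar> * (wt W A * \<bar>rho W (A0 \<union> Q) A - rstar (A0 \<union> Q)\<bar>))"
   by (simp add: sum_distrib_left abs_mult mult_ac)
  finally show "wt W A * \<bar>rate A0 W A - limit_rate A0\<bar> \<le> (\<Sum>Q\<in>Pow ?Y. \<bar>coeff A0 Q\<bar> * (wt W A * \<bar>rho W (A0 \<union> Q) A - rstar (A0 \<union> Q)\<bar>))" .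
 qed
 also have "... = (\<Sum>Q\<in>Pow ?Y. \<bar>coeff A0 Q\<bar> * (\<Sum>A\<in>cores W n. wt W A * \<bar>rho W (A0 \<union> Q) A - rstar (A0 \<union> Q)\<bar>))"
  by (subst sum.swap) (simp add: sum_distrib_left)
 also have "... \<le> (\<Sum>Q\<in>Pow ?Y. \<bar>coeff A0 Q\<bar> * (2 * \<epsilon> + \<epsilon> * rstar (A0 \<union> Q)))"
  by (intro sum_mono mult_left_mono Q) auto
 also have "... = \<epsilon> * S" unfolding S_def by (simp add: sum_distrib_left algebra_simps)
 finally have "(\<Sum>A\<in>cores W n. wt W A * \<bar>rate A0 W A - limit_rate A0\<bar>) \<le> \<delta>" using eS(1) by linarith
 moreover have "1 - \<delta> \<le> (\<Sum>A\<in>cores W n. wt W A)" using n eS(2) by linarith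
 ultimately show thesis using that W sub by blast
qed

text \<open>The complement of A0 burns in two stages: first outside A with A unburnt, which is
  given, then A - A0 inside A. So membership in the smaller event is decided by the pattern \<zeta>
  alone.\<close>

lemma EE_subpattern:
 assumes A: "finite A" "A0 \<subseteq> A" "\<zeta> \<in> rec A (kI W A)" and e: "h \<in> EE A \<zeta>"
 shows "h \<in> EE A0 \<zeta>0 \<longleftrightarrow> \<zeta> \<in> with_core A (kI W A) A0 \<zeta>0"
proof -
 have eA: "\<And>y. y \<in> A ==> h y = \<zeta> y" and cl: "clears A UNIV h" and sp: "h \<in> space \<mu>" using e by (auto simp: EE_def)
 have "clears A0 UNIV h \<longleftrightarrow> clears A0 A \<zeta>"
 proof
  assume c: "clears A0 UNIV h"
  show "clears A0 A \<zeta>" unfolding clears_def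
  proof (intro allI impI)
   fix F assume F: "finite F \<and> F \<subseteq> A - A0 \<and> F \<noteq> {}"
   then obtain y where "y \<in> F" "int (dg (F \<union> A0) y) < h y" using c unfolding clears_def by blast
   thus "\<exists>y\<in>F. int (dg (F \<union> A0) y) < \<zeta> y" using eA[of y] F by auto
  qed
 next
  assume c: "clears A0 A \<zeta>"
  show "clears A0 UNIV h" unfolding clears_def
  proof (intro allI impI)
   fix F assume F: "finite F \<and> F \<subseteq> UNIV - A0 \<and> F \<noteq> {}"
   show "\<exists>y\<in>F. int (dg (F \<union> A0) y) < h y"
   proof (cases "F \<subseteq> A")
    case True
    hence "F \<subseteq> A - A0" using F by auto
    then obtain y where "y \<in> F" "int (dg (F \<union> A0) y) < \<zeta> y" using c F unfolding clears_def by blast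
    thus ?thesis using eA True by (intro bexI[of _ y]) auto
   next
    case False
    hence "finite (F - A) \<and> F - A \<subseteq> UNIV - A \<and> F - A \<noteq> {}" using F by auto
    then obtain y where y: "y \<in> F - A" "int (dg ((F - A) \<union> A) y) < h y" using cl unfolding clears_def by blast
    have "dg (F \<union> A0) y \<le> dg ((F - A) \<union> A) y" by (rule dg_mono) (use F A in auto)
    thus ?thesis using y by (intro bexI[of _ y]) auto
   qed
  qed
 qed
 moreover have "(\<forall>y\<in>A0. h y = \<zeta>0 y) \<longleftrightarrow> (\<forall>y\<in>A0. \<zeta> y = \<zeta>0 y)"
  by (rule ball_cong[OF refl]) (use eA A(2) in auto)
 ultimately show ?thesis using sp A(3) by (simp add: EE_def with_core_def)
qed

lemma card_subpatterns:
 assumes A: "finite A" "W \<subseteq> A" "W0 \<subseteq> A0" "A0 \<subseteq> W" and z: "\<zeta>0 \<in> rec A0 (kI W0 A0)"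
 shows "card (with_core A (kI W A) A0 \<zeta>0) = trees (A - A0) (kI W A)"
proof (rule card_with_core)
 have sub: "A0 \<subseteq> A" using A by auto
 have "rec A0 (rim A (kI W A) W0 A0) = rec A0 (kI W0 A0)"
 proof (rule rec_cong)
  fix y assume "y \<in> A0"
  have "y \<in> W" if "y \<in> W0" using that A by auto
  thus "rim A (kI W A) W0 A0 y = kI W0 A0 y" using dg_out_Diff[OF A(1) sub, of y] by (simp add: rim_def kI_def)
 qed
 thus "\<zeta>0 \<in> rec A0 (rim A (kI W A) W0 A0)" using z by simp
 show "A0 \<subseteq> A" by (rule sub)
qed (use A in auto)

text \<open>Given the core, the pattern is uniform and \<open>rate\<close> is the conditional
  probability of the event. The deviation from it is a combination of pattern indicators with
  coefficients summing to zero on each core, and the rate itself is nearly constant.\<close>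

lemma EE_decomposition:
 assumes A0: "finite A0" "W0 \<subseteq> A0" "\<zeta>0 \<in> rec A0 (kI W0 A0)" and d: "0 < \<delta>"
 obtains W n c where "finite W" "\<And>A. A \<in> cores W n ==> (\<Sum>\<zeta>\<in>rec A (kI W A). c A \<zeta>) = 0"
  "nrm2 \<mu> (\<lambda>h. indicator (EE A0 \<zeta>0) h - (limit_rate A0 + (\<Sum>(A, \<zeta>)\<in>patterns W n. c A \<zeta> * indicator (EE A \<zeta>) h))) \<le> \<delta>"
proof -
 let ?p = "limit_rate A0"
 \<comment> \<open>Rates lie between 0 and 1, so K bounds both the distance of a rate from the limit
   and the error off the patterns.\<close>
 define K where "K = 1 + \<bar>?p\<bar>"
 have K: "1 \<le> K" "\<bar>?p\<bar> \<le> K - 1" by (auto simp: K_def)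
 have KK: "0 < K + K\<^sup>2" using K by (simp add: add_pos_pos)
 define \<epsilon> where "\<epsilon> = \<delta>\<^sup>2 / (K + K\<^sup>2)"
 have e: "0 < \<epsilon>" using d KK by (simp add: \<epsilon>_def)
 obtain W n where W: "finite W" "A0 \<subseteq> W" "A0 \<union> rim_sites A0 \<subseteq> W" "1 - \<epsilon> \<le> (\<Sum>A\<in>cores W n. wt W A)"
  "(\<Sum>A\<in>cores W n. wt W A * \<bar>rate A0 W A - ?p\<bar>) \<le> \<epsilon>" using rate_concentrated[OF A0(1) A0(1) e] by blast
 define c where "c A \<zeta> = of_bool (\<zeta> \<in> with_core A (kI W A) A0 \<zeta>0) - rate A0 W A" for A \<zeta>
 have sub: "with_core A (kI W A) A0 \<zeta>0 \<subseteq> rec A (kI W A)" for A by (auto simp: with_core_def)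
 have card: "card (with_core A (kI W A) A0 \<zeta>0) = trees (A - A0) (kI W A)" if "A \<in> cores W n" for A
  by (rule card_subpatterns) (use cores_finite[OF that] A0 W in auto)
 have c0: "(\<Sum>\<zeta>\<in>rec A (kI W A). c A \<zeta>) = 0" if A: "A \<in> cores W n" for A
 proof -
  have fr: "finite (rec A (kI W A))" by (rule finite_rec) (use cores_finite[OF A] in auto)
  have "(\<Sum>\<zeta>\<in>rec A (kI W A). of_bool (\<zeta> \<in> with_core A (kI W A) A0 \<zeta>0)) = real (card (with_core A (kI W A) A0 \<zeta>0))"
   using fr sub[of A] by (simp add: sum.If_cases of_bool_def Int_absorb1)
  moreover have "real (trees (A - A0) (kI W A)) = real (trees A (kI W A)) * rate A0 W A"
  proof (cases "trees A (kI W A) = 0")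
   case True
   hence "rec A (kI W A) = {}" using fr by (simp add: trees_def)
   thus ?thesis using card[OF A] sub[of A] True by simp
  qed (simp add: rate_def)
  ultimately show ?thesis using card[OF A] by (simp add: c_def sum_subtractf trees_def)
 qed
 let ?psi = "\<lambda>h. \<Sum>(A, \<zeta>)\<in>patterns W n. c A \<zeta> * indicator (EE A \<zeta>) h"
 let ?f = "\<lambda>h. indicator (EE A0 \<zeta>0) h - (?p + ?psi h) :: real"
 \<comment> \<open>\<open>?u\<close> plus K^2 dominates the squared error: it equals K times the
   deviation of the rate on a pattern, and K^2 on the small remaining part.\<close>
 let ?u = "\<lambda>h. \<Sum>(A, \<zeta>)\<in>patterns W n. (K * \<bar>rate A0 W A - ?p\<bar> - K\<^sup>2) * indicator (EE A \<zeta>) h"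
 have rate01: "0 \<le> rate A0 W A" "rate A0 W A \<le> 1" if A: "A \<in> cores W n" for A
 proof -
  show "0 \<le> rate A0 W A" by (simp add: rate_def)
  have "card (with_core A (kI W A) A0 \<zeta>0) \<le> card (rec A (kI W A))"
   by (rule card_mono[OF finite_rec sub]) (use cores_finite[OF A] in auto)
  hence "real (trees (A - A0) (kI W A)) \<le> real (trees A (kI W A))" using card[OF A] unfolding of_nat_le_iff by (simp add: trees_def)
  thus "rate A0 W A \<le> 1" unfolding rate_def by (auto simp: divide_le_eq_1)
 qed
 have le: "(?f h)\<^sup>2 \<le> ?u h + K\<^sup>2" for h
 proof (cases "\<exists>A \<zeta>. (A, \<zeta>) \<in> patterns W n \<and> h \<in> EE A \<zeta>")
  case True
  then obtain A \<zeta> where p: "(A, \<zeta>) \<in> patterns W n" "h \<in> EE A \<zeta>" by blast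
  note D = patternsD[OF p(1)]
  have "A0 \<subseteq> A" using W(2) D(2) by auto
  from EE_subpattern[OF D(1) this D(3) p(2), of \<zeta>0]
  have "?f h = rate A0 W A - ?p" unfolding pattern_sum_in[OF p] by (simp add: c_def indicator_def)
  hence "(?f h)\<^sup>2 = (rate A0 W A - ?p)\<^sup>2" by (simp only:)
  also have "... = \<bar>rate A0 W A - ?p\<bar> * \<bar>rate A0 W A - ?p\<bar>" by (simp add: power2_eq_square)
  also have "... \<le> K * \<bar>rate A0 W A - ?p\<bar>" using rate01[OF D(4)] K by (intro mult_right_mono) auto
  also have "... = ?u h + K\<^sup>2" unfolding pattern_sum_in[OF p] by simp
  finally show ?thesis .
 next
  case False
  hence "?u h = 0" "?psi h = 0" by (auto intro!: pattern_sum_out)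
  moreover have "\<bar>indicator (EE A0 \<zeta>0) h - ?p\<bar> \<le> K" using K by (auto simp: indicator_def)
  hence "\<bar>indicator (EE A0 \<zeta>0) h - ?p\<bar>\<^sup>2 \<le> K\<^sup>2" by (rule power_mono) simp
  ultimately show ?thesis by simp
 qed
 have E0: "EE A0 \<zeta>0 \<in> sets \<mu>" by (rule EE_sets[OF A0(1)])
 have fm: "?f \<in> borel_measurable \<mu>"
  by (intro borel_measurable_diff borel_measurable_add borel_measurable_const borel_measurable_indicator E0
    borel_measurable_integrable[OF pattern_integral(1)])
 have ui: "integrable \<mu> (\<lambda>h. ?u h + K\<^sup>2)" by (intro Bochner_Integration.integrable_add pattern_integral(1)) simp
 have fi: "integrable \<mu> (\<lambda>h. (?f h)\<^sup>2)"
 proof (rule Bochner_Integration.integrable_bound[OF ui])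
  show "AE h in \<mu>. norm ((?f h)\<^sup>2) \<le> norm (?u h + K\<^sup>2)" using le by (intro AE_I2) (simp add: order_trans[OF _ abs_ge_self])
 qed (use fm in measurable)
 have "(nrm2 \<mu> ?f)\<^sup>2 \<le> (\<integral>h. ?u h + K\<^sup>2 \<partial>\<mu>)"
  unfolding nrm2_sq by (rule integral_mono[OF fi ui]) (rule le)
 also have "... = (\<integral>h. ?u h \<partial>\<mu>) + K\<^sup>2"
  using Bochner_Integration.integral_add[OF pattern_integral(1), of "\<lambda>_. K\<^sup>2"] by (simp add: prob_space)
 also have "(\<integral>h. ?u h \<partial>\<mu>) = (\<Sum>A\<in>cores W n. (K * \<bar>rate A0 W A - ?p\<bar> - K\<^sup>2) * wt W A)"
 proof (rule trans[OF pattern_integral(2)], rule trans[OF sum_patterns[symmetric]], rule sum.cong[OF refl])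
  fix A assume "A \<in> cores W n"
  from wt_sum[OF cores_finite[OF this]]
  show "(\<Sum>\<zeta>\<in>rec A (kI W A). (K * \<bar>rate A0 W A - ?p\<bar> - K\<^sup>2) * prob (EE A \<zeta>)) = (K * \<bar>rate A0 W A - ?p\<bar> - K\<^sup>2) * wt W A"
   by (simp only: sum_distrib_left)
 qed
 also have "... = K * (\<Sum>A\<in>cores W n. wt W A * \<bar>rate A0 W A - ?p\<bar>) - K\<^sup>2 * (\<Sum>A\<in>cores W n. wt W A)"
  by (simp add: sum_distrib_left sum_subtractf algebra_simps)
 also have "... + K\<^sup>2 \<le> K * \<epsilon> - K\<^sup>2 * (1 - \<epsilon>) + K\<^sup>2"
  by (intro add_mono diff_mono mult_left_mono W order_refl) (use K in auto)
 also have "... = (K + K\<^sup>2) * \<epsilon>" by (simp add: algebra_simps)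
 also have "... = \<delta>\<^sup>2" using KK by (simp add: \<epsilon>_def)
 finally have "nrm2 \<mu> ?f \<le> \<delta>" by (rule power2_le_imp_le) (use d in simp)
 thus thesis using that[of W n c] W(1) c0 by blast
qed

end

section \<open>Mixing\<close>

context sandpile_process
begin

definition cov :: "real => ('d config => real) => ('d config => real) => real" where
 "cov t f g = (\<integral>h. f h * P t g h \<partial>\<mu>) - expectation f * expectation g"

lemma cov_bound:
 assumes t: "0 \<le> t" and f: "L2 \<mu> f" and g: "L2 \<mu> g"
 shows "\<bar>cov t f g\<bar> \<le> 2 * (N f * N g)"
proof -
 have "\<bar>\<integral>h. f h * P t g h \<partial>\<mu>\<bar> \<le> N f * N (P t g)" by (rule L2_Cauchy_Schwarz[OF f P_L2[OF t g]])
 also have "... \<le> N f * N g" by (intro mult_left_mono P_contract t g) simp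
 finally have "\<bar>\<integral>h. f h * P t g h \<partial>\<mu>\<bar> \<le> N f * N g" .
 moreover have "\<bar>expectation f * expectation g\<bar> \<le> N f * N g" unfolding abs_mult by (intro mult_mono L2_integral_le f g) auto
 ultimately show ?thesis unfolding cov_def by linarith
qed

lemma cov_lin:
 assumes t: "0 \<le> t" and f: "L2 \<mu> f" "L2 \<mu> f'" and g: "L2 \<mu> g"
 shows "cov t (\<lambda>h. a * f h + b * f' h) g = a * cov t f g + b * cov t f' g"
proof -
 note i = f[THEN L2_integrable] f[THEN integrable_square_sum, OF P_L2[OF t g]]
 have "(\<lambda>h. (a * f h + b * f' h) * P t g h) = (\<lambda>h. a * (f h * P t g h) + b * (f' h * P t g h))" by (simp add: algebra_simps)
 thus ?thesis using i by (simp add: cov_def algebra_simps)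
qed

lemma cov_lin_right:
 assumes t: "0 \<le> t" and f: "L2 \<mu> f" and g: "L2 \<mu> g" "L2 \<mu> g'"
 shows "cov t f (\<lambda>h. g h - g' h) = cov t f g - cov t f g'"
proof -
 note L = P_L2[OF t] f g
 have "(\<integral>h. f h * P t (\<lambda>h. g h - g' h) h \<partial>\<mu>) = (\<integral>h. f h * P t g h - f h * P t g' h \<partial>\<mu>)"
 proof (rule integral_cong_AE)
  show "AE h in \<mu>. f h * P t (\<lambda>h. g h - g' h) h = f h * P t g h - f h * P t g' h"
   using P_diff[OF t g] by eventually_elim (simp add: right_diff_distrib)
 qed (intro borel_measurable_times borel_measurable_diff L2_measurable L L2_diff)+
 thus ?thesis using g[THEN L2_integrable] g[THEN L(1), THEN integrable_square_sum[OF f]] by (simp add: cov_def right_diff_distrib)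
qed

text \<open>The second factor g stays fixed, in the domain of the generator wherever decay is
  derived, while f is enlarged step by step from pattern indicators to all of L2.\<close>

definition mixes :: "('d config => real) => ('d config => real) => bool" where
 "mixes g f \<longleftrightarrow> L2 \<mu> f \<and> ((\<lambda>t. cov t f g) \<longlongrightarrow> 0) at_top"

lemma tendsto_zero_approx:
 fixes a :: "real => real"
 assumes "\<And>e. 0 < e ==> \<exists>b. (b \<longlongrightarrow> 0) at_top \<and> (\<forall>t\<ge>0. \<bar>a t - b t\<bar> \<le> e)"
 shows "(a \<longlongrightarrow> 0) at_top"
proof (rule tendstoI)
 fix e :: real assume e: "0 < e"
 then obtain b where b: "(b \<longlongrightarrow> 0) at_top" "\<forall>t\<ge>0. \<bar>a t - b t\<bar> \<le> e / 2" using assms[of "e / 2"] by auto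
 have "\<forall>\<^sub>F t in at_top. dist (b t) 0 < e / 2" by (rule tendstoD[OF b(1)]) (use e in simp)
 thus "\<forall>\<^sub>F t in at_top. dist (a t) 0 < e" using eventually_ge_at_top[of 0]
 proof eventually_elim
  case (elim t)
  thus ?case using b(2)[rule_format, of t] unfolding dist_real_def by linarith
 qed
qed

text \<open>Covariances are bounded by twice the product of the norms, uniformly in time, so the
  class of mixing f is closed in L2.\<close>

lemma mixes_approx:
 assumes g: "L2 \<mu> g" and f: "L2 \<mu> f" and a: "\<And>\<delta>. 0 < \<delta> ==> \<exists>f1. mixes g f1 \<and> N (\<lambda>h. f h - f1 h) \<le> \<delta>"
 shows "mixes g f" unfolding mixes_def
proof (intro conjI f tendsto_zero_approx)
 fix e :: real assume e: "0 < e"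
 define \<delta> where "\<delta> = e / (2 * (1 + N g))"
 have G: "0 < 1 + N g" by (simp add: add_pos_nonneg)
 hence d: "0 < \<delta>" "2 * (\<delta> * (1 + N g)) = e" using e by (auto simp: \<delta>_def divide_simps)
 obtain f1 where f1: "mixes g f1" "N (\<lambda>h. f h - f1 h) \<le> \<delta>" using a[OF d(1)] by blast
 hence L1: "L2 \<mu> f1" by (simp add: mixes_def)
 have "\<bar>cov t f g - cov t f1 g\<bar> \<le> e" if t: "0 \<le> t" for t
 proof -
  have "\<bar>cov t (\<lambda>h. f h - f1 h) g\<bar> \<le> 2 * (N (\<lambda>h. f h - f1 h) * N g)" by (rule cov_bound[OF t L2_diff[OF f L1] g])
  also have "... \<le> 2 * (\<delta> * (1 + N g))" using f1(2) d(1) by (intro mult_left_mono mult_mono) auto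
  finally show ?thesis using cov_lin[OF t f L1 g, of 1 "-1"] d(2) by simp
 qed
 thus "\<exists>b. (b \<longlongrightarrow> 0) at_top \<and> (\<forall>t\<ge>0. \<bar>cov t f g - b t\<bar> \<le> e)" using f1(1) by (auto simp: mixes_def)
qed

lemma mixes_lin:
 assumes g: "L2 \<mu> g" and f: "mixes g f" "mixes g f'" shows "mixes g (\<lambda>h. a * f h + b * f' h)"
proof -
 have "((\<lambda>t. a * cov t f g + b * cov t f' g) \<longlongrightarrow> a * 0 + b * 0) at_top" using f by (intro tendsto_intros) (auto simp: mixes_def)
 moreover have "\<forall>\<^sub>F t in at_top. a * cov t f g + b * cov t f' g = cov t (\<lambda>h. a * f h + b * f' h) g"
  using eventually_ge_at_top[of 0] by eventually_elim (use f g cov_lin in \<open>simp add: mixes_def\<close>)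
 ultimately show ?thesis using f by (auto simp: mixes_def L2_lin dest: Lim_transform_eventually)
qed

lemma mixes_zero: "mixes g (\<lambda>_. 0)" by (simp add: mixes_def L2_zero cov_def)

lemma mixes_sum:
 assumes g: "L2 \<mu> g" and f: "finite I" "\<And>i. i \<in> I ==> mixes g (f i)" shows "mixes g (\<lambda>h. \<Sum>i\<in>I. c i * f i h)"
 using f
proof (induction I rule: finite_induct)
 case (insert i I)
 hence "mixes g (\<lambda>h. c i * f i h + 1 * (\<Sum>i\<in>I. c i * f i h))" by (intro mixes_lin[OF g]) auto
 thus ?case using insert by simp
qed (simp add: mixes_zero)

lemma mixes_const:
 assumes g: "generator_graph \<mu> P g h" shows "mixes g (\<lambda>_. c)"
proof -
 have "\<forall>\<^sub>F t in at_top. 0 = cov t (\<lambda>_. c) g" using eventually_ge_at_top[of 0]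
  by eventually_elim (use mean_const[OF g generator_mean] in \<open>simp add: cov_def prob_space\<close>)
 thus ?thesis by (simp add: mixes_def L2_const Lim_transform_eventually[OF tendsto_const])
qed

lemma L2_indicator: "B \<in> sets \<mu> ==> L2 \<mu> (indicator B)" by (rule L2_bounded[of _ 1]) (auto simp: indicator_def)

text \<open>With coefficients summing to zero on a core, every integral may be replaced by its
  difference from that of one reference pattern \<zeta>1, and these differences vanish by
  \<open>EE_balance\<close>. The mean is zero because all patterns on a core have the same
  probability.\<close>

lemma mixes_balanced:
 assumes g: "generator_graph \<mu> P g h" and c: "\<And>A. A \<in> cores W n ==> (\<Sum>\<zeta>\<in>rec A (kI W A). c A \<zeta>) = 0"
 shows "mixes g (\<lambda>u. \<Sum>(A, \<zeta>)\<in>patterns W n. c A \<zeta> * indicator (EE A \<zeta>) u)"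
proof -
 have Lg: "L2 \<mu> g" using g by (simp add: generator_graph_def)
 have LE: "L2 \<mu> (indicator (EE A \<zeta>))" if "(A, \<zeta>) \<in> patterns W n" for A \<zeta>
  by (rule L2_indicator[OF EE_sets[OF patternsD(1)[OF that]]])
 have Lp: "L2 \<mu> (\<lambda>u. \<Sum>(A, \<zeta>)\<in>patterns W n. c A \<zeta> * indicator (EE A \<zeta>) u)"
 proof (rule L2_sum[OF finite_patterns])
  fix i assume i: "i \<in> patterns W n"
  obtain A \<zeta> where A: "i = (A, \<zeta>)" by fastforce
  show "L2 \<mu> (\<lambda>u. case i of (A, \<zeta>) => c A \<zeta> * indicator (EE A \<zeta>) u)"
   unfolding A prod.case by (rule L2_cmult[OF LE]) (use i A in simp)
 qed
 have "(\<integral>u. (\<Sum>(A, \<zeta>)\<in>patterns W n. c A \<zeta> * indicator (EE A \<zeta>) u) \<partial>\<mu>) = (\<Sum>A\<in>cores W n. \<Sum>\<zeta>\<in>rec A (kI W A). c A \<zeta> * prob (EE A \<zeta>))"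
  by (rule trans[OF pattern_integral(2) sum_patterns[symmetric]])
 also have "... = (\<Sum>A\<in>cores W n. (\<Sum>\<zeta>\<in>rec A (kI W A). c A \<zeta>) * ee A)"
  unfolding sum_distrib_right by (intro sum.cong refl) (simp add: measure_EE[OF cores_finite])
 also have "... = 0" using c by simp
 finally have int0: "(\<integral>u. (\<Sum>(A, \<zeta>)\<in>patterns W n. c A \<zeta> * indicator (EE A \<zeta>) u) \<partial>\<mu>) = 0" .
 let ?I = "\<lambda>A \<zeta> t. \<integral>u. indicator (EE A \<zeta>) u * P t g u \<partial>\<mu>"
 have z: "((\<lambda>t. \<Sum>\<zeta>\<in>rec A (kI W A). c A \<zeta> * ?I A \<zeta> t) \<longlongrightarrow> 0) at_top" if A: "A \<in> cores W n" for A
 proof (cases "rec A (kI W A) = {}")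
  case False
  then obtain \<zeta>1 where z1: "\<zeta>1 \<in> rec A (kI W A)" by blast
  have "((\<lambda>t. \<Sum>\<zeta>\<in>rec A (kI W A). c A \<zeta> * (?I A \<zeta> t - ?I A \<zeta>1 t)) \<longlongrightarrow> (\<Sum>\<zeta>\<in>rec A (kI W A). c A \<zeta> * 0)) at_top"
   by (intro tendsto_sum tendsto_mult tendsto_const EE_balance[OF g cores_finite[OF A]] z1)
  moreover have "(\<Sum>\<zeta>\<in>rec A (kI W A). c A \<zeta> * (?I A \<zeta> t - ?I A \<zeta>1 t)) = (\<Sum>\<zeta>\<in>rec A (kI W A). c A \<zeta> * ?I A \<zeta> t)" for t
  proof -
   have "(\<Sum>\<zeta>\<in>rec A (kI W A). c A \<zeta> * (?I A \<zeta> t - ?I A \<zeta>1 t))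
     = (\<Sum>\<zeta>\<in>rec A (kI W A). c A \<zeta> * ?I A \<zeta> t) - (\<Sum>\<zeta>\<in>rec A (kI W A). c A \<zeta>) * ?I A \<zeta>1 t"
    unfolding right_diff_distrib sum_subtractf sum_distrib_right ..
   thus ?thesis using c[OF A] by simp
  qed
  ultimately show ?thesis by simp
 qed simp
 have "((\<lambda>t. \<Sum>A\<in>cores W n. \<Sum>\<zeta>\<in>rec A (kI W A). c A \<zeta> * ?I A \<zeta> t) \<longlongrightarrow> (\<Sum>A\<in>cores W n. 0)) at_top"
  by (rule tendsto_sum) (rule z)
 hence lim: "((\<lambda>t. \<Sum>(A, \<zeta>)\<in>patterns W n. c A \<zeta> * ?I A \<zeta> t) \<longlongrightarrow> 0) at_top"
  unfolding sum_patterns by simp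
 have "\<forall>\<^sub>F t in at_top. (\<Sum>(A, \<zeta>)\<in>patterns W n. c A \<zeta> * ?I A \<zeta> t) = (\<integral>u. (\<Sum>(A, \<zeta>)\<in>patterns W n. c A \<zeta> * indicator (EE A \<zeta>) u) * P t g u \<partial>\<mu>)"
  using eventually_ge_at_top[of 0]
 proof eventually_elim
  case (elim t)
  have Lt: "L2 \<mu> (P t g)" by (rule P_L2[OF elim Lg])
  have i: "integrable \<mu> (\<lambda>u. (case i of (A, \<zeta>) => c A \<zeta> * indicator (EE A \<zeta>) u) * P t g u)"
   and v: "(\<integral>u. (case i of (A, \<zeta>) => c A \<zeta> * indicator (EE A \<zeta>) u) * P t g u \<partial>\<mu>) = (case i of (A, \<zeta>) => c A \<zeta> * ?I A \<zeta> t)"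
   if i: "i \<in> patterns W n" for i
  proof -
   obtain A \<zeta> where A: "i = (A, \<zeta>)" by fastforce
   have "integrable \<mu> (\<lambda>u. indicator (EE A \<zeta>) u * P t g u)" by (rule integrable_square_sum[OF LE Lt]) (use i A in simp)
   thus "integrable \<mu> (\<lambda>u. (case i of (A, \<zeta>) => c A \<zeta> * indicator (EE A \<zeta>) u) * P t g u)"
    and "(\<integral>u. (case i of (A, \<zeta>) => c A \<zeta> * indicator (EE A \<zeta>) u) * P t g u \<partial>\<mu>) = (case i of (A, \<zeta>) => c A \<zeta> * ?I A \<zeta> t)"
    unfolding A prod.case mult.assoc by simp_all
  qed
  show ?case unfolding sum_distrib_right
   by (rule trans[OF sum.cong[OF refl v[symmetric]] Bochner_Integration.integral_sum[OF i, symmetric]])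
 qed
 hence "((\<lambda>t. \<integral>u. (\<Sum>(A, \<zeta>)\<in>patterns W n. c A \<zeta> * indicator (EE A \<zeta>) u) * P t g u \<partial>\<mu>) \<longlongrightarrow> 0) at_top"
  by (rule Lim_transform_eventually[OF lim])
 thus ?thesis unfolding mixes_def cov_def int0 using Lp by simp
qed

lemma mixes_EE:
 assumes g: "generator_graph \<mu> P g h" and A0: "finite A0" "W0 \<subseteq> A0" "\<zeta>0 \<in> rec A0 (kI W0 A0)"
 shows "mixes g (indicator (EE A0 \<zeta>0))"
proof (rule mixes_approx[OF _ L2_indicator[OF EE_sets[OF A0(1)]]])
 show Lg: "L2 \<mu> g" using g by (simp add: generator_graph_def)
 fix \<delta> :: real assume d: "0 < \<delta>"
 show "\<exists>f1. mixes g f1 \<and> N (\<lambda>u. indicator (EE A0 \<zeta>0) u - f1 u) \<le> \<delta>"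
 proof (rule EE_decomposition[OF A0 d])
  fix W n c
  assume c: "\<And>A. A \<in> cores W n ==> (\<Sum>\<zeta>\<in>rec A (kI W A). c A \<zeta>) = 0"
   "N (\<lambda>u. indicator (EE A0 \<zeta>0) u - (limit_rate A0 + (\<Sum>(A, \<zeta>)\<in>patterns W n. c A \<zeta> * indicator (EE A \<zeta>) u))) \<le> \<delta>"
  have "mixes g (\<lambda>u. 1 * limit_rate A0 + 1 * (\<Sum>(A, \<zeta>)\<in>patterns W n. c A \<zeta> * indicator (EE A \<zeta>) u))"
   by (rule mixes_lin[OF Lg mixes_const[OF g] mixes_balanced[OF g c(1)]])
  thus ?thesis using c(2) by auto
 qed
qed

text \<open>Taking the support of C as window, C is constant on every event
  \<open>EE A \<zeta>\<close>, since A contains W; the patterns miss mass at most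
  \<delta>^2.\<close>

lemma mixes_local:
 assumes g: "generator_graph \<mu> P g h" and C: "local_event W C"
 shows "mixes g (indicator {c\<in>space \<mu>. C c})"
proof (rule mixes_approx[OF _ L2_indicator[OF local_sets[OF C]]])
 show Lg: "L2 \<mu> g" using g by (simp add: generator_graph_def)
 fix \<delta> :: real assume d: "0 < \<delta>"
 hence d2: "0 < \<delta>\<^sup>2" by simp
 have W: "finite W" using C by (simp add: local_event_def)
 obtain n where n: "1 - \<delta>\<^sup>2 \<le> (\<Sum>A\<in>cores W n. wt W A)" using cores_mass[OF W d2] by blast
 let ?X = "{c\<in>space \<mu>. C c}"
 let ?f1 = "\<lambda>c. \<Sum>(A, \<zeta>)\<in>patterns W n. of_bool (C \<zeta>) * indicator (EE A \<zeta>) c :: real"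
 let ?u = "\<lambda>c. \<Sum>(A, \<zeta>)\<in>patterns W n. 1 * indicator (EE A \<zeta>) c :: real"
 have "mixes g (\<lambda>c. \<Sum>i\<in>patterns W n. of_bool (C (snd i)) * indicator (EE (fst i) (snd i)) c)"
 proof (rule mixes_sum[OF Lg finite_patterns])
  fix i assume "i \<in> patterns W n"
  hence "(fst i, snd i) \<in> patterns W n" by simp
  from patternsD[OF this] show "mixes g (indicator (EE (fst i) (snd i)))" by (intro mixes_EE[OF g])
 qed
 hence m: "mixes g ?f1" by (simp add: case_prod_beta)
 hence Lf1: "L2 \<mu> ?f1" by (simp add: mixes_def)
 have LX: "L2 \<mu> (\<lambda>c. indicator ?X c - ?f1 c)" by (rule L2_diff[OF L2_indicator[OF local_sets[OF C]] Lf1])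
 have le: "(indicator ?X c - ?f1 c)\<^sup>2 \<le> 1 - ?u c" if "c \<in> space \<mu>" for c
 proof (cases "\<exists>A \<zeta>. (A, \<zeta>) \<in> patterns W n \<and> c \<in> EE A \<zeta>")
  case True
  then obtain A \<zeta> where p: "(A, \<zeta>) \<in> patterns W n" "c \<in> EE A \<zeta>" by blast
  have "C c = C \<zeta>" by (rule local_eventD[OF C]) (use p(2) patternsD(2)[OF p(1)] in \<open>auto simp: EE_def\<close>)
  thus ?thesis unfolding pattern_sum_in[OF p] using that by (simp add: indicator_def)
 next
  case False
  hence z: "(A, \<zeta>) \<in> patterns W n ==> c \<notin> EE A \<zeta>" for A \<zeta> by blast
  have "?u c = 0" by (rule pattern_sum_out) (rule z)
  moreover have "?f1 c = 0" by (rule pattern_sum_out) (rule z)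
  ultimately show ?thesis by (simp only:) (simp add: indicator_def)
 qed
 have "(N (\<lambda>c. indicator ?X c - ?f1 c))\<^sup>2 \<le> (\<integral>c. 1 - ?u c \<partial>\<mu>)"
  unfolding nrm2_sq by (rule integral_mono[OF L2_sq[OF LX] _ le]) (intro Bochner_Integration.integrable_diff pattern_integral(1), simp_all)
 also have "... = (\<integral>c. 1 \<partial>\<mu>) - (\<integral>c. ?u c \<partial>\<mu>)"
  by (rule Bochner_Integration.integral_diff[OF _ pattern_integral(1)]) simp
 also have "(\<integral>c. 1 \<partial>\<mu>) = (1 :: real)" by (simp add: prob_space)
 also have "(\<integral>c. ?u c \<partial>\<mu>) = (\<Sum>A\<in>cores W n. wt W A)" unfolding wt_total pattern_integral(2) by simp
 finally have "(N (\<lambda>c. indicator ?X c - ?f1 c))\<^sup>2 \<le> \<delta>\<^sup>2" using n by simp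
 hence "N (\<lambda>c. indicator ?X c - ?f1 c) \<le> \<delta>" by (rule power2_le_imp_le) (use d in simp)
 thus "\<exists>f1. mixes g f1 \<and> N (\<lambda>c. indicator ?X c - f1 c) \<le> \<delta>" using m by blast
qed

lemma mixes_cong:
 assumes g: "L2 \<mu> g" and f: "L2 \<mu> f" "mixes g f1" and e: "\<And>h. h \<in> space \<mu> ==> f h = f1 h"
 shows "mixes g f"
proof (rule mixes_approx[OF g f(1)])
 fix \<delta> :: real assume "0 < \<delta>"
 have "(\<integral>h. (f h - f1 h)\<^sup>2 \<partial>\<mu>) = (\<integral>h. 0 \<partial>\<mu>)" by (rule Bochner_Integration.integral_cong) (use e in auto)
 hence "N (\<lambda>h. f h - f1 h) = 0" by (simp add: nrm2_def)
 thus "\<exists>f1. mixes g f1 \<and> N (\<lambda>h. f h - f1 h) \<le> \<delta>" using f(2) \<open>0 < \<delta>\<close> by (intro exI[of _ f1]) simp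
qed

text \<open>Dynkin induction from cylinders: complements use that constants mix, and countable
  disjoint unions are approximated in L2 by finite ones.\<close>

lemma mixes_sets:
 assumes g: "generator_graph \<mu> P g h" and X: "X \<in> sets \<mu>"
 shows "mixes g (indicator X)"
proof -
 let ?M = "\<lambda>_::'d site. count_space {1..2 * int CARD('d)}"
 let ?O = "\<Pi>\<^sub>E i\<in>UNIV. space (?M i)"
 have Lg: "L2 \<mu> g" using g by (simp add: generator_graph_def)
 have S: "sets \<mu> = sigma_sets ?O (prod_algebra UNIV ?M)" using sets_mu by (simp add: Omega_M_def sets_PiM)
 have sp: "?O = space \<mu>" using sets_eq_imp_space_eq[OF sets_mu] by (simp add: Omega_M_def space_PiM)
 have X': "X \<in> sigma_sets ?O (prod_algebra UNIV ?M)" using X S by simp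
 show ?thesis
 proof (rule sigma_sets_induct_disjoint[OF Int_stable_prod_algebra prod_algebra_sets_into_space X', where P="\<lambda>X. mixes g (indicator X)"])
  fix Y assume "Y \<in> prod_algebra UNIV ?M"
  then obtain J E where Y: "Y = prod_emb UNIV ?M J (\<Pi>\<^sub>E j\<in>J. E j)" "finite J" "\<And>i. i \<in> J ==> E i \<in> sets (?M i)"
   by (rule prod_algebraE) blast
  obtain C where C: "local_event J C" "Y = {c\<in>space \<mu>. C c}" unfolding Y(1) by (rule prod_emb_local[OF Y(2,3)])
  show "mixes g (indicator Y)" unfolding C(2) by (rule mixes_local[OF g C(1)])
 next
  have "indicat_real ({} :: 'd config set) = (\<lambda>_. 0)" by (simp add: fun_eq_iff)
  thus "mixes g (indicator {})" using mixes_zero[of g] by (simp only:)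
 next
  fix A assume A: "A \<in> sigma_sets ?O (prod_algebra UNIV ?M)" and m: "mixes g (indicator A)"
  have AS: "A \<in> sets \<mu>" using A S by simp
  show "mixes g (indicator (?O - A))"
  proof (rule mixes_cong[OF Lg])
   show "L2 \<mu> (indicator (?O - A))" unfolding sp using AS by (intro L2_indicator) auto
   show "mixes g (\<lambda>c. 1 * 1 + (- 1) * indicator A c)" by (rule mixes_lin[OF Lg mixes_const[OF g] m])
  qed (unfold sp, simp add: indicator_def)
 next
  fix A :: "nat => 'd config set" assume d: "disjoint_family A" and A: "range A \<subseteq> sigma_sets ?O (prod_algebra UNIV ?M)"
   and m: "\<And>i. mixes g (indicator (A i))"
  have AS: "range A \<subseteq> sets \<mu>" using A S by simp
  hence U: "(\<Union>i. A i) \<in> sets \<mu>" by auto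
  show "mixes g (indicat_real (\<Union>i. A i))"
  proof (rule mixes_approx[OF Lg L2_indicator[OF U]])
   fix \<delta> :: real assume d0: "0 < \<delta>"
   let ?f = "\<lambda>n c. \<Sum>i<n. 1 * indicat_real (A i) c :: real"
   have "(\<lambda>i. prob (A i)) sums prob (\<Union>i. A i)" by (rule finite_measure_UNION[OF AS d])
   hence "(\<lambda>n. \<Sum>i<n. prob (A i)) \<longlonglongrightarrow> prob (\<Union>i. A i)" by (simp add: sums_def)
   then obtain n where n: "\<bar>(\<Sum>i<n. prob (A i)) - prob (\<Union>i. A i)\<bar> < \<delta>\<^sup>2"
    using LIMSEQ_D[of _ _ "\<delta>\<^sup>2"] d0 by fastforce
   have mf: "mixes g (?f n)" by (rule mixes_sum[OF Lg]) (use m in auto)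
   have pw: "(indicat_real (\<Union>i. A i) c - ?f n c)\<^sup>2 = indicat_real (\<Union>i. A i) c - (\<Sum>i<n. indicat_real (A i) c)" for c
   proof -
    have "(\<Sum>i<n. indicat_real (A i) c) = (indicat_real (\<Union>i\<in>{..<n}. A i) c :: real)"
     by (rule indicator_UN_disjoint[symmetric]) (use d in \<open>auto simp: disjoint_family_on_def\<close>)
    thus ?thesis by (auto simp: indicator_def)
   qed
   have "(N (\<lambda>c. indicat_real (\<Union>i. A i) c - ?f n c))\<^sup>2 = (\<integral>c. indicat_real (\<Union>i. A i) c - (\<Sum>i<n. indicat_real (A i) c) \<partial>\<mu>)"
    unfolding nrm2_sq pw ..
   also have "... = prob (\<Union>i. A i) - (\<Sum>i<n. prob (A i))"
   proof -
    have i: "integrable \<mu> (indicat_real (A i))" for i using AS by (auto simp: emeasure_eq_measure)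
    have v: "(\<integral>c. indicat_real (A i) c \<partial>\<mu>) = prob (A i)" for i
     using AS sets.sets_into_space[of "A i" \<mu>] by (simp add: Int_absorb2 image_subset_iff)
    have iU: "integrable \<mu> (indicat_real (\<Union>i. A i))" using U by (auto simp: emeasure_eq_measure)
    have vU: "(\<integral>c. indicat_real (\<Union>i. A i) c \<partial>\<mu>) = prob (\<Union>i. A i)"
     using sets.sets_into_space[OF U] by (simp add: Int_absorb2)
    have "(\<integral>c. indicat_real (\<Union>i. A i) c - (\<Sum>i<n. indicat_real (A i) c) \<partial>\<mu>)
      = (\<integral>c. indicat_real (\<Union>i. A i) c \<partial>\<mu>) - (\<integral>c. (\<Sum>i<n. indicat_real (A i) c) \<partial>\<mu>)"
     by (rule Bochner_Integration.integral_diff[OF iU Bochner_Integration.integrable_sum[OF i]])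
    also have "(\<integral>c. (\<Sum>i<n. indicat_real (A i) c) \<partial>\<mu>) = (\<Sum>i<n. prob (A i))"
     by (rule trans[OF Bochner_Integration.integral_sum[OF i] sum.cong[OF refl v]])
    finally show ?thesis unfolding vU .
   qed
   also have "... \<le> \<delta>\<^sup>2" using n by linarith
   finally have "N (\<lambda>c. indicat_real (\<Union>i. A i) c - ?f n c) \<le> \<delta>" by (rule power2_le_imp_le) (use d0 in simp)
   thus "\<exists>f1. mixes g f1 \<and> N (\<lambda>c. indicat_real (\<Union>i. A i) c - f1 c) \<le> \<delta>" using mf by blast
  qed
 qed
qed

lemma mixes_all:
 assumes g: "generator_graph \<mu> P g h" and f: "L2 \<mu> f"
 shows "mixes g f"
proof -
 have Lg: "L2 \<mu> g" using g by (simp add: generator_graph_def)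
 have fm: "f \<in> borel_measurable \<mu>" by (rule L2_measurable[OF f])
 obtain F where "\<forall>i. simple_function \<mu> (F i)" "\<forall>x\<in>space \<mu>. (\<lambda>i. F i x) \<longlonglongrightarrow> f x"
  "\<forall>i. \<forall>x\<in>space \<mu>. dist (F i x) 0 \<le> 2 * dist (f x) 0"
  using borel_measurable_implies_sequence_metric[OF fm, of 0] by blast
 hence F: "\<And>i. simple_function \<mu> (F i)" "\<And>x. x \<in> space \<mu> ==> (\<lambda>i. F i x) \<longlonglongrightarrow> f x"
  "\<And>i x. x \<in> space \<mu> ==> \<bar>F i x\<bar> \<le> 2 * \<bar>f x\<bar>" by (simp_all add: dist_real_def)
 have Fm: "F i \<in> borel_measurable \<mu>" for i by (rule borel_measurable_simple_function[OF F(1)])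
 have LF: "L2 \<mu> (F i)" for i
 proof -
  have "integrable \<mu> (\<lambda>x. (F i x)\<^sup>2)"
  proof (rule Bochner_Integration.integrable_bound[of \<mu> "\<lambda>x. 4 * (f x)\<^sup>2"])
   show "AE x in \<mu>. norm ((F i x)\<^sup>2) \<le> norm (4 * (f x)\<^sup>2)"
   proof (rule AE_I2)
    fix x assume "x \<in> space \<mu>"
    hence "\<bar>F i x\<bar>\<^sup>2 \<le> (2 * \<bar>f x\<bar>)\<^sup>2" by (intro power_mono F(3)) auto
    thus "norm ((F i x)\<^sup>2) \<le> norm (4 * (f x)\<^sup>2)" by (simp add: power_mult_distrib)
   qed
  qed (use L2_sq[OF f] Fm in auto)
  thus ?thesis using Fm by (simp add: L2_def)
 qed
 have mF: "mixes g (F i)" for i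
 proof (rule mixes_cong[OF Lg LF])
  show "mixes g (\<lambda>x. \<Sum>y\<in>F i ` space \<mu>. y * indicator (F i -` {y} \<inter> space \<mu>) x)"
  proof (rule mixes_sum[OF Lg simple_functionD(1)[OF F(1)]])
   fix y show "mixes g (indicator (F i -` {y} \<inter> space \<mu>))" by (rule mixes_sets[OF g simple_functionD(2)[OF F(1)]])
  qed
  fix x assume "x \<in> space \<mu>"
  have "F i x = (\<Sum>y\<in>F i ` space \<mu>. indicator (F i -` {y} \<inter> space \<mu>) x *\<^sub>R y)"
   by (rule simple_function_indicator_representation_banach[OF F(1) \<open>x \<in> space \<mu>\<close>])
  also have "... = (\<Sum>y\<in>F i ` space \<mu>. y * indicator (F i -` {y} \<inter> space \<mu>) x)"
   by (rule sum.cong[OF refl]) (simp add: mult.commute)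
  finally show "F i x = (\<Sum>y\<in>F i ` space \<mu>. y * indicator (F i -` {y} \<inter> space \<mu>) x)" .
 qed
 have lim: "(\<lambda>i. \<integral>x. (f x - F i x)\<^sup>2 \<partial>\<mu>) \<longlonglongrightarrow> (\<integral>x. 0 \<partial>\<mu>)"
 proof (rule integral_dominated_convergence[where w="\<lambda>x. 9 * (f x)\<^sup>2"])
  show "AE x in \<mu>. (\<lambda>i. (f x - F i x)\<^sup>2) \<longlonglongrightarrow> 0"
  proof (rule AE_I2)
   fix x assume "x \<in> space \<mu>"
   hence "(\<lambda>i. (f x - F i x)\<^sup>2) \<longlonglongrightarrow> (f x - f x)\<^sup>2" by (intro tendsto_intros F(2))
   thus "(\<lambda>i. (f x - F i x)\<^sup>2) \<longlonglongrightarrow> 0" by simp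
  qed
  show "AE x in \<mu>. norm ((f x - F i x)\<^sup>2) \<le> 9 * (f x)\<^sup>2" for i
  proof (rule AE_I2)
   fix x assume "x \<in> space \<mu>"
   hence "\<bar>f x - F i x\<bar> \<le> 3 * \<bar>f x\<bar>" using F(3)[of x i] by linarith
   hence "\<bar>f x - F i x\<bar>\<^sup>2 \<le> (3 * \<bar>f x\<bar>)\<^sup>2" by (rule power_mono) simp
   thus "norm ((f x - F i x)\<^sup>2) \<le> 9 * (f x)\<^sup>2" by (simp add: power_mult_distrib)
  qed
 qed (use L2_sq[OF f] fm Fm in auto)
 show ?thesis
 proof (rule mixes_approx[OF Lg f])
  fix \<delta> :: real assume d: "0 < \<delta>"
  then obtain i where "\<bar>(\<integral>x. (f x - F i x)\<^sup>2 \<partial>\<mu>)\<bar> < \<delta>\<^sup>2" using LIMSEQ_D[OF lim, of "\<delta>\<^sup>2"] by auto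
  hence "(N (\<lambda>x. f x - F i x))\<^sup>2 \<le> \<delta>\<^sup>2" unfolding nrm2_sq by linarith
  hence "N (\<lambda>x. f x - F i x) \<le> \<delta>" by (rule power2_le_imp_le) (use d in simp)
  thus "\<exists>f1. mixes g f1 \<and> N (\<lambda>x. f x - f1 x) \<le> \<delta>" using mF by blast
 qed
qed

text \<open>The only restriction left is that g lie in the domain of the generator; density of the
  domain and the uniform covariance bound remove it.\<close>

lemma mixing:
 assumes f: "L2 \<mu> f" and g: "L2 \<mu> g"
 shows "((\<lambda>t. \<integral>c. f c * P t g c \<partial>\<mu>) \<longlongrightarrow> expectation f * expectation g) at_top"
proof -
 have "((\<lambda>t. cov t f g) \<longlongrightarrow> 0) at_top"
 proof (rule tendsto_zero_approx)
  fix e :: real assume e: "0 < e"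
  define \<delta> where "\<delta> = e / (2 * (1 + N f))"
  have "0 < 1 + N f" by (simp add: add_pos_nonneg)
  hence d: "0 < \<delta>" "2 * ((1 + N f) * \<delta>) = e" using e by (auto simp: \<delta>_def divide_simps)
  obtain g' h' where g': "generator_graph \<mu> P g' h'" "N (\<lambda>c. g c - g' c) \<le> \<delta>" by (rule generator_dense[OF g d(1)])
  have Lg': "L2 \<mu> g'" using g'(1) by (simp add: generator_graph_def)
  have "\<bar>cov t f g - cov t f g'\<bar> \<le> e" if t: "0 \<le> t" for t
  proof -
   have "\<bar>cov t f (\<lambda>c. g c - g' c)\<bar> \<le> 2 * (N f * N (\<lambda>c. g c - g' c))" by (rule cov_bound[OF t f L2_diff[OF g Lg']])
   also have "... \<le> 2 * ((1 + N f) * \<delta>)" using g'(2) by (intro mult_left_mono mult_mono) auto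
   finally show ?thesis unfolding cov_lin_right[OF t f g Lg'] d(2) .
  qed
  thus "\<exists>b. (b \<longlongrightarrow> 0) at_top \<and> (\<forall>t\<ge>0. \<bar>cov t f g - b t\<bar> \<le> e)"
   using mixes_all[OF g'(1) f] by (auto simp: mixes_def)
 qed
 thus ?thesis unfolding cov_def by (rule LIM_zero_cancel)
qed

end

theorem theorem10p2:
  fixes \<mu> :: "('d::finite) config measure"
    and \<phi> :: "'d site \<Rightarrow> real"
    and P :: "real \<Rightarrow> ('d config \<Rightarrow> real) \<Rightarrow> ('d config \<Rightarrow> real)"
  assumes d3: "CARD('d) \<ge> 3"
    and mu: "is_sandpile_limit \<mu>"
    and phi_pos: "\<And>x. \<phi> x > 0"
    and phi_G: "(\<lambda>x. \<phi> x * green (\<lambda>_. 0) x) summable_on UNIV"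
    and semigroup: "C0_contraction_semigroup \<mu> P"
    and gen: "\<And>f h. generator_graph \<mu> P f h \<longleftrightarrow> closure_graph \<mu> \<phi> f h"
  shows "\<forall>f g. L2 \<mu> f \<longrightarrow> L2 \<mu> g \<longrightarrow>
           ((\<lambda>t. \<integral>\<eta>. f \<eta> * P t g \<eta> \<partial>\<mu>) \<longlongrightarrow> (\<integral>\<eta>. f \<eta> \<partial>\<mu>) * (\<integral>\<eta>. g \<eta> \<partial>\<mu>)) at_top"
proof -
  interpret sandpile_process \<mu> \<phi> P
    by unfold_locales (fact d3 mu phi_pos phi_G semigroup gen)+
  show ?thesis using mixing by blast
qed

end
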